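(* Let $u_h$ denote the solution of the semidiscrete problem with initial value $u_{h,0}$ and suppose that the initial-condition assumption of the context is fulfilled with $\beta>0$. Let $r\in\mathbb N_0$ be a fixed parameter and use the constant time degree distribution $\mathbf r_t\equiv r$. Choose $\mathcal T_{(0,T)}$ as a graded mesh with grading function $h(t):=t^{(2r+3)/\beta}$, i.e. with nodes $t_j=T\,h(j/M)$, $j=0,\dots,M$. Let $N:=\dim(\mathcal S^{\mathbf r_t,0}(\mathcal T_{(0,T)}))$. Assume that $u_0$ is analytic in $\overline\Omega$ and that the right-hand side $f$ satisfies $$\|f^{(\ell)}(t)\|_{L^2(\Omega)}\le C_f\,d_f^{\,\ell}\,\Gamma(\ell+1)\qquad\forall t\in[0,T],\ \ell\in\mathbb N_0,$$ with constants $C_f$, $d_f$ independent of $\ell$ and $t$. Let $u_{h,k}=\operatorname{tr}\mathcal U^h_{x,y,t}$ be the trace of the discontinuous Galerkin solution. Then $$\Big(\int_0^T\|u_h(t)-u_{h,k}(t)\|^2_{\widetilde H^s(\Omega)}\,dt\Big)^{1/2}\le C\big(N^{-(r+1)}+e^{-b\,\mathcal N_\Omega^\mu}\big).$$ The constant $C$ depends only on $\Omega$, $u_0$, $f$, $r$, $T$ (and $s$, $A$, $c$), and the constants of the initial-condition assumption; $b,\mu>0$ are determined by the latter.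
   Context: Setting. $\Omega\subset\mathbb R^d$ is a bounded Lipschitz domain, $s\in(0,1)$, $\alpha=1-2s$, $d_s=2^{\alpha}\Gamma(1-s)/\Gamma(s)$. $A\in L^\infty(\Omega,\mathbb R^{d\times d})$ is symmetric and uniformly positive definite, $c\in L^\infty(\Omega)$, $c\ge0$ (the underlying operator is $\mathcal Lu=-\operatorname{div}(A\nabla u)+cu$ with Dirichlet conditions). For Banach spaces $X_1\subseteq X_0$ and $\theta\in(0,1)$, $[X_0,X_1]_{\theta,2}$ is the space with norm $\|u\|^2=\int_0^\infty t^{-2\theta}\big(\inf_{v\in X_1}\|u-v\|_{X_0}+t\|v\|_{X_1}\big)^2\frac{dt}{t}$. $\widetilde H^s(\Omega)=[L^2(\Omega),H_0^1(\Omega)]_{s,2}$. Extension. $\mathcal C=\Omega\times\mathbb R_+$, points $(x,y)$; $H^1(y^\alpha,\mathcal C)$ consists of $w$ with $\int_{\mathcal C}y^\alpha(|w|^2+|\nabla w|^2)<\infty$; $\mathring H^1(y^\alpha,\mathcal C)$ is the subspace of functions vanishing on $\partial\Omega\times\mathbb R_+$, normed by $\|\mathcal U\|^2=\int_{\mathcal C}y^\alpha|\nabla\mathcal U|^2$. $\operatorname{tr}\mathcal U=\mathcal U(\cdot,0)$; $\mathcal A(\mathcal U,\mathcal V)=\int_{\mathcal C}y^\alpha(A\nabla\mathcal U)\cdot\nabla\mathcal V+y^\alpha c\,\mathcal U\mathcal V$, where $A$ acts on the $x$-part of the gradient and as identity on $\partial_y$. Space discretization. $\mathbb V_h^{\mathcal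 X}\subset H_0^1(\Omega)$ and $\mathbb V_h^{\mathcal Y}\subset H^1(y^\alpha,\mathbb R_+)$ are finite dimensional, $\mathbb V_h^{\mathcal Y}$ contains some $v$ with $v(0)=1$, $\mathbb V_h^{\mathcal X,\mathcal Y}=\mathbb V_h^{\mathcal X}\otimes\mathbb V_h^{\mathcal Y}$, $\mathcal N_\Omega=\dim\mathbb V_h^{\mathcal X}$. For $u\in\mathbb V_h^{\mathcal X}$ the lifting $\mathcal D_hu\in\mathbb V_h^{\mathcal X,\mathcal Y}$ is defined by $\operatorname{tr}\mathcal D_hu=u$ and $\mathcal A(\mathcal D_hu,\mathcal V_h)=0$ for all $\mathcal V_h\in\mathbb V_h^{\mathcal X,\mathcal Y}$ with $\operatorname{tr}\mathcal V_h=0$; $\mathcal L_h^s$ is defined on $\mathbb V_h^{\mathcal X}$ by $(\mathcal L_h^su,v)_{L^2(\Omega)}=d_s^{-1}\mathcal A(\mathcal D_hu,\mathcal D_hv)$. Semidiscrete problem: $\dot u_h+\mathcal L_h^su_h=\Pi_{L^2}f$, $u_h(0)=u_{h,0}\in\mathbb V_h^{\mathcal X}$, with $\Pi_{L^2}$ the $L^2(\Omega)$-projection onto $\mathbb V_h^{\mathcal X}$. $\|u\|_{\mathbb V_h^{\mathcal X}}:=\|\mathcal D_hu\|_{\mathring H^1(y^\alpha,\mathcal C)}$ and $\mathbb V^{\mathcal X}_{h,\beta}:=[(\mathbb V_h^{\mathcal X},\|\cdot\|_{L^2(\Omega)}),(\mathbb V_h^{\mathcal X},\|\cdot\|_{\mathbb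 V_h^{\mathcal X}})]_{\beta,2}$. Initial-condition assumption. There are $\beta\in(0,1)$, $b,\mu>0$ and $C_{stab},C_{approx}$ with $\|u_{h,0}\|_{\mathbb V^{\mathcal X}_{h,\beta}}\le C_{stab}$ and $\|u_0-u_{h,0}\|_{L^2(\Omega)}\le C_{approx}e^{-b\mathcal N_\Omega^\mu}$. Time discretization. $\mathcal T_{(0,T)}=\{(t_{j-1},t_j)\}_{j=1}^M$ is a partition of $(0,T)$, $\mathcal S^{\mathbf r_t,0}(\mathcal T_{(0,T)})$ the (discontinuous) piecewise polynomials of degree $(\mathbf r_t)_j$ on the $j$-th interval, $\mathbb V_h^{\mathcal X,\mathcal Y,\mathcal T}=\mathcal S^{\mathbf r_t,0}(\mathcal T_{(0,T)})\otimes\mathbb V_h^{\mathcal X,\mathcal Y}$. With one-sided limits $u_j^{\pm}$ at $t_j$ and $[u]_j=u_j^+-u_j^-$, set $B(\mathcal U,\mathcal V)=\sum_{j=1}^M\int_{t_{j-1}}^{t_j}(\operatorname{tr}\dot{\mathcal U},\operatorname{tr}\mathcal V)_{L^2(\Omega)}+d_s^{-1}\mathcal A(\mathcal U,\mathcal V)\,dt+\sum_{j=2}^M([\operatorname{tr}\mathcal U]_{j-1},\operatorname{tr}\mathcal V_{j-1}^+)_{L^2(\Omega)}+(\operatorname{tr}\mathcal U_0^+,\operatorname{tr}\mathcal V_0^+)_{L^2(\Omega)}$ and $F(\mathcal V)=\sum_{j=1}^M\int_{t_{j-1}}^{t_j}(f,\operatorname{tr}\mathcal V)_{L^2(\Omega)}dt+(u_0,\operatorname{tr}\mathcal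 V_0^+)_{L^2(\Omega)}$. The DG solution $\mathcal U^h_{x,y,t}\in\mathbb V_h^{\mathcal X,\mathcal Y,\mathcal T}$ satisfies $B(\mathcal U^h_{x,y,t},\mathcal V_h)=F(\mathcal V_h)$ for all $\mathcal V_h\in\mathbb V_h^{\mathcal X,\mathcal Y,\mathcal T}$. *)

theory Defs
  imports "HOL-Analysis.Analysis" "HOL-Library.Function_Algebras"
    "HOL-Computational_Algebra.Polynomial"
begin

section \<open>Function spaces as real vector spaces\<close>

text \<open>Pointwise scalar multiplication makes the library's \<^const>\<open>subspace\<close>, \<^const>\<open>span\<close>
  and \<^const>\<open>dim\<close> available for sets of functions.\<close>

instantiation "fun" :: (type, real_vector) real_vector
begin
definition scaleR_fun :: "real \<Rightarrow> ('a \<Rightarrow> 'b) \<Rightarrow> 'a \<Rightarrow> 'b"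
  where "scaleR_fun r f = (\<lambda>x. r *\<^sub>R f x)"
instance
  by standard (simp_all add: scaleR_fun_def fun_eq_iff scaleR_add_right scaleR_add_left)
end

definition finite_dim :: "'v::real_vector set \<Rightarrow> bool"
  where "finite_dim V \<longleftrightarrow> subspace V \<and> (\<exists>B. finite B \<and> span B = V)"

definition tensor :: "('a \<Rightarrow> real) set \<Rightarrow> ('b \<Rightarrow> real) set \<Rightarrow> ('a \<times> 'b \<Rightarrow> real) set"
  where "tensor V W = span {(\<lambda>(x, y). v x * w y) | v w. v \<in> V \<and> w \<in> W}"


section \<open>The domain and the coefficients\<close>

text \<open>Near every boundary point the domain is, in suitable orthonormal coordinates, the region
  above the graph of a Lipschitz function; \<open>\<nu>\<close> is the upward direction and \<open>\<phi>\<close> is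
  a function of the components orthogonal to \<open>\<nu>\<close>.\<close>

definition lipschitz_domain :: "(real^'n) set \<Rightarrow> bool" where
  "lipschitz_domain \<Omega> \<longleftrightarrow> open \<Omega> \<and> connected \<Omega> \<and> \<Omega> \<noteq> {} \<and>
     (\<forall>p\<in>frontier \<Omega>. \<exists>\<nu> \<phi> L \<epsilon>. norm \<nu> = 1 \<and> L-lipschitz_on {z. z \<bullet> \<nu> = 0} \<phi> \<and> \<epsilon> > 0 \<and>
        (\<forall>x\<in>ball p \<epsilon>. x \<in> \<Omega> \<longleftrightarrow> (\<phi> (x - (x \<bullet> \<nu>) *\<^sub>R \<nu>) :: real) < x \<bullet> \<nu>))"

definition admissible_coefficients ::
  "(real^'n) set \<Rightarrow> (real^'n \<Rightarrow> real^'n^'n) \<Rightarrow> (real^'n \<Rightarrow> real) \<Rightarrow> bool" where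
  "admissible_coefficients \<Omega> A c \<longleftrightarrow>
     A \<in> borel_measurable (lebesgue_on \<Omega>) \<and>
     (\<exists>K. AE x in lebesgue_on \<Omega>. norm (A x) \<le> K) \<and>
     (AE x in lebesgue_on \<Omega>. transpose (A x) = A x) \<and>
     (\<exists>\<kappa>>0. AE x in lebesgue_on \<Omega>. \<forall>\<xi>. \<kappa> * (norm \<xi>)\<^sup>2 \<le> (A x *v \<xi>) \<bullet> \<xi>) \<and>
     c \<in> borel_measurable (lebesgue_on \<Omega>) \<and>
     (\<exists>K. AE x in lebesgue_on \<Omega>. c x \<le> K) \<and>
     (AE x in lebesgue_on \<Omega>. 0 \<le> c x)"

text \<open>Multi-indices are functions \<open>'n \<Rightarrow> nat\<close>.\<close>

definition real_analytic_at :: "(real^'n \<Rightarrow> real) \<Rightarrow> real^'n \<Rightarrow> bool" where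
  "real_analytic_at u p \<longleftrightarrow> (\<exists>\<epsilon>>0. \<exists>a :: ('n \<Rightarrow> nat) \<Rightarrow> real. \<forall>x\<in>ball p \<epsilon>.
     ((\<lambda>\<kappa>. a \<kappa> * (\<Prod>i\<in>UNIV. (x$i - p$i) ^ \<kappa> i)) has_sum u x) UNIV)"

text \<open>Analyticity in the closure: the function on \<open>\<Omega>\<close> has an extension that is analytic
  in a neighbourhood of every point of the closure.\<close>

definition analytic_on_closure :: "(real^'n) set \<Rightarrow> (real^'n \<Rightarrow> real) \<Rightarrow> bool" where
  "analytic_on_closure \<Omega> u \<longleftrightarrow>
     (\<exists>v. (\<forall>x\<in>\<Omega>. v x = u x) \<and> (\<forall>p\<in>closure \<Omega>. real_analytic_at v p))"


section \<open>Lebesgue and Sobolev spaces\<close>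

text \<open>Elements are functions on the whole type; only their values on \<open>\<Omega>\<close> matter, up to
  null sets.\<close>

definition L2 :: "'a::euclidean_space set \<Rightarrow> ('a \<Rightarrow> real) set" where
  "L2 \<Omega> = {u. u \<in> borel_measurable (lebesgue_on \<Omega>) \<and>
               integrable (lebesgue_on \<Omega>) (\<lambda>x. (u x)\<^sup>2)}"

definition L2_inner :: "'a::euclidean_space set \<Rightarrow> ('a \<Rightarrow> real) \<Rightarrow> ('a \<Rightarrow> real) \<Rightarrow> real" where
  "L2_inner \<Omega> u v = (LINT x|lebesgue_on \<Omega>. u x * v x)"

definition L2_norm :: "'a::euclidean_space set \<Rightarrow> ('a \<Rightarrow> real) \<Rightarrow> real" where
  "L2_norm \<Omega> u = sqrt (L2_inner \<Omega> u u)"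

primrec Ck :: "nat \<Rightarrow> ('a::euclidean_space \<Rightarrow> real) \<Rightarrow> bool" where
  "Ck 0 f \<longleftrightarrow> continuous_on UNIV f"
| "Ck (Suc k) f \<longleftrightarrow> (\<forall>x. f differentiable (at x)) \<and>
     (\<forall>i\<in>Basis. Ck k (\<lambda>x. frechet_derivative f (at x) i))"

definition test_functions :: "'a::euclidean_space set \<Rightarrow> ('a \<Rightarrow> real) set" where
  "test_functions S = {\<phi>. (\<forall>k. Ck k \<phi>) \<and>
     compact (closure {x. \<phi> x \<noteq> 0}) \<and> closure {x. \<phi> x \<noteq> 0} \<subseteq> S}"

definition is_weak_gradient ::
  "'a::euclidean_space set \<Rightarrow> ('a \<Rightarrow> real) \<Rightarrow> ('a \<Rightarrow> 'a) \<Rightarrow> bool" where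
  "is_weak_gradient S u g \<longleftrightarrow>
     (\<forall>K. compact K \<and> K \<subseteq> S \<longrightarrow> u absolutely_integrable_on K \<and> g absolutely_integrable_on K) \<and>
     (\<forall>\<phi>\<in>test_functions S. \<forall>i\<in>Basis.
        (LINT x|lebesgue_on S. u x * frechet_derivative \<phi> (at x) i) =
        - (LINT x|lebesgue_on S. (g x \<bullet> i) * \<phi> x))"

text \<open>The weak gradient is unique up to null sets.\<close>

definition weak_gradient :: "'a::euclidean_space set \<Rightarrow> ('a \<Rightarrow> real) \<Rightarrow> 'a \<Rightarrow> 'a" where
  "weak_gradient S u = (SOME g. is_weak_gradient S u g)"

definition weighted_H1 :: "('a::euclidean_space \<Rightarrow> real) \<Rightarrow> 'a set \<Rightarrow> ('a \<Rightarrow> real) set" where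
  "weighted_H1 w S = {u. (\<exists>g. is_weak_gradient S u g) \<and>
     integrable (lebesgue_on S) (\<lambda>x. w x * ((u x)\<^sup>2 + (norm (weak_gradient S u x))\<^sup>2))}"

definition H1_norm :: "'a::euclidean_space set \<Rightarrow> ('a \<Rightarrow> real) \<Rightarrow> real" where
  "H1_norm \<Omega> u = sqrt (LINT x|lebesgue_on \<Omega>. (u x)\<^sup>2 + (norm (weak_gradient \<Omega> u x))\<^sup>2)"

definition H10 :: "'a::euclidean_space set \<Rightarrow> ('a \<Rightarrow> real) set" where
  "H10 \<Omega> = {u \<in> weighted_H1 (\<lambda>_. 1) \<Omega>.
     \<exists>\<phi>. (\<forall>n. \<phi> n \<in> test_functions \<Omega>) \<and> (\<lambda>n. H1_norm \<Omega> (u - \<phi> n)) \<longlonglongrightarrow> 0}"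


section \<open>Interpolation norms\<close>

definition ennreal_sqrt :: "ennreal \<Rightarrow> ennreal" where
  "ennreal_sqrt x = (if x = \<infinity> then \<infinity> else ennreal (sqrt (enn2real x)))"

definition K_functional ::
  "('v::minus \<Rightarrow> real) \<Rightarrow> 'v set \<Rightarrow> ('v \<Rightarrow> real) \<Rightarrow> real \<Rightarrow> 'v \<Rightarrow> real" where
  "K_functional N0 X1 N1 t u = (INF v\<in>X1. N0 (u - v) + t * N1 v)"

text \<open>The norm of the interpolation space between \<open>(X0, N0)\<close> and \<open>(X1, N1)\<close>, with value
  \<open>\<infinity>\<close> outside that space.\<close>

definition interp_norm ::
  "'v set \<Rightarrow> ('v::minus \<Rightarrow> real) \<Rightarrow> 'v set \<Rightarrow> ('v \<Rightarrow> real) \<Rightarrow> real \<Rightarrow> 'v \<Rightarrow> ennreal" where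
  "interp_norm X0 N0 X1 N1 \<theta> u =
     (if u \<in> X0
      then ennreal_sqrt (\<integral>\<^sup>+ t\<in>{0<..}. ennreal (t powr (-2 * \<theta>) * (K_functional N0 X1 N1 t u)\<^sup>2 / t) \<partial>lborel)
      else \<infinity>)"

definition Htilde_norm :: "(real^'n) set \<Rightarrow> real \<Rightarrow> (real^'n \<Rightarrow> real) \<Rightarrow> ennreal" where
  "Htilde_norm \<Omega> s = interp_norm (L2 \<Omega>) (L2_norm \<Omega>) (H10 \<Omega>) (H1_norm \<Omega>) s"


section \<open>The extended problem\<close>

definition alpha :: "real \<Rightarrow> real" where "alpha s = 1 - 2 * s"

definition d_const :: "real \<Rightarrow> real" where
  "d_const s = 2 powr alpha s * Gamma (1 - s) / Gamma s"

definition cyl :: "(real^'n) set \<Rightarrow> ((real^'n) \<times> real) set" where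
  "cyl \<Omega> = \<Omega> \<times> {0<..}"

definition tr :: "('a \<times> real \<Rightarrow> real) \<Rightarrow> 'a \<Rightarrow> real" where
  "tr U = (\<lambda>x. U (x, 0))"

definition H1ring_norm :: "(real^'n) set \<Rightarrow> real \<Rightarrow> ((real^'n) \<times> real \<Rightarrow> real) \<Rightarrow> real" where
  "H1ring_norm \<Omega> s U =
     sqrt (LINT z|lebesgue_on (cyl \<Omega>). snd z powr alpha s * (norm (weak_gradient (cyl \<Omega>) U z))\<^sup>2)"

definition form_A :: "(real^'n) set \<Rightarrow> (real^'n \<Rightarrow> real^'n^'n) \<Rightarrow> (real^'n \<Rightarrow> real) \<Rightarrow> real \<Rightarrow>
    ((real^'n) \<times> real \<Rightarrow> real) \<Rightarrow> ((real^'n) \<times> real \<Rightarrow> real) \<Rightarrow> real" where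
  "form_A \<Omega> A c s U V = (LINT z|lebesgue_on (cyl \<Omega>).
     (let gU = weak_gradient (cyl \<Omega>) U z; gV = weak_gradient (cyl \<Omega>) V z in
        snd z powr alpha s * ((A (fst z) *v fst gU, snd gU) \<bullet> gV)
        + snd z powr alpha s * c (fst z) * U z * V z))"


section \<open>Space discretization\<close>

text \<open>Elements of the discrete spaces are given by fixed representatives. For \<open>VX\<close> these are
  chosen linearly, so that \<open>dim VX\<close> is the dimension of the space of equivalence classes; for
  \<open>VY\<close> they are the representatives continuous up to \<open>0\<close>, which exist for every
  element of the weighted space and give \<open>v 0\<close> its meaning as a trace.\<close>

definition discrete_spaces ::
  "(real^'n) set \<Rightarrow> real \<Rightarrow> (real^'n \<Rightarrow> real) set \<Rightarrow> (real \<Rightarrow> real) set \<Rightarrow> bool" where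
  "discrete_spaces \<Omega> s VX VY \<longleftrightarrow>
     finite_dim VX \<and> VX \<subseteq> H10 \<Omega> \<and>
     (\<forall>u\<in>VX. (AE x in lebesgue_on \<Omega>. u x = 0) \<longrightarrow> u = 0) \<and>
     finite_dim VY \<and> VY \<subseteq> weighted_H1 (\<lambda>y. y powr alpha s) {0<..} \<and>
     (\<forall>v\<in>VY. continuous_on {0..} v) \<and>
     (\<exists>v\<in>VY. v 0 = 1)"

text \<open>The lifting is determined up to functions vanishing almost everywhere on the cylinder,
  which do not affect \<^const>\<open>form_A\<close> and \<^const>\<open>H1ring_norm\<close>.\<close>

definition lifting :: "(real^'n) set \<Rightarrow> (real^'n \<Rightarrow> real^'n^'n) \<Rightarrow> (real^'n \<Rightarrow> real) \<Rightarrow> real \<Rightarrow>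
    (real^'n \<Rightarrow> real) set \<Rightarrow> (real \<Rightarrow> real) set \<Rightarrow> (real^'n \<Rightarrow> real) \<Rightarrow> (real^'n) \<times> real \<Rightarrow> real" where
  "lifting \<Omega> A c s VX VY u = (SOME U. U \<in> tensor VX VY \<and> tr U = u \<and>
     (\<forall>V\<in>tensor VX VY. tr V = 0 \<longrightarrow> form_A \<Omega> A c s U V = 0))"

definition Lh :: "(real^'n) set \<Rightarrow> (real^'n \<Rightarrow> real^'n^'n) \<Rightarrow> (real^'n \<Rightarrow> real) \<Rightarrow> real \<Rightarrow>
    (real^'n \<Rightarrow> real) set \<Rightarrow> (real \<Rightarrow> real) set \<Rightarrow> (real^'n \<Rightarrow> real) \<Rightarrow> real^'n \<Rightarrow> real" where
  "Lh \<Omega> A c s VX VY u = (THE w. w \<in> VX \<and> (\<forall>v\<in>VX. L2_inner \<Omega> w v =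
     form_A \<Omega> A c s (lifting \<Omega> A c s VX VY u) (lifting \<Omega> A c s VX VY v) / d_const s))"

definition L2_projection ::
  "(real^'n) set \<Rightarrow> (real^'n \<Rightarrow> real) set \<Rightarrow> (real^'n \<Rightarrow> real) \<Rightarrow> real^'n \<Rightarrow> real" where
  "L2_projection \<Omega> VX g = (THE w. w \<in> VX \<and> (\<forall>v\<in>VX. L2_inner \<Omega> w v = L2_inner \<Omega> g v))"

definition VX_norm :: "(real^'n) set \<Rightarrow> (real^'n \<Rightarrow> real^'n^'n) \<Rightarrow> (real^'n \<Rightarrow> real) \<Rightarrow> real \<Rightarrow>
    (real^'n \<Rightarrow> real) set \<Rightarrow> (real \<Rightarrow> real) set \<Rightarrow> (real^'n \<Rightarrow> real) \<Rightarrow> real" where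
  "VX_norm \<Omega> A c s VX VY u = H1ring_norm \<Omega> s (lifting \<Omega> A c s VX VY u)"

definition VX_interp_norm :: "(real^'n) set \<Rightarrow> (real^'n \<Rightarrow> real^'n^'n) \<Rightarrow> (real^'n \<Rightarrow> real) \<Rightarrow>
    real \<Rightarrow> (real^'n \<Rightarrow> real) set \<Rightarrow> (real \<Rightarrow> real) set \<Rightarrow> real \<Rightarrow> (real^'n \<Rightarrow> real) \<Rightarrow> ennreal" where
  "VX_interp_norm \<Omega> A c s VX VY \<beta> =
     interp_norm VX (L2_norm \<Omega>) VX (VX_norm \<Omega> A c s VX VY) \<beta>"

definition initial_condition :: "(real^'n) set \<Rightarrow> (real^'n \<Rightarrow> real^'n^'n) \<Rightarrow> (real^'n \<Rightarrow> real) \<Rightarrow>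
    real \<Rightarrow> (real^'n \<Rightarrow> real) set \<Rightarrow> (real \<Rightarrow> real) set \<Rightarrow> (real^'n \<Rightarrow> real) \<Rightarrow> (real^'n \<Rightarrow> real) \<Rightarrow>
    real \<Rightarrow> real \<Rightarrow> real \<Rightarrow> real \<Rightarrow> real \<Rightarrow> bool" where
  "initial_condition \<Omega> A c s VX VY u0 uh0 \<beta> b \<mu> Cstab Capprox \<longleftrightarrow>
     uh0 \<in> VX \<and>
     VX_interp_norm \<Omega> A c s VX VY \<beta> uh0 \<le> ennreal Cstab \<and>
     L2_norm \<Omega> (u0 - uh0) \<le> Capprox * exp (- b * real (dim VX) powr \<mu>)"


section \<open>Time dependence and the semidiscrete problem\<close>

definition has_L2_derivative :: "(real^'n) set \<Rightarrow> (real \<Rightarrow> real^'n \<Rightarrow> real) \<Rightarrow>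
    (real^'n \<Rightarrow> real) \<Rightarrow> real \<Rightarrow> real set \<Rightarrow> bool" where
  "has_L2_derivative \<Omega> u u' t J \<longleftrightarrow>
     ((\<lambda>\<tau>. L2_norm \<Omega> ((u \<tau> - u t) /\<^sub>R (\<tau> - t) - u')) \<longlongrightarrow> 0) (at t within J)"

definition L2_time_derivatives :: "(real^'n) set \<Rightarrow> real \<Rightarrow> (real \<Rightarrow> real^'n \<Rightarrow> real) \<Rightarrow>
    (nat \<Rightarrow> real \<Rightarrow> real^'n \<Rightarrow> real) \<Rightarrow> bool" where
  "L2_time_derivatives \<Omega> T f fd \<longleftrightarrow>
     (\<forall>t\<in>{0..T}. fd 0 t = f t) \<and>
     (\<forall>l. \<forall>t\<in>{0..T}. fd l t \<in> L2 \<Omega> \<and> has_L2_derivative \<Omega> (fd l) (fd (Suc l) t) t {0..T})"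

definition semidiscrete_solution :: "(real^'n) set \<Rightarrow> (real^'n \<Rightarrow> real^'n^'n) \<Rightarrow>
    (real^'n \<Rightarrow> real) \<Rightarrow> real \<Rightarrow> (real^'n \<Rightarrow> real) set \<Rightarrow> (real \<Rightarrow> real) set \<Rightarrow> real \<Rightarrow>
    (real \<Rightarrow> real^'n \<Rightarrow> real) \<Rightarrow> (real^'n \<Rightarrow> real) \<Rightarrow> (real \<Rightarrow> real^'n \<Rightarrow> real) \<Rightarrow> bool" where
  "semidiscrete_solution \<Omega> A c s VX VY T f uh0 uh \<longleftrightarrow>
     uh 0 = uh0 \<and>
     (\<forall>t\<in>{0..T}. uh t \<in> VX \<and>
        (\<exists>w\<in>VX. has_L2_derivative \<Omega> uh w t {0..T} \<and>
                w + Lh \<Omega> A c s VX VY (uh t) = L2_projection \<Omega> VX (f t)))"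


section \<open>Time discretization\<close>

text \<open>A mesh is given by its nodes \<open>\<tau> 0 < \<dots> < \<tau> M\<close>. Piecewise polynomials are normalized to
  vanish at the nodes and outside the mesh, so that each element of the space is represented by
  exactly one function.\<close>

definition pw_poly :: "nat \<Rightarrow> (nat \<Rightarrow> real) \<Rightarrow> (nat \<Rightarrow> nat) \<Rightarrow> (real \<Rightarrow> real) set" where
  "pw_poly M \<tau> r = {p.
     (\<forall>j\<in>{1..M}. \<exists>q :: real poly. degree q \<le> r j \<and> (\<forall>t\<in>{\<tau> (j-1)<..<\<tau> j}. p t = poly q t)) \<and>
     (\<forall>t. t \<notin> (\<Union>j\<in>{1..M}. {\<tau> (j-1)<..<\<tau> j}) \<longrightarrow> p t = 0)}"

definition space_time :: "(real \<Rightarrow> real) set \<Rightarrow> ('b \<Rightarrow> real) set \<Rightarrow> (real \<Rightarrow> 'b \<Rightarrow> real) set" where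
  "space_time S V = span {(\<lambda>t z. p t * W z) | p W. p \<in> S \<and> W \<in> V}"

definition lim_right :: "(real \<Rightarrow> 'a \<Rightarrow> real) \<Rightarrow> real \<Rightarrow> 'a \<Rightarrow> real" where
  "lim_right u t = (\<lambda>x. Lim (at_right t) (\<lambda>\<tau>. u \<tau> x))"

definition lim_left :: "(real \<Rightarrow> 'a \<Rightarrow> real) \<Rightarrow> real \<Rightarrow> 'a \<Rightarrow> real" where
  "lim_left u t = (\<lambda>x. Lim (at_left t) (\<lambda>\<tau>. u \<tau> x))"

definition jump :: "(real \<Rightarrow> 'a \<Rightarrow> real) \<Rightarrow> real \<Rightarrow> 'a \<Rightarrow> real" where
  "jump u t = lim_right u t - lim_left u t"

definition time_deriv :: "(real \<Rightarrow> 'a \<Rightarrow> real) \<Rightarrow> real \<Rightarrow> 'a \<Rightarrow> real" where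
  "time_deriv U t = (\<lambda>z. deriv (\<lambda>\<tau>. U \<tau> z) t)"

definition form_B :: "(real^'n) set \<Rightarrow> (real^'n \<Rightarrow> real^'n^'n) \<Rightarrow> (real^'n \<Rightarrow> real) \<Rightarrow> real \<Rightarrow>
    nat \<Rightarrow> (nat \<Rightarrow> real) \<Rightarrow>
    (real \<Rightarrow> (real^'n) \<times> real \<Rightarrow> real) \<Rightarrow> (real \<Rightarrow> (real^'n) \<times> real \<Rightarrow> real) \<Rightarrow> real" where
  "form_B \<Omega> A c s M \<tau> U V =
     (\<Sum>j=1..M. LINT t|lebesgue_on {\<tau> (j-1)<..<\<tau> j}.
         L2_inner \<Omega> (tr (time_deriv U t)) (tr (V t)) + form_A \<Omega> A c s (U t) (V t) / d_const s)
   + (\<Sum>j=2..M. L2_inner \<Omega> (jump (\<lambda>t. tr (U t)) (\<tau> (j-1))) (lim_right (\<lambda>t. tr (V t)) (\<tau> (j-1))))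
   + L2_inner \<Omega> (lim_right (\<lambda>t. tr (U t)) (\<tau> 0)) (lim_right (\<lambda>t. tr (V t)) (\<tau> 0))"

definition form_F :: "(real^'n) set \<Rightarrow> nat \<Rightarrow> (nat \<Rightarrow> real) \<Rightarrow> (real \<Rightarrow> real^'n \<Rightarrow> real) \<Rightarrow>
    (real^'n \<Rightarrow> real) \<Rightarrow> (real \<Rightarrow> (real^'n) \<times> real \<Rightarrow> real) \<Rightarrow> real" where
  "form_F \<Omega> M \<tau> f u0 V =
     (\<Sum>j=1..M. LINT t|lebesgue_on {\<tau> (j-1)<..<\<tau> j}. L2_inner \<Omega> (f t) (tr (V t)))
   + L2_inner \<Omega> u0 (lim_right (\<lambda>t. tr (V t)) (\<tau> 0))"

definition dg_solution :: "(real^'n) set \<Rightarrow> (real^'n \<Rightarrow> real^'n^'n) \<Rightarrow> (real^'n \<Rightarrow> real) \<Rightarrow> real \<Rightarrow>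
    (real^'n \<Rightarrow> real) set \<Rightarrow> (real \<Rightarrow> real) set \<Rightarrow> nat \<Rightarrow> (nat \<Rightarrow> real) \<Rightarrow> (nat \<Rightarrow> nat) \<Rightarrow>
    (real \<Rightarrow> real^'n \<Rightarrow> real) \<Rightarrow> (real^'n \<Rightarrow> real) \<Rightarrow>
    (real \<Rightarrow> (real^'n) \<times> real \<Rightarrow> real) \<Rightarrow> bool" where
  "dg_solution \<Omega> A c s VX VY M \<tau> r f u0 U \<longleftrightarrow>
     U \<in> space_time (pw_poly M \<tau> r) (tensor VX VY) \<and>
     (\<forall>V\<in>space_time (pw_poly M \<tau> r) (tensor VX VY).
        form_B \<Omega> A c s M \<tau> U V = form_F \<Omega> M \<tau> f u0 V)"

definition graded_mesh :: "real \<Rightarrow> (real \<Rightarrow> real) \<Rightarrow> nat \<Rightarrow> nat \<Rightarrow> real" where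
  "graded_mesh T h M j = T * h (real j / real M)"

end

theory Submission
  imports Defs
begin

text \<open>
The semidiscrete and the fully discrete problem are both diagonalised by the eigenvectors of the discrete
fractional operator. Its quadratic form on the finite dimensional space \<open>VX\<close> is that of the extended
problem, evaluated at liftings; \<open>simultaneous_diagonalisation\<close> yields an \<open>L2\<close>-orthonormal basis \<open>E\<close> of
\<open>VX\<close> that is orthogonal for it, with eigenvalues \<open>\<kappa> e \<ge> 0\<close>. Tested with \<open>p t * lift e\<close>, the discontinuous
Galerkin equations become the scalar discontinuous Galerkin equations for \<open>y' + \<kappa> e * y = g\<close> in every mode
(\<open>dg_equation\<close>). Nothing below depends on the size of the eigenvalues or on their number, which is why the
constant is independent of the discretization.

For one mode, \<open>dg_step\<close> compares the energy of the error with that of the error of a projection which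
interpolates at the right end point, and telescopes. The projection is stable, which is used on the first
interval, and of full order \<open>r + 1\<close> in terms of the derivative of that order, which is used on all others.
The derivatives blow up at \<open>t = 0\<close> at a rate determined by the interpolation order \<open>\<beta>\<close> of the initial value
(\<open>energy_decay\<close>): the part of the initial value that is small in \<open>L2\<close> is smoothed by the semigroup, the other
part has finite energy, and the K-functional balances the two at scale \<open>sqrt t\<close>. The grading exponent
\<open>(2 r + 3) / \<beta>\<close> is exactly what equidistributes the resulting local errors (\<open>graded_mesh_step\<close>), so that their
sum is of order \<open>M powr -(2 r + 2)\<close> (\<open>dg_error\<close>). The initial error enters through Bessel's inequality.

It remains to pass from the discrete energy to the interpolation norm (\<open>trace_inequality\<close>). In the
K-functional at \<open>t\<close> the trace of a discrete function \<open>U\<close> is compared with the slice of \<open>U\<close> at height \<open>t\<close>: the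
difference is the integral of the vertical derivative, controlled by Hardy's inequality, and the \<open>H1\<close>-norm of
the slice is controlled by the horizontal gradient and the Poincare inequality. This requires some of the
calculus of weak gradients, developed from smooth bump functions: uniqueness, the fundamental theorem of
calculus for functions on the half line, and the gradient of a product of functions of separate variables.
\<close>

section \<open>Semidefinite forms on finite dimensional spaces\<close>

text \<open>Only semidefiniteness is assumed, because the energy form is applied to functions on the cylinder before functions that agree almost everywhere are identified.\<close>

locale psd_form =
 fixes W :: "'v::real_vector set" and B :: "'v => 'v => real"
 assumes sub: "subspace W"
  and add: "\<lbrakk>x \<in> W; y \<in> W; z \<in> W\<rbrakk> \<Longrightarrow> B (x + y) z = B x z + B y z"
  and scale: "\<lbrakk>x \<in> W; z \<in> W\<rbrakk> \<Longrightarrow> B (k *\<^sub>R x) z = k * B x z"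
  and sym: "\<lbrakk>x \<in> W; y \<in> W\<rbrakk> \<Longrightarrow> B x y = B y x"
  and nonneg: "x \<in> W ==> 0 <= B x x"
begin

lemma in_W [simp]:
 "0 \<in> W" "x \<in> W ==> y \<in> W ==> x + y \<in> W" "x \<in> W ==> k *\<^sub>R x \<in> W"
 "x \<in> W ==> y \<in> W ==> x - y \<in> W" "x \<in> W ==> - x \<in> W"
 using sub by (auto simp: subspace_0 subspace_add subspace_scale subspace_diff subspace_neg)

lemma sum_in_W: "(\<And>i. i \<in> I ==> f i \<in> W) ==> sum f I \<in> W"
 by (rule subspace_sum[OF sub])

lemma zero_left [simp]: "z \<in> W ==> B 0 z = 0"
 using scale[of 0 z 0] by simp

lemma diff: "\<lbrakk>x \<in> W; y \<in> W; z \<in> W\<rbrakk> \<Longrightarrow> B (x - y) z = B x z - B y z"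
 using add[of x "(-1) *\<^sub>R y" z] scale[of y z "-1"] by simp

lemma add_right: "\<lbrakk>x \<in> W; y \<in> W; z \<in> W\<rbrakk> \<Longrightarrow> B z (x + y) = B z x + B z y"
 using add[of x y z] sym[of z "x+y"] sym[of z x] sym[of z y] by simp

lemma scale_right: "\<lbrakk>x \<in> W; z \<in> W\<rbrakk> \<Longrightarrow> B z (k *\<^sub>R x) = k * B z x"
 using scale[of x z k] sym[of z "k *\<^sub>R x"] sym[of z x] by simp

lemma diff_right: "\<lbrakk>x \<in> W; y \<in> W; z \<in> W\<rbrakk> \<Longrightarrow> B z (x - y) = B z x - B z y"
 using diff[of x y z] sym[of z "x-y"] sym[of z x] sym[of z y] by simp

lemma sum_left: "(\<And>i. i \<in> I ==> f i \<in> W) ==> z \<in> W ==> B (sum f I) z = (\<Sum>i\<in>I. B (f i) z)"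
 by (induction I rule: infinite_finite_induct) (auto simp: add sum_in_W)

lemma sum_right: "(\<And>i. i \<in> I ==> f i \<in> W) ==> z \<in> W ==> B z (sum f I) = (\<Sum>i\<in>I. B z (f i))"
 by (induction I rule: infinite_finite_induct) (auto simp: add_right sum_in_W sym[of z 0])

lemma quad_expand:
 assumes "x \<in> W" "y \<in> W"
 shows "B (x + k *\<^sub>R y) (x + k *\<^sub>R y) = B x x + 2 * k * B x y + k^2 * B y y"
 using assms sym[of y x]
 by (simp add: add add_right scale scale_right power2_eq_square algebra_simps)

lemma Cauchy_Schwarz:
 assumes "x \<in> W" "y \<in> W"
 shows "(B x y)^2 <= B x x * B y y"
proof (cases "B y y = 0")
 case True
 have "B x y = 0"
 proof (rule ccontr)
  assume n: "B x y \<noteq> 0"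
  have "0 <= B x x + 2 * (-(B x x + 1) / (2 * B x y)) * B x y"
   using nonneg[of "x + (-(B x x + 1) / (2 * B x y)) *\<^sub>R y"] quad_expand[OF assms] assms True by simp
  also have "\<dots> = -1" using n by (simp add: field_simps)
  finally show False by simp
 qed
 then show ?thesis using True by simp
next
 case False
 then have pos: "B y y > 0" using nonneg[OF assms(2)] by simp
 have "0 <= B x x + 2 * (- B x y / B y y) * B x y + (- B x y / B y y)^2 * B y y"
  using nonneg[of "x + (- B x y / B y y) *\<^sub>R y"] quad_expand[OF assms, of "- B x y / B y y"] assms
  by (metis in_W(2,3))
 also have "\<dots> = B x x - (B x y)\<^sup>2 / B y y"
  using pos by (simp add: field_simps power2_eq_square)
 finally show ?thesis using pos by (simp add: field_simps)
qed

lemma null_vector: "\<lbrakk>x \<in> W; y \<in> W; B y y = 0\<rbrakk> \<Longrightarrow> B x y = 0"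
 using Cauchy_Schwarz[of x y] by simp

text \<open>Orthogonalisation one vector at a time; a vector that becomes null in the process is
  orthogonal to everything by the Cauchy-Schwarz inequality and can be ignored, so definiteness
  is not an issue.\<close>

lemma projection_onto_span:
 assumes "finite S" "S \<subseteq> W" "u \<in> W"
 shows "\<exists>p\<in>span S. \<forall>v\<in>span S. B (u - p) v = 0"
 using assms
proof (induction S arbitrary: u rule: finite_induct)
 case empty
 then show ?case by (auto intro!: bexI[of _ 0] simp: sym[of _ 0])
next
 case (insert x S)
 have SW: "span S \<subseteq> W" "span (insert x S) \<subseteq> W"
  using insert.prems span_minimal[OF _ sub] by auto
 obtain q where q: "q \<in> span S" "\<forall>v\<in>span S. B (x - q) v = 0"
  using insert.IH[of x] insert.prems by auto
 obtain p where p: "p \<in> span S" "\<forall>v\<in>span S. B (u - p) v = 0"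
  using insert.IH[of u] insert.prems by auto
 define x' where "x' = x - q"
 define k where "k = B u x' / B x' x'"
 have W: "x \<in> W" "q \<in> W" "p \<in> W" "x' \<in> W" "u \<in> W"
  using insert.prems p q SW by (auto simp: x'_def)
 have x'p: "B x' p = 0" using q p by (simp add: x'_def)
 have k: "k * B x' x' = B u x'"
  using null_vector[of u x'] W by (cases "B x' x' = 0") (auto simp: k_def)
 have qS: "q \<in> span (insert x S)" "p \<in> span (insert x S)"
  using p q span_mono[of S "insert x S"] by auto
 then have x'S: "x' \<in> span (insert x S)"
  unfolding x'_def by (intro span_diff[OF span_base]) auto
 have res: "p + k *\<^sub>R x' \<in> span (insert x S)"
  by (intro span_add span_scale qS x'S)
 moreover have "B (u - (p + k *\<^sub>R x')) v = 0" if v: "v \<in> span (insert x S)" for v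
 proof -
  obtain c where c: "v - c *\<^sub>R x \<in> span S"
   using v by (auto simp: span_breakdown_eq)
  define w where "w = v - c *\<^sub>R x'"
  have "w = (v - c *\<^sub>R x) + c *\<^sub>R q" by (simp add: w_def x'_def algebra_simps)
  then have wS: "w \<in> span S" using c q by (simp add: span_add span_scale)
  have wW: "w \<in> W" using wS SW by auto
  have v_eq: "v = w + c *\<^sub>R x'" by (simp add: w_def)
  have 1: "B (u - p) w = 0" using p wS by auto
  have 2: "B x' w = 0" using q wS by (auto simp: x'_def)
  have px: "B p x' = 0" using x'p sym[of p x'] W by simp
  have "B (u - (p + k *\<^sub>R x')) v = B (u - p) w - k * B x' w + c * (B u x' - B p x' - k * B x' x')"
   unfolding v_eq using W wW by (simp add: diff add add_right scale scale_right algebra_simps)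
  then show ?thesis using 1 2 k px by simp
 qed
 ultimately show ?case by blast
qed

definition orthonormal :: "'v set => bool" where
 "orthonormal E \<longleftrightarrow> finite E \<and> E \<subseteq> W \<and> (\<forall>e\<in>E. \<forall>e'\<in>E. B e e' = (if e = e' then 1 else 0))"

lemma orthonormal_expand_inner:
 assumes "orthonormal E" "e \<in> E"
 shows "B (\<Sum>x\<in>E. c x *\<^sub>R x) e = c e"
proof -
 have "B (\<Sum>x\<in>E. c x *\<^sub>R x) e = (\<Sum>x\<in>E. c x * B x e)"
  using assms by (subst sum_left) (auto simp: orthonormal_def scale subset_iff intro!: sum.cong)
 also have "\<dots> = (\<Sum>x\<in>E. if x = e then c x else 0)"
  using assms by (intro sum.cong) (auto simp: orthonormal_def)
 finally show ?thesis using assms by (simp add: orthonormal_def)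
qed

lemma orthonormal_independent:
 assumes "orthonormal E"
 shows "independent E"
proof
 assume "dependent E"
 then obtain u where u: "\<exists>v\<in>E. u v \<noteq> 0" "(\<Sum>v\<in>E. u v *\<^sub>R v) = 0"
  using dependent_finite[of E] assms by (auto simp: orthonormal_def)
 then obtain v where v: "v \<in> E" "u v \<noteq> 0" by auto
 have "v \<in> W" using assms v by (auto simp: orthonormal_def)
 then show False using orthonormal_expand_inner[OF assms v(1), of u] u v by simp
qed

lemma orthonormal_residual:
 assumes "orthonormal E" "v \<in> W"
 defines "w \<equiv> v - (\<Sum>x\<in>E. B v x *\<^sub>R x)"
 shows "w \<in> W" and "\<And>e. e \<in> E ==> B w e = 0"
proof -
 have "(\<Sum>x\<in>E. B v x *\<^sub>R x) \<in> W"
  using assms(1) by (intro sum_in_W) (auto simp: orthonormal_def)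
 then show w: "w \<in> W" using assms by auto
 fix e assume e: "e \<in> E"
 then have "e \<in> W" using assms by (auto simp: orthonormal_def)
 then show "B w e = 0"
  using orthonormal_expand_inner[OF assms(1) e] assms(2) \<open>(\<Sum>x\<in>E. B v x *\<^sub>R x) \<in> W\<close>
  by (simp add: w_def diff)
qed

lemma Bessel:
 assumes "orthonormal E" "v \<in> W"
 shows "(\<Sum>e\<in>E. (B v e)^2) <= B v v"
proof -
 define p where "p = (\<Sum>x\<in>E. B v x *\<^sub>R x)"
 have EW: "E \<subseteq> W" using assms by (auto simp: orthonormal_def)
 have pW: "p \<in> W" unfolding p_def using EW by (intro sum_in_W) auto
 have vp: "B v p = (\<Sum>e\<in>E. (B v e)^2)"
  unfolding p_def using EW assms by (subst sum_right) (auto simp: scale_right power2_eq_square intro!: sum.cong)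
 have "B p p = (\<Sum>e\<in>E. B v e * B p e)"
  using EW pW by (subst (2) p_def, subst sum_right) (auto simp: scale_right intro!: sum.cong)
 also have "\<dots> = (\<Sum>e\<in>E. (B v e)^2)"
  using orthonormal_expand_inner[OF assms(1), of _ "B v"]
  by (intro sum.cong) (auto simp: p_def power2_eq_square)
 finally have pp: "B p p = (\<Sum>e\<in>E. (B v e)^2)" .
 have "0 <= B (v - p) (v - p)" using assms pW by (intro nonneg) auto
 also have "\<dots> = B v v - 2 * B v p + B p p"
  using assms pW sym[of p v] by (simp add: diff diff_right)
 finally show ?thesis using vp pp by simp
qed

end

locale inner_form = psd_form +
 assumes definite: "\<lbrakk>x \<in> W; B x x = 0\<rbrakk> \<Longrightarrow> x = 0"
begin

lemma orthonormal_expansion: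
 assumes "orthonormal E" "span E = W" "v \<in> W"
 shows "v = (\<Sum>x\<in>E. B v x *\<^sub>R x)"
proof -
 define w where "w = v - (\<Sum>x\<in>E. B v x *\<^sub>R x)"
 note w = orthonormal_residual[OF assms(1,3), folded w_def]
 have "x \<in> W \<and> B w x = 0" if "x \<in> span E" for x
  using that
 proof (induction rule: span_induct_alt)
  case base
  then show ?case using w(1) sym[of w 0] by simp
 next
  case (step c x y)
  have "x \<in> W" using step assms(1) by (auto simp: orthonormal_def)
  then show ?case using step w by (simp add: add_right scale_right)
 qed
 then have "B w w = 0" using w assms by auto
 then have "w = 0" using definite w by blast
 then show ?thesis unfolding w_def by simp
qed

lemma exists_unit_orthogonal:
 assumes "orthonormal E" "span E \<noteq> W"
 shows "\<exists>w\<in>W. w \<noteq> 0 \<and> (\<forall>e\<in>E. B w e = 0)"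
proof -
 have "span E \<subseteq> W" using assms span_minimal[OF _ sub] by (auto simp: orthonormal_def)
 then obtain v where v: "v \<in> W" "v \<notin> span E" using assms by blast
 define w where "w = v - (\<Sum>x\<in>E. B v x *\<^sub>R x)"
 note w = orthonormal_residual[OF assms(1) v(1), folded w_def]
 have "(\<Sum>x\<in>E. B v x *\<^sub>R x) \<in> span E" by (intro span_sum span_scale span_base) auto
 then have "w \<noteq> 0" using v unfolding w_def by auto
 then show ?thesis using w by auto
qed

text \<open>An orthonormal set of vectors with some property \<open>P\<close> has at most \<open>dim W\<close> elements, so one of
  maximal size exists; if every non-spanning one can be enlarged, the maximal one spans.\<close>

lemma orthonormal_basis_with:
 assumes "finite S" "W \<subseteq> span S"
  and ext: "\<And>E. orthonormal E ==> \<forall>e\<in>E. P e ==> span E \<noteq> W ==>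
     \<exists>u\<in>W. B u u = 1 \<and> P u \<and> (\<forall>e\<in>E. B u e = 0)"
 shows "\<exists>E. orthonormal E \<and> (\<forall>e\<in>E. P e) \<and> span E = W"
proof -
 define good where "good = (%k. \<exists>E. orthonormal E \<and> (\<forall>e\<in>E. P e) \<and> card E = k)"
 have bound: "k <= card S" if gk: "good k" for k
 proof -
  obtain E where E: "orthonormal E" "card E = k" using gk unfolding good_def by blast
  then have "E \<subseteq> span S" using assms(2) unfolding orthonormal_def by blast
  then show ?thesis
   using independent_span_bound[OF assms(1) orthonormal_independent[OF E(1)]] E by auto
 qed
 have "good 0" unfolding good_def by (rule exI[of _ "{}"]) (auto simp: orthonormal_def)
 then obtain k where k: "good k" "\<And>k'. good k' ==> k' <= k"
  using bound by (metis GreatestI_nat Greatest_le_nat)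
 then obtain E where E: "orthonormal E" "\<forall>e\<in>E. P e" "card E = k" unfolding good_def by blast
 have "span E = W"
 proof (rule ccontr)
  assume "span E \<noteq> W"
  then obtain u where u: "u \<in> W" "B u u = 1" "P u" "\<forall>e\<in>E. B u e = 0" using ext E by blast
  have "u \<notin> E" using u by force
  have "orthonormal (insert u E)"
   using E(1) u sym unfolding orthonormal_def by (auto simp: subset_iff)
  moreover have "card (insert u E) = Suc k"
   using E \<open>u \<notin> E\<close> by (simp add: orthonormal_def)
  ultimately have "good (Suc k)" using E u unfolding good_def by (intro exI[of _ "insert u E"]) auto
  then show False using k(2) by fastforce
 qed
 then show ?thesis using E by blast
qed

lemma normalize:
 assumes "w \<in> W" "w \<noteq> 0"
 shows "\<exists>k>0. B (k *\<^sub>R w) (k *\<^sub>R w) = 1"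
proof -
 have pos: "B w w > 0" using assms definite nonneg[of w] by (metis less_eq_real_def)
 show ?thesis
  using pos assms
  by (intro exI[of _ "1 / sqrt (B w w)"]) (auto simp: scale scale_right field_simps)
qed

lemma orthonormal_basis_exists:
 assumes "finite S" "W \<subseteq> span S"
 shows "\<exists>E. orthonormal E \<and> span E = W"
proof -
 have "\<exists>E. orthonormal E \<and> (\<forall>e\<in>E. True) \<and> span E = W"
 proof (rule orthonormal_basis_with[OF assms])
  fix E assume E: "orthonormal E" "span E \<noteq> W"
  obtain w where w: "w \<in> W" "w \<noteq> 0" "\<forall>e\<in>E. B w e = 0"
   using exists_unit_orthogonal[OF E] by auto
  obtain k where "B (k *\<^sub>R w) (k *\<^sub>R w) = 1" using normalize w by blast
  moreover have "\<forall>e\<in>E. B (k *\<^sub>R w) e = 0"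
   using w E by (auto simp: scale orthonormal_def subset_iff)
  ultimately show "\<exists>u\<in>W. B u u = 1 \<and> True \<and> (\<forall>e\<in>E. B u e = 0)" using w by auto
 qed
 then show ?thesis by auto
qed

lemma parseval:
 assumes "orthonormal E" "span E = W" "v \<in> W" "w \<in> W"
 shows "B v w = (\<Sum>e\<in>E. B v e * B w e)"
proof -
 have EW: "E \<subseteq> W" using assms by (auto simp: orthonormal_def)
 have "B v w = B v (\<Sum>x\<in>E. B w x *\<^sub>R x)" using orthonormal_expansion[OF assms(1,2,4)] by simp
 also have "\<dots> = (\<Sum>e\<in>E. B v (B w e *\<^sub>R e))"
  using EW assms(3) by (intro sum_right) auto
 also have "\<dots> = (\<Sum>e\<in>E. B v e * B w e)"
  using EW assms(3) by (intro sum.cong refl) (subst scale_right, auto)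
 finally show ?thesis .
qed

text \<open>The coefficients of the representing vector are the values of the functional on an orthonormal basis.\<close>

lemma Riesz:
 assumes "finite S" "W \<subseteq> span S"
  and lin: "\<And>x y. x \<in> W ==> y \<in> W ==> l (x + y) = l x + l y"
      "\<And>x k. x \<in> W ==> l (k *\<^sub>R x) = k * (l x :: real)"
 shows "\<exists>!w. w \<in> W \<and> (\<forall>v\<in>W. B w v = l v)"
proof -
 obtain E where E: "orthonormal E" "span E = W" using orthonormal_basis_exists[OF assms(1,2)] by blast
 have EW: "E \<subseteq> W" using E by (auto simp: orthonormal_def)
 define w where "w = (\<Sum>e\<in>E. l e *\<^sub>R e)"
 have wW: "w \<in> W" unfolding w_def using EW by (intro sum_in_W) auto
 have lsum: "l (\<Sum>e\<in>F. c e *\<^sub>R e) = (\<Sum>e\<in>F. c e * l e)" if "F \<subseteq> E" for F c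
  using finite_subset[OF that] E(1) that unfolding orthonormal_def
 proof (induction F rule: infinite_finite_induct)
  case (insert x F)
  then show ?case using lin EW by (auto simp: sum_in_W subset_iff)
 qed (use lin(2)[of 0 0] in auto)
 have "B w v = l v" if v: "v \<in> W" for v
 proof -
  have "B w v = (\<Sum>e\<in>E. B w e * B v e)" by (rule parseval[OF E wW v])
  also have "\<dots> = (\<Sum>e\<in>E. B v e * l e)"
   using orthonormal_expand_inner[OF E(1), of _ l] by (intro sum.cong) (auto simp: w_def)
  also have "\<dots> = l (\<Sum>e\<in>E. B v e *\<^sub>R e)" by (simp add: lsum)
  finally show ?thesis using orthonormal_expansion[OF E v] by simp
 qed
 moreover have "w' = w" if "w' \<in> W" "\<forall>v\<in>W. B w' v = l v" for w'
 proof -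
  have "B (w' - w) (w' - w) = 0" using that wW calculation by (simp add: diff)
  then have "w' - w = 0" using that wW by (intro definite) auto
  then show ?thesis by simp
 qed
 ultimately show ?thesis using wW by blast
qed

text \<open>The trace of \<open>B'\<close> with respect to an orthonormal basis gives a constant.\<close>

lemma form_dominated:
 assumes "finite S" "W \<subseteq> span S" and "psd_form W B'"
 shows "\<exists>C>0. \<forall>v\<in>W. B' v v <= C * B v v"
proof -
 interpret b: psd_form W B' by fact
 obtain E where E: "orthonormal E" "span E = W" using orthonormal_basis_exists[OF assms(1,2)] by blast
 have EW: "E \<subseteq> W" and fE: "finite E" using E by (auto simp: orthonormal_def)
 define C where "C = (\<Sum>e\<in>E. B' e e)"
 have C0: "C \<ge> 0" unfolding C_def using EW b.nonneg by (intro sum_nonneg) auto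
 have le: "B' v v <= C * B v v" if v: "v \<in> W" for v
 proof -
  define c where "c = B v"
  have ex: "v = (\<Sum>e\<in>E. c e *\<^sub>R e)" using orthonormal_expansion[OF E v] by (simp add: c_def)
  have one: "B' v e <= sqrt (B' v v) * sqrt (B' e e)" "- B' v e <= sqrt (B' v v) * sqrt (B' e e)"
   if "e \<in> E" for e
  proof -
   have "\<bar>B' v e\<bar> <= sqrt (B' v v * B' e e)"
    using b.Cauchy_Schwarz[OF v, of e] that EW by (intro real_le_rsqrt) (auto simp: )
   then show "B' v e <= sqrt (B' v v) * sqrt (B' e e)" "- B' v e <= sqrt (B' v v) * sqrt (B' e e)"
    by (auto simp: real_sqrt_mult)
  qed
  have "B' v v = (\<Sum>e\<in>E. c e * B' v e)"
  proof -
   have "B' v v = B' v (\<Sum>e\<in>E. c e *\<^sub>R e)" by (rule arg_cong[OF ex])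
   also have "\<dots> = (\<Sum>e\<in>E. B' v (c e *\<^sub>R e))" using EW v by (intro b.sum_right) auto
   also have "\<dots> = (\<Sum>e\<in>E. c e * B' v e)" using EW v by (intro sum.cong refl b.scale_right) auto
   finally show ?thesis .
  qed
  also have "\<dots> <= (\<Sum>e\<in>E. \<bar>c e\<bar> * (sqrt (B' v v) * sqrt (B' e e)))"
  proof (rule sum_mono)
   fix e assume "e \<in> E"
   then have "\<bar>B' v e\<bar> <= sqrt (B' v v) * sqrt (B' e e)" using one by (auto simp: abs_le_iff)
   then have "\<bar>c e\<bar> * \<bar>B' v e\<bar> <= \<bar>c e\<bar> * (sqrt (B' v v) * sqrt (B' e e))"
    by (rule mult_left_mono) simp
   then show "c e * B' v e <= \<bar>c e\<bar> * (sqrt (B' v v) * sqrt (B' e e))"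
    using abs_ge_self[of "c e * B' v e"] unfolding abs_mult by linarith
  qed
  also have "\<dots> = sqrt (B' v v) * (\<Sum>e\<in>E. \<bar>c e\<bar> * sqrt (B' e e))"
   by (simp add: sum_distrib_left mult_ac)
  finally have 1: "B' v v <= sqrt (B' v v) * (\<Sum>e\<in>E. \<bar>c e\<bar> * sqrt (B' e e))" .
  have "sqrt (B' v v) <= (\<Sum>e\<in>E. \<bar>c e\<bar> * sqrt (B' e e))"
  proof (cases "B' v v = 0")
   case True
   then show ?thesis using EW b.nonneg by (auto intro!: sum_nonneg)
  next
   case False
   then have p: "sqrt (B' v v) > 0" using b.nonneg[OF v] by auto
   have "sqrt (B' v v) * sqrt (B' v v) <= sqrt (B' v v) * (\<Sum>e\<in>E. \<bar>c e\<bar> * sqrt (B' e e))"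
    using 1 b.nonneg[OF v] by simp
   then show ?thesis using p by (simp only: mult_le_cancel_left_pos)
  qed
  then have "B' v v <= (\<Sum>e\<in>E. \<bar>c e\<bar> * sqrt (B' e e))^2"
   using b.nonneg[OF v] by (metis power_mono real_sqrt_ge_zero real_sqrt_pow2)
  also have "\<dots> <= (\<Sum>e\<in>E. \<bar>c e\<bar>\<^sup>2) * (\<Sum>e\<in>E. (sqrt (B' e e))^2)"
   by (rule Cauchy_Schwarz_ineq_sum)
  also have "(\<Sum>e\<in>E. (sqrt (B' e e))^2) = C"
   unfolding C_def using EW b.nonneg by (intro sum.cong) auto
  also have "(\<Sum>e\<in>E. \<bar>c e\<bar>\<^sup>2) = B v v"
   using parseval[OF E v v] by (simp add: c_def power2_eq_square)
  finally show ?thesis by (simp add: mult.commute)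
 qed
 show ?thesis
 proof (intro exI[of _ "C + 1"] conjI ballI)
  fix v assume v: "v \<in> W"
  then show "B' v v <= (C + 1) * B v v" using le[OF v] nonneg[OF v] by (simp add: algebra_simps)
 qed (use C0 in auto)
qed

text \<open>A unit vector minimising \<open>A\<close> over the unit sphere of a subspace is \<open>A\<close>-orthogonal to all
  vectors of that subspace that are \<open>B\<close>-orthogonal to it. The minimum exists because the coordinates
  with respect to an orthonormal basis range over a compact set.\<close>

lemma minimiser_on_sphere:
 assumes fin: "finite S" "W \<subseteq> span S" and "psd_form W A"
  and E: "E \<subseteq> W" and w: "w \<in> W" "w \<noteq> 0" "\<forall>e\<in>E. B w e = 0"
 shows "\<exists>u\<in>W. B u u = 1 \<and> (\<forall>e\<in>E. B u e = 0) \<and>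
     (\<forall>v\<in>W. (\<forall>e\<in>E. B v e = 0) \<longrightarrow> B u v = 0 \<longrightarrow> A u v = 0)"
proof -
 interpret a: psd_form W A by fact
 obtain F where F: "orthonormal F" "span F = W" using orthonormal_basis_exists[OF fin] by blast
 have FW: "F \<subseteq> W" and fF: "finite F" using F by (auto simp: orthonormal_def)
 define X where "X = PiE UNIV (%b. if b \<in> F then {-1..1::real} else {0})"
 define vec where "vec = (%x. \<Sum>b\<in>F. x b *\<^sub>R b)"
 define K where "K = X \<inter> {x. (\<Sum>b\<in>F. (x b)^2) = 1} \<inter> (\<Inter>e\<in>E. {x. (\<Sum>b\<in>F. x b * B b e) = 0})"
 have vecW: "vec x \<in> W" for x unfolding vec_def using FW by (intro sum_in_W) auto
 have vecB: "B (vec x) v = (\<Sum>b\<in>F. x b * B b v)" if "v \<in> W" for x v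
 proof -
  have "B (vec x) v = (\<Sum>b\<in>F. B (x b *\<^sub>R b) v)"
   unfolding vec_def using FW that by (intro sum_left) auto
  also have "\<dots> = (\<Sum>b\<in>F. x b * B b v)" using FW that by (intro sum.cong refl scale) auto
  finally show ?thesis .
 qed
 have vecA: "A (vec x) v = (\<Sum>b\<in>F. x b * A b v)" if "v \<in> W" for x v
 proof -
  have "A (vec x) v = (\<Sum>b\<in>F. A (x b *\<^sub>R b) v)"
   unfolding vec_def using FW that by (intro a.sum_left) auto
  also have "\<dots> = (\<Sum>b\<in>F. x b * A b v)" using FW that by (intro sum.cong refl a.scale) auto
  finally show ?thesis .
 qed
 have vecA2: "A (vec x) (vec x) = (\<Sum>b\<in>F. x b * (\<Sum>d\<in>F. x d * A d b))" for x
  unfolding vecA[OF vecW]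
 proof (intro sum.cong refl arg_cong2[where f = "(*)"])
  fix b assume "b \<in> F"
  then show "A b (vec x) = (\<Sum>d\<in>F. x d * A d b)"
   using FW vecA[of b x] a.sym[OF vecW, of b x] by auto
 qed
 have vecn: "B (vec x) (vec x) = (\<Sum>b\<in>F. (x b)^2)" for x
 proof -
  have "B (vec x) (vec x) = (\<Sum>b\<in>F. B (vec x) b * B (vec x) b)"
   by (rule parseval[OF F vecW vecW])
  also have "\<dots> = (\<Sum>b\<in>F. (x b)^2)"
   using orthonormal_expand_inner[OF F(1), of _ x] by (intro sum.cong) (auto simp: vec_def power2_eq_square)
  finally show ?thesis .
 qed
 have coord: "\<exists>x\<in>K. vec x = v" if v: "v \<in> W" "B v v = 1" "\<forall>e\<in>E. B v e = 0" for v
 proof -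
  define x where "x = (%b. if b \<in> F then B v b else 0)"
  have vx: "vec x = v" using orthonormal_expansion[OF F v(1)] by (simp add: vec_def x_def)
  have s: "(\<Sum>b\<in>F. (x b)^2) = 1" using vecn[of x] vx v by simp
  have "(x b)^2 <= 1" if "b \<in> F" for b
   using member_le_sum[of b F "%b. (x b)^2"] s that fF by simp
  then have "x \<in> X" by (auto simp: X_def x_def abs_square_le_1 abs_le_iff)
  moreover have "(\<Sum>b\<in>F. x b * B b e) = 0" if "e \<in> E" for e
   using vecB[of e x] that E vx v by auto
  ultimately have "x \<in> K" using s by (auto simp: K_def)
  then show ?thesis using vx by blast
 qed
 have cont: "continuous_on UNIV (%x::'a => real. x b)" for b
  by (rule continuous_on_product_coordinates)
 have "compact X"
  unfolding X_def
  using compactin_PiE[of "%_. euclideanreal" UNIV "%b. if b \<in> F then {-1..1::real} else {0}"]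
  by (auto simp: euclidean_product_topology)
 moreover have "closed {x::'a => real. (\<Sum>b\<in>F. (x b)^2) = 1}"
  by (intro closed_Collect_eq continuous_intros cont)
 moreover have "closed {x::'a => real. (\<Sum>b\<in>F. x b * B b e) = 0}" for e
  by (intro closed_Collect_eq continuous_intros cont)
 ultimately have "compact K"
  unfolding K_def by (intro compact_Int_closed closed_INT) auto
 moreover have "continuous_on K (%x. A (vec x) (vec x))"
  unfolding vecA2 by (intro continuous_intros continuous_on_subset[OF cont]) auto
 moreover have "K \<noteq> {}"
 proof -
  obtain k where "B (k *\<^sub>R w) (k *\<^sub>R w) = 1" using normalize w by blast
  moreover have "\<forall>e\<in>E. B (k *\<^sub>R w) e = 0" using w E by (auto simp: scale subset_iff)
  ultimately show ?thesis using coord[of "k *\<^sub>R w"] w by auto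
 qed
 ultimately obtain x where x: "x \<in> K" "\<forall>y\<in>K. A (vec x) (vec x) <= A (vec y) (vec y)"
  using continuous_attains_inf[of K "%x. A (vec x) (vec x)"] by auto
 define u where "u = vec x"
 define m where "m = A u u"
 define V where "V = {v \<in> W. \<forall>e\<in>E. B v e = 0}"
 have u: "u \<in> W" "B u u = 1" "\<forall>e\<in>E. B u e = 0"
  using x(1) vecB[of _ x] E vecn[of x] vecW by (auto simp: u_def K_def subset_iff)
 have min: "m * B z z <= A z z" if z: "z \<in> V" for z
 proof (cases "z = 0")
  case False
  have zW: "z \<in> W" "\<forall>e\<in>E. B z e = 0" using z by (auto simp: V_def)
  obtain k where k: "k > 0" "B (k *\<^sub>R z) (k *\<^sub>R z) = 1" using normalize zW False by blast
  have "\<forall>e\<in>E. B (k *\<^sub>R z) e = 0" using zW E by (auto simp: scale subset_iff)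
  then obtain y where "y \<in> K" "vec y = k *\<^sub>R z" using coord[of "k *\<^sub>R z"] zW k by auto
  then have "m <= A (k *\<^sub>R z) (k *\<^sub>R z)" using x(2) by (auto simp: m_def u_def)
  also have "\<dots> = k^2 * A z z" using zW by (simp add: a.scale a.scale_right power2_eq_square)
  finally have "m * B z z <= k^2 * A z z * B z z"
   using nonneg[OF zW(1)] by (rule mult_right_mono)
  also have "\<dots> = A z z"
   using k zW by (simp add: scale scale_right power2_eq_square)
  finally show ?thesis .
 qed auto
 have V: "subspace V" unfolding subspace_def V_def using E by (auto simp: add scale subset_iff)
 have VW: "V \<subseteq> W" by (auto simp: V_def)
 interpret d: psd_form V "%x y. A x y - m * B x y"
 proof
  fix x y assume "x \<in> V" "y \<in> V"
  then have "B x y = B y x" "A x y = A y x" using sym a.sym VW by blast+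
  then show "A x y - m * B x y = A y x - m * B y x" by simp
 qed (use V VW min in \<open>auto simp: subset_iff add scale a.add a.scale algebra_simps\<close>)
 have uV: "u \<in> V" using u by (auto simp: V_def)
 have "A v u = m * B v u" if "v \<in> V" for v
  using d.null_vector[OF that uV] u by (simp add: m_def)
 then have "A u v = 0" if "v \<in> W" "\<forall>e\<in>E. B v e = 0" "B u v = 0" for v
  using that sym[OF u(1) that(1)] a.sym[OF u(1) that(1)] by (auto simp: V_def)
 then show ?thesis using u by blast
qed

text \<open>Each new basis vector minimises \<open>A\<close> over the unit sphere of the complement of the previous ones.
  The property that \<open>B e v = 0\<close> implies \<open>A e v = 0\<close> characterises eigenvectors without operators and adjoints.\<close>

theorem simultaneous_diagonalisation:
 assumes "finite S" "W \<subseteq> span S" and "psd_form W A"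
 shows "\<exists>E. orthonormal E \<and> span E = W \<and> (\<forall>e\<in>E. \<forall>v\<in>W. A e v = A e e * B e v)"
proof -
 interpret a: psd_form W A by fact
 define P where "P = (%e. \<forall>v\<in>W. B e v = 0 \<longrightarrow> A e v = 0)"
 have "\<exists>E. orthonormal E \<and> (\<forall>e\<in>E. P e) \<and> span E = W"
 proof (rule orthonormal_basis_with[OF assms(1,2)])
  fix E assume E: "orthonormal E" "\<forall>e\<in>E. P e" "span E \<noteq> W"
  have EW: "E \<subseteq> W" using E by (auto simp: orthonormal_def)
  obtain w where w: "w \<in> W" "w \<noteq> 0" "\<forall>e\<in>E. B w e = 0"
   using exists_unit_orthogonal[OF E(1,3)] by auto
  obtain u where u: "u \<in> W" "B u u = 1" "\<forall>e\<in>E. B u e = 0"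
   and min: "\<And>v. v \<in> W ==> \<forall>e\<in>E. B v e = 0 ==> B u v = 0 ==> A u v = 0"
   using minimiser_on_sphere[OF assms EW w] by blast
  have "A u v = 0" if v: "v \<in> W" "B u v = 0" for v
  proof -
   define p where "p = (\<Sum>x\<in>E. B v x *\<^sub>R x)"
   note res = orthonormal_residual[OF E(1) v(1), folded p_def]
   have pW: "p \<in> W" unfolding p_def using EW by (intro sum_in_W) auto
   have ue: "A u e = 0" "B u e = 0" if "e \<in> E" for e
   proof -
    have "e \<in> W" "P e" using that EW E by auto
    then show "B u e = 0" "A u e = 0"
     using u that sym[of e u] a.sym[of e u] by (auto simp: P_def)
   qed
   have "A u p = (\<Sum>x\<in>E. A u (B v x *\<^sub>R x))" unfolding p_def using EW u by (intro a.sum_right) auto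
   also have "\<dots> = 0" using ue EW u by (intro sum.neutral) (auto simp: a.scale_right subset_iff)
   finally have Ap: "A u p = 0" .
   have "B u p = (\<Sum>x\<in>E. B u (B v x *\<^sub>R x))" unfolding p_def using EW u by (intro sum_right) auto
   also have "\<dots> = 0" using ue EW u by (intro sum.neutral) (auto simp: scale_right subset_iff)
   finally have Bp: "B u p = 0" .
   have "A u (v - p) = 0" using res v Bp pW u by (intro min) (auto simp: diff_right)
   then show ?thesis using Ap v pW u by (simp add: a.diff_right)
  qed
  then show "\<exists>u\<in>W. B u u = 1 \<and> P u \<and> (\<forall>e\<in>E. B u e = 0)" using u by (auto simp: P_def)
 qed
 then obtain E where E: "orthonormal E" "\<forall>e\<in>E. P e" "span E = W" by blast
 have "A e v = A e e * B e v" if "e \<in> E" "v \<in> W" for e v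
 proof -
  have e: "e \<in> W" "B e e = 1" "P e" using E that by (auto simp: orthonormal_def)
  have "A e (v - B e v *\<^sub>R e) = 0"
   using e that unfolding P_def by (auto simp: diff_right scale_right)
  then show ?thesis using e that by (simp add: a.diff_right a.scale_right)
 qed
 then show ?thesis using E by blast
qed

end

section \<open>Approximation by polynomials on one time interval\<close>

lemma continuous_on_poly [continuous_intros]:
 "continuous_on S f ==> continuous_on S (%x. poly p (f x :: real))"
 by (rule continuous_on_compose2[of UNIV "poly p"]) (auto intro: continuous_at_imp_continuous_on)

lemma poly_sq_integral_zero:
 fixes p :: "real poly"
 assumes "integral {0..1} (%x. x * (poly p x)^2) = 0"
 shows "p = 0"
proof (rule ccontr)
 assume "p \<noteq> 0"
 have "((%x. x * (poly p x)^2) has_integral 0) (cbox 0 1)"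
  using assms integrable_integral[OF integrable_continuous_interval[of 0 1 "%x. x * (poly p x)^2"]]
  by (simp add: continuous_on_poly continuous_on_mult continuous_on_power)
 then have zero: "x * (poly p x)^2 = 0" if "x \<in> {0..1}" for x :: real
  using that by (intro has_integral_0_cbox_imp_0[of 0 1 "%x. x * (poly p x)^2" x])
   (auto intro!: continuous_intros)
 have "poly p x = 0" if "x \<in> {0<..1}" for x
  using zero[of x] that by simp
 then have "{0<..1} \<subseteq> {x. poly p x = 0}" by blast
 then have "finite {0<..1::real}" using poly_roots_finite[OF \<open>p \<noteq> 0\<close>] finite_subset by blast
 then show False using infinite_Ioc[of 0 "1::real"] by simp
qed

lemma sum_fun_apply: "sum f A x = (\<Sum>a\<in>A. f a x)" for f :: "'a => 'b => 'c::comm_monoid_add"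
 by (induction A rule: infinite_finite_induct) auto

definition poly_funs :: "nat => (real => real) set" where
 "poly_funs n = {poly p | p. degree p <= n}"

lemma poly_funs_subspace: "subspace (poly_funs n)"
proof (rule subspaceI)
 show "0 \<in> poly_funs n" unfolding poly_funs_def by (auto intro!: exI[of _ "0::real poly"] simp: fun_eq_iff)
next
 fix f g assume "f \<in> poly_funs n" "g \<in> poly_funs n"
 then obtain p q where "f = poly p" "g = poly q" "degree p <= n" "degree q <= n" by (auto simp: poly_funs_def)
 then have "f + g = poly (p + q)" "degree (p + q) <= n" by (auto simp: fun_eq_iff intro: degree_add_le)
 then show "f + g \<in> poly_funs n" unfolding poly_funs_def by blast
next
 fix c f assume "f \<in> poly_funs n"
 then obtain p where "f = poly p" "degree p <= n" by (auto simp: poly_funs_def)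
 then have "c *\<^sub>R f = poly (smult c p)" "degree (smult c p) <= n"
  using degree_smult_le[of c p] by (auto simp: fun_eq_iff scaleR_fun_def simp del: degree_smult_eq)
 then show "c *\<^sub>R f \<in> poly_funs n" unfolding poly_funs_def by blast
qed

lemma poly_funs_finite_span: "\<exists>S. finite S \<and> poly_funs n \<subseteq> span S"
proof (intro exI[of _ "(%k x. x ^ k) ` {..n}"] conjI subsetI)
 fix f :: "real => real" assume "f \<in> poly_funs n"
 then obtain p where p: "f = poly p" "degree p <= n" by (auto simp: poly_funs_def)
 have "f = (\<Sum>k\<le>degree p. coeff p k *\<^sub>R (%x. x ^ k))"
  by (auto simp: p poly_altdef fun_eq_iff scaleR_fun_def sum_fun_apply)
 also have "\<dots> \<in> span ((%k x. x ^ k) ` {..n})"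
  using p by (intro span_sum span_scale span_base) auto
 finally show "f \<in> span ((%k x. x ^ k) ` {..n})" .
qed auto

lemma poly_funs_forms:
 assumes w: "continuous_on {0..1} (w :: real => real)" "\<And>x. x \<in> {0..1} ==> 0 <= w x"
 shows "psd_form (poly_funs n) (%f g. integral {0..1} (%x. w x * (f x * g x)))"
proof
 show "subspace (poly_funs n)" by (rule poly_funs_subspace)
next
 fix f g h assume fgh: "f \<in> poly_funs n" "g \<in> poly_funs n" "h \<in> poly_funs n"
 have "integral {0..1} (%x. w x * ((f + g) x * h x)) =
   integral {0..1} (%x. w x * (f x * h x) + w x * (g x * h x))"
  by (simp add: algebra_simps)
 also have "\<dots> = integral {0..1} (%x. w x * (f x * h x)) + integral {0..1} (%x. w x * (g x * h x))"
  using fgh w by (intro integral_add integrable_continuous_interval)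
   (auto simp: poly_funs_def intro!: continuous_intros)
 finally show "integral {0..1} (%x. w x * ((f + g) x * h x)) =
  integral {0..1} (%x. w x * (f x * h x)) + integral {0..1} (%x. w x * (g x * h x))" .
next
 fix f g :: "real => real" and k :: real
 have "integral {0..1} (%x. w x * ((k *\<^sub>R f) x * g x)) = integral {0..1} (%x. k * (w x * (f x * g x)))"
  by (simp add: scaleR_fun_def mult_ac)
 then show "integral {0..1} (%x. w x * ((k *\<^sub>R f) x * g x)) = k * integral {0..1} (%x. w x * (f x * g x))"
  by simp
next
 fix f assume "f \<in> poly_funs n"
 then show "0 <= integral {0..1} (%x. w x * (f x * f x))"
  using w by (intro integral_nonneg integrable_continuous_interval)
  (auto simp: poly_funs_def intro!: continuous_intros)
qed (simp add: mult_ac)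

lemma poly_funs_weighted_inner:
 "inner_form (poly_funs n) (%f g. integral {0..1} (%x. x * (f x * g x)))"
proof -
 interpret psd_form "poly_funs n" "%f g. integral {0..1} (%x. x * (f x * g x))"
  by (rule poly_funs_forms) (auto intro: continuous_intros)
 show ?thesis
 proof (rule inner_form.intro[OF psd_form_axioms], rule inner_form_axioms.intro)
  fix f assume "f \<in> poly_funs n" "integral {0..1} (%x. x * (f x * f x)) = 0"
  then obtain p where p: "f = poly p" "integral {0..1} (%x. x * (poly p x)^2) = 0"
   by (auto simp: poly_funs_def power2_eq_square)
  then show "f = 0" using poly_sq_integral_zero[OF p(2)] by (auto simp: fun_eq_iff)
 qed
qed

lemma square_sum_le: "(x + y)^2 <= 2 * x^2 + 2 * (y::real)^2"
 using zero_le_power2[of "x - y"] by (simp add: power2_eq_square algebra_simps)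

lemma square_diff_le: "(x - y)^2 <= 2 * x^2 + 2 * (y::real)^2"
 using square_sum_le[of x "-y"] by simp

text \<open>For \<open>r = n + 1\<close> the ansatz \<open>q = z 0 + x w\<close> takes care of the interpolation condition, and the
  orthogonality becomes an orthogonal projection for the inner product with weight \<open>x\<close>. Weighted and unweighted
  norms are equivalent on polynomials of bounded degree, which gives stability.\<close>

lemma reference_projection:
 "\<exists>C\<ge>0. \<forall>z. continuous_on {0..1} z \<longrightarrow> (\<exists>q :: real poly. degree q <= r \<and> poly q 0 = z 0 \<and>
   (\<forall>p. degree p < r \<longrightarrow> integral {0..1} (%x. (z x - poly q x) * poly p x) = 0) \<and>
   integral {0..1} (%x. (z x - poly q x)^2) <= C * (integral {0..1} (%x. (z x)^2) + (z 0)^2))"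
proof (cases r)
 case 0
 show ?thesis
 proof (intro exI[of _ "2::real"] conjI allI impI)
  fix z :: "real => real" assume z: "continuous_on {0..1} z"
  have "integral {0..1} (%x. (z x - z 0)^2) <= integral {0..1} (%x. 2 * (z x)^2 + 2 * (z 0)^2)"
   using z by (intro integral_le integrable_continuous_interval continuous_intros square_diff_le) auto
  also have "\<dots> = 2 * integral {0..1} (%x. (z x)^2) + 2 * (z 0)^2"
   using z by (subst integral_add) (auto intro!: integrable_continuous_interval continuous_intros)
  finally show "\<exists>q. degree q <= r \<and> poly q 0 = z 0 \<and>
   (\<forall>p. degree p < r \<longrightarrow> integral {0..1} (%x. (z x - poly q x) * poly p x) = 0) \<and>
   integral {0..1} (%x. (z x - poly q x)^2) <= 2 * (integral {0..1} (%x. (z x)^2) + (z 0)^2)"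
   using 0 by (intro exI[of _ "[:z 0:]"]) auto
 qed auto
next
 case (Suc n)
 interpret w: inner_form "poly_funs n" "%f g. integral {0..1} (%x. x * (f x * g x))"
  by (rule poly_funs_weighted_inner)
 obtain S where S: "finite S" "poly_funs n \<subseteq> span S" using poly_funs_finite_span by blast
 obtain K where K: "K > 0" "\<forall>f\<in>poly_funs n. integral {0..1} (%x. 1 * (f x * f x)) <= K * integral {0..1} (%x. x * (f x * f x))"
  using w.form_dominated[OF S poly_funs_forms[of "%_. 1" n]] by auto
 show ?thesis
 proof (intro exI[of _ "4 + 4 * K^2"] conjI allI impI)
  fix z :: "real => real" assume z: "continuous_on {0..1} z"
  define l where "l = (%f. integral {0..1} (%x. (z x - z 0) * f x))"
  have cont: "continuous_on X f" if "f \<in> poly_funs n" for f X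
   using that by (auto simp: poly_funs_def intro!: continuous_intros)
  have ex: "\<exists>!m. m \<in> poly_funs n \<and> (\<forall>v\<in>poly_funs n. integral {0..1} (%x. x * (m x * v x)) = l v)"
  proof (rule w.Riesz[OF S])
   fix f g assume fg: "f \<in> poly_funs n" "g \<in> poly_funs n"
   have "l (f + g) = integral {0..1} (%x. (z x - z 0) * f x + (z x - z 0) * g x)"
    by (simp add: l_def algebra_simps)
   also have "\<dots> = l f + l g" unfolding l_def using fg z
    by (intro integral_add integrable_continuous_interval) (auto intro!: continuous_intros cont[OF fg(1)] cont[OF fg(2)])
   finally show "l (f + g) = l f + l g" .
  next
   fix f :: "real => real" and k
   have "l (k *\<^sub>R f) = integral {0..1} (%x. k * ((z x - z 0) * f x))"
    by (simp add: l_def scaleR_fun_def mult_ac)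
   then show "l (k *\<^sub>R f) = k * l f" by (simp add: l_def)
  qed
  obtain m' where m': "m' \<in> poly_funs n" "\<forall>v\<in>poly_funs n. integral {0..1} (%x. x * (m' x * v x)) = l v"
   using ex1_implies_ex[OF ex] by blast
  obtain m where m0: "m' = poly m" "degree m <= n" using m'(1) unfolding poly_funs_def by blast
  have m: "degree m <= n"
   "\<And>v. degree v <= n ==> integral {0..1} (%x. x * (poly m x * poly v x)) = l (poly v)"
   using m0 m'(2) unfolding poly_funs_def by blast+
  define q where "q = [:z 0:] + [:0, 1:] * m"
  have q: "poly q x = z 0 + x * poly m x" for x by (simp add: q_def)
  have "degree ([:0, 1:] * m) <= r"
   using degree_mult_le[of "[:0,1:]" m] m(1) Suc by simp
  then have "degree q <= r" unfolding q_def by (intro degree_add_le) auto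
  moreover have "poly q 0 = z 0" by (simp add: q)
  moreover have "integral {0..1} (%x. (z x - poly q x) * poly p x) = 0" if "degree p < r" for p
  proof -
   have "integral {0..1} (%x. (z x - poly q x) * poly p x) =
     integral {0..1} (%x. (z x - z 0) * poly p x - x * (poly m x * poly p x))"
    by (simp add: q algebra_simps)
   also have "\<dots> = l (poly p) - integral {0..1} (%x. x * (poly m x * poly p x))"
    unfolding l_def using z by (intro integral_diff integrable_continuous_interval continuous_intros)
   also have "\<dots> = 0" using m(2)[of p] that Suc by simp
   finally show ?thesis .
  qed
  moreover have "integral {0..1} (%x. (z x - poly q x)^2) <= (4 + 4 * K^2) * (integral {0..1} (%x. (z x)^2) + (z 0)^2)"
  proof -
   define D where "D = integral {0..1} (%x. (z x - z 0)^2)"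
   define M where "M = integral {0..1} (%x. (poly m x)^2)"
   have "D <= integral {0..1} (%x. 2 * (z x)^2 + 2 * (z 0)^2)"
    unfolding D_def using z by (intro integral_le integrable_continuous_interval continuous_intros square_diff_le) auto
   also have "\<dots> = 2 * integral {0..1} (%x. (z x)^2) + 2 * (z 0)^2"
    using z by (subst integral_add) (auto intro!: integrable_continuous_interval continuous_intros)
   finally have D: "D <= 2 * (integral {0..1} (%x. (z x)^2) + (z 0)^2)" by simp
   have "M <= K * integral {0..1} (%x. x * (poly m x * poly m x))"
    using K(2) m(1) by (auto simp: M_def poly_funs_def power2_eq_square)
   also have "\<dots> = K * l (poly m)" using m by simp
   also have "\<dots> = integral {0..1} (%x. K * ((z x - z 0) * poly m x))" by (simp add: l_def)
   also have "\<dots> <= integral {0..1} (%x. (K^2 / 2) * (z x - z 0)^2 + (1/2) * (poly m x)^2)"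
   proof (intro integral_le integrable_continuous_interval continuous_intros z)
    fix x show "K * ((z x - z 0) * poly m x) <= (K^2 / 2) * (z x - z 0)^2 + (1/2) * (poly m x)^2"
     using zero_le_power2[of "K * (z x - z 0) - poly m x"] by (simp add: power2_eq_square algebra_simps)
   qed
   also have "\<dots> = (K^2 / 2) * D + (1/2) * M"
    unfolding D_def M_def using z
    by (subst integral_add) (auto intro!: integrable_continuous_interval continuous_intros)
   finally have M: "M <= K^2 * D" by simp
   have "integral {0..1} (%x. (z x - poly q x)^2) <= integral {0..1} (%x. 2 * (z x - z 0)^2 + 2 * (poly m x)^2)"
   proof (intro integral_le integrable_continuous_interval continuous_intros z)
    fix x :: real assume x: "x \<in> {0..1}"
    have "(z x - poly q x)^2 = ((z x - z 0) - x * poly m x)^2" by (simp add: q algebra_simps)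
    also have "\<dots> <= 2 * (z x - z 0)^2 + 2 * (x * poly m x)^2" by (rule square_diff_le)
    also have "(x * poly m x)^2 <= 1 * (poly m x)^2"
     unfolding power_mult_distrib using x by (intro mult_right_mono) (auto simp: power_le_one)
    finally show "(z x - poly q x)^2 <= 2 * (z x - z 0)^2 + 2 * (poly m x)^2" by simp
   qed
   also have "\<dots> = 2 * D + 2 * M"
    unfolding D_def M_def using z
    by (subst integral_add) (auto intro!: integrable_continuous_interval continuous_intros)
   also have "\<dots> <= (2 + 2 * K^2) * D" using M by (simp add: algebra_simps)
   also have "\<dots> <= (2 + 2 * K^2) * (2 * (integral {0..1} (%x. (z x)^2) + (z 0)^2))"
    using D by (intro mult_left_mono) (auto intro: add_nonneg_nonneg)
   finally show ?thesis by (simp add: algebra_simps)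
  qed
  ultimately show "\<exists>q. degree q <= r \<and> poly q 0 = z 0 \<and>
   (\<forall>p. degree p < r \<longrightarrow> integral {0..1} (%x. (z x - poly q x) * poly p x) = 0) \<and>
   integral {0..1} (%x. (z x - poly q x)^2) <= (4 + 4 * K^2) * (integral {0..1} (%x. (z x)^2) + (z 0)^2)"
   by blast
 qed (auto intro: add_nonneg_nonneg)
qed

text \<open>A Taylor polynomial can be subtracted first, since the projection reproduces it; only the
  remainder then contributes to the error.\<close>

lemma Taylor_remainder_square:
 fixes Z :: "nat => real => real"
 assumes Z: "\<And>l x. x \<in> {0..1} ==> (Z l has_real_derivative Z (Suc l) x) (at x within {0..1})"
  and x: "x \<in> {0..1}"
 shows "(Z 0 x - (\<Sum>i<Suc r. x ^ i / fact i * Z i 0))^2 <= integral {0..1} (%s. (Z (Suc r) s)^2)"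
proof -
 have Zc: "continuous_on {0..1} (Z l)" for l
  by (rule DERIV_continuous_on[OF Z])
 define I where "I = integral {0..x} (%s. ((x - s) ^ (Suc r - 1) / fact (Suc r - 1)) *\<^sub>R Z (Suc r) s)"
 have Zx: "(Z m has_vector_derivative Z (Suc m) t) (at t within {0..x})" if "0 <= t" "t <= x" for m t
  using Z[of t m] that x
  by (auto simp: has_real_derivative_iff_has_vector_derivative intro!: has_vector_derivative_within_subset[of _ _ _ "{0..1}"])
 have "Z 0 x = (\<Sum>i<Suc r. ((x - 0) ^ i / fact i) *\<^sub>R Z i 0) + I"
  unfolding I_def using x by (intro Taylor_integral) (auto intro!: Zx)
 then have eq: "Z 0 x - (\<Sum>i<Suc r. x ^ i / fact i * Z i 0) = I" by simp
 have cont: "continuous_on {0..x} (Z l)" for l by (rule continuous_on_subset[OF Zc]) (use x in auto)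
 have nrm: "norm (((x - s) ^ (Suc r - 1) / fact (Suc r - 1)) *\<^sub>R Z (Suc r) s) <= \<bar>Z (Suc r) s\<bar>"
  if "s \<in> {0..x}" for s
 proof -
  have "(x - s) ^ r <= 1" using that x by (intro power_le_one) auto
  then have "(x - s) ^ r / fact r <= 1 / 1" by (intro frac_le) (auto simp: fact_ge_1)
  then have "\<bar>(x - s) ^ (Suc r - 1) / fact (Suc r - 1)\<bar> <= 1" using that by simp
  then show ?thesis unfolding real_scaleR_def real_norm_def abs_mult
   by (rule mult_left_le_one_le[OF abs_ge_zero abs_ge_zero])
 qed
 have "norm I <= integral {0..x} (%s. \<bar>Z (Suc r) s\<bar>)"
  unfolding I_def using nrm
  by (intro integral_norm_bound_integral integrable_continuous_interval continuous_intros cont) auto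
 then have "\<bar>I\<bar> <= integral {0..x} (%s. \<bar>Z (Suc r) s\<bar>)" by simp
 also have "\<dots> <= integral {0..1} (%s. \<bar>Z (Suc r) s\<bar>)"
  using x by (intro integral_subset_le integrable_continuous_interval continuous_intros cont Zc) auto
 finally have I: "\<bar>I\<bar> <= integral {0..1} (%s. \<bar>Z (Suc r) s\<bar>)" (is "_ <= ?J") .
 have "0 <= integral {0..1} (%s. (\<bar>Z (Suc r) s\<bar> - ?J)^2)"
  by (intro integral_nonneg integrable_continuous_interval continuous_intros Zc) auto
 also have "\<dots> = integral {0..1} (%s. ((Z (Suc r) s)^2 - (2 * ?J) * \<bar>Z (Suc r) s\<bar>) + ?J^2)"
  by (intro integral_cong) (simp add: power2_eq_square algebra_simps)
 also have "\<dots> = integral {0..1} (%s. (Z (Suc r) s)^2 - (2 * ?J) * \<bar>Z (Suc r) s\<bar>) + ?J^2"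
  by (subst integral_add) (auto intro!: integrable_continuous_interval continuous_intros Zc)
 also have "\<dots> = integral {0..1} (%s. (Z (Suc r) s)^2) - (2 * ?J) * ?J + ?J^2"
  by (subst integral_diff) (auto intro!: integrable_continuous_interval continuous_intros Zc)
 finally have "?J^2 <= integral {0..1} (%s. (Z (Suc r) s)^2)" by (simp add: power2_eq_square)
 moreover have "I^2 <= ?J^2" using I by (rule power2_le_iff_abs_le[THEN iffD2, rotated]) (use I in linarith)
 ultimately show ?thesis unfolding eq by linarith
qed

lemma reference_projection_smooth:
 "\<exists>C\<ge>0. \<forall>Z. (\<forall>l. \<forall>x\<in>{0..1}. (Z l has_real_derivative Z (Suc l) x) (at x within {0..1})) \<longrightarrow>
  (\<exists>q :: real poly. degree q <= r \<and> poly q 0 = Z 0 0 \<and>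
   (\<forall>p. degree p < r \<longrightarrow> integral {0..1} (%x. (Z 0 x - poly q x) * poly p x) = 0) \<and>
   integral {0..1} (%x. (Z 0 x - poly q x)^2) <= C * integral {0..1} (%x. (Z (Suc r) x)^2))"
proof -
 obtain C where C: "C \<ge> 0"
  "\<And>z. continuous_on {0..1} z ==> (\<exists>q :: real poly. degree q <= r \<and> poly q 0 = z 0 \<and>
   (\<forall>p. degree p < r \<longrightarrow> integral {0..1} (%x. (z x - poly q x) * poly p x) = 0) \<and>
   integral {0..1} (%x. (z x - poly q x)^2) <= C * (integral {0..1} (%x. (z x)^2) + (z 0)^2))"
  using reference_projection[of r] by blast
 show ?thesis
 proof (intro exI[of _ C] conjI allI impI)
  fix Z :: "nat => real => real"
  assume "\<forall>l. \<forall>x\<in>{0..1}. (Z l has_real_derivative Z (Suc l) x) (at x within {0..1})"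
  then have Z: "\<And>l x. x \<in> {0..1} ==> (Z l has_real_derivative Z (Suc l) x) (at x within {0..1})" by blast
  have Zc: "continuous_on {0..1} (Z l)" for l by (rule DERIV_continuous_on[OF Z])
  define t where "t = (\<Sum>i<Suc r. monom (Z i 0 / fact i) i)"
  have t: "poly t x = (\<Sum>i<Suc r. x ^ i / fact i * Z i 0)" for x
   by (simp add: t_def poly_sum poly_monom mult_ac)
  have dt: "degree t <= r" unfolding t_def
   by (intro degree_sum_le) (auto intro: order.trans[OF degree_monom_le])
  define z where "z = (%x. Z 0 x - poly t x)"
  have zc: "continuous_on {0..1} z" unfolding z_def by (intro continuous_intros Zc)
  obtain q where q: "degree q <= r" "poly q 0 = z 0"
   "\<And>p. degree p < r ==> integral {0..1} (%x. (z x - poly q x) * poly p x) = 0"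
   "integral {0..1} (%x. (z x - poly q x)^2) <= C * (integral {0..1} (%x. (z x)^2) + (z 0)^2)"
   using C(2)[OF zc] by blast
  have eq: "Z 0 x - poly (t + q) x = z x - poly q x" for x by (simp add: z_def)
  have z0: "z 0 = 0"
   by (simp add: z_def t lessThan_Suc_eq_insert_0 sum.reindex)
  have "integral {0..1} (%x. (z x)^2) <= integral {0..1} (%x::real. integral {0..1} (%s. (Z (Suc r) s)^2))"
   using Taylor_remainder_square[of Z, OF Z] zc
   by (intro integral_le integrable_continuous_interval) (auto simp: z_def t intro!: continuous_intros Zc)
  then have z2: "integral {0..1} (%x. (z x)^2) <= integral {0..1} (%s. (Z (Suc r) s)^2)" by simp
  have "integral {0..1} (%x. (Z 0 x - poly (t + q) x)^2) <= C * integral {0..1} (%x. (Z (Suc r) x)^2)"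
   unfolding eq using q(4) z0 mult_left_mono[OF z2 C(1)] by simp
  moreover have "degree (t + q) <= r" using dt q(1) by (intro degree_add_le)
  moreover have "poly (t + q) 0 = Z 0 0" using q(2) by (simp add: z_def)
  ultimately show "\<exists>q. degree q <= r \<and> poly q 0 = Z 0 0 \<and>
   (\<forall>p. degree p < r \<longrightarrow> integral {0..1} (%x. (Z 0 x - poly q x) * poly p x) = 0) \<and>
   integral {0..1} (%x. (Z 0 x - poly q x)^2) <= C * integral {0..1} (%x. (Z (Suc r) x)^2)"
   using q(3) unfolding eq[symmetric] by blast
 qed (use C in auto)
qed

lemma integral_reflected:
 fixes F :: "real => real"
 assumes "a < b" and F: "continuous_on {0..1} F"
 shows "integral {a..b} (%t. F ((b - t) / (b - a))) = (b - a) * integral {0..1} F"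
proof -
 define k where "k = b - a"
 have k: "k > 0" using assms by (simp add: k_def)
 have "(F has_integral integral {0..1} F) (cbox 0 1)"
  using F by (auto intro!: integrable_integral integrable_continuous_interval)
 from has_integral_affinity[OF this, of "-1/k" "b/k"]
 have "((%t. F ((-1/k) *\<^sub>R t + b/k)) has_integral (1 / \<bar>-1/k\<bar> ^ DIM(real)) *\<^sub>R integral {0..1} F)
   ((%x. (1/(-1/k)) *\<^sub>R x + - ((1/(-1/k)) *\<^sub>R (b/k))) ` cbox 0 1)"
  using k by simp
 also have "(%x. (1/(-1/k)) *\<^sub>R x + - ((1/(-1/k)) *\<^sub>R (b/k))) = (%x. (-k) * x + b)"
  using k by (simp add: fun_eq_iff)
 also have "(%x. (-k) * x + b) ` cbox 0 1 = {a..b}"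
  using k image_affinity_atLeastAtMost[of "-k" b 0 1] by (simp add: k_def)
 also have "(%t. F ((-1/k) *\<^sub>R t + b/k)) = (%t. F ((b - t) / k))"
  by (simp add: fun_eq_iff diff_divide_distrib)
 finally show ?thesis using k by (simp add: k_def integral_unique)
qed

text \<open>The reflection \<open>t = b - (b - a) x\<close> maps the right end point to \<open>0\<close>.\<close>

lemma projection_transfer:
 fixes q :: "real poly"
 assumes "a < b" and y: "continuous_on {a..b} y"
  and q: "degree q <= r" "poly q 0 = y b"
   "\<And>p. degree p < r ==> integral {0..1} (%x. (y (b - (b - a) * x) - poly q x) * poly p x) = 0"
 shows "\<exists>Q. degree Q <= r \<and> poly Q b = y b \<and>
   (\<forall>p. degree p < r \<longrightarrow> integral {a..b} (%t. (y t - poly Q t) * poly p t) = 0) \<and>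
   integral {a..b} (%t. (y t - poly Q t)^2) = (b - a) * integral {0..1} (%x. (y (b - (b - a) * x) - poly q x)^2)"
proof -
 define k where "k = b - a"
 have k: "k > 0" using assms by (simp add: k_def)
 define Q where "Q = pcompose q [:b/k, -1/k:]"
 have Q: "poly Q t = poly q ((b - t) / k)" for t
  using k by (simp add: Q_def poly_pcompose diff_divide_distrib)
 have rng: "b - k * x \<in> {a..b}" if "x \<in> {0..1}" for x
 proof -
  have "k * x <= k * 1" "0 <= k * x" using k that by (intro mult_left_mono mult_nonneg_nonneg; simp)+
  then show ?thesis using k_def by simp
 qed
 have yc: "continuous_on {0..1} (%x. y (b - k * x))"
  by (rule continuous_on_compose2[OF y]) (use rng in \<open>auto intro!: continuous_intros\<close>)
 have inv: "b - k * ((b - t) / k) = t" for t using k by simp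
 have "degree Q = degree q * degree [:b/k, -1/k:]" unfolding Q_def by (rule degree_pcompose)
 then have "degree Q <= r" using q(1) k by simp
 moreover have "poly Q b = y b" using q(2) by (simp add: Q)
 moreover have "integral {a..b} (%t. (y t - poly Q t) * poly p t) = 0" if p: "degree p < r" for p
 proof -
  define p' where "p' = pcompose p [:b, -k:]"
  have p': "poly p' x = poly p (b - k * x)" for x by (simp add: p'_def poly_pcompose mult.commute)
  have "degree p' < r" using p k by (simp add: p'_def degree_pcompose)
  then have 0: "integral {0..1} (%x. (y (b - k * x) - poly q x) * poly p' x) = 0"
   using q(3) by (simp add: k_def)
  have "integral {a..b} (%t. (%x. (y (b - k * x) - poly q x) * poly p' x) ((b - t) / (b - a))) =
    (b - a) * integral {0..1} (%x. (y (b - k * x) - poly q x) * poly p' x)"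
   by (intro integral_reflected assms continuous_intros yc)
  also have "(%t. (%x. (y (b - k * x) - poly q x) * poly p' x) ((b - t) / (b - a))) =
   (%t. (y t - poly Q t) * poly p t)"
   using inv by (simp add: fun_eq_iff Q p' k_def)
  finally show ?thesis using 0 by simp
 qed
 moreover have "integral {a..b} (%t. (y t - poly Q t)^2) = (b - a) * integral {0..1} (%x. (y (b - k * x) - poly q x)^2)"
 proof -
  have "integral {a..b} (%t. (%x. (y (b - k * x) - poly q x)^2) ((b - t) / (b - a))) =
    (b - a) * integral {0..1} (%x. (y (b - k * x) - poly q x)^2)"
   by (intro integral_reflected assms continuous_intros yc)
  also have "(%t. (%x. (y (b - k * x) - poly q x)^2) ((b - t) / (b - a))) = (%t. (y t - poly Q t)^2)"
   using inv by (simp add: fun_eq_iff Q k_def)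
  finally show ?thesis .
 qed
 ultimately show ?thesis unfolding k_def by blast
qed

text \<open>The projection that is natural for the discontinuous Galerkin method: it interpolates at the
  right end point and its error is orthogonal to lower degree.\<close>

definition dg_projection :: "nat => real => real => (real => real) => real poly => bool" where
 "dg_projection r a b y Q \<longleftrightarrow> degree Q <= r \<and> poly Q b = y b \<and>
  (\<forall>p. degree p < r \<longrightarrow> integral {a..b} (%t. (y t - poly Q t) * poly p t) = 0)"

lemma dg_projection_stable:
 "\<exists>C\<ge>0. \<forall>a b y. a < b \<longrightarrow> continuous_on {a..b} y \<longrightarrow> (\<exists>Q. dg_projection r a b y Q \<and>
   integral {a..b} (%t. (y t - poly Q t)^2) <= C * (integral {a..b} (%t. (y t)^2) + (b - a) * (y b)^2))"
proof -
 obtain C where C: "C \<ge> 0"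
  "\<And>z. continuous_on {0..1} z ==> (\<exists>q :: real poly. degree q <= r \<and> poly q 0 = z 0 \<and>
   (\<forall>p. degree p < r \<longrightarrow> integral {0..1} (%x. (z x - poly q x) * poly p x) = 0) \<and>
   integral {0..1} (%x. (z x - poly q x)^2) <= C * (integral {0..1} (%x. (z x)^2) + (z 0)^2))"
  using reference_projection[of r] by blast
 show ?thesis
 proof (intro exI[of _ C] conjI allI impI)
  fix a b y assume ab: "a < (b::real)" and y: "continuous_on {a..b} (y :: real => real)"
  define z where "z = (%x. y (b - (b - a) * x))"
  have rng: "b - (b - a) * x \<in> {a..b}" if "x \<in> {0..1}" for x
  proof -
   have "(b - a) * x <= (b - a) * 1" "0 <= (b - a) * x" using ab that by (intro mult_left_mono mult_nonneg_nonneg; simp)+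
   then show ?thesis by simp
  qed
  have zc: "continuous_on {0..1} z" unfolding z_def
   by (rule continuous_on_compose2[OF y]) (use rng in \<open>auto intro!: continuous_intros\<close>)
  obtain q where q: "degree q <= r" "poly q 0 = z 0"
   "\<And>p. degree p < r ==> integral {0..1} (%x. (z x - poly q x) * poly p x) = 0"
   "integral {0..1} (%x. (z x - poly q x)^2) <= C * (integral {0..1} (%x. (z x)^2) + (z 0)^2)"
   using C(2)[OF zc] by blast
  obtain Q where Q: "dg_projection r a b y Q"
   "integral {a..b} (%t. (y t - poly Q t)^2) = (b - a) * integral {0..1} (%x. (z x - poly q x)^2)"
   using projection_transfer[OF ab y, of q r] q unfolding z_def dg_projection_def by auto
  have "integral {a..b} (%t. (%x. (z x)^2) ((b - t) / (b - a))) = (b - a) * integral {0..1} (%x. (z x)^2)"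
   by (intro integral_reflected ab continuous_intros zc)
  also have "(%t. (%x. (z x)^2) ((b - t) / (b - a))) = (%t. (y t)^2)"
   using ab by (simp add: fun_eq_iff z_def)
  finally have e: "(b - a) * integral {0..1} (%x. (z x)^2) = integral {a..b} (%t. (y t)^2)" by simp
  have "integral {a..b} (%t. (y t - poly Q t)^2) <= (b - a) * (C * (integral {0..1} (%x. (z x)^2) + (z 0)^2))"
   unfolding Q(2) using ab q(4) by (intro mult_left_mono) auto
  also have "\<dots> = C * (integral {a..b} (%t. (y t)^2) + (b - a) * (y b)^2)"
   unfolding e[symmetric] by (simp add: z_def algebra_simps)
  finally show "\<exists>Q. dg_projection r a b y Q \<and>
   integral {a..b} (%t. (y t - poly Q t)^2) <= C * (integral {a..b} (%t. (y t)^2) + (b - a) * (y b)^2)"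
   using Q(1) by blast
 qed (use C in auto)
qed

text \<open>Each derivative contributes a factor \<open>b - a\<close> under the affine map, which produces the power of the step size.\<close>

lemma dg_projection_accurate:
 "\<exists>C\<ge>0. \<forall>a b Y. a < b \<longrightarrow>
  (\<forall>l. \<forall>t\<in>{a..b}. (Y l has_real_derivative Y (Suc l) t) (at t within {a..b})) \<longrightarrow>
  (\<exists>Q. dg_projection r a b (Y 0) Q \<and>
   integral {a..b} (%t. (Y 0 t - poly Q t)^2) <= C * (b - a) ^ (2 * r + 2) * integral {a..b} (%t. (Y (Suc r) t)^2))"
proof -
 obtain C where C: "C \<ge> 0"
  "\<And>Z. (\<And>l x. x\<in>{0..1} ==> (Z l has_real_derivative Z (Suc l) x) (at x within {0..1})) ==>
  (\<exists>q :: real poly. degree q <= r \<and> poly q 0 = Z 0 0 \<and>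
   (\<forall>p. degree p < r \<longrightarrow> integral {0..1} (%x. (Z 0 x - poly q x) * poly p x) = 0) \<and>
   integral {0..1} (%x. (Z 0 x - poly q x)^2) <= C * integral {0..1} (%x. (Z (Suc r) x)^2))"
  using reference_projection_smooth[of r] by blast
 show ?thesis
 proof (intro exI[of _ C] conjI allI impI)
  fix a b :: real and Y :: "nat => real => real"
  assume ab: "a < b"
   and "\<forall>l. \<forall>t\<in>{a..b}. (Y l has_real_derivative Y (Suc l) t) (at t within {a..b})"
  then have Y: "\<And>l t. t\<in>{a..b} ==> (Y l has_real_derivative Y (Suc l) t) (at t within {a..b})" by blast
  have Yc: "continuous_on {a..b} (Y l)" for l by (rule DERIV_continuous_on[OF Y])
  define k where "k = b - a"
  have k: "k > 0" using ab by (simp add: k_def)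
  define Z where "Z = (%l x. (-k) ^ l * Y l (b - k * x))"
  have rng: "b - k * x \<in> {a..b}" if "x \<in> {0..1}" for x
  proof -
   have "k * x <= k * 1" "0 <= k * x" using k that by (intro mult_left_mono mult_nonneg_nonneg; simp)+
   then show ?thesis using k_def by simp
  qed
  have Z: "(Z l has_real_derivative Z (Suc l) x) (at x within {0..1})" if x: "x \<in> {0..1}" for l x
  proof -
   have sub: "(%x. b - k * x) ` {0..1} \<subseteq> {a..b}" using rng by auto
   have "(Y l has_real_derivative Y (Suc l) (b - k * x)) (at (b - k * x) within (%x. b - k * x) ` {0..1})"
    by (rule DERIV_subset[OF Y[OF rng[OF x]] sub])
   moreover have "((%x. b - k * x) has_real_derivative (- k)) (at x within {0..1})"
    by (auto intro!: derivative_eq_intros)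
   ultimately have "((%x. Y l (b - k * x)) has_real_derivative Y (Suc l) (b - k * x) * (- k)) (at x within {0..1})"
    by (rule DERIV_image_chain[unfolded o_def])
   then show ?thesis unfolding Z_def
    by (auto intro!: derivative_eq_intros simp: algebra_simps)
  qed
  obtain q where q: "degree q <= r" "poly q 0 = Z 0 0"
   "\<And>p. degree p < r ==> integral {0..1} (%x. (Z 0 x - poly q x) * poly p x) = 0"
   "integral {0..1} (%x. (Z 0 x - poly q x)^2) <= C * integral {0..1} (%x. (Z (Suc r) x)^2)"
   using C(2)[of Z, OF Z] by blast
  obtain Q where Q: "dg_projection r a b (Y 0) Q"
   "integral {a..b} (%t. (Y 0 t - poly Q t)^2) = k * integral {0..1} (%x. (Z 0 x - poly q x)^2)"
   using projection_transfer[OF ab Yc, of q r 0] q unfolding Z_def dg_projection_def k_def by auto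
  have zc: "continuous_on {0..1} (Z l)" for l by (rule DERIV_continuous_on[OF Z])
  have "integral {a..b} (%t. (%x. (Z (Suc r) x)^2) ((b - t) / (b - a))) = (b - a) * integral {0..1} (%x. (Z (Suc r) x)^2)"
   by (intro integral_reflected ab continuous_intros zc)
  also have "(%t. (%x. (Z (Suc r) x)^2) ((b - t) / (b - a))) = (%t. k ^ (2 * r + 2) * (Y (Suc r) t)^2)"
  proof
   fix t
   have "((- k) ^ Suc r)^2 = (- k) ^ (2 * Suc r)" by (rule power_even_eq[symmetric])
   also have "\<dots> = k ^ (2 * Suc r)" by (rule power_minus_even) (rule dvd_triv_left)
   also have "\<dots> = k ^ (2 * r + 2)" by simp
   finally show "(%x. (Z (Suc r) x)^2) ((b - t) / (b - a)) = k ^ (2 * r + 2) * (Y (Suc r) t)^2"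
    using k by (simp only: Z_def power_mult_distrib) (simp add: k_def)
  qed
  finally have "integral {a..b} (%t. k ^ (2 * r + 2) * (Y (Suc r) t)^2) = k * integral {0..1} (%x. (Z (Suc r) x)^2)"
   unfolding k_def .
  then have e: "k * integral {0..1} (%x. (Z (Suc r) x)^2) = k ^ (2 * r + 2) * integral {a..b} (%t. (Y (Suc r) t)^2)"
   unfolding integral_mult_right by (rule sym)
  have "integral {a..b} (%t. (Y 0 t - poly Q t)^2) <= k * (C * integral {0..1} (%x. (Z (Suc r) x)^2))"
   unfolding Q(2) using k q(4) by (intro mult_left_mono) auto
  also have "\<dots> = C * k ^ (2 * r + 2) * integral {a..b} (%t. (Y (Suc r) t)^2)"
   using e by (simp add: algebra_simps)
  finally show "\<exists>Q. dg_projection r a b (Y 0) Q \<and>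
   integral {a..b} (%t. (Y 0 t - poly Q t)^2) <= C * (b - a) ^ (2 * r + 2) * integral {a..b} (%t. (Y (Suc r) t)^2)"
   using Q(1) unfolding k_def by blast
 qed (use C in auto)
qed

section \<open>Error propagation of the discontinuous Galerkin method\<close>

text \<open>With \<open>\<theta> = Q - P\<close>, integration by parts moves the time derivative from the projection error
  \<open>y - Q\<close> to \<open>\<theta>\<close>, where orthogonality and interpolation at \<open>b\<close> make it vanish. What remains is
  \<open>\<kappa> \<integral> (y - P) \<theta>\<close> together with the jump terms, and \<open>2 (y - P) \<theta> = (y - P)\<^sup>2 + \<theta>\<^sup>2 - (y - Q)\<^sup>2\<close>.\<close>

lemma dg_step:
 fixes P Q :: "real poly"
 assumes "a < b" "0 <= \<kappa>" and g: "continuous_on {a..b} g"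
  and y: "\<And>t. t \<in> {a..b} ==> (y has_real_derivative g t - \<kappa> * y t) (at t within {a..b})"
  and Q: "dg_projection r a b y Q" and P: "degree P <= r"
  and dg: "\<And>q. degree q <= r ==>
   integral {a..b} (%t. (poly (pderiv P) t + \<kappa> * poly P t) * poly q t) + (poly P a - l) * poly q a
    = integral {a..b} (%t. g t * poly q t)"
 shows "\<kappa> * integral {a..b} (%t. (y t - poly P t)^2) + (y b - poly P b)^2
   <= \<kappa> * integral {a..b} (%t. (y t - poly Q t)^2) + (y a - l)^2"
proof -
 note yc = DERIV_continuous_on[OF y]
 define \<theta> where "\<theta> = Q - P"
 have d\<theta>: "degree \<theta> <= r" unfolding \<theta>_def using Q P by (intro degree_diff_le) (auto simp: dg_projection_def)
 note ic = integrable_continuous_interval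
 have F1: "((%t. poly (pderiv Q) t * poly \<theta> t + poly Q t * poly (pderiv \<theta>) t) has_integral
   poly Q b * poly \<theta> b - poly Q a * poly \<theta> a) {a..b}"
  using assms(1) by (intro fundamental_theorem_of_calculus)
   (auto intro!: derivative_eq_intros poly_DERIV simp flip: has_real_derivative_iff_has_vector_derivative)
 have F2: "((%t. (g t - \<kappa> * y t) * poly \<theta> t + y t * poly (pderiv \<theta>) t) has_integral
   y b * poly \<theta> b - y a * poly \<theta> a) {a..b}"
  using assms(1) by (intro fundamental_theorem_of_calculus)
   (auto intro!: derivative_eq_intros y poly_DERIV simp flip: has_real_derivative_iff_has_vector_derivative)
 have F3: "((%t. 2 * (poly \<theta> t * poly (pderiv \<theta>) t)) has_integral (poly \<theta> b)\<^sup>2 - (poly \<theta> a)\<^sup>2) {a..b}"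
  using assms(1) by (intro fundamental_theorem_of_calculus)
   (auto intro!: derivative_eq_intros poly_DERIV simp flip: has_real_derivative_iff_has_vector_derivative)
 have "integral {a..b} (%t. (y t - poly Q t) * poly (pderiv \<theta>) t) = 0"
 proof (cases "degree \<theta> = 0")
  case True
  then have "pderiv \<theta> = 0" using pderiv_eq_0_iff by blast
  then show ?thesis by simp
 next
  case False
  then have "degree (pderiv \<theta>) < r" using d\<theta> by (simp add: degree_pderiv)
  then show ?thesis using Q by (simp add: dg_projection_def)
 qed
 then have F4: "((%t. (y t - poly Q t) * poly (pderiv \<theta>) t) has_integral 0) {a..b}"
  using integrable_integral[OF ic[of a b "%t. (y t - poly Q t) * poly (pderiv \<theta>) t"]]
   continuous_on_mult[OF continuous_on_diff[OF yc continuous_on_poly[OF continuous_on_id]]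
    continuous_on_poly[OF continuous_on_id]] by simp
 define A where "A = integral {a..b} (%t. g t * poly \<theta> t)"
 have F6: "((%t. g t * poly \<theta> t) has_integral A) {a..b}"
  unfolding A_def by (intro integrable_integral ic continuous_intros g)
 have "integral {a..b} (%t. (poly (pderiv P) t + \<kappa> * poly P t) * poly \<theta> t) = A - (poly P a - l) * poly \<theta> a"
  using dg[OF d\<theta>] by (simp add: A_def)
 then have F5: "((%t. (poly (pderiv P) t + \<kappa> * poly P t) * poly \<theta> t) has_integral A - (poly P a - l) * poly \<theta> a) {a..b}"
  using integrable_integral[OF ic[of a b "%t. (poly (pderiv P) t + \<kappa> * poly P t) * poly \<theta> t"]]
  by (simp add: continuous_on_add continuous_on_mult continuous_on_poly)
 define e where "e = (%t. y t - poly P t)"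
 define \<eta> where "\<eta> = (%t. y t - poly Q t)"
 have qb: "poly Q b = y b" using Q by (simp add: dg_projection_def)
 have "((%t. (poly (pderiv Q) t * poly \<theta> t + poly Q t * poly (pderiv \<theta>) t)
   - ((g t - \<kappa> * y t) * poly \<theta> t + y t * poly (pderiv \<theta>) t)
   + (y t - poly Q t) * poly (pderiv \<theta>) t
   - (poly (pderiv P) t + \<kappa> * poly P t) * poly \<theta> t
   + g t * poly \<theta> t - (1/2) * (2 * (poly \<theta> t * poly (pderiv \<theta>) t))) has_integral
  ((poly Q b * poly \<theta> b - poly Q a * poly \<theta> a) - (y b * poly \<theta> b - y a * poly \<theta> a) + 0
   - (A - (poly P a - l) * poly \<theta> a) + A - (1/2) * ((poly \<theta> b)^2 - (poly \<theta> a)\<^sup>2))) {a..b}"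
  by (intro has_integral_add has_integral_diff has_integral_mult_right F1 F2 F3 F4 F5 F6)
 also have "(%t. (poly (pderiv Q) t * poly \<theta> t + poly Q t * poly (pderiv \<theta>) t)
   - ((g t - \<kappa> * y t) * poly \<theta> t + y t * poly (pderiv \<theta>) t)
   + (y t - poly Q t) * poly (pderiv \<theta>) t
   - (poly (pderiv P) t + \<kappa> * poly P t) * poly \<theta> t
   + g t * poly \<theta> t - (1/2) * (2 * (poly \<theta> t * poly (pderiv \<theta>) t))) = (%t. \<kappa> * (e t * poly \<theta> t))"
  by (simp add: fun_eq_iff e_def \<theta>_def pderiv_diff algebra_simps)
 also have "(poly Q b * poly \<theta> b - poly Q a * poly \<theta> a) - (y b * poly \<theta> b - y a * poly \<theta> a) + 0
   - (A - (poly P a - l) * poly \<theta> a) + A - (1/2) * ((poly \<theta> b)^2 - (poly \<theta> a)\<^sup>2)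
  = (y a - l) * poly \<theta> a - (1/2) * (poly \<theta> a)^2 - (1/2) * (poly \<theta> b)^2" (is "_ = ?R")
  by (simp add: qb \<theta>_def power2_eq_square algebra_simps)
 finally have I: "((%t. \<kappa> * (e t * poly \<theta> t)) has_integral ?R) {a..b}" .
 have "((%t. \<kappa> * ((e t)^2 - (\<eta> t)\<^sup>2)) has_integral \<kappa> * (integral {a..b} (%t. (e t)^2) - integral {a..b} (%t. (\<eta> t)^2))) {a..b}"
  unfolding e_def \<eta>_def
  by (intro has_integral_mult_right has_integral_diff integrable_integral ic continuous_intros yc)
 moreover have "\<kappa> * ((e t)^2 - (\<eta> t)\<^sup>2) <= 2 * (\<kappa> * (e t * poly \<theta> t))" for t
 proof -
  have "2 * (e t * poly \<theta> t) = (e t)^2 - (\<eta> t)\<^sup>2 + (poly \<theta> t)^2"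
   by (simp add: e_def \<eta>_def \<theta>_def power2_eq_square algebra_simps)
  then have "(e t)^2 - (\<eta> t)\<^sup>2 <= 2 * (e t * poly \<theta> t)" by simp
  from mult_left_mono[OF this assms(2)] show ?thesis by (simp add: algebra_simps)
 qed
 ultimately have "\<kappa> * (integral {a..b} (%t. (e t)^2) - integral {a..b} (%t. (\<eta> t)^2)) <= 2 * ?R"
  by (rule has_integral_le[OF _ has_integral_mult_right[OF I]])
 also have "\<dots> <= (y a - l)^2 - (poly \<theta> b)\<^sup>2"
  using zero_le_power2[of "y a - l - poly \<theta> a"] by (simp add: power2_eq_square algebra_simps)
 also have "poly \<theta> b = y b - poly P b" by (simp add: \<theta>_def qb)
 finally show ?thesis unfolding e_def \<eta>_def by (simp add: algebra_simps)
qed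

section \<open>Smoothing of the semidiscrete flow\<close>

lemma power_exp_le_fact: "(x::real) ^ m * exp (- x) <= fact m" if "0 <= x"
proof -
 have "x ^ m / fact m <= exp x"
  unfolding exp_def
  using that sum_le_suminf[OF summable_exp_generic[of x], of "{m}"] by (auto simp: field_simps)
 then show ?thesis by (simp add: exp_minus field_simps)
qed

text \<open>Up to a factorial, the power of \<open>\<kappa> t\<close> is absorbed by the exponential.\<close>

lemma exp_smoothing:
 fixes \<kappa> t :: real
 assumes "0 <= \<kappa>" "0 < t"
 shows "\<kappa> ^ m * exp (- \<kappa> * t) ^ 2 <= fact m * t powr (- real m)"
proof -
 have "(\<kappa> * t) ^ m * exp (- (\<kappa> * t)) <= fact m" using assms by (intro power_exp_le_fact) auto
 moreover have "exp (- \<kappa> * t) ^ 2 <= exp (- (\<kappa> * t))"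
  using assms by (simp flip: exp_double)
 then have "(\<kappa> * t) ^ m * exp (- \<kappa> * t) ^ 2 <= (\<kappa> * t) ^ m * exp (- (\<kappa> * t))"
  using assms by (intro mult_left_mono) auto
 ultimately have "(\<kappa> ^ m * exp (- \<kappa> * t) ^ 2) * t ^ m <= fact m"
  by (simp add: power_mult_distrib mult_ac)
 then show ?thesis using assms by (simp add: powr_minus powr_realpow field_simps)
qed

text \<open>The modes of the semidiscrete solution: \<open>y l e\<close> is the \<open>l\<close>-th time derivative of the coefficient
  of an eigenvector with eigenvalue \<open>\<kappa> e\<close>, and \<open>g l e\<close> that of the data. The last assumption
  expresses membership of the initial value in an interpolation space of order \<open>\<beta>\<close> through the
  K-functional.\<close>

locale smoothing =
 fixes E :: "'e set" and \<kappa> :: "'e => real" and y g :: "nat => 'e => real => real"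
  and T \<beta> C0 :: real and G :: "nat => real"
 assumes fin: "finite E" and \<kappa>: "\<And>e. e \<in> E ==> 0 <= \<kappa> e" and T: "0 < T" and \<beta>: "0 < \<beta>" "\<beta> < 1"
  and dy: "\<And>l e t. e \<in> E ==> t \<in> {0..T} ==> (y l e has_real_derivative y (Suc l) e t) (at t within {0..T})"
  and ode: "\<And>l e t. e \<in> E ==> t \<in> {0..T} ==> y (Suc l) e t = g l e t - \<kappa> e * y l e t"
  and g: "\<And>l t. t \<in> {0..T} ==> (\<Sum>e\<in>E. (g l e t)^2) <= G l"
  and init: "\<And>\<tau>. 0 < \<tau> ==> \<exists>p q. (\<forall>e\<in>E. y 0 e 0 = p e + q e) \<and>
    (\<Sum>e\<in>E. (p e)^2) + \<tau>^2 * (\<Sum>e\<in>E. \<kappa> e * (q e)^2) <= C0 * \<tau> powr (2 * \<beta>)"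
begin

definition energy :: "nat => real => real" where
 "energy l t = (\<Sum>e\<in>E. \<kappa> e * (y l e t)^2)"

lemma G_nonneg: "0 <= G l"
proof -
 have "0 <= (\<Sum>e\<in>E. (g l e 0)^2)" by (intro sum_nonneg) auto
 also have "\<dots> <= G l" using T by (intro g) auto
 finally show ?thesis .
qed

lemma powr_le_of_le_T:
 assumes "a <= b" "0 < t" "t <= T"
 shows "t powr b <= T powr (b - a) * t powr a"
proof -
 have "t powr b = t powr (b - a) * t powr a" using assms by (simp flip: powr_add)
 also have "\<dots> <= T powr (b - a) * t powr a" using assms by (intro mult_right_mono powr_mono2) auto
 finally show ?thesis .
qed

text \<open>The bound on the part of the energy that comes from letting the value of the \<open>l\<close>-th derivative at
  time \<open>0\<close> decay freely. The additional powers of \<open>\<kappa>\<close> make an induction on \<open>l\<close> possible, because the equation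
  turns \<open>y (Suc l)\<close> into \<open>\<kappa> y l\<close> up to sign and data.\<close>

definition hom_bound :: "nat => nat => real => bool" where
 "hom_bound l m C \<longleftrightarrow> (\<forall>t. 0 < t \<longrightarrow> t <= T \<longrightarrow>
  (\<Sum>e\<in>E. \<kappa> e ^ (2 * m + 1) * exp (- \<kappa> e * t) ^ 2 * (y l e 0)^2)
   <= C * t powr (\<beta> - 1 - 2 * real l - 2 * real m))"

primrec hom_const :: "nat => nat => real" where
 "hom_const 0 m = 2 * fact (2 * m + 1) * C0"
| "hom_const (Suc l) m = 2 * fact (2 * m + 1) * G l * T powr (2 * real (Suc l) - \<beta>) + 2 * hom_const l (Suc m)"

text \<open>The splitting of the initial value is used at the scale \<open>sqrt t\<close>, which balances its two terms.\<close>

lemma hom_bound_0: "hom_bound 0 m (hom_const 0 m)"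
 unfolding hom_bound_def
proof (intro allI impI)
 fix t assume t: "0 < t" "t <= T"
 obtain p q where pq: "\<forall>e\<in>E. y 0 e 0 = p e + q e"
  "(\<Sum>e\<in>E. (p e)^2) + (sqrt t)^2 * (\<Sum>e\<in>E. \<kappa> e * (q e)^2) <= C0 * sqrt t powr (2 * \<beta>)"
  using init[of "sqrt t"] t by auto
 have tb: "sqrt t powr (2 * \<beta>) = t powr \<beta>" using t by (simp add: powr_half_sqrt[symmetric] powr_powr)
 define F where "F = (2 * fact (2 * m + 1) :: real)"
 have F: "F \<ge> 0" by (simp add: F_def)
 have term_le: "\<kappa> e ^ (2 * m + 1) * exp (- \<kappa> e * t) ^ 2 * (y 0 e 0)^2
   <= F * t powr (- real (2 * m + 1)) * ((p e)^2 + t * (\<kappa> e * (q e)^2))" if e: "e \<in> E" for e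
 proof -
  define w where "w = exp (- \<kappa> e * t) ^ 2"
  have k: "0 <= \<kappa> e" using e \<kappa> by auto
  have 1: "\<kappa> e ^ (2 * m + 1) * w <= fact (2 * m + 1) * t powr (- real (2 * m + 1))"
   using exp_smoothing[OF k t(1), of "2 * m + 1"] by (simp add: w_def)
  have "\<kappa> e ^ (2 * m) * w <= fact (2 * m) * t powr (- real (2 * m))"
   using exp_smoothing[OF k t(1), of "2 * m"] by (simp add: w_def)
  also have "\<dots> <= fact (2 * m + 1) * t powr (- real (2 * m))"
   by (intro mult_right_mono fact_mono) auto
  also have "t powr (- real (2 * m)) = t powr (- real (2 * m + 1)) * t"
  proof -
   have "t powr (- real (2 * m + 1)) * t powr 1 = t powr (- real (2 * m + 1) + 1)"
    by (rule powr_add[symmetric])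
   also have "- real (2 * m + 1) + 1 = - real (2 * m)" by simp
   finally have "t powr (- real (2 * m + 1)) * t powr 1 = t powr (- real (2 * m))" .
   moreover have "t powr 1 = t" using t by simp
   ultimately show ?thesis by metis
  qed
  finally have 2: "\<kappa> e ^ (2 * m) * w <= fact (2 * m + 1) * (t powr (- real (2 * m + 1)) * t)" .
  have "(y 0 e 0)^2 <= 2 * (p e)^2 + 2 * (q e)^2"
   using pq(1) e zero_le_power2[of "p e - q e"] by (simp add: power2_eq_square algebra_simps)
  then have "\<kappa> e ^ (2 * m + 1) * w * (y 0 e 0)^2 <= \<kappa> e ^ (2 * m + 1) * w * (2 * (p e)^2 + 2 * (q e)^2)"
   using k by (intro mult_left_mono) (auto simp: w_def)
  also have "\<dots> = (\<kappa> e ^ (2 * m + 1) * w) * (2 * (p e)^2) + (\<kappa> e ^ (2 * m) * w) * (2 * (\<kappa> e * (q e)^2))"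
   by (simp add: algebra_simps)
  also have "\<dots> <= fact (2 * m + 1) * t powr (- real (2 * m + 1)) * (2 * (p e)^2)
    + fact (2 * m + 1) * (t powr (- real (2 * m + 1)) * t) * (2 * (\<kappa> e * (q e)^2))"
   using 1 2 k by (intro add_mono mult_right_mono) auto
  also have "\<dots> = F * t powr (- real (2 * m + 1)) * ((p e)^2 + t * (\<kappa> e * (q e)^2))"
   unfolding F_def by (simp only: algebra_simps)
  finally show ?thesis unfolding w_def .
 qed
 have "(\<Sum>e\<in>E. \<kappa> e ^ (2 * m + 1) * exp (- \<kappa> e * t) ^ 2 * (y 0 e 0)^2)
   <= (\<Sum>e\<in>E. F * t powr (- real (2 * m + 1)) * ((p e)^2 + t * (\<kappa> e * (q e)^2)))"
  by (rule sum_mono[OF term_le])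
 also have "\<dots> = F * t powr (- real (2 * m + 1)) * ((\<Sum>e\<in>E. (p e)^2) + (sqrt t)^2 * (\<Sum>e\<in>E. \<kappa> e * (q e)^2))"
  using t by (simp add: sum_distrib_left[symmetric] sum.distrib)
 also have "\<dots> <= F * t powr (- real (2 * m + 1)) * (C0 * t powr \<beta>)"
  using pq(2) F tb by (intro mult_left_mono) auto
 also have "\<dots> = F * C0 * (t powr (- real (2 * m + 1)) * t powr \<beta>)" by simp
 also have "t powr (- real (2 * m + 1)) * t powr \<beta> = t powr (\<beta> - 1 - 2 * real 0 - 2 * real m)"
  by (simp add: algebra_simps flip: powr_add)
 finally show "(\<Sum>e\<in>E. \<kappa> e ^ (2 * m + 1) * exp (- \<kappa> e * t) ^ 2 * (y 0 e 0)^2)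
   <= hom_const 0 m * t powr (\<beta> - 1 - 2 * real 0 - 2 * real m)" by (simp add: F_def)
qed

lemma hom_bound: "hom_bound l m (hom_const l m)"
proof (induction l arbitrary: m)
 case 0
 then show ?case by (rule hom_bound_0)
next
 case (Suc l)
 show ?case unfolding hom_bound_def
 proof (intro allI impI)
  fix t assume t: "0 < t" "t <= T"
  define F where "F = (2 * fact (2 * m + 1) :: real)"
  have term_le: "\<kappa> e ^ (2 * m + 1) * exp (- \<kappa> e * t) ^ 2 * (y (Suc l) e 0)^2
   <= F * t powr (- real (2 * m + 1)) * (g l e 0)^2
    + 2 * (\<kappa> e ^ (2 * Suc m + 1) * exp (- \<kappa> e * t) ^ 2 * (y l e 0)^2)" if e: "e \<in> E" for e
  proof -
   define w where "w = exp (- \<kappa> e * t) ^ 2"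
   have k: "0 <= \<kappa> e" using e \<kappa> by auto
   have 1: "\<kappa> e ^ (2 * m + 1) * w <= fact (2 * m + 1) * t powr (- real (2 * m + 1))"
    using exp_smoothing[OF k t(1), of "2 * m + 1"] by (simp add: w_def)
   have "(y (Suc l) e 0)^2 <= 2 * (g l e 0)^2 + 2 * (\<kappa> e * y l e 0)^2"
   proof -
    have eq: "y (Suc l) e 0 = g l e 0 - \<kappa> e * y l e 0" using ode[OF e, of 0 l] T by simp
    show ?thesis unfolding eq using zero_le_power2[of "g l e 0 + \<kappa> e * y l e 0"]
     by (simp add: power2_eq_square algebra_simps)
   qed
   then have "\<kappa> e ^ (2 * m + 1) * w * (y (Suc l) e 0)^2
     <= \<kappa> e ^ (2 * m + 1) * w * (2 * (g l e 0)^2 + 2 * (\<kappa> e * y l e 0)^2)"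
    using k by (intro mult_left_mono) (auto simp: w_def)
   also have "\<dots> = (\<kappa> e ^ (2 * m + 1) * w) * (2 * (g l e 0)^2) + 2 * (\<kappa> e ^ (2 * Suc m + 1) * w * (y l e 0)^2)"
    by (simp add: algebra_simps power2_eq_square)
   also have "\<dots> <= (fact (2 * m + 1) * t powr (- real (2 * m + 1))) * (2 * (g l e 0)^2)
     + 2 * (\<kappa> e ^ (2 * Suc m + 1) * w * (y l e 0)^2)"
    by (intro add_mono mult_right_mono[OF 1] order_refl) auto
   finally show ?thesis unfolding w_def F_def by (simp add: mult_ac)
  qed
  have e1: "t powr (- real (2 * m + 1)) <= T powr (2 * real (Suc l) - \<beta>) * t powr (\<beta> - 1 - 2 * real (Suc l) - 2 * real m)"
   using powr_le_of_le_T[of "\<beta> - 1 - 2 * real (Suc l) - 2 * real m" "- real (2 * m + 1)" t] t \<beta>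
   by (simp add: algebra_simps)
  have "(\<Sum>e\<in>E. \<kappa> e ^ (2 * m + 1) * exp (- \<kappa> e * t) ^ 2 * (y (Suc l) e 0)^2)
   <= (\<Sum>e\<in>E. F * t powr (- real (2 * m + 1)) * (g l e 0)^2
    + 2 * (\<kappa> e ^ (2 * Suc m + 1) * exp (- \<kappa> e * t) ^ 2 * (y l e 0)^2))"
   by (rule sum_mono[OF term_le])
  also have "\<dots> = F * t powr (- real (2 * m + 1)) * (\<Sum>e\<in>E. (g l e 0)^2)
    + 2 * (\<Sum>e\<in>E. \<kappa> e ^ (2 * Suc m + 1) * exp (- \<kappa> e * t) ^ 2 * (y l e 0)^2)"
   by (simp add: sum.distrib sum_distrib_left)
  also have "\<dots> <= F * (T powr (2 * real (Suc l) - \<beta>) * t powr (\<beta> - 1 - 2 * real (Suc l) - 2 * real m)) * G l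
    + 2 * (hom_const l (Suc m) * t powr (\<beta> - 1 - 2 * real l - 2 * real (Suc m)))"
  proof (intro add_mono mult_mono)
   show "(\<Sum>e\<in>E. (g l e 0)^2) <= G l" using T by (intro g) auto
   show "(\<Sum>e\<in>E. \<kappa> e ^ (2 * Suc m + 1) * exp (- \<kappa> e * t) ^ 2 * (y l e 0)^2)
     <= hom_const l (Suc m) * t powr (\<beta> - 1 - 2 * real l - 2 * real (Suc m))"
    using Suc.IH[of "Suc m"] t unfolding hom_bound_def by blast
  qed (use e1 G_nonneg \<kappa> in \<open>auto simp: F_def intro!: sum_nonneg mult_nonneg_nonneg\<close>)
  also have "\<beta> - 1 - 2 * real l - 2 * real (Suc m) = \<beta> - 1 - 2 * real (Suc l) - 2 * real m" by simp
  finally show "(\<Sum>e\<in>E. \<kappa> e ^ (2 * m + 1) * exp (- \<kappa> e * t) ^ 2 * (y (Suc l) e 0)^2)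
    <= hom_const (Suc l) m * t powr (\<beta> - 1 - 2 * real (Suc l) - 2 * real m)"
   by (simp add: F_def algebra_simps)
 qed
qed

text \<open>The remaining part of the solution starts from zero and is driven by the data only.\<close>

lemma Phi_bound:
 assumes t: "0 < t" "t <= T"
 shows "(\<Sum>e\<in>E. \<kappa> e * (y l e t - exp (- \<kappa> e * t) * y l e 0)^2) <= G l * T"
proof -
 define R where "R = (%e t. y l e t - exp (- \<kappa> e * t) * y l e 0)"
 define \<Phi> where "\<Phi> = (%t. \<Sum>e\<in>E. \<kappa> e * (R e t)^2)"
 define \<Phi>' where "\<Phi>' = (%t. \<Sum>e\<in>E. \<kappa> e * (2 * R e t * (g l e t - \<kappa> e * R e t)))"
 have dR: "(R e has_real_derivative g l e x - \<kappa> e * R e x) (at x within {0..t})"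
  if "e \<in> E" "x \<in> {0..t}" for e x
 proof -
  have x: "x \<in> {0..T}" using that t by auto
  have "(y l e has_real_derivative y (Suc l) e x) (at x within {0..t})"
   using t by (intro DERIV_subset[OF dy[OF that(1) x]]) auto
  then have "(R e has_real_derivative y (Suc l) e x + \<kappa> e * (exp (- \<kappa> e * x) * y l e 0)) (at x within {0..t})"
   unfolding R_def by (auto intro!: derivative_eq_intros)
  moreover have "y (Suc l) e x + \<kappa> e * (exp (- \<kappa> e * x) * y l e 0) = g l e x - \<kappa> e * R e x"
   using ode[OF that(1) x, of l] by (simp add: R_def algebra_simps)
  ultimately show ?thesis by simp
 qed
 have d\<Phi>: "(\<Phi> has_real_derivative \<Phi>' x) (at x within {0..t})" if "x \<in> {0..t}" for x
  unfolding \<Phi>_def \<Phi>'_def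
  by (intro DERIV_sum DERIV_cmult) (auto intro!: derivative_eq_intros dR that)
 have le: "\<Phi>' x <= G l" if "x \<in> {0..t}" for x
 proof -
  have "\<kappa> e * (2 * R e x * (g l e x - \<kappa> e * R e x)) <= (g l e x)^2" for e
   using zero_le_power2[of "g l e x - \<kappa> e * R e x"] zero_le_power2[of "\<kappa> e * R e x"]
   by (simp add: power2_eq_square algebra_simps)
  then have "\<Phi>' x <= (\<Sum>e\<in>E. (g l e x)^2)" unfolding \<Phi>'_def by (intro sum_mono)
  also have "\<dots> <= G l" using that t by (intro g) auto
  finally show ?thesis .
 qed
 obtain x where x: "x \<in> {0<..<t}" "\<Phi> t - \<Phi> 0 = \<Phi>' x * (t - 0)"
  using mvt_simple[of 0 t \<Phi> "%x h. \<Phi>' x * h"] t d\<Phi> by (auto simp: has_field_derivative_def)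
 have "\<Phi> 0 = 0" by (simp add: \<Phi>_def R_def)
 then have "\<Phi> t = \<Phi>' x * t" using x by simp
 also have "\<dots> <= G l * T" using le[of x] x t G_nonneg by (intro mult_mono) auto
 finally show ?thesis by (simp add: \<Phi>_def R_def)
qed

definition smoothing_const :: "nat => real" where
 "smoothing_const l = 2 * hom_const l 0 + 2 * (G l * T * T powr (1 + 2 * real l - \<beta>))"

text \<open>Each time derivative costs a factor \<open>1/t\<close> in the norm, hence two of them in the energy.\<close>

lemma energy_decay:
 assumes t: "0 < t" "t <= T"
 shows "energy l t <= smoothing_const l * t powr (\<beta> - 1 - 2 * real l)"
proof -
 have "energy l t <= (\<Sum>e\<in>E. 2 * (\<kappa> e ^ (2 * 0 + 1) * exp (- \<kappa> e * t) ^ 2 * (y l e 0)^2)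
   + 2 * (\<kappa> e * (y l e t - exp (- \<kappa> e * t) * y l e 0)^2))"
  unfolding energy_def
 proof (rule sum_mono)
  fix e assume "e \<in> E"
  then have k: "0 <= \<kappa> e" using \<kappa> by auto
  define u where "u = exp (- \<kappa> e * t) * y l e 0"
  have "(y l e t)^2 <= 2 * u^2 + 2 * (y l e t - u)^2"
   using zero_le_power2[of "y l e t - 2 * u"] by (simp add: power2_eq_square algebra_simps)
  from mult_left_mono[OF this k]
  show "\<kappa> e * (y l e t)^2 <= 2 * (\<kappa> e ^ (2 * 0 + 1) * exp (- \<kappa> e * t) ^ 2 * (y l e 0)^2)
    + 2 * (\<kappa> e * (y l e t - exp (- \<kappa> e * t) * y l e 0)^2)"
   unfolding u_def by (simp add: power_mult_distrib algebra_simps)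
 qed
 also have "\<dots> = 2 * (\<Sum>e\<in>E. \<kappa> e ^ (2 * 0 + 1) * exp (- \<kappa> e * t) ^ 2 * (y l e 0)^2)
   + 2 * (\<Sum>e\<in>E. \<kappa> e * (y l e t - exp (- \<kappa> e * t) * y l e 0)^2)"
  by (simp add: sum.distrib sum_distrib_left)
 also have "\<dots> <= 2 * (hom_const l 0 * t powr (\<beta> - 1 - 2 * real l - 2 * real 0)) + 2 * (G l * T)"
  using hom_bound[of l 0] t Phi_bound[OF t, of l] unfolding hom_bound_def by (intro add_mono mult_left_mono) auto
 also have "\<dots> <= 2 * (hom_const l 0 * t powr (\<beta> - 1 - 2 * real l)) + 2 * (G l * T * (T powr (1 + 2 * real l - \<beta>) * t powr (\<beta> - 1 - 2 * real l)))"
 proof -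
  have "1 <= T powr (1 + 2 * real l - \<beta>) * t powr (\<beta> - 1 - 2 * real l)"
  proof -
   have e: "0 - (\<beta> - 1 - 2 * real l) = 1 + 2 * real l - \<beta>" by simp
   have "t powr 0 <= T powr (0 - (\<beta> - 1 - 2 * real l)) * t powr (\<beta> - 1 - 2 * real l)"
    using t \<beta> by (intro powr_le_of_le_T) auto
   then show ?thesis unfolding e using t by simp
  qed
  then have "G l * T * 1 <= G l * T * (T powr (1 + 2 * real l - \<beta>) * t powr (\<beta> - 1 - 2 * real l))"
   using G_nonneg T by (intro mult_left_mono) auto
  then show ?thesis by simp
 qed
 finally show ?thesis by (simp add: smoothing_const_def algebra_simps)
qed

end

section \<open>Graded meshes\<close>

text \<open>Since \<open>\<gamma> \<beta> = p\<close>, the factor \<open>t\<^sub>j\<^sup>\<beta>\<close> is \<open>(j/M)\<^sup>p\<close>, which turns the \<open>j\<^sup>-\<^sup>p\<close> from the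
  ratio of step size and distance to the origin into \<open>M\<^sup>-\<^sup>p\<close>.\<close>

lemma graded_mesh_step:
 fixes \<beta> p T :: real and M j :: nat
 assumes \<beta>: "0 < \<beta>" "\<beta> < 1" and p: "1 <= p" and T: "0 < T" and j: "2 <= j" "j <= M"
 defines "\<gamma> \<equiv> p / \<beta>"
 defines "\<tau> \<equiv> graded_mesh T (%t. t powr \<gamma>) M"
 shows "(\<tau> j - \<tau> (j - 1)) powr p * \<tau> (j - 1) powr (\<beta> - p)
   <= (\<gamma> * 2 powr \<gamma>) powr p * T powr \<beta> * real M powr (- p)"
proof -
 have \<gamma>: "\<gamma> \<ge> 1" using \<beta> p by (simp add: \<gamma>_def field_simps)
 have M: "M > 0" using j by auto
 define u where "u = real j / real M"
 define v where "v = real (j - 1) / real M"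
 have v: "0 < v" "v < u" "u = v + 1 / M" "u <= 2 * v" using j M by (auto simp: u_def v_def field_simps of_nat_diff)
 have tj: "\<tau> j = T * u powr \<gamma>" "\<tau> (j - 1) = T * v powr \<gamma>"
  by (simp_all add: \<tau>_def graded_mesh_def u_def v_def)
 have pos: "\<tau> (j - 1) > 0" unfolding tj using v(1) T by (intro mult_pos_pos) auto
 obtain z where z: "v < z" "z < u" "u powr \<gamma> - v powr \<gamma> = (u - v) * (\<gamma> * z powr (\<gamma> - 1))"
 proof -
  have "\<exists>z>v. z < u \<and> u powr \<gamma> - v powr \<gamma> = (u - v) * (\<gamma> * z powr (\<gamma> - 1))"
  proof (rule MVT2[OF v(2)])
   fix x assume "v <= x" "x <= u"
   then have "0 < x" using v(1) by linarith
   then show "((%x. x powr \<gamma>) has_real_derivative \<gamma> * x powr (\<gamma> - 1)) (at x)"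
    by (auto intro!: derivative_eq_intros)
  qed
  then show ?thesis using that by blast
 qed
 have "u powr \<gamma> - v powr \<gamma> <= (1 / M) * (\<gamma> * u powr (\<gamma> - 1))"
  unfolding z(3) using z v \<gamma> by (intro mult_mono powr_mono2) auto
 also have "u powr (\<gamma> - 1) = u powr \<gamma> / u" using v(1,2) by (simp add: powr_diff)
 also have "(1 / M) * (\<gamma> * (u powr \<gamma> / u)) = \<gamma> * u powr \<gamma> / j" using M j by (simp add: u_def)
 also have "\<dots> <= \<gamma> * (2 * v) powr \<gamma> / j"
  using v(1,2,4) \<gamma> by (intro divide_right_mono mult_left_mono powr_mono2) auto
 also have "\<dots> = \<gamma> * 2 powr \<gamma> / j * v powr \<gamma>" using v by (simp add: powr_mult)
 finally have "T * (u powr \<gamma> - v powr \<gamma>) <= T * (\<gamma> * 2 powr \<gamma> / j * v powr \<gamma>)"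
  using T by (intro mult_left_mono) auto
 then have k: "\<tau> j - \<tau> (j - 1) <= (\<gamma> * 2 powr \<gamma> / j) * \<tau> (j - 1)"
  unfolding tj by (simp add: algebra_simps)
 have k0: "0 <= \<tau> j - \<tau> (j - 1)"
  unfolding tj using T v(1,2) \<gamma> by (simp add: powr_mono2 less_imp_le)
 have "(\<tau> j - \<tau> (j - 1)) powr p * \<tau> (j - 1) powr (\<beta> - p)
   <= ((\<gamma> * 2 powr \<gamma> / j) * \<tau> (j - 1)) powr p * \<tau> (j - 1) powr (\<beta> - p)"
  using k k0 p by (intro mult_right_mono powr_mono2) auto
 also have "\<dots> = (\<gamma> * 2 powr \<gamma> / j) powr p * (\<tau> (j - 1) powr p * \<tau> (j - 1) powr (\<beta> - p))"
  using pos \<gamma> by (subst powr_mult) (auto simp: mult.assoc)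
 also have "\<tau> (j - 1) powr p * \<tau> (j - 1) powr (\<beta> - p) = \<tau> (j - 1) powr \<beta>"
  by (simp flip: powr_add)
 also have "\<dots> <= (T * u powr \<gamma>) powr \<beta>"
  unfolding tj using T v(1,2) \<beta> \<gamma> by (intro powr_mono2 mult_left_mono) auto
 also have "(T * u powr \<gamma>) powr \<beta> = T powr \<beta> * u powr p"
  using T v(1,2) \<beta> by (simp add: powr_mult powr_powr \<gamma>_def)
 also have "(\<gamma> * 2 powr \<gamma> / j) powr p * (T powr \<beta> * u powr p) = (\<gamma> * 2 powr \<gamma>) powr p * T powr \<beta> * real M powr (- p)"
  using \<gamma> j M by (simp add: u_def powr_divide powr_minus field_simps)
 finally show ?thesis by (simp add: mult_left_mono)
qed

section \<open>The discontinuous Galerkin method on a graded mesh\<close>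

text \<open>The constants of the two projection estimates depend only on the degree. Naming them keeps this
  independence visible in the final bound.\<close>

definition stable_with :: "nat => real => bool" where
 "stable_with r C \<longleftrightarrow> C \<ge> 0 \<and> (\<forall>a b y. a < b \<longrightarrow> continuous_on {a..b} y \<longrightarrow> (\<exists>Q. dg_projection r a b y Q \<and>
   integral {a..b} (%t. (y t - poly Q t)^2) <= C * (integral {a..b} (%t. (y t)^2) + (b - a) * (y b)^2)))"

definition accurate_with :: "nat => real => bool" where
 "accurate_with r C \<longleftrightarrow> C \<ge> 0 \<and> (\<forall>a b Y. a < b \<longrightarrow>
  (\<forall>l. \<forall>t\<in>{a..b}. (Y l has_real_derivative Y (Suc l) t) (at t within {a..b})) \<longrightarrow>
  (\<exists>Q. dg_projection r a b (Y 0) Q \<and>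
   integral {a..b} (%t. (Y 0 t - poly Q t)^2) <= C * (b - a) ^ (2 * r + 2) * integral {a..b} (%t. (Y (Suc r) t)^2)))"

text \<open>The scalar equations satisfied by the coefficients of the fully discrete solution; \<open>left e j\<close> is
  the value from which the interval after node \<open>j\<close> starts, namely the data for \<open>j = 0\<close>.\<close>

locale graded_dg = smoothing +
 fixes r M :: nat and \<tau> :: "nat => real" and P :: "'a => nat => real poly" and z :: "'a => real"
  and left :: "'a => nat => real"
 assumes M: "1 <= M" and \<tau>: "\<tau> = graded_mesh T (%t. t powr ((2 * real r + 3) / \<beta>)) M"
  and left: "\<And>e j. left e j = (if j = 0 then z e else poly (P e j) (\<tau> j))"
  and degP: "\<And>e j. e \<in> E ==> j \<in> {1..M} ==> degree (P e j) <= r"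
  and dg: "\<And>e j q. e \<in> E ==> j \<in> {1..M} ==> degree q <= r ==>
   integral {\<tau> (j-1)..\<tau> j} (%t. (poly (pderiv (P e j)) t + \<kappa> e * poly (P e j) t) * poly q t)
    + (poly (P e j) (\<tau> (j-1)) - left e (j-1)) * poly q (\<tau> (j-1))
   = integral {\<tau> (j-1)..\<tau> j} (%t. g 0 e t * poly q t)"
begin

lemma mesh:
 shows "\<tau> 0 = 0" and "\<tau> M = T"
  and "\<And>i j. i < j ==> \<tau> i < \<tau> j" and "\<And>j. j <= M ==> \<tau> j \<in> {0..T}"
proof -
 define \<gamma> where "\<gamma> = (2 * real r + 3) / \<beta>"
 have \<gamma>: "\<gamma> > 0" using \<beta> by (simp add: \<gamma>_def)
 have t: "\<tau> j = T * (real j / real M) powr \<gamma>" for j by (simp add: \<tau> graded_mesh_def \<gamma>_def)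
 show "\<tau> 0 = 0" "\<tau> M = T" using M by (auto simp: t)
 show "\<tau> i < \<tau> j" if "i < j" for i j
  unfolding t using that M T \<gamma> by (intro mult_strict_left_mono powr_less_mono2 divide_strict_right_mono) auto
 show "\<tau> j \<in> {0..T}" if "j <= M" for j
 proof -
  have "(real j / real M) powr \<gamma> <= 1 powr \<gamma>" using that M \<gamma> by (intro powr_mono2) auto
  then have "T * (real j / real M) powr \<gamma> <= T * 1" using T by (intro mult_left_mono) auto
  then show ?thesis unfolding t using T by auto
 qed
qed

lemma cell:
 assumes "j \<in> {1..M}"
 shows "\<tau> (j-1) < \<tau> j" and "{\<tau> (j-1)..\<tau> j} \<subseteq> {0..T}"
 using assms mesh(3)[of "j-1" j] mesh(4)[of "j-1"] mesh(4)[of j] by auto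

lemma dy_cell:
 assumes "e \<in> E" "j \<in> {1..M}" "t \<in> {\<tau> (j-1)..\<tau> j}"
 shows "(y l e has_real_derivative y (Suc l) e t) (at t within {\<tau> (j-1)..\<tau> j})"
 using cell(2)[OF assms(2)] assms by (intro DERIV_subset[OF dy]) auto

lemma y_cont: "e \<in> E ==> j \<in> {1..M} ==> continuous_on {\<tau> (j-1)..\<tau> j} (y l e)"
 by (rule DERIV_continuous_on[OF dy_cell])

lemma g_cont:
 assumes "e \<in> E" "j \<in> {1..M}"
 shows "continuous_on {\<tau> (j-1)..\<tau> j} (g 0 e)"
proof -
 have "continuous_on {\<tau> (j-1)..\<tau> j} (%t. y (Suc 0) e t + \<kappa> e * y 0 e t)"
  by (intro continuous_intros y_cont assms)
 then show ?thesis
  by (rule continuous_on_eq) (use ode[OF assms(1)] cell(2)[OF assms(2)] in auto)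
qed

lemma energy_cont: "j \<in> {1..M} ==> continuous_on {\<tau> (j-1)..\<tau> j} (energy l)"
 unfolding energy_def by (intro continuous_intros y_cont) auto

lemma energy_integral:
 assumes "j \<in> {1..M}"
 shows "integral {\<tau> (j-1)..\<tau> j} (energy l) = (\<Sum>e\<in>E. \<kappa> e * integral {\<tau> (j-1)..\<tau> j} (%t. (y l e t)^2))"
proof -
 have "integral {\<tau> (j-1)..\<tau> j} (energy l) = (\<Sum>e\<in>E. integral {\<tau> (j-1)..\<tau> j} (%t. \<kappa> e * (y l e t)^2))"
  unfolding energy_def
  by (intro integral_sum fin integrable_continuous_interval continuous_intros y_cont assms)
 then show ?thesis by simp
qed

lemma cell_error:
 assumes e: "e \<in> E" and j: "j \<in> {1..M}" and Q: "dg_projection r (\<tau> (j-1)) (\<tau> j) (y 0 e) Q"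
 shows "\<kappa> e * integral {\<tau> (j-1)..\<tau> j} (%t. (y 0 e t - poly (P e j) t)^2) + (y 0 e (\<tau> j) - left e j)^2
  <= \<kappa> e * integral {\<tau> (j-1)..\<tau> j} (%t. (y 0 e t - poly Q t)^2) + (y 0 e (\<tau> (j-1)) - left e (j-1))^2"
proof -
 have l: "left e j = poly (P e j) (\<tau> j)" using j by (simp add: left)
 show ?thesis unfolding l
 proof (rule dg_step[OF cell(1)[OF j] \<kappa>[OF e] g_cont[OF e j] _ Q degP[OF e j] dg[OF e j]])
  fix t assume t: "t \<in> {\<tau> (j-1)..\<tau> j}"
  then show "(y 0 e has_real_derivative g 0 e t - \<kappa> e * y 0 e t) (at t within {\<tau> (j-1)..\<tau> j})"
   using dy_cell[OF e j t, of 0] ode[OF e, of t 0] cell(2)[OF j] by auto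
 qed
qed

text \<open>Summing the one-step inequality over the intervals telescopes the nodal errors. On the first interval
  only stability of the projection is available; on the others its accuracy is combined with the decay of the
  derivatives. All \<open>M\<close> contributions are of order \<open>M powr - p\<close>.\<close>

theorem dg_error:
 assumes Cs: "stable_with r Cs" and Ca: "accurate_with r Ca"
 defines "p \<equiv> 2 * real r + 3"
 defines "K \<equiv> Cs * smoothing_const 0 * (1 / \<beta> + 1) * T powr \<beta>
  + Ca * smoothing_const (Suc r) * ((p / \<beta> * 2 powr (p / \<beta>)) powr p * T powr \<beta>)"
 shows "(\<Sum>e\<in>E. \<kappa> e * (\<Sum>j=1..M. integral {\<tau> (j-1)..\<tau> j} (%t. (y 0 e t - poly (P e j) t)^2)))
  <= \<bar>K\<bar> * real M powr (- (2 * real r + 2)) + (\<Sum>e\<in>E. (y 0 e 0 - z e)^2)"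
proof -
 let ?I = "%j. {\<tau> (j-1)..\<tau> j}"
 define good where "good = (%e j Q. dg_projection r (\<tau> (j-1)) (\<tau> j) (y 0 e) Q \<and>
  integral (?I j) (%t. (y 0 e t - poly Q t)^2) \<le>
   (if j = 1 then Cs * (integral (?I j) (%t. (y 0 e t)^2) + (\<tau> j - \<tau> (j-1)) * (y 0 e (\<tau> j))^2)
    else Ca * (\<tau> j - \<tau> (j-1)) ^ (2 * r + 2) * integral (?I j) (%t. (y (Suc r) e t)^2)))"
 have ex: "\<exists>Q. good e j Q"
  if e: "e \<in> E" and j: "j \<in> {1..M}" for e j
 proof (cases "j = 1")
  case True
  have st: "a < b ==> continuous_on {a..b} Y ==>
    \<exists>Q. dg_projection r a b Y Q \<and> integral {a..b} (%t. (Y t - poly Q t)^2)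
     <= Cs * (integral {a..b} (%t. (Y t)^2) + (b - a) * (Y b)^2)" for a b Y
   using Cs unfolding stable_with_def by blast
  from st[OF cell(1)[OF j] y_cont[OF e j, of 0]] show ?thesis using True by (simp add: good_def)
 next
  case False
  have acc: "a < b ==> \<forall>l. \<forall>t\<in>{a..b}. (Y l has_real_derivative Y (Suc l) t) (at t within {a..b}) ==>
    \<exists>Q. dg_projection r a b (Y 0) Q \<and> integral {a..b} (%t. (Y 0 t - poly Q t)^2)
     <= Ca * (b - a) ^ (2 * r + 2) * integral {a..b} (%t. (Y (Suc r) t)^2)" for a b Y
   using Ca unfolding accurate_with_def by blast
  have "\<forall>l. \<forall>t\<in>?I j. (y l e has_real_derivative y (Suc l) e t) (at t within ?I j)"
   using dy_cell[OF e j] by blast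
  from acc[OF cell(1)[OF j] this] show ?thesis using False by (simp add: good_def)
 qed
 have sel: "good e j (SOME Q. good e j Q)" if "e \<in> E" "j \<in> {1..M}" for e j
  by (rule someI_ex[OF ex[OF that]])
 define Q where "Q = (%e j. SOME Q. good e j Q)"
 have Q: "dg_projection r (\<tau> (j-1)) (\<tau> j) (y 0 e) (Q e j)"
  and Qle: "integral (?I j) (%t. (y 0 e t - poly (Q e j) t)^2) \<le>
   (if j = 1 then Cs * (integral (?I j) (%t. (y 0 e t)^2) + (\<tau> j - \<tau> (j-1)) * (y 0 e (\<tau> j))^2)
    else Ca * (\<tau> j - \<tau> (j-1)) ^ (2 * r + 2) * integral (?I j) (%t. (y (Suc r) e t)^2))"
  if ej: "e \<in> E" "j \<in> {1..M}" for e j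
 proof -
  have "good e j (Q e j)" unfolding Q_def by (rule sel[OF ej])
  then have c: "dg_projection r (\<tau> (j-1)) (\<tau> j) (y 0 e) (Q e j) \<and> integral (?I j) (%t. (y 0 e t - poly (Q e j) t)^2) \<le>
   (if j = 1 then Cs * (integral (?I j) (%t. (y 0 e t)^2) + (\<tau> j - \<tau> (j-1)) * (y 0 e (\<tau> j))^2)
    else Ca * (\<tau> j - \<tau> (j-1)) ^ (2 * r + 2) * integral (?I j) (%t. (y (Suc r) e t)^2))"
   unfolding good_def .
  show "dg_projection r (\<tau> (j-1)) (\<tau> j) (y 0 e) (Q e j)" by (rule conjunct1[OF c])
  show "integral (?I j) (%t. (y 0 e t - poly (Q e j) t)^2) \<le>
   (if j = 1 then Cs * (integral (?I j) (%t. (y 0 e t)^2) + (\<tau> j - \<tau> (j-1)) * (y 0 e (\<tau> j))^2)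
    else Ca * (\<tau> j - \<tau> (j-1)) ^ (2 * r + 2) * integral (?I j) (%t. (y (Suc r) e t)^2))" by (rule conjunct2[OF c])
 qed
 define \<eta> where "\<eta> = (%j. \<Sum>e\<in>E. \<kappa> e * integral (?I j) (%t. (y 0 e t - poly (Q e j) t)^2))"
 define d where "d = (%e j. (y 0 e (\<tau> j) - left e j)^2)"
 have Mr: "real M > 0" using M by simp
 have S0: "0 <= smoothing_const l" for l
 proof -
  have "0 <= energy l T" unfolding energy_def using \<kappa> by (intro sum_nonneg) auto
  also have "\<dots> <= smoothing_const l * T powr (\<beta> - 1 - 2 * real l)" using T by (intro energy_decay) auto
  finally show ?thesis using T by (simp add: zero_le_mult_iff)
 qed
 have Cs0: "Cs \<ge> 0" and Ca0: "Ca \<ge> 0" using Cs Ca by (auto simp: stable_with_def accurate_with_def)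
 have first: "\<eta> 1 <= Cs * smoothing_const 0 * (1 / \<beta> + 1) * T powr \<beta> * real M powr (- p)"
 proof -
  have j: "1 \<in> {1..M}" using M by simp
  have t1: "0 < \<tau> 1" "\<tau> 1 <= T" using mesh(1) mesh(3)[of 0 1] mesh(4)[of 1] M by auto
  have "\<eta> 1 <= (\<Sum>e\<in>E. \<kappa> e * (Cs * (integral (?I 1) (%t. (y 0 e t)^2) + (\<tau> 1 - \<tau> 0) * (y 0 e (\<tau> 1))^2)))"
   unfolding \<eta>_def using Qle[OF _ j] \<kappa> by (intro sum_mono mult_left_mono) auto
  also have "\<dots> = Cs * (integral (?I 1) (energy 0) + \<tau> 1 * energy 0 (\<tau> 1))"
   unfolding energy_integral[OF j] energy_def mesh(1)
   by (simp add: sum_distrib_left sum.distrib algebra_simps)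
  finally have 1: "\<eta> 1 <= Cs * (integral (?I 1) (energy 0) + \<tau> 1 * energy 0 (\<tau> 1))" .
  have "((%t. smoothing_const 0 * t powr (\<beta> - 1)) has_integral smoothing_const 0 * (\<tau> 1 powr (\<beta> - 1 + 1) / (\<beta> - 1 + 1))) {0..\<tau> 1}"
   using \<beta> t1 by (intro has_integral_mult_right has_integral_powr_from_0) auto
  then have hi0: "((%t. smoothing_const 0 * t powr (\<beta> - 1)) has_integral smoothing_const 0 * (\<tau> 1 powr \<beta> / \<beta>)) {0..\<tau> 1}"
   by simp
  have hi: "((%t. if t = 0 then energy 0 0 else smoothing_const 0 * t powr (\<beta> - 1)) has_integral smoothing_const 0 * (\<tau> 1 powr \<beta> / \<beta>)) {0..\<tau> 1}"
   by (rule has_integral_spike_finite[OF _ _ hi0, of "{0}"]) simp_all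
  have "integral {0..\<tau> 1} (energy 0) <= smoothing_const 0 * (\<tau> 1 powr \<beta> / \<beta>)"
  proof (rule has_integral_le[OF _ hi])
   show "(energy 0 has_integral integral {0..\<tau> 1} (energy 0)) {0..\<tau> 1}"
    using energy_cont[OF j, of 0] mesh(1) by (intro integrable_integral integrable_continuous_interval) auto
   fix t assume "t \<in> {0..\<tau> 1}"
   then show "energy 0 t <= (if t = 0 then energy 0 0 else smoothing_const 0 * t powr (\<beta> - 1))"
    using energy_decay[of t 0] t1 by auto
  qed
  moreover have "\<tau> 1 * energy 0 (\<tau> 1) <= \<tau> 1 * (smoothing_const 0 * \<tau> 1 powr (\<beta> - 1))"
   using energy_decay[of "\<tau> 1" 0] t1 by (intro mult_left_mono) auto
  moreover have "\<tau> 1 * (smoothing_const 0 * \<tau> 1 powr (\<beta> - 1)) = smoothing_const 0 * \<tau> 1 powr \<beta>"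
   using t1 by (simp add: powr_diff)
  moreover have rhs: "smoothing_const 0 * (1 / \<beta> + 1) * \<tau> 1 powr \<beta>
    = smoothing_const 0 * (\<tau> 1 powr \<beta> / \<beta>) + smoothing_const 0 * \<tau> 1 powr \<beta>"
   by (simp add: algebra_simps)
  moreover have I1: "?I 1 = {0..\<tau> 1}" using mesh(1) by simp
  ultimately have "integral (?I 1) (energy 0) + \<tau> 1 * energy 0 (\<tau> 1) <= smoothing_const 0 * (1 / \<beta> + 1) * \<tau> 1 powr \<beta>"
   unfolding rhs I1 by linarith
  from mult_left_mono[OF this Cs0] 1
  have "\<eta> 1 <= Cs * smoothing_const 0 * (1 / \<beta> + 1) * \<tau> 1 powr \<beta>" by (simp add: mult_ac)
  also have "\<tau> 1 powr \<beta> = T powr \<beta> * real M powr (- p)"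
  proof -
   have "\<tau> 1 = T * (1 / real M) powr (p / \<beta>)" by (simp add: \<tau> graded_mesh_def p_def)
   then have "\<tau> 1 powr \<beta> = T powr \<beta> * (1 / real M) powr (p / \<beta> * \<beta>)" using T by (simp add: powr_mult powr_powr)
   also have "p / \<beta> * \<beta> = p" using \<beta> by simp
   also have "1 / real M = real M powr - 1" using Mr by (simp add: powr_minus divide_inverse)
   also have "(real M powr - 1) powr p = real M powr (- p)" unfolding powr_powr by simp
   finally show ?thesis .
  qed
  finally show ?thesis by (simp add: mult_ac)
 qed
 have later: "\<eta> j <= Ca * smoothing_const (Suc r) * ((p / \<beta> * 2 powr (p / \<beta>)) powr p * T powr \<beta>) * real M powr (- p)"
  if j: "j \<in> {1..M}" "j \<noteq> 1" for j
 proof -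
  define k where "k = \<tau> j - \<tau> (j-1)"
  have k: "k > 0" using cell(1)[OF j(1)] by (simp add: k_def)
  have t0: "0 < \<tau> (j-1)" using j mesh(1) mesh(3)[of 0 "j-1"] by auto
  have "\<eta> j <= (\<Sum>e\<in>E. \<kappa> e * (Ca * k ^ (2 * r + 2) * integral (?I j) (%t. (y (Suc r) e t)^2)))"
   unfolding \<eta>_def k_def using Qle[OF _ j(1)] \<kappa> j(2) by (intro sum_mono mult_left_mono) auto
  also have "\<dots> = Ca * k ^ (2 * r + 2) * integral (?I j) (energy (Suc r))"
   unfolding energy_integral[OF j(1)] by (simp add: sum_distrib_left mult_ac)
  also have "\<dots> <= Ca * k ^ (2 * r + 2) * (k * (smoothing_const (Suc r) * \<tau> (j-1) powr (\<beta> - p)))"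
  proof (intro mult_left_mono)
   have "energy (Suc r) t <= smoothing_const (Suc r) * \<tau> (j-1) powr (\<beta> - p)" if t: "t \<in> ?I j" for t
   proof -
    have "energy (Suc r) t <= smoothing_const (Suc r) * t powr (\<beta> - 1 - 2 * real (Suc r))"
     using t t0 cell(2)[OF j(1)] by (intro energy_decay) auto
    also have "\<beta> - 1 - 2 * real (Suc r) = \<beta> - p" by (simp add: p_def)
    also have "smoothing_const (Suc r) * t powr (\<beta> - p) <= smoothing_const (Suc r) * \<tau> (j-1) powr (\<beta> - p)"
     using t t0 \<beta> S0 by (intro mult_left_mono powr_mono2') (auto simp: p_def)
    finally show ?thesis .
   qed
   then have "integral (?I j) (energy (Suc r)) <= integral (?I j) (%t. smoothing_const (Suc r) * \<tau> (j-1) powr (\<beta> - p))"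
    by (intro integral_le integrable_continuous_interval energy_cont j continuous_intros) auto
   also have "\<dots> = k * (smoothing_const (Suc r) * \<tau> (j-1) powr (\<beta> - p))"
    using k by (simp add: k_def)
   finally show "integral (?I j) (energy (Suc r)) <= k * (smoothing_const (Suc r) * \<tau> (j-1) powr (\<beta> - p))" .
  qed (use Ca0 k in auto)
  also have "\<dots> = Ca * smoothing_const (Suc r) * (k powr p * \<tau> (j-1) powr (\<beta> - p))"
  proof -
   have "k powr p = k powr real (2 * r + 3)" by (simp add: p_def)
   also have "\<dots> = k ^ (2 * r + 3)" using k by (rule powr_realpow)
   finally have "k powr p = k ^ (2 * r + 2) * k" by (simp add: power_add numeral_3_eq_3 power2_eq_square)
   then show ?thesis by (simp add: mult_ac)
  qed
  also have "\<dots> <= Ca * smoothing_const (Suc r) * ((p / \<beta> * 2 powr (p / \<beta>)) powr p * T powr \<beta> * real M powr (- p))"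
   using graded_mesh_step[OF \<beta>, of p T j M] T j S0 Ca0 unfolding k_def \<tau> p_def[symmetric]
   by (intro mult_left_mono mult_nonneg_nonneg) (auto simp: p_def)
  finally show ?thesis by (simp add: mult_ac)
 qed
 have A1: "0 <= Cs * smoothing_const 0 * (1 / \<beta> + 1) * T powr \<beta>" using Cs0 S0 \<beta> by simp
 have A2: "0 <= Ca * smoothing_const (Suc r) * ((p / \<beta> * 2 powr (p / \<beta>)) powr p * T powr \<beta>)" using Ca0 S0 by simp
 define K1 where "K1 = Cs * smoothing_const 0 * (1 / \<beta> + 1) * T powr \<beta>"
 define K2 where "K2 = Ca * smoothing_const (Suc r) * ((p / \<beta> * 2 powr (p / \<beta>)) powr p * T powr \<beta>)"
 have KK: "K = K1 + K2" unfolding K_def K1_def K2_def ..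
 have K: "\<eta> j <= \<bar>K\<bar> * real M powr (- p)" if j: "j \<in> {1..M}" for j
 proof -
  have w: "0 <= K1 * real M powr (- p)" "0 <= K2 * real M powr (- p)"
   unfolding K1_def K2_def by (rule mult_nonneg_nonneg[OF A1 powr_ge_zero], rule mult_nonneg_nonneg[OF A2 powr_ge_zero])
  have f: "\<eta> j <= K1 * real M powr (- p)" if "j = 1" unfolding that K1_def by (rule first)
  have l: "\<eta> j <= K2 * real M powr (- p)" if "j \<noteq> 1" unfolding K2_def by (rule later[OF j that])
  have "\<eta> j <= K * real M powr (- p)"
   unfolding KK distrib_right using f l w by (cases "j = 1") linarith+
  also have "\<dots> <= \<bar>K\<bar> * real M powr (- p)" by (intro mult_right_mono) auto
  finally show ?thesis .
 qed
 have step: "\<kappa> e * integral (?I j) (%t. (y 0 e t - poly (P e j) t)^2) + d e j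
   <= \<kappa> e * integral (?I j) (%t. (y 0 e t - poly (Q e j) t)^2) + d e (j-1)" if "e \<in> E" "j \<in> {1..M}" for e j
  unfolding d_def by (rule cell_error[OF that Q[OF that]])
 have tele: "(\<Sum>j=1..m. \<kappa> e * integral (?I j) (%t. (y 0 e t - poly (P e j) t)^2)) + d e m
   <= (\<Sum>j=1..m. \<kappa> e * integral (?I j) (%t. (y 0 e t - poly (Q e j) t)^2)) + d e 0"
  if "e \<in> E" "m <= M" for e m
  using that(2)
 proof (induction m)
  case (Suc m)
  then show ?case using step[OF that(1), of "Suc m"] by simp
 qed simp
 have "(\<Sum>e\<in>E. \<kappa> e * (\<Sum>j=1..M. integral (?I j) (%t. (y 0 e t - poly (P e j) t)^2)))
   <= (\<Sum>e\<in>E. (\<Sum>j=1..M. \<kappa> e * integral (?I j) (%t. (y 0 e t - poly (Q e j) t)^2)) + d e 0)"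
 proof (rule sum_mono)
  fix e assume "e \<in> E"
  moreover have "d e M \<ge> 0" by (simp add: d_def)
  ultimately show "\<kappa> e * (\<Sum>j=1..M. integral (?I j) (%t. (y 0 e t - poly (P e j) t)^2))
    <= (\<Sum>j=1..M. \<kappa> e * integral (?I j) (%t. (y 0 e t - poly (Q e j) t)^2)) + d e 0"
   using tele[of e M] by (simp add: sum_distrib_left)
 qed
 also have "\<dots> = (\<Sum>j=1..M. \<eta> j) + (\<Sum>e\<in>E. (y 0 e 0 - z e)^2)"
 proof -
  have sw: "(\<Sum>e\<in>E. \<Sum>j=1..M. \<kappa> e * integral (?I j) (%t. (y 0 e t - poly (Q e j) t)^2)) = (\<Sum>j=1..M. \<eta> j)"
   unfolding \<eta>_def by (rule sum.swap)
  have d0: "d e 0 = (y 0 e 0 - z e)^2" for e by (simp add: d_def left mesh(1))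
  show ?thesis unfolding sum.distrib sw d0 ..
 qed
 finally have total: "(\<Sum>e\<in>E. \<kappa> e * (\<Sum>j=1..M. integral (?I j) (%t. (y 0 e t - poly (P e j) t)^2)))
   <= (\<Sum>j=1..M. \<eta> j) + (\<Sum>e\<in>E. (y 0 e 0 - z e)^2)" .
 have "(\<Sum>j=1..M. \<eta> j) <= (\<Sum>j=1..M. \<bar>K\<bar> * real M powr (- p))" by (rule sum_mono[OF K])
 also have "\<dots> = \<bar>K\<bar> * (real M * real M powr (- p))" by simp
 also have "real M * real M powr (- p) = real M powr 1 * real M powr (- p)" using Mr by simp
 also have "real M powr 1 * real M powr (- p) = real M powr (1 + - p)" by (rule powr_add[symmetric])
 also have "1 + - p = - (2 * real r + 2)" by (simp add: p_def)
 finally show ?thesis using total by linarith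
qed

end

section \<open>Smooth bump functions\<close>

lemma Ck_SucD: "Ck (Suc k) f ==> Ck k f"
proof (induction k arbitrary: f)
 case 0
 then show ?case
  by (auto simp: continuous_on_eq_continuous_within intro: differentiable_imp_continuous_within)
qed auto

lemma Ck_const: "Ck k (%x. c)"
proof (induction k arbitrary: c)
 case (Suc k)
 have "frechet_derivative (%x::'a. c) (at x) = (%_. 0)" for x
  by (rule frechet_derivative_at[symmetric]) (rule has_derivative_const)
 then show ?case using Suc[of 0] by simp
qed simp

lemma frechet_derivative_apply:
 "(f has_derivative f') (at x) ==> frechet_derivative f (at x) = f'"
 by (rule frechet_derivative_at[symmetric])

lemma has_frechet: "f differentiable (at x) ==> (f has_derivative frechet_derivative f (at x)) (at x)"
 by (simp add: frechet_derivative_works)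

lemma Ck_add: "Ck k f ==> Ck k g ==> Ck k (%x. f x + g x)"
proof (induction k arbitrary: f g)
 case (Suc k)
 have "frechet_derivative (%x. f x + g x) (at x) = (%h. frechet_derivative f (at x) h + frechet_derivative g (at x) h)" for x
  using Suc.prems by (intro frechet_derivative_apply has_derivative_add has_frechet) auto
 then show ?case using Suc by (auto intro!: differentiable_add Suc.IH)
qed (auto intro: continuous_on_add)

lemma Ck_mult: "Ck k f ==> Ck k g ==> Ck k (%x. f x * g x)"
proof (induction k arbitrary: f g)
 case (Suc k)
 have "frechet_derivative (%x. f x * g x) (at x)
   = (%h. f x * frechet_derivative g (at x) h + frechet_derivative f (at x) h * g x)" for x
  using Suc.prems by (intro frechet_derivative_apply has_derivative_mult has_frechet) auto
 then show ?case using Suc.prems Suc.prems[THEN Ck_SucD] by (auto intro!: differentiable_mult Suc.IH Ck_add)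
qed (auto intro: continuous_on_mult)

lemma Ck_prod: "(\<And>i. i \<in> I ==> Ck k (f i)) ==> Ck k (%x. \<Prod>i\<in>I. f i x)"
 by (induction I rule: infinite_finite_induct) (auto intro: Ck_const Ck_mult)

lemma Ck_ridge:
 fixes H :: "nat => real => real"
 assumes "\<And>m x. (H m has_real_derivative H (Suc m) x) (at x)"
 shows "Ck k (%x::'a::euclidean_space. H m (c * (x \<bullet> i) + d))"
proof (induction k arbitrary: m)
 case 0
 have "continuous_on UNIV (H m)"
  using assms by (meson DERIV_continuous_on has_field_derivative_at_within)
 then show ?case
  by (auto intro!: continuous_on_compose2[of UNIV "H m"] continuous_intros)
next
 case (Suc k)
 have D: "((%x::'a. H m (c * (x \<bullet> i) + d)) has_derivative (%h. H (Suc m) (c * (x \<bullet> i) + d) * (c * (h \<bullet> i)))) (at x)" for x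
 proof -
  have "((%x::'a. c * (x \<bullet> i) + d) has_derivative (%h. c * (h \<bullet> i))) (at x)"
   by (auto intro!: derivative_eq_intros)
  from has_derivative_compose[OF this, of "H m" "%h. H (Suc m) (c * (x \<bullet> i) + d) * h"]
  show ?thesis using assms[of m "c * (x \<bullet> i) + d"] by (simp add: has_field_derivative_def)
 qed
 then have "frechet_derivative (%x::'a. H m (c * (x \<bullet> i) + d)) (at x)
   = (%h. H (Suc m) (c * (x \<bullet> i) + d) * (c * (h \<bullet> i)))" for x
  by (rule frechet_derivative_apply)
 then show ?case using Suc D by (auto intro!: Ck_mult Ck_const differentiableI)
qed

text \<open>All derivatives of \<open>exp (-1/x)\<close> are of the form \<open>p (1/x) exp (-1/x)\<close> with a polynomial \<open>p\<close>.\<close>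

definition flat :: "real poly => real => real" where
 "flat p x = (if x > 0 then poly p (1 / x) * exp (- (1 / x)) else 0)"

lemma poly_exp_tendsto_0: "((%z. poly p z * exp (- z)) \<longlongrightarrow> (0::real)) at_top"
proof -
 have "((%z. \<Sum>k\<le>degree p. coeff p k * (z ^ k / exp z)) \<longlongrightarrow> (\<Sum>k\<le>degree p. coeff p k * 0)) at_top"
  by (intro tendsto_sum tendsto_mult tendsto_const tendsto_power_div_exp_0)
 moreover have "(%z. \<Sum>k\<le>degree p. coeff p k * (z ^ k / exp z)) = (%z. poly p z * exp (- z))"
  by (simp add: fun_eq_iff poly_altdef sum_distrib_right exp_minus divide_inverse mult.assoc)
 ultimately show ?thesis by simp
qed

lemma flat_derivative:
 "(flat p has_real_derivative flat (monom 1 2 * (p - pderiv p)) x) (at x)"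
proof -
 consider "x > 0" | "x < 0" | "x = 0" by linarith
 then show ?thesis
 proof cases
  case 1
  have i: "((%x. 1 / x) has_real_derivative (- 1 / x^2)) (at x)"
   using 1 by (auto intro!: derivative_eq_intros simp: power2_eq_square)
  have "((%x. exp (- (1 / x))) has_real_derivative exp (- (1 / x)) * (1 / x^2)) (at x)"
   using 1 by (auto intro!: derivative_eq_intros simp: power2_eq_square)
  from DERIV_mult[OF DERIV_chain2[OF poly_DERIV i] this]
  have "((%x. poly p (1 / x) * exp (- (1 / x))) has_real_derivative
    poly (pderiv p) (1 / x) * (- 1 / x^2) * exp (- (1 / x)) + exp (- (1 / x)) * (1 / x^2) * poly p (1 / x)) (at x)" .
  also have "poly (pderiv p) (1 / x) * (- 1 / x^2) * exp (- (1 / x)) + exp (- (1 / x)) * (1 / x^2) * poly p (1 / x)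
   = flat (monom 1 2 * (p - pderiv p)) x"
   using 1 by (simp add: flat_def poly_monom field_simps power2_eq_square)
  finally show ?thesis
   by (rule has_field_derivative_transform_within_open[where S = "{0<..}"]) (use 1 in \<open>auto simp: flat_def\<close>)
 next
  case 2
  have "((%x. 0) has_real_derivative flat (monom 1 2 * (p - pderiv p)) x) (at x)"
   using 2 by (simp add: flat_def)
  then show ?thesis
   by (rule has_field_derivative_transform_within_open[where S = "{..<0}"]) (use 2 in \<open>auto simp: flat_def\<close>)
 next
  case 3
  have "((%y. (flat p y - flat p 0) / (y - 0)) \<longlongrightarrow> 0) (at 0)"
  proof (rule filterlim_split_at)
   show "((%y. (flat p y - flat p 0) / (y - 0)) \<longlongrightarrow> 0) (at_left 0)"
    by (rule tendsto_eventually) (auto simp: flat_def eventually_at_filter)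
   have "((%y. poly (monom 1 1 * p) (inverse y) * exp (- inverse y)) \<longlongrightarrow> 0) (at_right 0)"
    by (rule filterlim_compose[OF poly_exp_tendsto_0 filterlim_inverse_at_top_right])
   moreover have "eventually (%y. poly (monom 1 1 * p) (inverse y) * exp (- inverse y) = (flat p y - flat p 0) / (y - 0)) (at_right 0)"
    by (auto simp: flat_def eventually_at_filter poly_monom field_simps)
   ultimately show "((%y. (flat p y - flat p 0) / (y - 0)) \<longlongrightarrow> 0) (at_right 0)"
    by (rule Lim_transform_eventually)
  qed
  then show ?thesis using 3 by (simp add: has_field_derivative_iff flat_def)
 qed
qed

primrec bump_derivs :: "nat => real poly" where
 "bump_derivs 0 = 1"
| "bump_derivs (Suc m) = monom 1 2 * (bump_derivs m - pderiv (bump_derivs m))"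

definition bump1 :: "real => real" where "bump1 = flat 1"

lemma bump1: "bump1 x = (if x > 0 then exp (- (1 / x)) else 0)"
 by (simp add: bump1_def flat_def)

lemma bump1_range: "0 <= bump1 x" "bump1 x <= 1" "bump1 x \<noteq> 0 \<longleftrightarrow> x > 0"
 by (auto simp: bump1)

lemma bump1_smooth: "Ck k (%x::'a::euclidean_space. bump1 (c * (x \<bullet> i) + d))"
 using Ck_ridge[of "%m. flat (bump_derivs m)" k 0 c i d] flat_derivative by (simp add: bump1_def)

text \<open>A smooth function supported in the box between \<open>a\<close> and \<open>b\<close>; for \<open>n\<close> tending to infinity it
  increases to the indicator function of the open box.\<close>

definition box_bump :: "'a::euclidean_space => 'a => nat => 'a => real" where
 "box_bump a b n x = (\<Prod>i\<in>Basis. bump1 (real n * (x \<bullet> i) + (- real n * (a \<bullet> i))) * bump1 (- real n * (x \<bullet> i) + real n * (b \<bullet> i)))"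

lemma box_bump_smooth: "Ck k (box_bump a b n)"
 unfolding box_bump_def by (intro Ck_prod Ck_mult bump1_smooth)

lemma box_bump_range: "0 <= box_bump a b n x" "box_bump a b n x <= 1"
 unfolding box_bump_def
 by (auto intro!: prod_nonneg prod_le_1 mult_le_one mult_nonneg_nonneg bump1_range)

lemma box_bump_nonzero: "box_bump a b (Suc n) x \<noteq> 0 \<longleftrightarrow> x \<in> box a b"
proof -
 have e: "real (Suc n) * u - real (Suc n) * v > 0 \<longleftrightarrow> v < u" for u v
  by (simp add: zero_less_mult_iff flip: right_diff_distrib del: of_nat_Suc)
 have "(real (Suc n) * (x \<bullet> i) + - real (Suc n) * (a \<bullet> i) > 0) = (a \<bullet> i < x \<bullet> i)" for i
  using e[of "x \<bullet> i" "a \<bullet> i"] by (simp del: of_nat_Suc)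
 moreover have "(- real (Suc n) * (x \<bullet> i) + real (Suc n) * (b \<bullet> i) > 0) = (x \<bullet> i < b \<bullet> i)" for i
  using e[of "b \<bullet> i" "x \<bullet> i"] by (simp del: of_nat_Suc)
 ultimately show ?thesis unfolding box_bump_def by (auto simp: bump1_range(3) mem_box simp del: of_nat_Suc)
qed

lemma box_bump_tendsto: "(%n. box_bump a b (Suc n) x) \<longlonglongrightarrow> indicat_real (box a b) x"
proof (cases "x \<in> box a b")
 case True
 have lim: "(%n. bump1 (real (Suc n) * y)) \<longlonglongrightarrow> 1" if "y > 0" for y
 proof -
  have "(%n. exp (- (1 / y * (1 / real (Suc n))))) \<longlonglongrightarrow> exp (- (1 / y * 0))"
   by (intro tendsto_intros LIMSEQ_Suc[OF lim_1_over_n])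
  moreover have "bump1 (real (Suc n) * y) = exp (- (1 / y * (1 / real (Suc n))))" for n
   using that by (simp add: bump1 mult.commute del: of_nat_Suc)
  ultimately show ?thesis by simp
 qed
 have "(%n. \<Prod>i\<in>Basis. bump1 (real (Suc n) * (x \<bullet> i - a \<bullet> i)) * bump1 (real (Suc n) * (b \<bullet> i - x \<bullet> i)))
   \<longlonglongrightarrow> (\<Prod>i\<in>(Basis::'a set). 1 * 1)"
  using True by (intro tendsto_prod tendsto_mult lim) (auto simp: mem_box)
 then show ?thesis using True unfolding box_bump_def by (simp add: algebra_simps del: of_nat_Suc)
next
 case False
 then show ?thesis using box_bump_nonzero[of a b _ x] by simp
qed

lemma box_bump_test_function:
 assumes "cbox a b \<subseteq> S"
 shows "box_bump a b (Suc n) \<in> test_functions S"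
proof -
 have "closure {x. box_bump a b (Suc n) x \<noteq> 0} \<subseteq> cbox a b"
  unfolding box_bump_nonzero using box_subset_cbox[of a b] by (intro closure_minimal closed_cbox) auto
 then show ?thesis unfolding test_functions_def
  using assms box_bump_smooth compact_cbox[of a b]
  by (auto simp: compact_eq_bounded_closed bounded_subset intro: bounded_subset[of "cbox a b"])
qed

section \<open>The fundamental lemma of the calculus of variations\<close>

text \<open>Open boxes generate the Borel sets and are stable under intersection.\<close>

lemma integral_boxes_zero_imp_AE_zero:
 fixes h :: "'a::euclidean_space => real"
 assumes h: "integrable lborel h" and total: "(LINT x|lborel. h x) = 0"
  and boxes: "\<And>a b. (LINT x|lborel. indicat_real (box a b) x * h x) = 0"
 shows "AE x in lborel. h x = 0"
proof -
 have int: "integrable lborel (%x. indicat_real A x * h x)" if "A \<in> sets borel" for A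
  using integrable_mult_indicator[OF _ h, of A] that by simp
 have "(LINT x|lborel. indicat_real A x * h x) = 0" if "A \<in> sets borel" for A
 proof -
  have "Int_stable (range (%(a, b). box a b) :: 'a set set)"
  proof (rule Int_stableI)
   fix X Y :: "'a set" assume "X \<in> range (%(a, b). box a b)" "Y \<in> range (%(a, b). box a b)"
   then obtain a b c d where "X = box a b" "Y = box c d" by auto
   then have "X \<inter> Y = (%(a, b). box a b) (\<Sum>i\<in>Basis. max (a\<bullet>i) (c\<bullet>i) *\<^sub>R i, \<Sum>i\<in>Basis. min (b\<bullet>i) (d\<bullet>i) *\<^sub>R i)"
    by (simp add: box_Int_box)
   then show "X \<inter> Y \<in> range (%(a, b). box a b)" by blast
  qed
  moreover have "range (%(a, b). box a b) \<subseteq> Pow (UNIV :: 'a set)" by auto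
  moreover have "A \<in> sigma_sets UNIV (range (%(a, b). box a b))"
   using that by (simp add: borel_eq_box)
  ultimately show ?thesis
  proof (induction rule: sigma_sets_induct_disjoint)
   case (basic A)
   then show ?case using boxes by auto
  next
   case empty
   then show ?case by simp
  next
   case (compl A)
   then have A: "A \<in> sets borel" by (simp add: borel_eq_box)
   have "(LINT x|lborel. indicat_real (UNIV - A) x * h x) = (LINT x|lborel. h x - indicat_real A x * h x)"
    by (intro Bochner_Integration.integral_cong) (auto simp: indicator_def)
   also have "\<dots> = 0" using compl total by (simp add: h int A)
   finally show ?case .
  next
   case (union A)
   then have A: "range A \<subseteq> sets lborel" by (auto simp: borel_eq_box)
   have "set_integrable lborel (\<Union>i. A i) h"
    using int[of "\<Union>i. A i"] A by (auto simp: set_integrable_def)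
   from lebesgue_integral_countable_add[OF _ _ this] A union
   show ?case by (auto simp: set_lebesgue_integral_def disjoint_family_on_def)
  qed
 qed
 then show ?thesis
  using h by (intro density_unique_real) (auto simp: set_lebesgue_integral_def)
qed

definition locally_integrable_on :: "('a::euclidean_space => 'b::euclidean_space) => 'a set => bool" where
 "locally_integrable_on h S \<longleftrightarrow> (\<forall>K. compact K \<and> K \<subseteq> S \<longrightarrow> h absolutely_integrable_on K)"

lemma integral_lebesgue_on_restrict:
 fixes f :: "'a::euclidean_space => real"
 assumes "S \<in> sets lebesgue"
 shows "(LINT x|lebesgue_on S. f x) = (LINT x|lebesgue. indicator S x * f x)"
 using integral_restrict_space[of S lebesgue f] assms by simp

lemma box_bump_integral_tendsto:
 fixes h :: "'a::euclidean_space => real"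
 assumes Sm: "S \<in> sets lebesgue" and h: "locally_integrable_on h S" and ab: "cbox a b \<subseteq> S"
 shows "integrable lebesgue (%x. indicat_real (box a b) x * h x)"
  and "(%n. LINT x|lebesgue_on S. h x * box_bump a b (Suc n) x)
   \<longlonglongrightarrow> (LINT x|lebesgue. indicat_real (box a b) x * h x)"
proof -
 have "h absolutely_integrable_on cbox a b"
  using h ab by (auto simp: locally_integrable_on_def)
 then have ci: "integrable lebesgue (%x. indicat_real (cbox a b) x * h x)"
  by (simp add: set_integrable_def)
 have "integrable lebesgue (%x. indicat_real (box a b) x *\<^sub>R (indicat_real (cbox a b) x * h x))"
  by (intro integrable_mult_indicator ci) auto
 moreover have "(%x. indicat_real (box a b) x *\<^sub>R (indicat_real (cbox a b) x * h x)) = (%x. indicat_real (box a b) x * h x)"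
  using box_subset_cbox[of a b] by (auto simp: fun_eq_iff indicator_def)
 ultimately show "integrable lebesgue (%x. indicat_real (box a b) x * h x)" by simp
 have eq: "h x * box_bump a b (Suc n) x = (indicat_real (cbox a b) x * h x) * box_bump a b (Suc n) x" for n x
  using box_bump_nonzero[of a b n x] box_subset_cbox[of a b] by (auto simp: indicator_def)
 have meas: "box_bump a b (Suc n) \<in> borel_measurable lebesgue" for n
  using box_bump_smooth[of 0 a b "Suc n"] by (auto intro!: borel_measurable_continuous_onI measurable_completion)
 have lim: "(%n. LINT x|lebesgue. (indicat_real (cbox a b) x * h x) * box_bump a b (Suc n) x)
   \<longlonglongrightarrow> (LINT x|lebesgue. (indicat_real (cbox a b) x * h x) * indicat_real (box a b) x)"
 proof (rule integral_dominated_convergence[where w = "%x. norm (indicat_real (cbox a b) x * h x)"])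
  show "AE x in lebesgue. (%n. indicat_real (cbox a b) x * h x * box_bump a b (Suc n) x)
    \<longlonglongrightarrow> indicat_real (cbox a b) x * h x * indicat_real (box a b) x"
   by (intro AE_I2 tendsto_mult tendsto_const box_bump_tendsto)
  show "AE x in lebesgue. norm (indicat_real (cbox a b) x * h x * box_bump a b (Suc n) x) <= norm (indicat_real (cbox a b) x * h x)" for n
   using box_bump_range[of a b "Suc n"] by (intro AE_I2) (auto simp: abs_mult mult_left_le)
  show "(%x. indicat_real (cbox a b) x * h x * indicat_real (box a b) x) \<in> borel_measurable lebesgue"
   by (intro borel_measurable_times[OF borel_measurable_integrable[OF ci]] borel_measurable_indicator) auto
  show "(%x. indicat_real (cbox a b) x * h x * box_bump a b (Suc n) x) \<in> borel_measurable lebesgue" for n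
   by (rule borel_measurable_times[OF borel_measurable_integrable[OF ci] meas])
 qed (rule integrable_norm[OF ci])
 have "(LINT x|lebesgue_on S. h x * box_bump a b (Suc n) x)
   = (LINT x|lebesgue. (indicat_real (cbox a b) x * h x) * box_bump a b (Suc n) x)" for n
 proof -
  have "indicator S x * (h x * box_bump a b (Suc n) x) = (indicat_real (cbox a b) x * h x) * box_bump a b (Suc n) x" for x
   unfolding eq using ab by (auto simp: indicator_def)
  then show ?thesis unfolding integral_lebesgue_on_restrict[OF Sm] by (simp only:)
 qed
 moreover have "(indicat_real (cbox a b) x * h x) * indicat_real (box a b) x = indicat_real (box a b) x * h x" for x
  using box_subset_cbox[of a b] by (auto simp: indicator_def)
 ultimately show "(%n. LINT x|lebesgue_on S. h x * box_bump a b (Suc n) x)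
   \<longlonglongrightarrow> (LINT x|lebesgue. indicat_real (box a b) x * h x)"
  using lim by (simp only:)
qed

text \<open>The bumps of a box converge to its indicator function, so the integral over every box with
  closure in \<open>S\<close> vanishes. Intersections of boxes are boxes, hence the restriction to one box has
  zero integral over all boxes.\<close>

lemma fundamental_lemma:
 fixes h :: "'a::euclidean_space => real"
 assumes S: "open S" and h: "locally_integrable_on h S"
  and zero: "\<And>\<phi>. \<phi> \<in> test_functions S ==> (LINT x|lebesgue_on S. h x * \<phi> x) = 0"
 shows "AE x in lebesgue_on S. h x = 0"
proof -
 have Sm: "S \<in> sets lebesgue" using S by auto
 have boxint: "integrable lebesgue (%x. indicat_real (box a b) x * h x)" if "cbox a b \<subseteq> S" for a b
  by (rule box_bump_integral_tendsto(1)[OF Sm h that])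
 have box0: "(LINT x|lebesgue. indicat_real (box a b) x * h x) = 0" if "cbox a b \<subseteq> S" for a b
  using box_bump_integral_tendsto(2)[OF Sm h that] zero[OF box_bump_test_function[OF that]]
  by (simp add: LIMSEQ_const_iff)
 have AEbox: "AE x in lebesgue. x \<in> box a b \<longrightarrow> h x = 0" if ab: "cbox a b \<subseteq> S" for a b
 proof -
  define hb where "hb = (%x. indicat_real (box a b) x * h x)"
  have hbi: "integrable lebesgue hb" unfolding hb_def by (rule boxint[OF ab])
  obtain h' where h': "h' \<in> borel_measurable lborel" "AE x in lborel. hb x = h' x"
   using completion_ex_borel_measurable_real[OF borel_measurable_integrable[OF hbi]] by auto
  have h'2: "AE x in lebesgue. hb x = h' x" using h'(2) by (rule AE_completion)
  have h'm: "h' \<in> borel_measurable lebesgue" using h'(1) by (simp add: measurable_completion)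
  have h'i: "integrable lborel h'"
  proof -
   have "integrable lebesgue h'"
    using hbi h'm h'2 integrable_cong_AE[of hb lebesgue h'] borel_measurable_integrable[OF hbi] by simp
   then show ?thesis using h'(1) integrable_completion by blast
  qed
  have B: "(LINT x|lborel. indicat_real B x * h' x) = (LINT x|lebesgue. indicat_real B x * hb x)"
   if "B \<in> sets borel" for B
  proof -
   have "(LINT x|lborel. indicat_real B x * h' x) = (LINT x|lebesgue. indicat_real B x * h' x)"
    using h'(1) that by (intro integral_completion[symmetric]) auto
   also have "\<dots> = (LINT x|lebesgue. indicat_real B x * hb x)"
    using h'2 h'm borel_measurable_integrable[OF hbi] that
    by (intro integral_cong_AE borel_measurable_times) (auto intro: borel_measurable_indicator)
   finally show ?thesis .
  qed
  have "AE x in lborel. h' x = 0"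
  proof (rule integral_boxes_zero_imp_AE_zero[OF h'i])
   show "(LINT x|lborel. h' x) = 0"
    using B[of UNIV] box0[OF ab] by (simp add: hb_def)
   fix c d :: 'a
   define u v where "u = (\<Sum>i\<in>Basis. max (a\<bullet>i) (c\<bullet>i) *\<^sub>R i)" and "v = (\<Sum>i\<in>Basis. min (b\<bullet>i) (d\<bullet>i) *\<^sub>R i)"
   have uv: "box a b \<inter> box c d = box u v" by (simp add: box_Int_box u_def v_def)
   have "cbox u v \<subseteq> cbox a b" by (auto simp: u_def v_def mem_box)
   then have "(LINT x|lebesgue. indicat_real (box u v) x * h x) = 0" using ab by (intro box0) auto
   moreover have "indicat_real (box c d) x * hb x = indicat_real (box u v) x * h x" for x
    unfolding uv[symmetric] hb_def by (auto simp: indicator_def)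
   ultimately show "(LINT x|lborel. indicat_real (box c d) x * h' x) = 0" using B[of "box c d"] by simp
  qed
  then have "AE x in lebesgue. h' x = 0" by (rule AE_completion)
  with h'2 show ?thesis by eventually_elim (auto simp: hb_def)
 qed
 have ex: "\<exists>c d. x \<in> box c d \<and> cbox c d \<subseteq> S \<and> (\<forall>i\<in>Basis. c \<bullet> i \<in> \<rat> \<and> d \<bullet> i \<in> \<rat>)" if xS: "x \<in> S" for x
 proof -
  obtain e where e: "0 < e" "ball x e \<subseteq> S" using openE[OF S xS] by blast
  from rational_boxes[of "e/2" x] e obtain c d where
   cd: "\<forall>i\<in>Basis. c \<bullet> i \<in> \<rat> \<and> d \<bullet> i \<in> \<rat>" "x \<in> box c d" "box c d \<subseteq> ball x (e/2)" by auto
  have "cbox c d = closure (box c d)" using cd(2) by (intro closure_box[symmetric]) auto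
  also have "\<dots> \<subseteq> closure (ball x (e/2))" by (rule closure_mono[OF cd(3)])
  also have "\<dots> \<subseteq> ball x e" using e by auto
  finally show ?thesis using cd e by blast
 qed
 define Q where "Q = {(c, d). cbox c d \<subseteq> S \<and> (\<forall>i\<in>Basis. c \<bullet> i \<in> \<rat> \<and> d \<bullet> i \<in> \<rat>)}"
 have "countable {c::'a. \<forall>i\<in>Basis. c \<bullet> i \<in> \<rat>}"
 proof -
  have "{c::'a. \<forall>i\<in>Basis. c \<bullet> i \<in> \<rat>} \<subseteq> (%f. \<Sum>i\<in>Basis. f i *\<^sub>R i) ` (Basis \<rightarrow>\<^sub>E \<rat>)"
  proof
   fix c :: 'a assume c: "c \<in> {c. \<forall>i\<in>Basis. c \<bullet> i \<in> \<rat>}"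
   have "c = (\<Sum>i\<in>Basis. restrict (%i. c \<bullet> i) Basis i *\<^sub>R i)"
    by (simp add: euclidean_representation cong: sum.cong)
   then show "c \<in> (%f. \<Sum>i\<in>Basis. f i *\<^sub>R i) ` (Basis \<rightarrow>\<^sub>E \<rat>)" 
    by (rule image_eqI[where x = "restrict (%i. c \<bullet> i) Basis"]) (use c in \<open>simp add: restrict_PiE_iff\<close>)
  qed
  then show ?thesis by (rule countable_subset) (auto intro!: countable_image countable_PiE countable_rat)
 qed
 then have "countable ({c::'a. \<forall>i\<in>Basis. c \<bullet> i \<in> \<rat>} \<times> {c::'a. \<forall>i\<in>Basis. c \<bullet> i \<in> \<rat>})" by auto
 then have cQ: "countable Q" by (rule countable_subset[rotated]) (auto simp: Q_def)
 have "AE x in lebesgue. \<forall>(c, d)\<in>Q. x \<in> box c d \<longrightarrow> h x = 0"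
  unfolding AE_ball_countable[OF cQ] by (auto simp: Q_def intro: AEbox)
 then have "AE x in lebesgue. x \<in> S \<longrightarrow> h x = 0"
 proof eventually_elim
  case (elim x)
  then show ?case using ex[of x] by (auto simp: Q_def)
 qed
 then show ?thesis using Sm by (simp add: AE_restrict_space_iff)
qed

section \<open>Weak gradients\<close>

lemma locally_integrable_measurable:
 fixes h :: "'a::euclidean_space => 'b::euclidean_space"
 assumes S: "open S" and h: "locally_integrable_on h S"
 shows "h \<in> borel_measurable (lebesgue_on S)"
proof -
 obtain C where C: "\<And>n. compact (C n)" "\<And>n. C n \<subseteq> S" "\<And>n. C n \<subseteq> C (Suc n)" "\<Union>(range C) = S"
 proof -
  obtain C where "\<And>n. compact (C n)" "\<And>n. C n \<subseteq> S" "\<And>n. C n \<subseteq> interior (C (Suc n))" "\<Union>(range C) = S"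
   using open_Union_compact_subsets[OF S] by metis
  moreover have "interior (C (Suc n)) \<subseteq> C (Suc n)" for n by (rule interior_subset)
  ultimately show ?thesis by (intro that[of C]) (blast intro: order.trans)+
 qed
 have Sm: "S \<in> sets lebesgue" using S by auto
 have "(%x. indicat_real (C n) x *\<^sub>R h x) \<in> borel_measurable lebesgue" for n
  using h C(1,2)[of n] by (auto simp: locally_integrable_on_def set_integrable_def dest: borel_measurable_integrable)
 then have m: "(%x. indicat_real (C n) x *\<^sub>R h x) \<in> borel_measurable (lebesgue_on S)" for n
  by (rule measurable_restrict_space1)
 show ?thesis
 proof (rule borel_measurable_LIMSEQ_metric[OF m])
  fix x assume "x \<in> space (lebesgue_on S)"
  then have "x \<in> S" by (simp add: space_restrict_space)
  then obtain m where "x \<in> C m" using C(4) by auto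
  then have "x \<in> C n" if "n \<ge> m" for n
   using lift_Suc_mono_le[of C m n] C(3) that by blast
  then have "eventually (%n. indicat_real (C n) x *\<^sub>R h x = h x) sequentially"
   unfolding eventually_sequentially by (intro exI[of _ m]) simp
  then show "(%n. indicat_real (C n) x *\<^sub>R h x) \<longlonglongrightarrow> h x" by (rule tendsto_eventually)
 qed
qed

lemma locally_integrable_add:
 "locally_integrable_on f S ==> locally_integrable_on g S ==> locally_integrable_on (%x. f x + g x) S"
 unfolding locally_integrable_on_def by (auto intro!: set_integral_add)

lemma locally_integrable_scale:
 "locally_integrable_on f S ==> locally_integrable_on (%x. c *\<^sub>R f x) S"
 unfolding locally_integrable_on_def by (auto intro!: set_integrable_scaleR_right)

lemma locally_integrable_inner:
 assumes "locally_integrable_on g S"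
 shows "locally_integrable_on (%x. g x \<bullet> i) S"
 unfolding locally_integrable_on_def
proof (intro allI impI)
 fix K assume "compact K \<and> K \<subseteq> S"
 then have "integrable lebesgue (%x. indicat_real K x *\<^sub>R g x)"
  using assms by (auto simp: locally_integrable_on_def set_integrable_def)
 from integrable_inner_left[OF this, of i]
 show "(%x. g x \<bullet> i) absolutely_integrable_on K" by (simp add: set_integrable_def)
qed

lemma locally_integrable_continuous:
 "continuous_on UNIV (f :: 'a::euclidean_space => 'b::euclidean_space) ==> locally_integrable_on f S"
 unfolding locally_integrable_on_def
proof (intro allI impI)
 fix K assume f: "continuous_on UNIV f" and "compact K \<and> K \<subseteq> S"
 then have "integrable lborel (%x. indicator K x *\<^sub>R f x)"
  by (intro borel_integrable_compact continuous_on_subset[OF f]) auto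
 then have "integrable lebesgue (%x. indicator K x *\<^sub>R f x)"
  by (subst integrable_completion) (auto dest: borel_measurable_integrable)
 then show "f absolutely_integrable_on K" by (simp add: set_integrable_def)
qed

lemma integrable_times_compactly_supported:
 fixes h \<psi> :: "'a::euclidean_space => real"
 assumes S: "S \<in> sets lebesgue" and h: "locally_integrable_on h S" and \<psi>: "continuous_on UNIV \<psi>"
  and K: "compact K" "K \<subseteq> S" "\<And>x. x \<notin> K ==> \<psi> x = 0"
 shows "integrable (lebesgue_on S) (%x. h x * \<psi> x)"
proof -
 have hK: "integrable lebesgue (%x. indicat_real K x * h x)"
  using h K by (auto simp: locally_integrable_on_def set_integrable_def)
 have "compact (\<psi> ` K)" using \<psi> K(1) by (intro compact_continuous_image continuous_on_subset[OF \<psi>]) auto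
 then obtain C where C: "\<And>x. x \<in> K ==> \<bar>\<psi> x\<bar> <= C"
  using compact_imp_bounded[of "\<psi> ` K"] unfolding bounded_iff by auto
 have m: "\<psi> \<in> borel_measurable lebesgue"
  by (rule measurable_completion) (simp add: borel_measurable_continuous_onI \<psi>)
 have "integrable lebesgue (%x. (indicat_real K x * h x) * \<psi> x)"
 proof (rule Bochner_Integration.integrable_bound)
  show "integrable lebesgue (%x. C * (indicat_real K x * h x))" by (intro integrable_mult_right hK)
  show "(%x. (indicat_real K x * h x) * \<psi> x) \<in> borel_measurable lebesgue"
   by (intro borel_measurable_times borel_measurable_integrable[OF hK] m)
  show "AE x in lebesgue. norm ((indicat_real K x * h x) * \<psi> x) <= norm (C * (indicat_real K x * h x))"
  proof (rule AE_I2)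
   fix x
   show "norm ((indicat_real K x * h x) * \<psi> x) <= norm (C * (indicat_real K x * h x))"
   proof (cases "x \<in> K")
    case True
    have "\<bar>h x\<bar> * \<bar>\<psi> x\<bar> <= \<bar>h x\<bar> * \<bar>C\<bar>" using C[OF True] by (intro mult_left_mono) auto
    then show ?thesis using True by (simp add: abs_mult mult_ac)
   qed simp
  qed
 qed
 moreover have "(%x. (indicat_real K x * h x) * \<psi> x) = (%x. indicat_real S x *\<^sub>R (h x * \<psi> x))"
  using K(2,3) by (auto simp: fun_eq_iff indicator_def)
 ultimately show ?thesis using S by (simp add: integrable_restrict_space)
qed

definition supp :: "('a::topological_space => real) => 'a set" where
 "supp \<phi> = closure {x. \<phi> x \<noteq> 0}"

lemma outside_supp: "x \<notin> supp \<phi> ==> \<phi> x = 0"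
proof (rule ccontr)
 assume out: "x \<notin> supp \<phi>" and "\<phi> x \<noteq> 0"
 then have "x \<in> {x. \<phi> x \<noteq> 0}" by simp
 then have "x \<in> supp \<phi>" unfolding supp_def by (rule subsetD[OF closure_subset])
 with out show False by contradiction
qed

lemma test_function_props:
 assumes "\<phi> \<in> test_functions S"
 shows "continuous_on UNIV \<phi>" and "\<phi> differentiable (at x)"
  and "i \<in> Basis ==> continuous_on UNIV (%x. frechet_derivative \<phi> (at x) i)"
  and "x \<notin> supp \<phi> ==> \<phi> x = 0"
  and "x \<notin> supp \<phi> ==> frechet_derivative \<phi> (at x) i = 0"
  and "compact (supp \<phi>)" "supp \<phi> \<subseteq> S"
  and "x \<notin> S ==> \<phi> x = 0" and "x \<notin> S ==> frechet_derivative \<phi> (at x) i = 0"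
proof -
 have "\<forall>k. Ck k \<phi>" using assms unfolding test_functions_def by blast
 then have C: "Ck k \<phi>" for k by blast
 show "continuous_on UNIV \<phi>" using C[of 0] unfolding Ck.simps .
 note C1 = C[of "Suc 0", unfolded Ck.simps]
 show "\<phi> differentiable (at x)" using C1 by (rule conjunct1[THEN spec])
 show "continuous_on UNIV (%x. frechet_derivative \<phi> (at x) i)" if "i \<in> Basis"
  using conjunct2[OF C1] that by (rule bspec)
 show "\<phi> x = 0" if "x \<notin> supp \<phi>" using that by (rule outside_supp)
 show d0: "frechet_derivative \<phi> (at x) i = 0" if x: "x \<notin> supp \<phi>" for x
 proof -
  have "((%_. 0) has_derivative (%_. 0)) (at x)" by (rule has_derivative_const)
  then have "(\<phi> has_derivative (%_. 0)) (at x)"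
  proof (rule has_derivative_transform_within_open)
   show "open (- supp \<phi>)" unfolding supp_def by (intro open_Compl closed_closure)
   show "x \<in> - supp \<phi>" using x by simp
   show "0 = \<phi> y" if "y \<in> - supp \<phi>" for y using outside_supp[of y \<phi>] that by simp
  qed
  then show ?thesis by (simp add: frechet_derivative_apply)
 qed
 show sub: "compact (supp \<phi>)" "supp \<phi> \<subseteq> S"
  using assms unfolding test_functions_def supp_def by blast+
 show "\<phi> x = 0" if "x \<notin> S" using that sub(2) by (intro outside_supp) blast
 show "frechet_derivative \<phi> (at x) i = 0" if "x \<notin> S" using that sub(2) by (intro d0) blast
qed

lemma integrable_times_test:
 assumes S: "open S" and h: "locally_integrable_on h S" and \<phi>: "\<phi> \<in> test_functions S"
 shows "integrable (lebesgue_on S) (%x. h x * \<phi> x)"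
  and "i \<in> Basis ==> integrable (lebesgue_on S) (%x. h x * frechet_derivative \<phi> (at x) i)"
proof -
 note p = test_function_props[OF \<phi>]
 have Sm: "S \<in> sets lebesgue" using S by auto
 show "integrable (lebesgue_on S) (%x. h x * \<phi> x)"
  by (rule integrable_times_compactly_supported[OF Sm h p(1,6,7,4)])
 show "integrable (lebesgue_on S) (%x. h x * frechet_derivative \<phi> (at x) i)" if "i \<in> Basis"
  by (rule integrable_times_compactly_supported[OF Sm h p(3)[OF that] p(6,7,5)])
qed

lemma is_weak_gradientD:
 assumes "is_weak_gradient S u g"
 shows "locally_integrable_on u S" "locally_integrable_on g S"
  "\<phi> \<in> test_functions S ==> i \<in> Basis ==>
   (LINT x|lebesgue_on S. u x * frechet_derivative \<phi> (at x) i) = - (LINT x|lebesgue_on S. (g x \<bullet> i) * \<phi> x)"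
 using assms unfolding is_weak_gradient_def locally_integrable_on_def by auto

lemma weak_gradient_unique:
 fixes u :: "'a::euclidean_space => real"
 assumes S: "open S" and g: "is_weak_gradient S u g" "is_weak_gradient S u g'"
 shows "AE x in lebesgue_on S. g x = g' x"
proof -
 have "AE x in lebesgue_on S. \<forall>i\<in>Basis. (g x - g' x) \<bullet> i = 0"
 proof (rule AE_finite_allI[OF finite_Basis])
  fix i :: 'a assume i: "i \<in> Basis"
  have loc: "locally_integrable_on (%x. g x \<bullet> i) S" "locally_integrable_on (%x. g' x \<bullet> i) S"
   using g by (auto intro: locally_integrable_inner is_weak_gradientD)
  have "locally_integrable_on (%x. (g x - g' x) \<bullet> i) S"
   using locally_integrable_add[OF loc(1) locally_integrable_scale[OF loc(2), of "-1"]]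
   by (simp add: inner_diff_left)
  then show "AE x in lebesgue_on S. (g x - g' x) \<bullet> i = 0"
  proof (rule fundamental_lemma[OF S])
   fix \<phi> :: "'a => real" assume \<phi>: "\<phi> \<in> test_functions S"
   have "(LINT x|lebesgue_on S. ((g x - g' x) \<bullet> i) * \<phi> x)
     = (LINT x|lebesgue_on S. (g x \<bullet> i) * \<phi> x - (g' x \<bullet> i) * \<phi> x)"
    by (simp add: inner_diff_left algebra_simps)
   also have "\<dots> = (LINT x|lebesgue_on S. (g x \<bullet> i) * \<phi> x) - (LINT x|lebesgue_on S. (g' x \<bullet> i) * \<phi> x)"
    by (intro Bochner_Integration.integral_diff integrable_times_test[OF S _ \<phi>] loc)
   also have "\<dots> = 0" using is_weak_gradientD(3)[OF g(1) \<phi> i] is_weak_gradientD(3)[OF g(2) \<phi> i] by simp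
   finally show "(LINT x|lebesgue_on S. ((g x - g' x) \<bullet> i) * \<phi> x) = 0" .
  qed
 qed
 then show ?thesis
 proof eventually_elim
  case (elim x)
  then have "g x - g' x = 0" by (subst euclidean_all_zero_iff[symmetric]) auto
  then show ?case by simp
 qed
qed

lemma weak_gradient_works: "is_weak_gradient S u g ==> is_weak_gradient S u (weak_gradient S u)"
 using someI[of "is_weak_gradient S u" g] by (simp add: weak_gradient_def)

lemma weak_gradient_eq:
 "open S ==> is_weak_gradient S u g ==> AE x in lebesgue_on S. weak_gradient S u x = g x"
 using weak_gradient_unique weak_gradient_works by blast

lemma is_weak_gradient_add:
 assumes S: "open S" and g: "is_weak_gradient S u g" "is_weak_gradient S v h"
 shows "is_weak_gradient S (u + v) (%x. g x + h x)"
proof -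
 note loc = is_weak_gradientD(1,2)[OF g(1)] is_weak_gradientD(1,2)[OF g(2)]
 have "(LINT x|lebesgue_on S. (u + v) x * frechet_derivative \<phi> (at x) i) = - (LINT x|lebesgue_on S. ((g x + h x) \<bullet> i) * \<phi> x)"
  if \<phi>: "\<phi> \<in> test_functions S" and i: "i \<in> Basis" for \<phi> i
 proof -
  note I = integrable_times_test(2)[OF S loc(1) \<phi> i] integrable_times_test(2)[OF S loc(3) \<phi> i]
   integrable_times_test(1)[OF S locally_integrable_inner[OF loc(2)] \<phi>, of i]
   integrable_times_test(1)[OF S locally_integrable_inner[OF loc(4)] \<phi>, of i]
  show ?thesis
   using is_weak_gradientD(3)[OF g(1) \<phi> i] is_weak_gradientD(3)[OF g(2) \<phi> i] I
   by (simp add: distrib_right inner_add_left)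
 qed
 then show ?thesis
  using locally_integrable_add[OF loc(1,3)] locally_integrable_add[OF loc(2,4)]
  unfolding is_weak_gradient_def locally_integrable_on_def plus_fun_def by auto
qed

lemma is_weak_gradient_scale:
 assumes g: "is_weak_gradient S u g"
 shows "is_weak_gradient S (c *\<^sub>R u) (%x. c *\<^sub>R g x)"
proof -
 note loc = is_weak_gradientD(1,2)[OF g]
 have "(LINT x|lebesgue_on S. (c *\<^sub>R u) x * frechet_derivative \<phi> (at x) i) = - (LINT x|lebesgue_on S. ((c *\<^sub>R g x) \<bullet> i) * \<phi> x)"
  if "\<phi> \<in> test_functions S" "i \<in> Basis" for \<phi> i
  using is_weak_gradientD(3)[OF g that] by (simp add: scaleR_fun_def mult.assoc)
 then show ?thesis
  using locally_integrable_scale[OF loc(1), of c] locally_integrable_scale[OF loc(2), of c]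
  unfolding is_weak_gradient_def locally_integrable_on_def scaleR_fun_def by auto
qed

lemma is_weak_gradient_diff:
 assumes "open S" "is_weak_gradient S u g" "is_weak_gradient S v h"
 shows "is_weak_gradient S (u - v) (%x. g x - h x)"
 using is_weak_gradient_add[OF assms(1,2) is_weak_gradient_scale[OF assms(3), of "-1"]] by simp

text \<open>Positivity of the weight allows the integrability of the sum to be split into that of its terms.\<close>

lemma weighted_H1D:
 assumes S: "open S" and u: "u \<in> weighted_H1 w S"
  and w: "w \<in> borel_measurable (lebesgue_on S)" "\<And>x. x \<in> S ==> w x > 0"
 shows "is_weak_gradient S u (weak_gradient S u)"
  and "u \<in> borel_measurable (lebesgue_on S)" "weak_gradient S u \<in> borel_measurable (lebesgue_on S)"
  and "integrable (lebesgue_on S) (%x. w x * (u x)^2)"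
  and "integrable (lebesgue_on S) (%x. w x * (norm (weak_gradient S u x))^2)"
proof -
 show wg: "is_weak_gradient S u (weak_gradient S u)"
  using u weak_gradient_works by (auto simp: weighted_H1_def)
 show m: "u \<in> borel_measurable (lebesgue_on S)" "weak_gradient S u \<in> borel_measurable (lebesgue_on S)"
  using is_weak_gradientD(1,2)[OF wg] by (auto intro: locally_integrable_measurable[OF S])
 have I: "integrable (lebesgue_on S) (%x. w x * ((u x)^2 + (norm (weak_gradient S u x))^2))"
  using u by (simp add: weighted_H1_def)
 have sp: "space (lebesgue_on S) = S" by (simp add: space_restrict_space)
 show "integrable (lebesgue_on S) (%x. w x * (u x)^2)"
  by (rule Bochner_Integration.integrable_bound[OF I])
   (use m w in \<open>auto simp: sp abs_mult intro!: AE_I2 mult_left_mono\<close>)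
 show "integrable (lebesgue_on S) (%x. w x * (norm (weak_gradient S u x))^2)"
  by (rule Bochner_Integration.integrable_bound[OF I])
   (use m w in \<open>auto simp: sp abs_mult intro!: AE_I2 mult_left_mono\<close>)
qed

section \<open>Test functions, integration by parts and the Poincare inequality\<close>

lemma integral_derivative_zero:
 fixes \<psi> :: "'a::euclidean_space => real"
 assumes d: "\<And>x. \<psi> differentiable (at x)" and c: "continuous_on UNIV (%x. frechet_derivative \<psi> (at x) i)"
  and K: "compact K" "\<And>x. x \<notin> K ==> \<psi> x = 0" and i: "i \<in> Basis"
 shows "(LINT x|lborel. frechet_derivative \<psi> (at x) i) = 0"
proof -
 let ?D = "%x. frechet_derivative \<psi> (at x) i"
 have \<psi>c: "continuous_on UNIV \<psi>"
  using d by (auto simp: continuous_on_eq_continuous_within intro: differentiable_imp_continuous_within)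
 have \<psi>m: "\<psi> \<in> borel_measurable borel" using \<psi>c by (rule borel_measurable_continuous_onI)
 have D0: "?D x = 0" if "x \<notin> K" for x
 proof -
  have "((%_. 0) has_derivative (%_. 0)) (at x)" by (rule has_derivative_const)
  then have "(\<psi> has_derivative (%_. 0)) (at x)"
   by (rule has_derivative_transform_within_open[where s = "- K"]) (use K that compact_imp_closed in auto)
  then show ?thesis by (simp add: frechet_derivative_apply)
 qed
 have "compact (?D ` K)" using c K(1) by (intro compact_continuous_image continuous_on_subset[OF c]) auto
 then obtain C where C0: "\<And>x. x \<in> K ==> \<bar>?D x\<bar> <= C"
  using compact_imp_bounded[of "?D ` K"] unfolding bounded_iff by auto
 define B where "B = \<bar>C\<bar>"
 have B: "\<bar>?D x\<bar> <= B" for x using C0[of x] D0[of x] by (cases "x \<in> K") (auto simp: B_def)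
 obtain R where "\<And>x. x \<in> K ==> norm x <= R" using compact_imp_bounded[OF K(1)] unfolding bounded_iff by auto
 then have R: "K \<subseteq> cball 0 R" by auto
 define h where "h = (%n. 1 / real (Suc n))"
 have h: "0 < h n" "h n <= 1" for n by (auto simp: h_def)
 have hlim: "h \<longlonglongrightarrow> 0" unfolding h_def by (rule LIMSEQ_Suc[OF lim_1_over_n])
 define q where "q = (%n x. (\<psi> (h n *\<^sub>R i + x) - \<psi> x) / h n)"
 have \<psi>i: "integrable lborel \<psi>"
 proof -
  have "integrable lborel (%x. indicator K x *\<^sub>R \<psi> x)"
   by (intro borel_integrable_compact K continuous_on_subset[OF \<psi>c]) auto
  also have "(%x. indicator K x *\<^sub>R \<psi> x) = \<psi>" using K(2) by (auto simp: fun_eq_iff indicator_def)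
  finally show ?thesis .
 qed
 have shift: "integrable lborel (%x. \<psi> (v + x))" "(LINT x|lborel. \<psi> (v + x)) = (LINT x|lborel. \<psi> x)" for v
 proof -
  have "integrable (distr lborel borel ((+) v)) \<psi>" using \<psi>i by (simp add: lborel_distr_plus)
  then show "integrable lborel (%x. \<psi> (v + x))" using \<psi>m by (subst (asm) integrable_distr_eq) auto
  have "(LINT x|distr lborel borel ((+) v). \<psi> x) = (LINT x|lborel. \<psi> (v + x))"
   using \<psi>m by (intro integral_distr) auto
  then show "(LINT x|lborel. \<psi> (v + x)) = (LINT x|lborel. \<psi> x)" by (simp add: lborel_distr_plus)
 qed
 have line: "((%t. \<psi> (t *\<^sub>R i + x)) has_real_derivative ?D (t *\<^sub>R i + x)) (at t)" for t x
 proof -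
  have "((%t. t *\<^sub>R i + x) has_derivative (%s. s *\<^sub>R i)) (at t)" by (auto intro!: derivative_eq_intros)
  from has_derivative_compose[OF this has_frechet[OF d]]
  have "((%t. \<psi> (t *\<^sub>R i + x)) has_derivative (%s. frechet_derivative \<psi> (at (t *\<^sub>R i + x)) (s *\<^sub>R i))) (at t)" .
  moreover have "frechet_derivative \<psi> (at (t *\<^sub>R i + x)) (s *\<^sub>R i) = ?D (t *\<^sub>R i + x) * s" for s
   using linear_scale[OF linear_frechet_derivative[OF d]] by (simp add: mult.commute)
  ultimately show ?thesis by (simp add: has_field_derivative_def)
 qed
 have qlim: "(%n. q n x) \<longlonglongrightarrow> ?D x" for x
 proof -
  have "((%s. (\<psi> (s *\<^sub>R i + x) - \<psi> x) / s) \<longlongrightarrow> ?D x) (at 0)"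
   using line[where t = 0 and x = x] by (simp add: has_field_derivative_iff)
  then show ?thesis unfolding q_def
   by (rule filterlim_compose) (use h hlim in \<open>auto simp: filterlim_at intro!: always_eventually less_imp_neq[symmetric]\<close>)
 qed
 have qb: "\<bar>q n x\<bar> <= B * indicator (cball 0 (R + 1)) x" for n x
 proof (cases "x \<in> cball 0 (R + 1)")
  case True
  obtain s where "\<psi> (h n *\<^sub>R i + x) - \<psi> (0 *\<^sub>R i + x) = (h n - 0) * ?D (s *\<^sub>R i + x)"
   using MVT2[OF h(1)[of n], of "%t. \<psi> (t *\<^sub>R i + x)" "%t. ?D (t *\<^sub>R i + x)"] line by blast
  then have "q n x = ?D (s *\<^sub>R i + x)" using h(1)[of n] by (simp add: q_def)
  then show ?thesis using B True by simp
 next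
  case False
  then have x: "norm x > R + 1" by simp
  have "norm x <= norm (h n *\<^sub>R i + x) + norm (h n *\<^sub>R i)"
   using norm_triangle_ineq4[of "h n *\<^sub>R i + x" "h n *\<^sub>R i"] by simp
  also have "norm (h n *\<^sub>R i) <= 1" using h[of n] i by simp
  finally have "norm (h n *\<^sub>R i + x) > R" using x by simp
  then have "x \<notin> K" "h n *\<^sub>R i + x \<notin> K" using x R by auto
  then show ?thesis using K(2) False by (simp add: q_def)
 qed
 have q0: "(LINT x|lborel. q n x) = 0" for n
  using shift[of "h n *\<^sub>R i"] \<psi>i by (simp add: q_def)
 have "(%n. LINT x|lborel. q n x) \<longlonglongrightarrow> (LINT x|lborel. ?D x)"
 proof (rule integral_dominated_convergence[where w = "%x. B * indicator (cball 0 (R + 1)) x"])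
  show "?D \<in> borel_measurable lborel" using borel_measurable_continuous_onI[OF c] by simp
  show "q n \<in> borel_measurable lborel" for n unfolding q_def using \<psi>m by measurable
  have "integrable lborel (%x::'a. indicator (cball 0 (R + 1)) x *\<^sub>R B)"
   by (intro borel_integrable_compact) auto
  then show "integrable lborel (%x::'a. B * indicator (cball 0 (R + 1)) x)" by (simp add: mult.commute)
  show "AE x in lborel. (%n. q n x) \<longlonglongrightarrow> ?D x" using qlim by simp
  show "AE x in lborel. norm (q n x) <= B * indicator (cball 0 (R + 1)) x" for n using qb by simp
 qed
 then show ?thesis unfolding q0 using LIMSEQ_unique tendsto_const by blast
qed

lemma integral_lebesgue_on_eq_lborel:
 fixes F :: "'a::euclidean_space => 'b::{banach, second_countable_topology}"
 assumes "F \<in> borel_measurable borel" "\<And>x. x \<notin> S ==> F x = 0" "S \<in> sets lebesgue"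
 shows "(LINT x|lebesgue_on S. F x) = (LINT x|lborel. F x)"
  and "integrable (lebesgue_on S) F \<longleftrightarrow> integrable lborel F"
proof -
 have e: "(%x. indicator S x *\<^sub>R F x) = F" using assms(2) by (auto simp: fun_eq_iff indicator_def)
 show "(LINT x|lebesgue_on S. F x) = (LINT x|lborel. F x)"
  using assms by (subst integral_restrict_space) (auto simp: e integral_completion)
 show "integrable (lebesgue_on S) F \<longleftrightarrow> integrable lborel F"
  using assms by (subst integrable_restrict_space) (auto simp: e integrable_completion)
qed

lemma compactly_supported_integrable:
 fixes F :: "'a::euclidean_space => real"
 assumes "continuous_on UNIV F" "compact K" "\<And>x. x \<notin> K ==> F x = 0"
 shows "integrable lborel F"
proof -
 have "integrable lborel (%x. indicator K x *\<^sub>R F x)"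
  by (intro borel_integrable_compact assms continuous_on_subset[OF assms(1)]) auto
 also have "(%x. indicator K x *\<^sub>R F x) = F" using assms(3) by (auto simp: fun_eq_iff indicator_def)
 finally show ?thesis .
qed

definition grad :: "('a::euclidean_space => real) => 'a => 'a" where
 "grad \<phi> x = (\<Sum>i\<in>Basis. frechet_derivative \<phi> (at x) i *\<^sub>R i)"

lemma grad_inner: "i \<in> Basis ==> grad \<phi> x \<bullet> i = frechet_derivative \<phi> (at x) i"
 by (simp add: grad_def inner_sum_left inner_Basis if_distrib cong: if_cong)

lemma grad_continuous: "\<phi> \<in> test_functions S ==> continuous_on UNIV (grad \<phi>)"
 unfolding grad_def by (intro continuous_intros test_function_props)

lemma test_function_by_parts:
 fixes \<phi> \<psi> :: "'a::euclidean_space => real"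
 assumes \<phi>: "\<phi> \<in> test_functions S" and \<psi>: "\<psi> \<in> test_functions S'" and i: "i \<in> Basis"
 shows "(LINT x|lborel. \<phi> x * frechet_derivative \<psi> (at x) i) = - (LINT x|lborel. frechet_derivative \<phi> (at x) i * \<psi> x)"
proof -
 note p = test_function_props[OF \<phi>] and q = test_function_props[OF \<psi>]
 define K where "K = supp \<phi>"
 have D: "frechet_derivative (%x. \<phi> x * \<psi> x) (at x) = (%h. \<phi> x * frechet_derivative \<psi> (at x) h + frechet_derivative \<phi> (at x) h * \<psi> x)" for x
  by (intro frechet_derivative_apply has_derivative_mult has_frechet p q)
 have "(LINT x|lborel. frechet_derivative (%x. \<phi> x * \<psi> x) (at x) i) = 0"
  unfolding D
  by (rule integral_derivative_zero[where K = K and \<psi> = "%x. \<phi> x * \<psi> x", unfolded D])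
   (use p q i in \<open>auto simp: K_def intro!: differentiable_mult continuous_intros\<close>)
 moreover have "integrable lborel (%x. \<phi> x * frechet_derivative \<psi> (at x) i)" "integrable lborel (%x. frechet_derivative \<phi> (at x) i * \<psi> x)"
  using p q i by (auto intro!: compactly_supported_integrable[where K = K] continuous_intros simp: K_def)
 ultimately show ?thesis unfolding D by simp
qed

lemma test_function_weak_gradient:
 assumes S: "open S" and \<phi>: "\<phi> \<in> test_functions S"
 shows "is_weak_gradient S \<phi> (grad \<phi>)"
proof -
 have "locally_integrable_on \<phi> S" "locally_integrable_on (grad \<phi>) S"
  using test_function_props(1)[OF \<phi>] grad_continuous[OF \<phi>] by (auto intro: locally_integrable_continuous)
 moreover have "(LINT x|lebesgue_on S. \<phi> x * frechet_derivative \<psi> (at x) i) = - (LINT x|lebesgue_on S. (grad \<phi> x \<bullet> i) * \<psi> x)"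
  if \<psi>: "\<psi> \<in> test_functions S" and i: "i \<in> Basis" for \<psi> i
 proof -
  note p = test_function_props[OF \<phi>] and q = test_function_props[OF \<psi>]
  have "(LINT x|lebesgue_on S. \<phi> x * frechet_derivative \<psi> (at x) i) = (LINT x|lborel. \<phi> x * frechet_derivative \<psi> (at x) i)"
   using p(1) q(3,9) i S by (intro integral_lebesgue_on_eq_lborel borel_measurable_continuous_onI continuous_intros) auto
  also have "\<dots> = - (LINT x|lborel. frechet_derivative \<phi> (at x) i * \<psi> x)" by (rule test_function_by_parts[OF \<phi> \<psi> i])
  also have "(LINT x|lborel. frechet_derivative \<phi> (at x) i * \<psi> x) = (LINT x|lebesgue_on S. frechet_derivative \<phi> (at x) i * \<psi> x)"
   using p(3,9) q(1) i S by (intro integral_lebesgue_on_eq_lborel[symmetric] borel_measurable_continuous_onI continuous_intros) auto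
  finally show ?thesis using i by (simp add: grad_inner)
 qed
 ultimately show ?thesis unfolding is_weak_gradient_def locally_integrable_on_def by auto
qed

text \<open>The divergence theorem for the compactly supported field \<open>(x\<^sub>i \<phi>\<^sup>2) e\<^sub>i\<close>, followed by Young's
  inequality.\<close>

lemma Poincare_test_function:
 fixes \<phi> :: "'a::euclidean_space => real"
 assumes \<phi>: "\<phi> \<in> test_functions S" and R: "\<And>x. x \<in> S ==> norm x <= R"
 shows "(LINT x|lborel. (\<phi> x)^2) <= 4 * R^2 * (LINT x|lborel. (norm (grad \<phi> x))^2)"
proof -
 note p = test_function_props[OF \<phi>]
 define K where "K = supp \<phi>"
 obtain i :: 'a where i: "i \<in> Basis" using SOME_Basis by blast
 let ?D = "%x. frechet_derivative \<phi> (at x) i"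
 have D: "frechet_derivative (%x. (x \<bullet> i) * (\<phi> x * \<phi> x)) (at x) = (%h. (x \<bullet> i) * (\<phi> x * frechet_derivative \<phi> (at x) h + frechet_derivative \<phi> (at x) h * \<phi> x) + (h \<bullet> i) * (\<phi> x * \<phi> x))" for x
  by (intro frechet_derivative_apply has_derivative_mult has_frechet p) (auto intro!: derivative_eq_intros)
 have diff: "(%x. (x \<bullet> i) * (\<phi> x * \<phi> x)) differentiable (at x)" for x
  using p(2) by (intro differentiable_mult) (auto intro!: derivative_eq_intros simp: differentiable_def)
 have "(LINT x|lborel. frechet_derivative (%x. (x \<bullet> i) * (\<phi> x * \<phi> x)) (at x) i) = 0"
  by (rule integral_derivative_zero[where K = K, OF diff])
   (use p i in \<open>auto simp: K_def D intro!: continuous_intros\<close>)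
 moreover have I: "integrable lborel (%x. (\<phi> x)^2)" "integrable lborel (%x. 2 * (x \<bullet> i) * (\<phi> x * ?D x))" "integrable lborel (%x. (?D x)^2)"
  using p i by (auto intro!: compactly_supported_integrable[where K = K] continuous_intros simp: K_def)
 moreover have "frechet_derivative (%x. (x \<bullet> i) * (\<phi> x * \<phi> x)) (at x) i = (\<phi> x)^2 + 2 * (x \<bullet> i) * (\<phi> x * ?D x)" for x
  unfolding D using i by (simp add: power2_eq_square algebra_simps)
 ultimately have e: "(LINT x|lborel. (\<phi> x)^2) = - (LINT x|lborel. 2 * (x \<bullet> i) * (\<phi> x * ?D x))" by simp
 also have "\<dots> = (LINT x|lborel. - (2 * (x \<bullet> i) * (\<phi> x * ?D x)))" by simp
 also have "\<dots> <= (LINT x|lborel. (1/2) * (\<phi> x)^2 + (2 * R^2) * (?D x)^2)"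
 proof (intro integral_mono)
  fix x
  show "- (2 * (x \<bullet> i) * (\<phi> x * ?D x)) <= (1/2) * (\<phi> x)^2 + (2 * R^2) * (?D x)^2"
  proof (cases "x \<in> S")
   case True
   have "\<bar>x \<bullet> i\<bar> <= R" using R[OF True] Basis_le_norm[OF i, of x] by linarith
   then have "(x \<bullet> i)^2 <= R^2" by (metis abs_ge_zero power2_abs power_mono)
   then have "(x \<bullet> i)^2 * (?D x)^2 <= R^2 * (?D x)^2" by (intro mult_right_mono) auto
   moreover have "0 <= (\<phi> x + 2 * ((x \<bullet> i) * ?D x))^2" by simp
   ultimately show ?thesis by (simp add: power2_eq_square algebra_simps)
  next
   case False
   then have "\<phi> x = 0" by (rule p(8))
   then show ?thesis by simp
  qed
 qed (use I in auto)
 also have "\<dots> = (1/2) * (LINT x|lborel. (\<phi> x)^2) + (2 * R^2) * (LINT x|lborel. (?D x)^2)" using I by simp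
 finally have "(LINT x|lborel. (\<phi> x)^2) <= 4 * R^2 * (LINT x|lborel. (?D x)^2)" by simp
 also have "\<dots> <= 4 * R^2 * (LINT x|lborel. (norm (grad \<phi> x))^2)"
 proof (intro mult_left_mono integral_mono I)
  have "grad \<phi> x = 0" if "x \<notin> K" for x using p(5)[of x] that by (simp add: grad_def K_def)
  then show "integrable lborel (%x. (norm (grad \<phi> x))^2)"
   using p(6) grad_continuous[OF \<phi>]
   by (auto intro!: compactly_supported_integrable[where K = K] continuous_intros simp: K_def)
  fix x show "(?D x)^2 <= (norm (grad \<phi> x))^2"
  proof -
   have "\<bar>?D x\<bar> <= norm (grad \<phi> x)" using Basis_le_norm[OF i, of "grad \<phi> x"] i by (simp add: grad_inner)
   then have "\<bar>?D x\<bar>\<^sup>2 <= (norm (grad \<phi> x))^2" by (intro power_mono) auto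
   then show ?thesis by simp
  qed
 qed auto
 finally show ?thesis .
qed

text \<open>The inequality for test functions passes to the limit in the norm in which they approximate \<open>u\<close>.\<close>

lemma H10_Poincare:
 fixes u :: "'a::euclidean_space => real"
 assumes S: "open S" and R: "\<And>x. x \<in> S ==> norm x <= R" and u: "u \<in> H10 S"
 shows "(LINT x|lebesgue_on S. (u x)^2) <= 16 * R^2 * (LINT x|lebesgue_on S. (norm (weak_gradient S u x))^2)"
proof -
 let ?M = "lebesgue_on S"
 have uH: "u \<in> weighted_H1 (%_. 1) S" using u by (simp add: H10_def)
 note W = weighted_H1D[OF S uH, simplified]
 obtain \<phi> where \<phi>: "\<And>n. \<phi> n \<in> test_functions S" "(%n. H1_norm S (u - \<phi> n)) \<longlonglongrightarrow> 0"
  using u by (auto simp: H10_def)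
 define A where "A = (LINT x|?M. (u x)^2)"
 define G where "G = (LINT x|?M. (norm (weak_gradient S u x))^2)"
 have key: "A <= 16 * R^2 * G + (16 * R^2 + 2) * (H1_norm S (u - \<phi> n))^2" for n
 proof -
  define f where "f = \<phi> n"
  have f: "f \<in> test_functions S" using \<phi> by (simp add: f_def)
  note p = test_function_props[OF f]
  define K where "K = supp f"
  have g0: "grad f x = 0" if "x \<notin> K" for x using p(5)[of x] that by (simp add: grad_def K_def)
  have fi: "integrable lborel (%x. (f x)^2)" "integrable lborel (%x. (norm (grad f x))^2)"
   using p g0 grad_continuous[OF f]
   by (auto intro!: compactly_supported_integrable[where K = K] continuous_intros simp: K_def)
  have S0: "x \<notin> S ==> (f x)^2 = 0" "x \<notin> S ==> (norm (grad f x))^2 = 0" for x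
   using p(8)[of x] p(9)[of x] by (auto simp: grad_def)
  have Sm: "S \<in> sets lebesgue" using S by auto
  have bm: "(%x. (f x)^2) \<in> borel_measurable borel" "(%x. (norm (grad f x))^2) \<in> borel_measurable borel"
   using p grad_continuous[OF f] by (auto intro!: borel_measurable_continuous_onI continuous_intros)
  have c1: "(LINT x|?M. (f x)^2) = (LINT x|lborel. (f x)^2)" "integrable ?M (%x. (f x)^2)"
   by (use integral_lebesgue_on_eq_lborel[OF bm(1) _ Sm] S0 fi in blast)+
  have c2: "(LINT x|?M. (norm (grad f x))^2) = (LINT x|lborel. (norm (grad f x))^2)"
    "integrable ?M (%x. (norm (grad f x))^2)"
   by (use integral_lebesgue_on_eq_lborel[OF bm(2) _ Sm] S0 fi in blast)+
  have fi': "integrable ?M (%x. (f x)^2)" "integrable ?M (%x. (norm (grad f x))^2)" using fi c1 c2 by auto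
  have fm: "f \<in> borel_measurable ?M" "grad f \<in> borel_measurable ?M"
   using locally_integrable_measurable[OF S] is_weak_gradientD(1,2)[OF test_function_weak_gradient[OF S f]] by auto
  have wg: "AE x in ?M. weak_gradient S (u - f) x = weak_gradient S u x - grad f x"
   by (rule weak_gradient_eq[OF S is_weak_gradient_diff[OF S W(1) test_function_weak_gradient[OF S f]]])
  define d where "d = (%x. weak_gradient S u x - grad f x)"
  have dm: "d \<in> borel_measurable ?M" unfolding d_def using W(3) fm(2) by measurable
  have sq: "(norm (a - b))^2 <= 2 * (norm a)^2 + 2 * (norm b)^2" for a b :: "'b::real_inner"
  proof -
   have "(norm (a - b))^2 + (norm (a + b))^2 = 2 * (norm a)^2 + 2 * (norm b)^2"
    by (simp add: power2_norm_eq_inner inner_diff_left inner_diff_right inner_add_left inner_add_right inner_commute)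
   then show ?thesis by (smt (verit) zero_le_power2)
  qed
  have di: "integrable ?M (%x. (norm (d x))^2)"
  proof (rule Bochner_Integration.integrable_bound)
   show "integrable ?M (%x. 2 * (norm (weak_gradient S u x))^2 + 2 * (norm (grad f x))^2)"
    using W(5) fi' by auto
  qed (use dm sq in \<open>auto simp: d_def\<close>)
  have ei: "integrable ?M (%x. (u x - f x)^2)"
  proof (rule Bochner_Integration.integrable_bound)
   show "integrable ?M (%x. 2 * (u x)^2 + 2 * (f x)^2)" using W(4) fi' by auto
   show "(%x. (u x - f x)^2) \<in> borel_measurable ?M" using W(2) fm(1) by measurable
  qed (use sq[of "u _ :: real" "f _"] in auto)
  have "(LINT x|?M. ((u - f) x)^2 + (norm (weak_gradient S (u - f) x))^2) = (LINT x|?M. (u x - f x)^2 + (norm (d x))^2)"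
  proof (rule integral_cong_AE)
   have "is_weak_gradient S (u - f) (weak_gradient S (u - f))"
    by (rule weak_gradient_works[OF is_weak_gradient_diff[OF S W(1) test_function_weak_gradient[OF S f]]])
   then have "weak_gradient S (u - f) \<in> borel_measurable ?M"
    using locally_integrable_measurable[OF S] is_weak_gradientD(2) by blast
   then show "(%x. ((u - f) x)^2 + (norm (weak_gradient S (u - f) x))^2) \<in> borel_measurable ?M"
    using W(2) fm(1) by (simp add: fun_diff_def)
   show "(%x. (u x - f x)^2 + (norm (d x))^2) \<in> borel_measurable ?M" using W(2) fm(1) dm by measurable
   show "AE x in ?M. ((u - f) x)^2 + (norm (weak_gradient S (u - f) x))^2 = (u x - f x)^2 + (norm (d x))^2"
    using wg by eventually_elim (simp add: d_def)
  qed
  also have "\<dots> = (LINT x|?M. (u x - f x)^2) + (LINT x|?M. (norm (d x))^2)" using ei di by simp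
  finally have H: "(H1_norm S (u - f))^2 = (LINT x|?M. (u x - f x)^2) + (LINT x|?M. (norm (d x))^2)"
   unfolding H1_norm_def by (simp add: integral_nonneg_AE)
  have "A <= (LINT x|?M. 2 * (f x)^2 + 2 * (u x - f x)^2)"
   unfolding A_def using W(4) fi' ei
  proof (intro integral_mono)
   fix x show "(u x)^2 <= 2 * (f x)^2 + 2 * (u x - f x)^2" using sq[of "f x" "f x - u x"] by (simp add: power2_commute)
  qed auto
  also have "\<dots> = 2 * (LINT x|?M. (f x)^2) + 2 * (LINT x|?M. (u x - f x)^2)" using fi' ei by simp
  finally have 1: "A <= 2 * (LINT x|?M. (f x)^2) + 2 * (LINT x|?M. (u x - f x)^2)" .
  have 2: "(LINT x|?M. (f x)^2) <= 4 * R^2 * (LINT x|?M. (norm (grad f x))^2)"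
  proof -
   have "(LINT x|lborel. (f x)^2) <= 4 * R^2 * (LINT x|lborel. (norm (grad f x))^2)"
    using f R by (rule Poincare_test_function)
   then show ?thesis using c1(1) c2(1) by (simp only:)
  qed
  have "(LINT x|?M. (norm (grad f x))^2) <= (LINT x|?M. 2 * (norm (weak_gradient S u x))^2 + 2 * (norm (d x))^2)"
   using W(5) fi' di
  proof (intro integral_mono)
   fix x show "(norm (grad f x))^2 <= 2 * (norm (weak_gradient S u x))^2 + 2 * (norm (d x))^2"
    using sq[of "weak_gradient S u x" "d x"] by (simp add: d_def)
  qed auto
  also have "\<dots> = 2 * G + 2 * (LINT x|?M. (norm (d x))^2)" using W(5) di by (simp add: G_def)
  finally have 3: "(LINT x|?M. (norm (grad f x))^2) <= 2 * G + 2 * (LINT x|?M. (norm (d x))^2)" .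
  have n: "0 <= (LINT x|?M. (u x - f x)^2)" "0 <= (LINT x|?M. (norm (d x))^2)" by (simp_all add: integral_nonneg_AE)
  have "A <= 2 * (4 * R^2 * (2 * G + 2 * (LINT x|?M. (norm (d x))^2))) + 2 * (LINT x|?M. (u x - f x)^2)"
   using 1 2 mult_left_mono[OF 3, of "4 * R^2"] by simp
  also have "\<dots> <= 16 * R^2 * G + (16 * R^2 + 2) * ((LINT x|?M. (u x - f x)^2) + (LINT x|?M. (norm (d x))^2))"
   using n mult_nonneg_nonneg[of "16 * R^2" "LINT x|?M. (u x - f x)^2"] by (simp add: algebra_simps)
  finally show ?thesis unfolding H[unfolded f_def, symmetric] f_def .
 qed
 have "(%n. 16 * R^2 * G + (16 * R^2 + 2) * (H1_norm S (u - \<phi> n))^2) \<longlonglongrightarrow> 16 * R^2 * G + (16 * R^2 + 2) * 0^2"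
  by (intro tendsto_intros \<phi>(2))
 then have "A <= 16 * R^2 * G"
  using key by (intro LIMSEQ_le_const[where a = A]) auto
 then show ?thesis by (simp add: A_def G_def)
qed

section \<open>The fundamental theorem of calculus for weak derivatives on the half line\<close>

definition bump1' :: "real => real" where "bump1' = flat (monom 1 2)"

lemma bump1'_simp: "bump1' z = (if z > 0 then exp (- (1 / z)) / z^2 else 0)"
 by (simp add: bump1'_def flat_def poly_monom power_one_over divide_inverse mult.commute power_inverse)

lemma bump1_derivative: "(bump1 has_real_derivative bump1' z) (at z)"
 using flat_derivative[of 1 z] by (simp add: bump1_def bump1'_def)

lemma bump1_continuous: "continuous_on UNIV bump1" "continuous_on UNIV bump1'"
 using bump1_derivative flat_derivative[of "monom 1 2"]
 by (auto simp: bump1'_def intro!: continuous_at_imp_continuous_on DERIV_isCont)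

lemma bump1_tendsto_1: "(bump1 \<longlongrightarrow> 1) at_top"
proof -
 have "((%x::real. exp (- (1 / x))) \<longlongrightarrow> exp (- 0)) at_top"
  by (intro tendsto_intros tendsto_divide_0[OF tendsto_const] filterlim_at_top_imp_at_infinity filterlim_ident)
 moreover have "eventually (%x. exp (- (1 / x)) = bump1 x) at_top"
  using eventually_gt_at_top[of 0] by eventually_elim (simp add: bump1)
 ultimately show ?thesis using Lim_transform_eventually by fastforce
qed

text \<open>The derivative of \<open>bump1\<close> is a probability density, so that \<open>n bump1' (n (x - a))\<close> is an
  approximate identity at \<open>a\<close>.\<close>

lemma bump1'_integral: "integrable lborel bump1'" "(LINT z|lborel. bump1' z) = 1"
proof -
 have nn: "0 <= bump1' z" for z by (simp add: bump1'_simp)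
 have "(\<integral>\<^sup>+z. ennreal (bump1' z) * indicator {0..} z \<partial>lborel) = ennreal (1 - bump1 0)"
  by (rule nn_integral_FTC_atLeast[OF borel_measurable_continuous_onI[OF bump1_continuous(2)] bump1_derivative nn bump1_tendsto_1])
 moreover have "ennreal (bump1' z) * indicator {0..} z = ennreal (bump1' z)" for z
  by (auto simp: bump1'_simp indicator_def)
 ultimately have "(\<integral>\<^sup>+z. ennreal (bump1' z) \<partial>lborel) = ennreal 1" by (simp add: bump1)
 then have "has_bochner_integral lborel bump1' 1"
  using nn borel_measurable_continuous_onI[OF bump1_continuous(2)]
  by (intro has_bochner_integral_nn_integral) auto
 then show "integrable lborel bump1'" "(LINT z|lborel. bump1' z) = 1" by (auto simp: has_bochner_integral_iff)
qed

lemma approximate_identity: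
 fixes W :: "real => real"
 assumes W: "W \<in> borel_measurable borel" "\<And>x. \<bar>W x\<bar> <= B"
  and c: "\<bar>c\<bar> = 1" and L: "\<And>z. z > 0 ==> (%n. W (a + c * z / real (Suc n))) \<longlonglongrightarrow> l" and d: "0 < d"
 shows "(%n. LINT x|lborel. W x * (real (Suc n) * bump1' (real (Suc n) * (c * (x - a))) * bump1 (real (Suc n) * (d - c * (x - a)))))
  \<longlonglongrightarrow> l"
  and "integrable lborel (%x. W x * (real (Suc n) * bump1' (real (Suc n) * (c * (x - a))) * bump1 (real (Suc n) * (d - c * (x - a)))))"
proof -
 have cc: "c * c = 1" "c \<noteq> 0" using c by (auto simp: abs_if split: if_splits)
 have m: "bump1 \<in> borel_measurable borel" "bump1' \<in> borel_measurable borel"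
  by (auto intro: borel_measurable_continuous_onI bump1_continuous)
 define f where "f = (%n x. W x * (real (Suc n) * bump1' (real (Suc n) * (c * (x - a))) * bump1 (real (Suc n) * (d - c * (x - a)))))"
 define F where "F = (%n z. W (a + c * z / real (Suc n)) * bump1' z * bump1 (real (Suc n) * d - z))"
 have fF: "f n (a + c / real (Suc n) * z) = real (Suc n) * F n z" for n z
 proof -
  have e: "c * (a + c / real (Suc n) * z - a) = z / real (Suc n)" using cc by (simp add: mult.assoc[symmetric])
  show ?thesis unfolding f_def F_def e by (simp add: right_diff_distrib del: of_nat_Suc)
 qed
 have Fb: "\<bar>F n z\<bar> <= B * bump1' z" for n z
 proof -
  have "\<bar>F n z\<bar> = \<bar>W (a + c * z / real (Suc n))\<bar> * bump1' z * bump1 (real (Suc n) * d - z)"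
   using bump1_range[of "real (Suc n) * d - z"] by (simp add: F_def abs_mult bump1'_simp del: of_nat_Suc)
  also have "\<dots> <= (B * bump1' z) * 1"
   using W(2) bump1_range[of "real (Suc n) * d - z"] order.trans[OF abs_ge_zero W(2)]
   by (intro mult_mono mult_right_mono) (auto simp: bump1'_simp)
  finally show ?thesis by simp
 qed
 have Fm: "F n \<in> borel_measurable lborel" for n unfolding F_def using W m by measurable
 have Fi: "integrable lborel (F n)" for n
  by (rule Bochner_Integration.integrable_bound[of _ "%z. B * bump1' z"])
   (use Fm Fb bump1'_integral in \<open>auto intro!: order.trans[OF Fb abs_ge_self]\<close>)
 have fi: "integrable lborel (f n)" for n
 proof -
  have "integrable lborel (%z. f n (a + c / real (Suc n) * z))" unfolding fF using Fi by auto
  then show ?thesis using cc by (subst (asm) lborel_integrable_real_affine_iff) auto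
 qed
 then show "integrable lborel (%x. W x * (real (Suc n) * bump1' (real (Suc n) * (c * (x - a))) * bump1 (real (Suc n) * (d - c * (x - a)))))"
  unfolding f_def .
 have "(LINT x|lborel. f n x) = (LINT z|lborel. F n z)" for n
 proof -
  have "(LINT x|lborel. f n x) = \<bar>c / real (Suc n)\<bar> *\<^sub>R (LINT z|lborel. f n (a + c / real (Suc n) * z))"
   using cc by (intro lborel_integral_real_affine) simp
  also have "\<dots> = (LINT z|lborel. F n z)" unfolding fF using c by (simp add: abs_divide del: of_nat_Suc)
  finally show ?thesis .
 qed
 moreover have "(%n. LINT z|lborel. F n z) \<longlonglongrightarrow> (LINT z|lborel. l * bump1' z)"
 proof (rule integral_dominated_convergence[where w = "%z. B * bump1' z"])
  show "AE z in lborel. (%n. F n z) \<longlonglongrightarrow> l * bump1' z"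
  proof (rule AE_I2)
   fix z :: real
   show "(%n. F n z) \<longlonglongrightarrow> l * bump1' z"
   proof (cases "z > 0")
    case True
    have "filterlim (%n. - z + d * real (Suc n)) at_top sequentially"
     by (intro filterlim_tendsto_add_at_top[OF tendsto_const] filterlim_tendsto_pos_mult_at_top[OF tendsto_const d]
       filterlim_compose[OF filterlim_real_sequentially filterlim_Suc])
    then have "(%n. bump1 (real (Suc n) * d - z)) \<longlonglongrightarrow> 1"
     using filterlim_compose[OF bump1_tendsto_1] by (simp add: algebra_simps del: of_nat_Suc)
    from tendsto_mult[OF tendsto_mult[OF L[OF True] tendsto_const] this]
    show ?thesis unfolding F_def by simp
   qed (simp add: F_def bump1'_simp)
  qed
  show "AE z in lborel. norm (F n z) <= B * bump1' z" for n using Fb by simp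
 qed (use Fm m bump1'_integral in auto)
 ultimately show "(%n. LINT x|lborel. W x * (real (Suc n) * bump1' (real (Suc n) * (c * (x - a))) * bump1 (real (Suc n) * (d - c * (x - a))))) \<longlonglongrightarrow> l"
  unfolding f_def using bump1'_integral by simp
qed

text \<open>Test functions of the form \<open>bump1 (n (x - a)) * bump1 (n (b - x))\<close> approximate the indicator function of
  the interval; their derivatives are approximate identities at the two end points.\<close>

lemma weak_derivative_increment:
 fixes w g :: "real => real"
 assumes g: "is_weak_gradient {0<..} w g" and w: "continuous_on {0<..} w" and ab: "0 < a" "a < b"
 shows "(LINT y|lebesgue. indicat_real {a<..<b} y * g y) = w b - w a"
proof -
 define W where "W = (%x. indicat_real {a..b} x * w x)"
 have wc: "continuous_on {a..b} w" by (rule continuous_on_subset[OF w]) (use ab in auto)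
 have "compact (w ` {a..b})" using wc by (intro compact_continuous_image) auto
 then obtain B0 where "\<forall>y\<in>w ` {a..b}. norm y <= B0"
  using compact_imp_bounded[of "w ` {a..b}"] unfolding bounded_iff by blast
 then have B0: "\<bar>w x\<bar> <= B0" if "x \<in> {a..b}" for x using that by auto
 have WB: "\<bar>W x\<bar> <= \<bar>B0\<bar>" for x using B0[of x] by (auto simp: W_def indicator_def)
 have Wm: "W \<in> borel_measurable borel"
  unfolding W_def using borel_measurable_continuous_on_indicator[OF _ wc] by simp
 have iso: "isCont w a" "isCont w b" using w ab by (auto simp: continuous_on_eq_continuous_at)
 define N where "N = (%n. real (Suc n))"
 have N: "N n > 0" for n by (simp add: N_def)
 have Ninv: "(%n. z / N n) \<longlonglongrightarrow> 0" for z
  unfolding N_def by (rule LIMSEQ_Suc[OF lim_const_over_n])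
 have La: "(%n. W (a + 1 * z / real (Suc n))) \<longlonglongrightarrow> w a" if z: "z > 0" for z
 proof -
  have "(%n. a + 1 * z / N n) \<longlonglongrightarrow> a + 0" using Ninv[of z] by (intro tendsto_intros) simp
  then have "(%n. w (a + 1 * z / N n)) \<longlonglongrightarrow> w a" using isCont_tendsto_compose[OF iso(1)] by simp
  moreover have "eventually (%n. z / N n < b - a) sequentially" using Ninv[of z] ab by (intro order_tendstoD) auto
  then have "eventually (%n. w (a + 1 * z / N n) = W (a + 1 * z / N n)) sequentially"
   by eventually_elim (use z N in \<open>auto simp: W_def less_imp_le\<close>)
  ultimately show ?thesis unfolding N_def by (rule Lim_transform_eventually)
 qed
 have Lb: "(%n. W (b + (-1) * z / real (Suc n))) \<longlonglongrightarrow> w b" if z: "z > 0" for z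
 proof -
  have "(%n. b + (-1) * z / N n) \<longlonglongrightarrow> b + 0" using Ninv[of "- z"] by (intro tendsto_intros) simp
  then have "(%n. w (b + (-1) * z / N n)) \<longlonglongrightarrow> w b" using isCont_tendsto_compose[OF iso(2)] by simp
  moreover have "eventually (%n. z / N n < b - a) sequentially" using Ninv[of z] ab by (intro order_tendstoD) auto
  then have "eventually (%n. w (b + (-1) * z / N n) = W (b + (-1) * z / N n)) sequentially"
   by eventually_elim (use z N in \<open>auto simp: W_def less_imp_le\<close>)
  ultimately show ?thesis unfolding N_def by (rule Lim_transform_eventually)
 qed
 note IA = approximate_identity[OF Wm WB, of 1 a "w a" "b - a", OF _ La]
 note IB = approximate_identity[OF Wm WB, of "-1" b "w b" "b - a", OF _ Lb]
 define \<phi> where "\<phi> = (%n. box_bump a b (Suc n))"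
 have ab_sub: "cbox a b \<subseteq> {0<..}" using ab by auto
 have \<phi>: "\<phi> n \<in> test_functions {0<..}" for n unfolding \<phi>_def by (rule box_bump_test_function[OF ab_sub])
 have \<phi>eq: "\<phi> n = (%x. bump1 (N n * (x - a)) * bump1 (N n * (b - x)))" for n
  by (auto simp: \<phi>_def box_bump_def N_def algebra_simps fun_eq_iff)
 have D: "frechet_derivative (\<phi> n) (at x) 1 = N n * bump1' (N n * (x - a)) * bump1 (N n * (b - x))
   - N n * bump1' (N n * (b - x)) * bump1 (N n * (x - a))" for n x
 proof -
  have 1: "((%x. bump1 (N n * (x - a))) has_real_derivative bump1' (N n * (x - a)) * N n) (at x)"
   by (rule DERIV_chain2[OF bump1_derivative]) (auto intro!: derivative_eq_intros)
  have 2: "((%x. bump1 (N n * (b - x))) has_real_derivative bump1' (N n * (b - x)) * (- N n)) (at x)"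
   by (rule DERIV_chain2[OF bump1_derivative]) (auto intro!: derivative_eq_intros)
  have "(\<phi> n has_derivative (*) (bump1' (N n * (x - a)) * N n * bump1 (N n * (b - x)) + bump1' (N n * (b - x)) * (- N n) * bump1 (N n * (x - a)))) (at x)"
   using DERIV_mult[OF 1 2] unfolding \<phi>eq has_field_derivative_def .
  from frechet_derivative_apply[OF this] show ?thesis by (simp add: algebra_simps)
 qed
 have split: "(LINT x|lebesgue_on {0<..}. w x * frechet_derivative (\<phi> n) (at x) 1) =
  (LINT x|lborel. W x * (N n * bump1' (N n * (1 * (x - a))) * bump1 (N n * ((b - a) - 1 * (x - a)))))
  - (LINT x|lborel. W x * (N n * bump1' (N n * ((-1) * (x - b))) * bump1 (N n * ((b - a) - (-1) * (x - b)))))" for n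
 proof -
  have z: "bump1' (N n * (x - a)) * bump1 (N n * (b - x)) = 0 \<and> bump1' (N n * (b - x)) * bump1 (N n * (x - a)) = 0"
   if "x \<notin> {a..b}" for x
   using that N[of n] by (auto simp: bump1 bump1'_simp zero_less_mult_iff)
  have "w x * frechet_derivative (\<phi> n) (at x) 1 = W x * frechet_derivative (\<phi> n) (at x) 1" for x
   using z[of x] by (cases "x \<in> {a..b}") (auto simp: W_def D mult.assoc)
  then have "(LINT x|lebesgue_on {0<..}. w x * frechet_derivative (\<phi> n) (at x) 1)
   = (LINT x|lebesgue_on {0<..}. W x * frechet_derivative (\<phi> n) (at x) 1)" by (simp only:)
  also have "\<dots> = (LINT x|lborel. W x * frechet_derivative (\<phi> n) (at x) 1)"
   by (rule integral_lebesgue_on_eq_lborel(1)[OF borel_measurable_times[OF Wm borel_measurable_continuous_onI[OF test_function_props(3)[OF \<phi>, of 1 n]]]])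
    (use ab in \<open>auto simp: W_def\<close>)
  also have "\<dots> = (LINT x|lborel. W x * (N n * bump1' (N n * (1 * (x - a))) * bump1 (N n * ((b - a) - 1 * (x - a))))
  - W x * (N n * bump1' (N n * ((-1) * (x - b))) * bump1 (N n * ((b - a) - (-1) * (x - b)))))"
   by (intro Bochner_Integration.integral_cong refl) (simp add: D algebra_simps)
  also have "\<dots> = (LINT x|lborel. W x * (N n * bump1' (N n * (1 * (x - a))) * bump1 (N n * ((b - a) - 1 * (x - a)))))
  - (LINT x|lborel. W x * (N n * bump1' (N n * ((-1) * (x - b))) * bump1 (N n * ((b - a) - (-1) * (x - b)))))"
   unfolding N_def using ab by (intro Bochner_Integration.integral_diff IA(2) IB(2)) auto
  finally show ?thesis .
 qed
 have "(%n. LINT x|lebesgue_on {0<..}. w x * frechet_derivative (\<phi> n) (at x) 1) \<longlonglongrightarrow> w a - w b"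
  unfolding split N_def using ab by (intro tendsto_diff IA(1) IB(1)) auto
 moreover have "(LINT x|lebesgue_on {0<..}. w x * frechet_derivative (\<phi> n) (at x) 1) = - (LINT x|lebesgue_on {0<..}. g x * \<phi> n x)" for n
  using is_weak_gradientD(3)[OF g \<phi>, of 1] by simp
 moreover have "locally_integrable_on g {0<..}" using is_weak_gradientD(2)[OF g] .
 then have "(%n. LINT x|lebesgue_on {0<..}. g x * \<phi> n x) \<longlonglongrightarrow> (LINT y|lebesgue. indicat_real (box a b) y * g y)"
  unfolding \<phi>_def by (intro box_bump_integral_tendsto ab_sub) auto
 then have "(%n. - (LINT x|lebesgue_on {0<..}. g x * \<phi> n x)) \<longlonglongrightarrow> - (LINT y|lebesgue. indicat_real (box a b) y * g y)"
  by (rule tendsto_minus)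
 ultimately have "w a - w b = - (LINT y|lebesgue. indicat_real (box a b) y * g y)"
  using LIMSEQ_unique by simp
 then show ?thesis by simp
qed

text \<open>Near \<open>0\<close> the weak derivative is integrable because \<open>2 |g| \<le> y\<^sup>-\<^sup>a + y\<^sup>a g\<^sup>2\<close> and \<open>a < 1\<close>.\<close>

lemma weighted_FTC:
 fixes w :: "real => real"
 assumes w: "w \<in> weighted_H1 (%y. y powr a) {0<..}" and a: "a < 1" and c: "continuous_on {0..} w" and t: "0 < t"
 defines "g \<equiv> weak_gradient {0<..} w"
 shows "integrable lebesgue (%y. indicat_real {0<..<t} y * g y)"
  and "(LINT y|lebesgue. indicat_real {0<..<t} y * g y) = w t - w 0"
proof -
 have meas: "(%y. y powr a) \<in> borel_measurable (lebesgue_on {0<..})"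
  by (intro measurable_restrict_space1 measurable_completion) auto
 have "open {0::real<..}" by simp
 note W = weighted_H1D[OF this w meas, folded g_def]
 have gi: "integrable lebesgue (%y. indicat_real {0<..} y * (y powr a * (g y)^2))"
  using W(5) by (simp add: integrable_restrict_space)
 have gm: "(%y. indicat_real {0<..} y * g y) \<in> borel_measurable lebesgue"
  using W(3) by (simp add: borel_measurable_restrict_space_iff)
 have "(%x. x powr (- a)) integrable_on {0..t}"
  using has_integral_powr_from_0[of "- a" t] a t by auto
 then have "(%x. x powr (- a)) absolutely_integrable_on {0..t}"
  by (intro nonnegative_absolutely_integrable_1) auto
 then have pi: "integrable lebesgue (%y. indicat_real {0..t} y * y powr (- a))" by (simp add: set_integrable_def)
 have pm: "(%y. indicat_real {0<..<t} y * g y) \<in> borel_measurable lebesgue"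
 proof -
  have "(%y. indicat_real {0<..<t} y * (indicat_real {0<..} y * g y)) \<in> borel_measurable lebesgue"
   by (intro borel_measurable_times gm borel_measurable_indicator) auto
  also have "(%y. indicat_real {0<..<t} y * (indicat_real {0<..} y * g y)) = (%y. indicat_real {0<..<t} y * g y)"
   by (auto simp: fun_eq_iff indicator_def)
  finally show ?thesis .
 qed
 show I: "integrable lebesgue (%y. indicat_real {0<..<t} y * g y)"
 proof (rule Bochner_Integration.integrable_bound[OF Bochner_Integration.integrable_add[OF pi gi] pm AE_I2])
  fix y
  show "norm (indicat_real {0<..<t} y * g y) <= norm (indicat_real {0..t} y * y powr (- a) + indicat_real {0<..} y * (y powr a * (g y)^2))"
  proof (cases "y \<in> {0<..<t}")
   case True
   define q where "q = y powr a"
   have q: "q > 0" using True by (simp add: q_def)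
   have "0 <= (1 - q * \<bar>g y\<bar>)^2 + 1 + (q * \<bar>g y\<bar>)^2" by (intro add_nonneg_nonneg) auto
   then have "2 * (q * \<bar>g y\<bar>) <= 2 * (1 + q^2 * (g y)^2)" by (simp add: power2_eq_square algebra_simps)
   then have "q * \<bar>g y\<bar> <= q * (1 / q + q * (g y)^2)" using q by (simp add: algebra_simps power2_eq_square)
   then have "\<bar>g y\<bar> <= 1 / q + q * (g y)^2" using q by (simp only: mult_le_cancel_left_pos)
   moreover have "y powr (- a) = 1 / q" by (simp add: q_def powr_minus_divide)
   ultimately show ?thesis using True q by (auto simp: q_def)
  qed (auto simp: indicator_def)
 qed
 have wpos: "continuous_on {0<..} w" by (rule continuous_on_subset[OF c]) auto
 define e where "e = (%n. t / real (Suc (Suc n)))"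
 have e: "0 < e n" "e n < t" for n
 proof -
  show "0 < e n" using t by (simp add: e_def)
  have "t / real (Suc (Suc n)) < t / 1" using t by (intro divide_strict_left_mono) auto
  then show "e n < t" by (simp add: e_def)
 qed
 have elim: "e \<longlonglongrightarrow> 0" unfolding e_def using LIMSEQ_Suc[OF LIMSEQ_Suc[OF lim_const_over_n[of t]]] by simp
 have "(%n. LINT y|lebesgue. indicat_real {e n<..<t} y * g y) \<longlonglongrightarrow> (LINT y|lebesgue. indicat_real {0<..<t} y * g y)"
 proof (rule integral_dominated_convergence[where w = "%y. norm (indicat_real {0<..<t} y * g y)"])
  show "AE y in lebesgue. (%n. indicat_real {e n<..<t} y * g y) \<longlonglongrightarrow> indicat_real {0<..<t} y * g y"
  proof (rule AE_I2, rule tendsto_eventually)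
   fix y
   show "eventually (%n. indicat_real {e n<..<t} y * g y = indicat_real {0<..<t} y * g y) sequentially"
   proof (cases "0 < y")
    case True
    then have "eventually (%n. e n < y) sequentially" using elim by (intro order_tendstoD)
    then show ?thesis by eventually_elim (use True in \<open>auto simp: indicator_def\<close>)
   next
    case False
    then show ?thesis using e less_trans by (intro always_eventually) (fastforce simp: indicator_def)
   qed
  qed
  show "AE y in lebesgue. norm (indicat_real {e n<..<t} y * g y) <= norm (indicat_real {0<..<t} y * g y)" for n
   using e[of n] by (intro AE_I2) (auto simp: indicator_def)
  show "(%y. indicat_real {e n<..<t} y * g y) \<in> borel_measurable lebesgue" for n
  proof -
   have "(%y. indicat_real {e n<..<t} y * (indicat_real {0<..<t} y * g y)) \<in> borel_measurable lebesgue"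
    by (intro borel_measurable_times pm borel_measurable_indicator) auto
   also have "(%y. indicat_real {e n<..<t} y * (indicat_real {0<..<t} y * g y)) = (%y. indicat_real {e n<..<t} y * g y)"
    using e[of n] by (auto simp: fun_eq_iff indicator_def)
   finally show ?thesis .
  qed
 qed (use I pm in \<open>auto intro!: integrable_norm\<close>)
 moreover have "(LINT y|lebesgue. indicat_real {e n<..<t} y * g y) = w t - w (e n)" for n
  by (rule weak_derivative_increment[OF W(1) wpos e]) auto
 moreover have "(%n. w t - w (e n)) \<longlonglongrightarrow> w t - w 0"
 proof -
  have "(%n. w (e n)) \<longlonglongrightarrow> w 0"
   using c elim e by (intro continuous_on_tendsto_compose[OF c]) (auto intro!: always_eventually less_imp_le)
  then show ?thesis by (intro tendsto_intros)
 qed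
 ultimately show "(LINT y|lebesgue. indicat_real {0<..<t} y * g y) = w t - w 0"
  using LIMSEQ_unique by auto
qed

section \<open>Products on the cylinder\<close>

lemma borel_representative_real:
 fixes h :: "'a::euclidean_space => real"
 assumes "h \<in> borel_measurable (lebesgue_on S)" "S \<in> sets borel"
 shows "\<exists>h'\<in>borel_measurable borel. (\<forall>x. x \<notin> S \<longrightarrow> h' x = 0) \<and> (AE x in lebesgue_on S. h x = h' x)"
proof -
 have Sm: "S \<in> sets lebesgue" using assms by auto
 have "(%x. indicat_real S x *\<^sub>R h x) \<in> borel_measurable lebesgue"
  using assms Sm by (simp add: borel_measurable_restrict_space_iff)
 from completion_ex_borel_measurable_real[of _ lborel, OF this[unfolded real_scaleR_def]]
 obtain k where k: "k \<in> borel_measurable borel" "AE x in lborel. indicat_real S x * h x = k x" by auto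
 have "AE x in lebesgue. x \<in> S \<longrightarrow> h x = indicat_real S x * k x"
  using AE_completion[OF k(2)] by eventually_elim auto
 then have "AE x in lebesgue_on S. h x = indicat_real S x * k x" using Sm by (simp add: AE_restrict_space_iff)
 then show ?thesis using k(1) assms(2) by (intro bexI[of _ "%x. indicat_real S x * k x"]) auto
qed

text \<open>Borel representatives are needed wherever sections or iterated integrals occur, since sections of
  Lebesgue measurable functions need not be measurable.\<close>

lemma borel_representative:
 fixes h :: "'a::euclidean_space => 'b::euclidean_space"
 assumes "h \<in> borel_measurable (lebesgue_on S)" "S \<in> sets borel"
 shows "\<exists>h'\<in>borel_measurable borel. (\<forall>x. x \<notin> S \<longrightarrow> h' x = 0) \<and> (AE x in lebesgue_on S. h x = h' x)"
proof -
 have "\<exists>k. k \<in> borel_measurable borel \<and> (\<forall>x. x \<notin> S \<longrightarrow> k x = 0) \<and> (AE x in lebesgue_on S. h x \<bullet> i = k x)" for i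
  using borel_representative_real[OF borel_measurable_inner[OF assms(1) borel_measurable_const] assms(2)] by blast
 then obtain k where k: "\<And>i. k i \<in> borel_measurable borel" "\<And>i x. x \<notin> S ==> k i x = 0"
  "\<And>i. AE x in lebesgue_on S. h x \<bullet> i = k i x" by metis
 have "AE x in lebesgue_on S. \<forall>i\<in>Basis. h x \<bullet> i = k i x" by (rule AE_finite_allI[OF finite_Basis k(3)])
 then have "AE x in lebesgue_on S. h x = (\<Sum>i\<in>Basis. k i x *\<^sub>R i)"
 proof eventually_elim
  case (elim x)
  have "h x = (\<Sum>i\<in>Basis. (h x \<bullet> i) *\<^sub>R i)" by (simp add: euclidean_representation)
  also have "\<dots> = (\<Sum>i\<in>Basis. k i x *\<^sub>R i)" using elim by (intro sum.cong) auto
  finally show ?case .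
 qed
 moreover have "(%x. \<Sum>i\<in>Basis. k i x *\<^sub>R i) \<in> borel_measurable borel"
  using k(1) by (intro borel_measurable_sum borel_measurable_scaleR) auto
 ultimately show ?thesis using k(2) by (intro bexI[of _ "%x. \<Sum>i\<in>Basis. k i x *\<^sub>R i"]) auto
qed

lemma borel_measurable_AE_lebesgue_on:
 fixes f g :: "'a::euclidean_space => 'b::euclidean_space"
 assumes "f \<in> borel_measurable (lebesgue_on S)" "AE x in lebesgue_on S. f x = g x" "S \<in> sets lebesgue"
 shows "g \<in> borel_measurable (lebesgue_on S)"
proof -
 have "(%x. indicat_real S x *\<^sub>R f x) \<in> borel_measurable lebesgue"
  using assms by (simp add: borel_measurable_restrict_space_iff)
 moreover have "AE x in lebesgue. indicat_real S x *\<^sub>R f x = indicat_real S x *\<^sub>R g x"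
  using assms(2) unfolding AE_restrict_space_iff[of S lebesgue, simplified, OF assms(3)]
  by eventually_elim (auto simp: indicator_def)
 ultimately have "(%x. indicat_real S x *\<^sub>R g x) \<in> borel_measurable lebesgue" by (rule borel_measurable_AE)
 then show ?thesis using assms by (simp add: borel_measurable_restrict_space_iff)
qed

lemma lborel_null_times:
 fixes N :: "'a::euclidean_space set"
 assumes "N \<in> null_sets lborel"
 shows "N \<times> (UNIV :: 'b::euclidean_space set) \<in> null_sets lborel" "(UNIV :: 'b set) \<times> N \<in> null_sets lborel"
proof -
 have "emeasure (lborel \<Otimes>\<^sub>M lborel) (N \<times> (UNIV :: 'b set)) = emeasure lborel N * emeasure lborel (UNIV :: 'b set)"
  using assms by (intro lborel.emeasure_pair_measure_Times) auto
 moreover have "N \<times> (UNIV :: 'b set) \<in> sets (lborel \<Otimes>\<^sub>M lborel)" using assms by auto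
 ultimately show "N \<times> (UNIV :: 'b set) \<in> null_sets lborel" using assms unfolding lborel_prod by (auto simp: null_sets_def)
 have "emeasure (lborel \<Otimes>\<^sub>M lborel) ((UNIV :: 'b set) \<times> N) = emeasure lborel (UNIV :: 'b set) * emeasure lborel N"
  using assms by (intro lborel.emeasure_pair_measure_Times) auto
 moreover have "(UNIV :: 'b set) \<times> N \<in> sets (lborel \<Otimes>\<^sub>M lborel)" using assms by auto
 ultimately show "(UNIV :: 'b set) \<times> N \<in> null_sets lborel" using assms unfolding lborel_prod by (auto simp: null_sets_def)
qed

lemma AE_lebesgue_on_iff_lborel_null:
 fixes S :: "'a::euclidean_space set"
 assumes "S \<in> sets lebesgue"
 shows "(AE x in lebesgue_on S. Q x) \<longleftrightarrow> (\<exists>N\<in>null_sets lborel. \<forall>x\<in>S. x \<notin> N \<longrightarrow> Q x)"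
proof -
 have "(AE x in lebesgue_on S. Q x) \<longleftrightarrow> (AE x in lebesgue. x \<in> S \<longrightarrow> Q x)"
  using assms by (simp add: AE_restrict_space_iff)
 also have "\<dots> \<longleftrightarrow> (AE x in lborel. x \<in> S \<longrightarrow> Q x)"
  by (rule AE_completion_iff)
 also have "\<dots> \<longleftrightarrow> (\<exists>N\<in>null_sets lborel. \<forall>x\<in>S. x \<notin> N \<longrightarrow> Q x)"
  by (auto simp: eventually_ae_filter)
 finally show ?thesis .
qed

lemma AE_cylinder:
 fixes S :: "'a::euclidean_space set" and J :: "'b::euclidean_space set"
 assumes S: "S \<in> sets borel" and J: "J \<in> sets borel"
 shows "AE x in lebesgue_on S. Q x ==> AE z in lebesgue_on (S \<times> J). Q (fst z)"
  and "AE y in lebesgue_on J. Q' y ==> AE z in lebesgue_on (S \<times> J). Q' (snd z)"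
proof -
 have SJ: "S \<times> J \<in> sets lebesgue" using borel_Times[OF S J] by auto
 have Sl: "S \<in> sets lebesgue" "J \<in> sets lebesgue" using S J by auto
 show "AE z in lebesgue_on (S \<times> J). Q (fst z)" if "AE x in lebesgue_on S. Q x"
 proof -
  obtain N where "N \<in> null_sets lborel" "\<forall>x\<in>S. x \<notin> N \<longrightarrow> Q x"
   using \<open>AE x in lebesgue_on S. Q x\<close> unfolding AE_lebesgue_on_iff_lborel_null[OF Sl(1)] by blast
  then show ?thesis unfolding AE_lebesgue_on_iff_lborel_null[OF SJ]
   using lborel_null_times(1)[of N, where 'b = 'b] by (intro bexI[of _ "N \<times> UNIV"]) auto
 qed
 show "AE z in lebesgue_on (S \<times> J). Q' (snd z)" if "AE y in lebesgue_on J. Q' y"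
 proof -
  obtain N where "N \<in> null_sets lborel" "\<forall>x\<in>J. x \<notin> N \<longrightarrow> Q' x"
   using \<open>AE y in lebesgue_on J. Q' y\<close> unfolding AE_lebesgue_on_iff_lborel_null[OF Sl(2)] by blast
  then show ?thesis unfolding AE_lebesgue_on_iff_lborel_null[OF SJ]
   using lborel_null_times(2)[of N, where 'b = 'a] by (intro bexI[of _ "UNIV \<times> N"]) auto
 qed
qed

lemma integrable_product:
 fixes f :: "'a::euclidean_space => real" and g :: "'b::euclidean_space => real"
 assumes "integrable lborel f" "integrable lborel g"
 shows "integrable lborel (%z. f (fst z) * g (snd z))"
proof -
 have m: "f \<in> borel_measurable borel" "g \<in> borel_measurable borel" using assms by auto
 have m': "(%z. f (fst z) * g (snd z)) \<in> borel_measurable (lborel \<Otimes>\<^sub>M lborel)"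
  using m by (intro borel_measurable_times) auto
 have "(\<integral>\<^sup>+z. ennreal (norm (f (fst z) * g (snd z))) \<partial>(lborel \<Otimes>\<^sub>M lborel))
   = (\<integral>\<^sup>+x. (\<integral>\<^sup>+y. ennreal (norm (f x * g y)) \<partial>lborel) \<partial>lborel)"
  using m' by (subst lborel.nn_integral_fst[symmetric]) auto
 also have "\<dots> = (\<integral>\<^sup>+x. ennreal (norm (f x)) * (\<integral>\<^sup>+y. ennreal (norm (g y)) \<partial>lborel) \<partial>lborel)"
  using m by (simp add: abs_mult ennreal_mult nn_integral_cmult)
 also have "\<dots> = (\<integral>\<^sup>+x. ennreal (norm (f x)) \<partial>lborel) * (\<integral>\<^sup>+y. ennreal (norm (g y)) \<partial>lborel)"
  using m by (simp add: nn_integral_multc)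
 also have "\<dots> < \<infinity>" using assms unfolding integrable_iff_bounded by (simp add: ennreal_mult_less_top)
 finally show ?thesis using m' unfolding lborel_prod integrable_iff_bounded by auto
qed

lemma locally_integrable_cong_AE:
 fixes f g :: "'a::euclidean_space => 'b::euclidean_space"
 assumes S: "S \<in> sets lebesgue" and g: "locally_integrable_on g S" and ae: "AE x in lebesgue_on S. f x = g x"
 shows "locally_integrable_on f S"
 unfolding locally_integrable_on_def
proof (intro allI impI)
 fix K assume K: "compact K \<and> K \<subseteq> S"
 then have gi: "integrable lebesgue (%x. indicat_real K x *\<^sub>R g x)" using g by (auto simp: locally_integrable_on_def set_integrable_def)
 have ae': "AE x in lebesgue. indicat_real K x *\<^sub>R g x = indicat_real K x *\<^sub>R f x"
  using ae unfolding AE_restrict_space_iff[of S lebesgue, simplified, OF S]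
  by eventually_elim (use K in \<open>auto simp: indicator_def\<close>)
 have "(%x. indicat_real K x *\<^sub>R f x) \<in> borel_measurable lebesgue"
  by (rule borel_measurable_AE[OF borel_measurable_integrable[OF gi] ae'])
 then have "integrable lebesgue (%x. indicat_real K x *\<^sub>R f x)"
  using integrable_cong_AE[OF borel_measurable_integrable[OF gi] _ ae'] gi by blast
 then show "f absolutely_integrable_on K" by (simp add: set_integrable_def)
qed

lemma is_weak_gradient_cong_AE:
 assumes S: "open S" and g: "is_weak_gradient S u g"
  and ae: "AE x in lebesgue_on S. u' x = u x" "AE x in lebesgue_on S. g' x = g x"
 shows "is_weak_gradient S u' g'"
proof -
 have Sm: "S \<in> sets lebesgue" using S by auto
 note loc = locally_integrable_cong_AE[OF Sm is_weak_gradientD(1)[OF g] ae(1)]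
  locally_integrable_cong_AE[OF Sm is_weak_gradientD(2)[OF g] ae(2)]
 have "(LINT x|lebesgue_on S. u' x * frechet_derivative \<phi> (at x) i) = - (LINT x|lebesgue_on S. (g' x \<bullet> i) * \<phi> x)"
  if \<phi>: "\<phi> \<in> test_functions S" and i: "i \<in> Basis" for \<phi> i
 proof -
  note g1 = integrable_times_test(2)[OF S is_weak_gradientD(1)[OF g] \<phi> i]
   and g2 = integrable_times_test(2)[OF S loc(1) \<phi> i]
   and g3 = integrable_times_test(1)[OF S locally_integrable_inner[OF is_weak_gradientD(2)[OF g]] \<phi>, of i]
   and g4 = integrable_times_test(1)[OF S locally_integrable_inner[OF loc(2)] \<phi>, of i]
  have "(LINT x|lebesgue_on S. u' x * frechet_derivative \<phi> (at x) i) = (LINT x|lebesgue_on S. u x * frechet_derivative \<phi> (at x) i)"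
  proof (intro integral_cong_AE borel_measurable_integrable g1 g2)
   show "AE x in lebesgue_on S. u' x * frechet_derivative \<phi> (at x) i = u x * frechet_derivative \<phi> (at x) i"
    using ae(1) by eventually_elim simp
  qed
  also have "\<dots> = - (LINT x|lebesgue_on S. (g x \<bullet> i) * \<phi> x)" by (rule is_weak_gradientD(3)[OF g \<phi> i])
  also have "(LINT x|lebesgue_on S. (g x \<bullet> i) * \<phi> x) = (LINT x|lebesgue_on S. (g' x \<bullet> i) * \<phi> x)"
  proof (intro integral_cong_AE borel_measurable_integrable g3 g4)
   show "AE x in lebesgue_on S. (g x \<bullet> i) * \<phi> x = (g' x \<bullet> i) * \<phi> x"
    using ae(2) by eventually_elim simp
  qed
  finally show ?thesis .
 qed
 then show ?thesis using loc unfolding is_weak_gradient_def locally_integrable_on_def by auto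
qed

lemma locally_integrable_components:
 fixes f :: "'a::euclidean_space => 'b::euclidean_space"
 assumes "\<And>i. i \<in> Basis ==> locally_integrable_on (%x. f x \<bullet> i) S"
 shows "locally_integrable_on f S"
 unfolding locally_integrable_on_def
proof (intro allI impI)
 fix K assume K: "compact K \<and> K \<subseteq> S"
 have "integrable lebesgue (%x. \<Sum>i\<in>Basis. (indicat_real K x * (f x \<bullet> i)) *\<^sub>R i)"
  using assms K by (intro Bochner_Integration.integrable_sum integrable_scaleR_left)
   (auto simp: locally_integrable_on_def set_integrable_def)
 moreover have "(\<Sum>i\<in>Basis. (indicat_real K x * (f x \<bullet> i)) *\<^sub>R i) = indicat_real K x *\<^sub>R f x" for x
  using euclidean_representation[of "f x"] by (simp add: scaleR_sum_right[symmetric] scaleR_scaleR[symmetric] del: scaleR_scaleR)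
 ultimately show "f absolutely_integrable_on K" by (simp add: set_integrable_def)
qed

text \<open>The compact set only has to be compared with the product of its projections.\<close>

lemma locally_integrable_product:
 fixes f :: "'a::euclidean_space => real" and g :: "'b::euclidean_space => real"
 assumes f: "locally_integrable_on f S" "f \<in> borel_measurable borel"
  and g: "locally_integrable_on g J" "g \<in> borel_measurable borel"
 shows "locally_integrable_on (%z. f (fst z) * g (snd z)) (S \<times> J)"
 unfolding locally_integrable_on_def
proof (intro allI impI)
 fix K assume K: "compact K \<and> K \<subseteq> S \<times> J"
 define K1 K2 where "K1 = fst ` K" and "K2 = snd ` K"
 have K12: "compact K1" "compact K2" "K1 \<subseteq> S" "K2 \<subseteq> J" "K \<subseteq> K1 \<times> K2"
  using K by (force simp: K1_def K2_def intro: compact_continuous_image continuous_intros)+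
 have b: "K1 \<in> sets borel" "K2 \<in> sets borel" "K \<in> sets borel" using K12 K by (auto intro: borel_compact)
 have "integrable lebesgue (%x. indicat_real K1 x * f x)" "integrable lebesgue (%x. indicat_real K2 x * g x)"
  using f(1) g(1) K12 by (auto simp: locally_integrable_on_def set_integrable_def)
 then have "integrable lborel (%x. indicat_real K1 x * f x)" "integrable lborel (%x. indicat_real K2 x * g x)"
  using f(2) g(2) b by (auto simp: integrable_completion)
 from integrable_product[OF this]
 have I: "integrable lborel (%z. (indicat_real K1 (fst z) * f (fst z)) * (indicat_real K2 (snd z) * g (snd z)))" .
 have m: "(%z. indicat_real K z *\<^sub>R (f (fst z) * g (snd z))) \<in> borel_measurable borel"
  using b f(2) g(2) by (intro borel_measurable_scaleR borel_measurable_indicator borel_measurable_times)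
  (auto simp: borel_prod[symmetric])
 have "integrable lborel (%z. indicat_real K z *\<^sub>R (f (fst z) * g (snd z)))"
 proof (rule Bochner_Integration.integrable_bound[OF I])
  show "AE z in lborel. norm (indicat_real K z *\<^sub>R (f (fst z) * g (snd z)))
    <= norm (indicat_real K1 (fst z) * f (fst z) * (indicat_real K2 (snd z) * g (snd z)))"
   using K12(5) by (intro AE_I2) (auto simp: indicator_def abs_mult)
 qed (use m in auto)
 then show "(%z. f (fst z) * g (snd z)) absolutely_integrable_on K"
  unfolding set_integrable_def using m by (subst integrable_completion) auto
qed

section \<open>Slices of test functions\<close>

lemma frechet_derivative_slice:
 fixes \<phi> :: "'a::euclidean_space \<times> 'b::euclidean_space => real"
 assumes "\<phi> differentiable (at (x, y))"
 shows "((%x. \<phi> (x, y)) has_derivative (%h. frechet_derivative \<phi> (at (x, y)) (h, 0))) (at x)"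
  and "((%y. \<phi> (x, y)) has_derivative (%h. frechet_derivative \<phi> (at (x, y)) (0, h))) (at y)"
proof -
 have "((%x. (x, y)) has_derivative (%h. (h, 0))) (at x)" by (auto intro!: derivative_eq_intros)
 from has_derivative_compose[OF this has_frechet[OF assms]]
 show "((%x. \<phi> (x, y)) has_derivative (%h. frechet_derivative \<phi> (at (x, y)) (h, 0))) (at x)" .
 have "((%y. (x, y)) has_derivative (%h. (0, h))) (at y)" by (auto intro!: derivative_eq_intros)
 from has_derivative_compose[OF this has_frechet[OF assms]]
 show "((%y. \<phi> (x, y)) has_derivative (%h. frechet_derivative \<phi> (at (x, y)) (0, h))) (at y)" .
qed

lemma Ck_slice:
 fixes \<phi> :: "'a::euclidean_space \<times> 'b::euclidean_space => real"
 shows "Ck k \<phi> ==> Ck k (%x. \<phi> (x, y))" and "Ck k \<phi> ==> Ck k (%y. \<phi> (x, y))"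
proof (induction k arbitrary: \<phi>)
 case 0
 {
  case 1
  then have "continuous_on UNIV \<phi>" by simp
  then show ?case by (auto intro!: continuous_on_compose2[of UNIV \<phi>] continuous_intros)
 next
  case 2
  then have "continuous_on UNIV \<phi>" by simp
  then show ?case by (auto intro!: continuous_on_compose2[of UNIV \<phi>] continuous_intros)
 }
next
 case (Suc k)
 {
  case 1
  then have d: "\<phi> differentiable (at z)" for z by (cases z) simp
  have e: "frechet_derivative (%x. \<phi> (x, y)) (at x) = (%h. frechet_derivative \<phi> (at (x, y)) (h, 0))" for x
   by (rule frechet_derivative_apply[OF frechet_derivative_slice(1)[OF d]])
  have "Ck k (%x. frechet_derivative \<phi> (at (x, y)) (i, 0))" if "i \<in> Basis" for i
   using Suc(1)[of "%z. frechet_derivative \<phi> (at z) (i, 0)"] 1 that by (auto simp: Basis_prod_def)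
  then show ?case unfolding Ck.simps e using frechet_derivative_slice(1)[OF d] by (auto intro: differentiableI)
 next
  case 2
  then have d: "\<phi> differentiable (at z)" for z by (cases z) simp
  have e: "frechet_derivative (%y. \<phi> (x, y)) (at y) = (%h. frechet_derivative \<phi> (at (x, y)) (0, h))" for y
   by (rule frechet_derivative_apply[OF frechet_derivative_slice(2)[OF d]])
  have "Ck k (%y. frechet_derivative \<phi> (at (x, y)) (0, i))" if "i \<in> Basis" for i
   using Suc(2)[of "%z. frechet_derivative \<phi> (at z) (0, i)"] 2 that by (auto simp: Basis_prod_def)
  then show ?case unfolding Ck.simps e using frechet_derivative_slice(2)[OF d] by (auto intro: differentiableI)
 }
qed

lemma test_function_slice:
 fixes \<phi> :: "'a::euclidean_space \<times> 'b::euclidean_space => real"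
 assumes \<phi>: "\<phi> \<in> test_functions (S \<times> J)"
 shows "(%x. \<phi> (x, y)) \<in> test_functions S" and "(%y. \<phi> (x, y)) \<in> test_functions J"
proof -
 define K where "K = closure {z. \<phi> z \<noteq> 0}"
 have K: "compact K" "K \<subseteq> S \<times> J" using \<phi> by (auto simp: test_functions_def K_def)
 have C: "Ck k \<phi>" for k using \<phi> by (auto simp: test_functions_def)
 have K12: "compact (fst ` K)" "compact (snd ` K)" "fst ` K \<subseteq> S" "snd ` K \<subseteq> J"
  using K by (force intro: compact_continuous_image continuous_intros)+
 have "closure {x. \<phi> (x, y) \<noteq> 0} \<subseteq> fst ` K"
 proof (rule closure_minimal)
  show "{x. \<phi> (x, y) \<noteq> 0} \<subseteq> fst ` K"
   using closure_subset[of "{z. \<phi> z \<noteq> 0}"] by (force simp: K_def)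
 qed (use K12 compact_imp_closed in auto)
 then show "(%x. \<phi> (x, y)) \<in> test_functions S"
  using K12 Ck_slice(1)[OF C] closed_Int_compact[OF closed_closure K12(1), of "{x. \<phi> (x, y) \<noteq> 0}"]
  by (auto simp: test_functions_def Int_absorb2)
 have "closure {y. \<phi> (x, y) \<noteq> 0} \<subseteq> snd ` K"
 proof (rule closure_minimal)
  show "{y. \<phi> (x, y) \<noteq> 0} \<subseteq> snd ` K"
   using closure_subset[of "{z. \<phi> z \<noteq> 0}"] by (force simp: K_def)
 qed (use K12 compact_imp_closed in auto)
 then show "(%y. \<phi> (x, y)) \<in> test_functions J"
  using K12 Ck_slice(2)[OF C] closed_Int_compact[OF closed_closure K12(2), of "{y. \<phi> (x, y) \<noteq> 0}"]
  by (auto simp: test_functions_def Int_absorb2)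
qed

text \<open>Fubini's theorem reduces the defining identity on the product to the one on the factors, applied
  to slices of the test function.\<close>

lemma is_weak_gradient_product:
 fixes v :: "'a::euclidean_space => real" and w :: "real => real"
 assumes S: "open S" and J: "open J" and v: "is_weak_gradient S v gv" and w: "is_weak_gradient J w gw"
  and b: "v \<in> borel_measurable borel" "gv \<in> borel_measurable borel" "w \<in> borel_measurable borel" "gw \<in> borel_measurable borel"
  and z: "\<And>x. x \<notin> S ==> v x = 0" "\<And>x. x \<notin> S ==> gv x = 0" "\<And>y. y \<notin> J ==> w y = 0" "\<And>y. y \<notin> J ==> gw y = 0"
 shows "is_weak_gradient (S \<times> J) (%z. v (fst z) * w (snd z)) (%z. (w (snd z) *\<^sub>R gv (fst z), v (fst z) * gw (snd z)))"
proof -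
 have SJ: "open (S \<times> J)" using S J by (rule open_Times)
 have SJm: "S \<times> J \<in> sets lebesgue" using SJ by auto
 note lv = is_weak_gradientD(1)[OF v] and lw = is_weak_gradientD(1)[OF w]
  and lgw = is_weak_gradientD(2)[OF w]
 have lgv: "locally_integrable_on (%x. gv x \<bullet> i) S" "(%x. gv x \<bullet> i) \<in> borel_measurable borel" for i
  using is_weak_gradientD(2)[OF v] b by (auto intro: locally_integrable_inner)
 note P = locally_integrable_product[OF lv b(1) lw b(3)]
  and Py = locally_integrable_product[OF lv b(1) lgw b(4)]
  and Px = locally_integrable_product[OF lgv lw b(3)]
 have loc: "locally_integrable_on (%z. (w (snd z) *\<^sub>R gv (fst z), v (fst z) * gw (snd z))) (S \<times> J)"
  by (rule locally_integrable_components) (use Px Py in \<open>auto simp: Basis_prod_def mult.commute\<close>)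
 have prodm: "(%z. f (fst z) * g (snd z) * \<psi> z) \<in> borel_measurable borel"
  if "f \<in> borel_measurable borel" "g \<in> borel_measurable borel" "continuous_on UNIV \<psi>"
  for f :: "'a => real" and g :: "real => real" and \<psi> :: "'a \<times> real => real"
 proof -
  have "\<psi> \<in> borel_measurable borel" by (rule borel_measurable_continuous_onI[OF that(3)])
  then show ?thesis using that unfolding borel_prod[symmetric] by measurable
 qed
 have key: "(LINT z|lebesgue_on (S \<times> J). f (fst z) * g (snd z) * \<psi> z) = (LINT y|lborel. g y * (LINT x|lborel. f x * \<psi> (x, y)))"
  "(LINT z|lebesgue_on (S \<times> J). f (fst z) * g (snd z) * \<psi> z) = (LINT x|lborel. f x * (LINT y|lborel. g y * \<psi> (x, y)))"
  if fg: "f \<in> borel_measurable borel" "g \<in> borel_measurable borel" "locally_integrable_on (%z. f (fst z) * g (snd z)) (S \<times> J)"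
   and \<psi>: "continuous_on UNIV \<psi>" "compact K" "K \<subseteq> S \<times> J" "\<And>z. z \<notin> K ==> \<psi> z = 0"
  for f :: "'a => real" and g :: "real => real" and \<psi> :: "'a \<times> real => real" and K
 proof -
  note m = prodm[OF fg(1,2) \<psi>(1)]
  have 0: "f (fst z) * g (snd z) * \<psi> z = 0" if "z \<notin> S \<times> J" for z using \<psi>(3) \<psi>(4)[of z] that by auto
  have e: "(LINT z|lebesgue_on (S \<times> J). f (fst z) * g (snd z) * \<psi> z) = (LINT z|lborel. f (fst z) * g (snd z) * \<psi> z)"
   "integrable (lebesgue_on (S \<times> J)) (%z. f (fst z) * g (snd z) * \<psi> z) \<longleftrightarrow> integrable lborel (%z. f (fst z) * g (snd z) * \<psi> z)"
   by (rule integral_lebesgue_on_eq_lborel[OF m _ SJm]; rule 0; assumption)+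
  have "integrable (lebesgue_on (S \<times> J)) (%z. f (fst z) * g (snd z) * \<psi> z)"
   by (rule integrable_times_compactly_supported[OF SJm fg(3) \<psi>(1,2,3,4)])
  then have "integrable lborel (%z. f (fst z) * g (snd z) * \<psi> z)" using e(2) by blast
  then have i: "integrable (lborel \<Otimes>\<^sub>M lborel) (%(x, y). f x * g y * \<psi> (x, y))"
   unfolding lborel_prod by (simp add: case_prod_beta')
  have L: "(LINT z|lebesgue_on (S \<times> J). f (fst z) * g (snd z) * \<psi> z) = (LINT z|(lborel \<Otimes>\<^sub>M lborel). (case z of (x, y) => f x * g y * \<psi> (x, y)))"
   unfolding e(1) lborel_prod by (simp add: case_prod_beta')
  have "(LINT y|lborel. LINT x|lborel. f x * g y * \<psi> (x, y)) = (LINT z|(lborel \<Otimes>\<^sub>M lborel). (case z of (x, y) => f x * g y * \<psi> (x, y)))"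
   by (rule lborel_pair.integral_snd[OF i])
  moreover have "(LINT x|lborel. f x * g y * \<psi> (x, y)) = g y * (LINT x|lborel. f x * \<psi> (x, y))" for y
  proof -
   have "(LINT x|lborel. f x * g y * \<psi> (x, y)) = (LINT x|lborel. g y * (f x * \<psi> (x, y)))" by (simp add: mult_ac)
   then show ?thesis by simp
  qed
  ultimately show "(LINT z|lebesgue_on (S \<times> J). f (fst z) * g (snd z) * \<psi> z) = (LINT y|lborel. g y * (LINT x|lborel. f x * \<psi> (x, y)))"
   unfolding L by simp
  have "(LINT x|lborel. LINT y|lborel. f x * g y * \<psi> (x, y)) = (LINT z|(lborel \<Otimes>\<^sub>M lborel). (case z of (x, y) => f x * g y * \<psi> (x, y)))"
   by (rule lborel_pair.integral_fst[OF i])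
  moreover have "(LINT y|lborel. f x * g y * \<psi> (x, y)) = f x * (LINT y|lborel. g y * \<psi> (x, y))" for x
   by (simp add: mult.assoc)
  ultimately show "(LINT z|lebesgue_on (S \<times> J). f (fst z) * g (snd z) * \<psi> z) = (LINT x|lborel. f x * (LINT y|lborel. g y * \<psi> (x, y)))"
   unfolding L by simp
 qed
 have Sm: "S \<in> sets lebesgue" "J \<in> sets lebesgue" using S J by auto
 have identity: "(LINT z|lebesgue_on (S \<times> J). v (fst z) * w (snd z) * frechet_derivative \<phi> (at z) k)
   = - (LINT z|lebesgue_on (S \<times> J). ((w (snd z) *\<^sub>R gv (fst z), v (fst z) * gw (snd z)) \<bullet> k) * \<phi> z)"
  if \<phi>: "\<phi> \<in> test_functions (S \<times> J)" and k: "k \<in> Basis" for \<phi> k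
 proof -
  note p = test_function_props[OF \<phi>]
  consider i where "i \<in> Basis" "k = (i, 0)" | "k = (0, 1)" using k by (auto simp: Basis_prod_def)
  then show ?thesis
  proof cases
   case 1
   have sl: "(LINT x|lborel. v x * frechet_derivative \<phi> (at (x, y)) k) = - (LINT x|lborel. (gv x \<bullet> i) * \<phi> (x, y))" for y
   proof -
    note t = test_function_slice(1)[OF \<phi>, of y]
    note q = test_function_props[OF t]
    have fd: "frechet_derivative (%x. \<phi> (x, y)) (at x) i = frechet_derivative \<phi> (at (x, y)) k" for x
     using frechet_derivative_apply[OF frechet_derivative_slice(1)[OF p(2)[of "(x, y)"]]] 1 by simp
    have "(LINT x|lebesgue_on S. v x * frechet_derivative (%x. \<phi> (x, y)) (at x) i)
      = - (LINT x|lebesgue_on S. (gv x \<bullet> i) * \<phi> (x, y))"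
     by (rule is_weak_gradientD(3)[OF v t 1(1)])
    moreover have "(LINT x|lebesgue_on S. v x * frechet_derivative (%x. \<phi> (x, y)) (at x) i) = (LINT x|lborel. v x * frechet_derivative (%x. \<phi> (x, y)) (at x) i)"
     by (rule integral_lebesgue_on_eq_lborel(1)[OF borel_measurable_times[OF b(1) borel_measurable_continuous_onI[OF q(3)[OF 1(1)]]] _ Sm(1)])
      (simp add: z)
    moreover have "(LINT x|lebesgue_on S. (gv x \<bullet> i) * \<phi> (x, y)) = (LINT x|lborel. (gv x \<bullet> i) * \<phi> (x, y))"
     by (rule integral_lebesgue_on_eq_lborel(1)[OF borel_measurable_times[OF lgv(2) borel_measurable_continuous_onI[OF q(1)]] _ Sm(1)])
      (simp add: z)
    ultimately show ?thesis by (simp add: fd)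
   qed
   have "(LINT z|lebesgue_on (S \<times> J). v (fst z) * w (snd z) * frechet_derivative \<phi> (at z) k)
     = (LINT y|lborel. w y * (LINT x|lborel. v x * frechet_derivative \<phi> (at (x, y)) k))"
    by (rule key(1)[OF b(1,3) P p(3)[OF k] p(6,7,5)])
   also have "\<dots> = - (LINT y|lborel. w y * (LINT x|lborel. (gv x \<bullet> i) * \<phi> (x, y)))" by (simp add: sl)
   also have "(LINT y|lborel. w y * (LINT x|lborel. (gv x \<bullet> i) * \<phi> (x, y))) = (LINT z|lebesgue_on (S \<times> J). (gv (fst z) \<bullet> i) * w (snd z) * \<phi> z)"
    by (rule key(1)[OF lgv(2) b(3) Px p(1,6,7,4), symmetric])
   finally show ?thesis using 1 by (simp add: mult_ac)
  next
   case 2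
   have sl: "(LINT y|lborel. w y * frechet_derivative \<phi> (at (x, y)) k) = - (LINT y|lborel. gw y * \<phi> (x, y))" for x
   proof -
    note t = test_function_slice(2)[OF \<phi>, of x]
    note q = test_function_props[OF t]
    have fd: "frechet_derivative (%y. \<phi> (x, y)) (at y) 1 = frechet_derivative \<phi> (at (x, y)) k" for y
     using frechet_derivative_apply[OF frechet_derivative_slice(2)[OF p(2)[of "(x, y)"]]] 2 by simp
    have one: "(1::real) \<in> Basis" by simp
    have "(LINT y|lebesgue_on J. w y * frechet_derivative (%y. \<phi> (x, y)) (at y) 1)
      = - (LINT y|lebesgue_on J. gw y * \<phi> (x, y))"
     using is_weak_gradientD(3)[OF w t one] by simp
    moreover have "(LINT y|lebesgue_on J. w y * frechet_derivative (%y. \<phi> (x, y)) (at y) 1) = (LINT y|lborel. w y * frechet_derivative (%y. \<phi> (x, y)) (at y) 1)"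
     by (rule integral_lebesgue_on_eq_lborel(1)[OF borel_measurable_times[OF b(3) borel_measurable_continuous_onI[OF q(3)[OF one]]] _ Sm(2)])
      (simp add: z)
    moreover have "(LINT y|lebesgue_on J. gw y * \<phi> (x, y)) = (LINT y|lborel. gw y * \<phi> (x, y))"
     by (rule integral_lebesgue_on_eq_lborel(1)[OF borel_measurable_times[OF b(4) borel_measurable_continuous_onI[OF q(1)]] _ Sm(2)])
      (simp add: z)
    ultimately show ?thesis by (simp add: fd)
   qed
   have "(LINT z|lebesgue_on (S \<times> J). v (fst z) * w (snd z) * frechet_derivative \<phi> (at z) k)
     = (LINT x|lborel. v x * (LINT y|lborel. w y * frechet_derivative \<phi> (at (x, y)) k))"
    by (rule key(2)[OF b(1,3) P p(3)[OF k] p(6,7,5)])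
   also have "\<dots> = - (LINT x|lborel. v x * (LINT y|lborel. gw y * \<phi> (x, y)))" by (simp add: sl)
   also have "(LINT x|lborel. v x * (LINT y|lborel. gw y * \<phi> (x, y))) = (LINT z|lebesgue_on (S \<times> J). v (fst z) * gw (snd z) * \<phi> z)"
    by (rule key(2)[OF b(1,4) Py p(1,6,7,4), symmetric])
   finally show ?thesis using 2 by (simp add: mult_ac)
  qed
 qed
 then show ?thesis using P loc unfolding is_weak_gradient_def locally_integrable_on_def by auto
qed

section \<open>Discrete functions on the cylinder\<close>

lemma norm_matrix_vector_le:
 fixes B :: "real^'n^'m"
 shows "norm (B *v x) <= norm B * norm x"
proof -
 have c: "(B *v x) $ i = (B $ i) \<bullet> x" for i
  by (simp add: matrix_vector_mult_def inner_vec_def)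
 have "(norm (B *v x))^2 = (\<Sum>i\<in>UNIV. ((B $ i) \<bullet> x)^2)"
  unfolding power2_norm_eq_inner inner_vec_def[of "B *v x"] c by (simp add: power2_eq_square)
 also have "\<dots> <= (\<Sum>i\<in>UNIV. (norm (B $ i))^2 * (norm x)^2)"
 proof (rule sum_mono)
  fix i
  have "\<bar>(B $ i) \<bullet> x\<bar> <= norm (B $ i) * norm x" by (rule Cauchy_Schwarz_ineq2)
  then have "\<bar>(B $ i) \<bullet> x\<bar>\<^sup>2 <= (norm (B $ i) * norm x)^2" by (intro power_mono) auto
  then show "((B $ i) \<bullet> x)^2 <= (norm (B $ i))^2 * (norm x)^2" by (simp add: power_mult_distrib)
 qed
 also have "\<dots> = (norm B * norm x)^2"
 proof -
  have "(norm B)^2 = (\<Sum>i\<in>UNIV. (norm (B $ i))^2)"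
   unfolding power2_norm_eq_inner by (simp add: inner_vec_def[of B])
  then show ?thesis by (simp add: power_mult_distrib sum_distrib_right)
 qed
 finally show ?thesis by (rule power2_le_imp_le) simp
qed

lemma matrix_vector_measurable:
 fixes B :: "'b => real^'n^'m"
 assumes "B \<in> borel_measurable M" "g \<in> borel_measurable M"
 shows "(%z. B z *v g z) \<in> borel_measurable M"
proof (rule borel_measurable_continuous_Pair[OF assms, of "(*v)"])
 show "continuous_on UNIV (%x::(real^'n^'m) \<times> (real^'n). fst x *v snd x)"
  unfolding matrix_vector_mult_def by (intro continuous_intros)
qed

lemma Young: "\<bar>x * y\<bar> <= x^2 + (y::real)^2"
proof -
 have "0 <= (\<bar>x\<bar> - \<bar>y\<bar>)^2" "0 <= \<bar>x\<bar> * \<bar>y\<bar>" by auto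
 then show ?thesis unfolding power2_diff abs_mult power2_abs by linarith
qed

text \<open>The bounds \<open>R\<close>, \<open>\<kappa>\<close>, \<open>KA\<close> and \<open>Kc\<close> are parameters in their own right, because the final constant
  may depend on them but not on the discrete spaces.\<close>

locale cylinder =
 fixes \<Omega> :: "(real^'n) set" and A :: "real^'n => real^'n^'n" and c :: "real^'n => real" and s R \<kappa> KA Kc :: real
  and VX :: "(real^'n => real) set" and VY :: "(real => real) set"
 assumes open\<Omega>: "open \<Omega>" and R: "\<And>x. x \<in> \<Omega> ==> norm x <= R" and s: "0 < s" "s < 1"
  and Am: "A \<in> borel_measurable (lebesgue_on \<Omega>)" and AK: "AE x in lebesgue_on \<Omega>. norm (A x) <= KA"
  and Asym: "AE x in lebesgue_on \<Omega>. transpose (A x) = A x"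
  and \<kappa>: "0 < \<kappa>" and Apos: "AE x in lebesgue_on \<Omega>. \<forall>\<xi>. \<kappa> * (norm \<xi>)^2 <= (A x *v \<xi>) \<bullet> \<xi>"
  and cm: "c \<in> borel_measurable (lebesgue_on \<Omega>)" and cK: "AE x in lebesgue_on \<Omega>. c x <= Kc"
  and c0: "AE x in lebesgue_on \<Omega>. 0 <= c x"
  and K0: "0 <= KA" "0 <= Kc"
  and spaces: "discrete_spaces \<Omega> s VX VY"
begin

abbreviation "MC \<equiv> lebesgue_on (cyl \<Omega>)"
abbreviation "T \<equiv> tensor VX VY"
abbreviation "wt z \<equiv> snd z powr alpha s"

lemma alpha_bounds: "alpha s < 1" "-1 < alpha s" using s by (auto simp: alpha_def)

lemma open_cyl: "open (cyl \<Omega>)" unfolding cyl_def using open\<Omega> by (intro open_Times) auto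

lemma cyl_sets [simp]: "cyl \<Omega> \<in> sets lebesgue" "\<Omega> \<in> sets lebesgue" "\<Omega> \<in> sets borel" "cyl \<Omega> \<in> sets borel"
 using open_cyl open\<Omega> by auto

lemma VX: "subspace VX" "VX \<subseteq> H10 \<Omega>" "\<And>u. u \<in> VX ==> AE x in lebesgue_on \<Omega>. u x = 0 ==> u = 0"
 and VY: "subspace VY" "VY \<subseteq> weighted_H1 (%y. y powr alpha s) {0<..}" "\<And>v. v \<in> VY ==> continuous_on {0..} v"
 using spaces unfolding discrete_spaces_def finite_dim_def by auto

lemma T_subspace: "subspace T" unfolding tensor_def by (rule subspace_span)

lemma slice_in_VX: "U \<in> T ==> (%x. U (x, t)) \<in> VX"
 unfolding tensor_def
proof (induction rule: span_induct_alt)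
 case base
 then show ?case using subspace_0[OF VX(1)] by (simp add: zero_fun_def)
next
 case (step k x y)
 then obtain v w where vw: "x = (%(x, y). v x * w y)" "v \<in> VX" by auto
 have "(%xa. (k *\<^sub>R x + y) (xa, t)) = (k * w t) *\<^sub>R v + (%x. y (x, t))"
  by (auto simp: vw scaleR_fun_def fun_eq_iff)
 then show ?case using step vw by (auto intro!: subspace_add[OF VX(1)] subspace_scale[OF VX(1)])
qed

text \<open>A discrete function together with Borel representatives of itself and of the two parts of its
  gradient, and with what is needed about slices: horizontal slices are weakly differentiable with the expected
  gradient, and almost every vertical slice satisfies the fundamental theorem of calculus down to \<open>0\<close>. All of
  this is stable under linear combinations, so that it only has to be checked for products.\<close>

definition rep :: "((real^'n) \<times> real => real) => ((real^'n) \<times> real => real) => ((real^'n) \<times> real => real^'n)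
  => ((real^'n) \<times> real => real) => bool" where
 "rep U P Gx Gy \<longleftrightarrow> P \<in> borel_measurable borel \<and> Gx \<in> borel_measurable borel \<and> Gy \<in> borel_measurable borel \<and>
  (AE z in MC. U z = P z) \<and> is_weak_gradient (cyl \<Omega>) U (%z. (Gx z, Gy z)) \<and>
  integrable MC (%z. wt z * (P z)^2) \<and> integrable MC (%z. wt z * (norm (Gx z))^2) \<and> integrable MC (%z. wt z * (Gy z)^2) \<and>
  (\<forall>t>0. AE x in lebesgue_on \<Omega>. U (x, t) = P (x, t)) \<and>
  (\<forall>t>0. is_weak_gradient \<Omega> (%x. U (x, t)) (%x. Gx (x, t))) \<and>
  (AE x in lebesgue_on \<Omega>. \<forall>t>0. integrable lebesgue (%\<eta>. indicat_real {0<..<t} \<eta> * Gy (x, \<eta>)) \<and>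
    (LINT \<eta>|lebesgue. indicat_real {0<..<t} \<eta> * Gy (x, \<eta>)) = U (x, t) - U (x, 0))"

lemma weight_measurable: "wt \<in> borel_measurable MC"
proof -
 have "(%z::(real^'n) \<times> real. snd z powr alpha s) \<in> borel_measurable borel"
  unfolding borel_prod[symmetric] by measurable
 then have "(%z::(real^'n) \<times> real. snd z powr alpha s) \<in> borel_measurable lebesgue"
  by (intro measurable_completion) simp
 then show ?thesis by (rule measurable_restrict_space1)
qed

lemma borel_MC: "f \<in> borel_measurable borel ==> f \<in> borel_measurable MC"
 by (intro measurable_restrict_space1 measurable_completion) simp

lemma weighted_square_add:
 fixes f g :: "(real^'n) \<times> real => 'z::euclidean_space"
 assumes "f \<in> borel_measurable MC" "g \<in> borel_measurable MC"
  and "integrable MC (%z. wt z * (norm (f z))^2)" "integrable MC (%z. wt z * (norm (g z))^2)"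
 shows "integrable MC (%z. wt z * (norm (f z + g z))^2)"
proof (rule Bochner_Integration.integrable_bound)
 show "integrable MC (%z. 2 * (wt z * (norm (f z))^2) + 2 * (wt z * (norm (g z))^2))" using assms by auto
 show "(%z. wt z * (norm (f z + g z))^2) \<in> borel_measurable MC" using assms weight_measurable by measurable
 show "AE z in MC. norm (wt z * (norm (f z + g z))^2) <= norm (2 * (wt z * (norm (f z))^2) + 2 * (wt z * (norm (g z))^2))"
 proof (rule AE_I2)
  fix z
  have "(norm (f z + g z))^2 <= (norm (f z) + norm (g z))^2" by (intro power_mono norm_triangle_ineq) auto
  also have "\<dots> <= 2 * (norm (f z))^2 + 2 * (norm (g z))^2"
   using zero_le_power2[of "norm (f z) - norm (g z)"] by (simp add: power2_eq_square algebra_simps)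
  finally have "wt z * (norm (f z + g z))^2 <= wt z * (2 * (norm (f z))^2 + 2 * (norm (g z))^2)"
   by (intro mult_left_mono) auto
  then show "norm (wt z * (norm (f z + g z))^2) <= norm (2 * (wt z * (norm (f z))^2) + 2 * (wt z * (norm (g z))^2))"
   by (simp add: algebra_simps)
 qed
qed

lemma rep_zero: "rep 0 (%_. 0) (%_. 0) (%_. 0)"
 by (auto simp: rep_def is_weak_gradient_def zero_fun_def absolutely_integrable_zero zero_prod_def[symmetric])

lemma rep_add:
 assumes "rep U P Gx Gy" "rep V Q Hx Hy"
 shows "rep (U + V) (%z. P z + Q z) (%z. Gx z + Hx z) (%z. Gy z + Hy z)"
 unfolding rep_def
proof (intro conjI allI impI)
 note u = assms[unfolded rep_def]
 show "(%z. P z + Q z) \<in> borel_measurable borel" "(%z. Gx z + Hx z) \<in> borel_measurable borel" "(%z. Gy z + Hy z) \<in> borel_measurable borel"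
  using u by auto
 show "AE z in MC. (U + V) z = P z + Q z"
 proof -
  have "AE z in MC. U z = P z" "AE z in MC. V z = Q z" using u by auto
  then show ?thesis by eventually_elim simp
 qed
 have "is_weak_gradient (cyl \<Omega>) (U + V) (%z. (Gx z, Gy z) + (Hx z, Hy z))"
  using u by (intro is_weak_gradient_add open_cyl) auto
 then show "is_weak_gradient (cyl \<Omega>) (U + V) (%z. (Gx z + Hx z, Gy z + Hy z))" by simp
 show "integrable MC (%z. wt z * (P z + Q z)^2)" "integrable MC (%z. wt z * (norm (Gx z + Hx z))^2)"
  "integrable MC (%z. wt z * (Gy z + Hy z)^2)"
  using u weighted_square_add[of P Q] weighted_square_add[of Gx Hx] weighted_square_add[of Gy Hy] by (auto simp: borel_MC)
 fix t :: real assume t: "0 < t"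
 have "AE x in lebesgue_on \<Omega>. U (x, t) = P (x, t)" "AE x in lebesgue_on \<Omega>. V (x, t) = Q (x, t)" using u t by auto
 then show "AE x in lebesgue_on \<Omega>. (U + V) (x, t) = P (x, t) + Q (x, t)" by eventually_elim simp
 have "is_weak_gradient \<Omega> ((%x. U (x, t)) + (%x. V (x, t))) (%x. Gx (x, t) + Hx (x, t))"
  using u t by (intro is_weak_gradient_add open\<Omega>) auto
 then show "is_weak_gradient \<Omega> (%x. (U + V) (x, t)) (%x. Gx (x, t) + Hx (x, t))" by (simp add: plus_fun_def)
next
 note u = assms[unfolded rep_def]
 have "AE x in lebesgue_on \<Omega>. \<forall>t>0. integrable lebesgue (%\<eta>. indicat_real {0<..<t} \<eta> * Gy (x, \<eta>)) \<and>
    (LINT \<eta>|lebesgue. indicat_real {0<..<t} \<eta> * Gy (x, \<eta>)) = U (x, t) - U (x, 0)"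
  "AE x in lebesgue_on \<Omega>. \<forall>t>0. integrable lebesgue (%\<eta>. indicat_real {0<..<t} \<eta> * Hy (x, \<eta>)) \<and>
    (LINT \<eta>|lebesgue. indicat_real {0<..<t} \<eta> * Hy (x, \<eta>)) = V (x, t) - V (x, 0)"
  using u by auto
 then show "AE x in lebesgue_on \<Omega>. \<forall>t>0. integrable lebesgue (%\<eta>. indicat_real {0<..<t} \<eta> * (Gy (x, \<eta>) + Hy (x, \<eta>))) \<and>
    (LINT \<eta>|lebesgue. indicat_real {0<..<t} \<eta> * (Gy (x, \<eta>) + Hy (x, \<eta>))) = (U + V) (x, t) - (U + V) (x, 0)"
  by eventually_elim (simp add: distrib_left)
qed

lemma rep_scale:
 assumes "rep U P Gx Gy"
 shows "rep (k *\<^sub>R U) (%z. k * P z) (%z. k *\<^sub>R Gx z) (%z. k * Gy z)"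
 unfolding rep_def
proof (intro conjI allI impI)
 note u = assms[unfolded rep_def]
 show "(%z. k * P z) \<in> borel_measurable borel" "(%z. k *\<^sub>R Gx z) \<in> borel_measurable borel" "(%z. k * Gy z) \<in> borel_measurable borel"
  using u by auto
 have "AE z in MC. U z = P z" using u by auto
 then show "AE z in MC. (k *\<^sub>R U) z = k * P z" by eventually_elim (simp add: scaleR_fun_def)
 have "is_weak_gradient (cyl \<Omega>) (k *\<^sub>R U) (%z. k *\<^sub>R (Gx z, Gy z))" using u by (intro is_weak_gradient_scale) auto
 then show "is_weak_gradient (cyl \<Omega>) (k *\<^sub>R U) (%z. (k *\<^sub>R Gx z, k * Gy z))" by simp
 have e: "wt z * (k * f)^2 = k^2 * (wt z * f^2)" for z :: "(real^'n) \<times> real" and f :: real by (simp add: power_mult_distrib)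
 show "integrable MC (%z. wt z * (k * P z)^2)" "integrable MC (%z. wt z * (k * Gy z)^2)" unfolding e using u by auto
 have e': "wt z * (norm (k *\<^sub>R Gx z))^2 = k^2 * (wt z * (norm (Gx z))^2)" for z by (simp add: power_mult_distrib)
 show "integrable MC (%z. wt z * (norm (k *\<^sub>R Gx z))^2)" unfolding e' using u by auto
 have "AE x in lebesgue_on \<Omega>. \<forall>t>0. integrable lebesgue (%\<eta>. indicat_real {0<..<t} \<eta> * Gy (x, \<eta>)) \<and>
    (LINT \<eta>|lebesgue. indicat_real {0<..<t} \<eta> * Gy (x, \<eta>)) = U (x, t) - U (x, 0)" using u by auto
 then show "AE x in lebesgue_on \<Omega>. \<forall>t>0. integrable lebesgue (%\<eta>. indicat_real {0<..<t} \<eta> * (k * Gy (x, \<eta>))) \<and>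
    (LINT \<eta>|lebesgue. indicat_real {0<..<t} \<eta> * (k * Gy (x, \<eta>))) = (k *\<^sub>R U) (x, t) - (k *\<^sub>R U) (x, 0)"
  by eventually_elim (simp add: scaleR_fun_def mult.left_commute[of _ k] right_diff_distrib)
 fix t :: real assume t: "0 < t"
 have "AE x in lebesgue_on \<Omega>. U (x, t) = P (x, t)" using u t by auto
 then show "AE x in lebesgue_on \<Omega>. (k *\<^sub>R U) (x, t) = k * P (x, t)" by eventually_elim (simp add: scaleR_fun_def)
 have "is_weak_gradient \<Omega> (k *\<^sub>R (%x. U (x, t))) (%x. k *\<^sub>R Gx (x, t))" using u t by (intro is_weak_gradient_scale) auto
 then show "is_weak_gradient \<Omega> (%x. (k *\<^sub>R U) (x, t)) (%x. k *\<^sub>R Gx (x, t))" by (simp add: scaleR_fun_def)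
qed

lemma weighted_square_product:
 fixes f :: "real^'n => 'z::euclidean_space" and g :: "real => real"
 assumes f: "f \<in> borel_measurable borel" "\<And>x. x \<notin> \<Omega> ==> f x = 0" "integrable (lebesgue_on \<Omega>) (%x. (norm (f x))^2)"
  and g: "g \<in> borel_measurable borel" "\<And>y. y \<notin> {0<..} ==> g y = 0" "integrable (lebesgue_on {0<..}) (%y. y powr alpha s * (g y)^2)"
 shows "integrable MC (%z. wt z * (norm (g (snd z) *\<^sub>R f (fst z)))^2)"
proof -
 have i: "integrable lborel (%x. (norm (f x))^2)"
  using integral_lebesgue_on_eq_lborel(2)[of "%x. (norm (f x))^2" \<Omega>] f by auto
 have j: "integrable lborel (%y. y powr alpha s * (g y)^2)"
  using integral_lebesgue_on_eq_lborel(2)[of "%y. y powr alpha s * (g y)^2" "{0<..}"] g by auto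
 have e: "wt z * (norm (g (snd z) *\<^sub>R f (fst z)))^2 = (norm (f (fst z)))^2 * (snd z powr alpha s * (g (snd z))^2)" for z
  by (simp add: power_mult_distrib)
 have m: "(%z. (norm (f (fst z)))^2 * (snd z powr alpha s * (g (snd z))^2)) \<in> borel_measurable borel"
  using borel_measurable_integrable[OF integrable_product[OF i j]] by simp
 have out: "(norm (f (fst z)))^2 * (snd z powr alpha s * (g (snd z))^2) = 0" if z: "z \<notin> cyl \<Omega>" for z
 proof (cases "fst z \<in> \<Omega>")
  case True
  then have "snd z \<notin> {0<..}" using z by (auto simp: cyl_def mem_Times_iff)
  then show ?thesis using g(2) by simp
 next
  case False
  then show ?thesis using f(2) by simp
 qed
 have "integrable MC (%z. (norm (f (fst z)))^2 * (snd z powr alpha s * (g (snd z))^2))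
   \<longleftrightarrow> integrable lborel (%z. (norm (f (fst z)))^2 * (snd z powr alpha s * (g (snd z))^2))"
  by (rule integral_lebesgue_on_eq_lborel(2)[OF m out]) simp_all
 then show ?thesis unfolding e using integrable_product[OF i j] by blast
qed

lemma rep_product:
 assumes v: "v \<in> VX" and w: "w \<in> VY"
 shows "\<exists>P Gx Gy. rep (%(x, y). v x * w y) P Gx Gy"
proof -
 let ?J = "{0<..} :: real set"
 have vH: "v \<in> weighted_H1 (%_. 1) \<Omega>" using v VX(2) by (auto simp: H10_def)
 note v1 = weighted_H1D[OF open\<Omega> vH, simplified]
 have wH: "w \<in> weighted_H1 (%y. y powr alpha s) ?J" using w VY(2) by auto
 have J: "open ?J" "?J \<in> sets borel" "?J \<in> sets lebesgue" by auto
 have wm: "(%y. y powr alpha s) \<in> borel_measurable (lebesgue_on ?J)"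
  by (intro measurable_restrict_space1 measurable_completion) auto
 have wpos: "y powr alpha s > 0" if "y \<in> ?J" for y using that by simp
 note w1 = weighted_H1D[OF J(1) wH wm wpos]
 obtain v' where v': "v' \<in> borel_measurable borel" "\<And>x. x \<notin> \<Omega> ==> v' x = 0" "AE x in lebesgue_on \<Omega>. v x = v' x"
  using borel_representative[OF v1(2) cyl_sets(3)] by blast
 obtain gv where gv: "gv \<in> borel_measurable borel" "\<And>x. x \<notin> \<Omega> ==> gv x = 0" "AE x in lebesgue_on \<Omega>. weak_gradient \<Omega> v x = gv x"
  using borel_representative[OF v1(3) cyl_sets(3)] by blast
 obtain gw where gw: "gw \<in> borel_measurable borel" "\<And>y. y \<notin> ?J ==> gw y = 0" "AE y in lebesgue_on ?J. weak_gradient ?J w y = gw y"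
  using borel_representative[OF w1(3) J(2)] by blast
 define w' where "w' = (%y. indicat_real ?J y * w y)"
 have w': "w' \<in> borel_measurable borel" "\<And>y. y \<notin> ?J ==> w' y = 0" "\<And>y. y \<in> ?J ==> w' y = w y"
 proof -
  have "continuous_on ?J w" using VY(3)[OF w] by (rule continuous_on_subset) auto
  then show "w' \<in> borel_measurable borel" unfolding w'_def
   using borel_measurable_continuous_on_indicator[of ?J w] by simp
 qed (auto simp: w'_def)
 have AE_sym: "AE x in M. f x = g x ==> AE x in M. g x = f x" for M and f g :: "'p => 'q" by (auto elim: eventually_mono)
 have gradv: "is_weak_gradient \<Omega> v' gv"
  by (rule is_weak_gradient_cong_AE[OF open\<Omega> v1(1)]) (use v' gv in \<open>auto intro: AE_sym\<close>)
 have w'AE: "AE y in lebesgue_on ?J. w y = w' y" by (rule AE_I2) (simp add: space_restrict_space w')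
 have gradw: "is_weak_gradient ?J w' gw"
  by (rule is_weak_gradient_cong_AE[OF J(1) w1(1)]) (use w'AE gw in \<open>auto intro: AE_sym\<close>)
 define U where "U = (%(x, y). v x * w y)"
 define P where "P = (%z. v' (fst z) * w' (snd z))"
 define Gx where "Gx = (%z. w' (snd z) *\<^sub>R gv (fst z))"
 define Gy where "Gy = (%z. v' (fst z) * gw (snd z))"
 have meas: "P \<in> borel_measurable borel" "Gx \<in> borel_measurable borel" "Gy \<in> borel_measurable borel"
  using v' gv w' gw unfolding P_def Gx_def Gy_def borel_prod[symmetric] by measurable
 have UP: "AE z in MC. U z = P z"
 proof -
  have 1: "AE z in MC. v (fst z) = v' (fst z)" unfolding cyl_def by (rule AE_cylinder(1)[OF _ J(2) v'(3)]) simp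
  have 2: "AE z in MC. w (snd z) = w' (snd z)" unfolding cyl_def by (rule AE_cylinder(2)[OF _ J(2) w'AE]) simp
  from 1 2 show ?thesis by eventually_elim (auto simp: U_def P_def case_prod_beta)
 qed
 have grad: "is_weak_gradient (cyl \<Omega>) U (%z. (Gx z, Gy z))"
 proof (rule is_weak_gradient_cong_AE[OF open_cyl _ UP])
  show "is_weak_gradient (cyl \<Omega>) P (%z. (Gx z, Gy z))"
   unfolding cyl_def P_def Gx_def Gy_def
   by (rule is_weak_gradient_product[OF open\<Omega> J(1) gradv gradw v'(1) gv(1) w'(1) gw(1) v'(2) gv(2) w'(2) gw(2)])
 qed simp
 have sqv: "integrable (lebesgue_on \<Omega>) (%x. (norm (v' x))^2)"
  using v1(4) v'(3) borel_measurable_AE_lebesgue_on[OF v1(2) v'(3)] v1(2)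
  by (subst integrable_cong_AE[where g = "%x. (v x)^2"]) (auto elim: eventually_mono)
 have sqgv: "integrable (lebesgue_on \<Omega>) (%x. (norm (gv x))^2)"
  using v1(5) gv(3) borel_measurable_AE_lebesgue_on[OF v1(3) gv(3)] v1(3)
  by (subst integrable_cong_AE[where g = "%x. (norm (weak_gradient \<Omega> v x))^2"]) (auto elim: eventually_mono)
 have sqw: "integrable (lebesgue_on ?J) (%y. y powr alpha s * (w' y)^2)"
  using w1(4) w'AE borel_measurable_AE_lebesgue_on[OF w1(2) w'AE] w1(2) wm
  by (subst integrable_cong_AE[where g = "%y. y powr alpha s * (w y)^2"]) (auto elim: eventually_mono)
 have sqgw: "integrable (lebesgue_on ?J) (%y. y powr alpha s * (gw y)^2)"
  using w1(5) gw(3) borel_measurable_AE_lebesgue_on[OF w1(3) gw(3)] w1(3) wm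
  by (subst integrable_cong_AE[where g = "%y. y powr alpha s * (norm (weak_gradient ?J w y))^2"]) (auto elim: eventually_mono)
 have I: "integrable MC (%z. wt z * (P z)^2)" "integrable MC (%z. wt z * (norm (Gx z))^2)" "integrable MC (%z. wt z * (Gy z)^2)"
  using weighted_square_product[OF v'(1,2) sqv w'(1,2) sqw] weighted_square_product[OF gv(1,2) sqgv w'(1,2) sqw]
   weighted_square_product[OF v'(1,2) sqv gw(1,2) sqgw]
  by (auto simp: P_def Gx_def Gy_def abs_mult power_mult_distrib mult_ac)
 have slices: "AE x in lebesgue_on \<Omega>. U (x, t) = P (x, t)" "is_weak_gradient \<Omega> (%x. U (x, t)) (%x. Gx (x, t))" if t: "t > 0" for t
 proof -
  show "AE x in lebesgue_on \<Omega>. U (x, t) = P (x, t)"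
   using v'(3) by eventually_elim (use t w'(3) in \<open>simp add: U_def P_def\<close>)
  show "is_weak_gradient \<Omega> (%x. U (x, t)) (%x. Gx (x, t))"
  proof (rule is_weak_gradient_cong_AE[OF open\<Omega> is_weak_gradient_scale[OF gradv, of "w t"]])
   show "AE x in lebesgue_on \<Omega>. U (x, t) = (w t *\<^sub>R v') x"
    using v'(3) by eventually_elim (simp add: U_def scaleR_fun_def)
  qed (use t w'(3) in \<open>simp add: Gx_def\<close>)
 qed
 have ftc: "AE x in lebesgue_on \<Omega>. \<forall>t>0. integrable lebesgue (%\<eta>. indicat_real {0<..<t} \<eta> * Gy (x, \<eta>)) \<and>
    (LINT \<eta>|lebesgue. indicat_real {0<..<t} \<eta> * Gy (x, \<eta>)) = U (x, t) - U (x, 0)"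
 proof -
  have g: "integrable lebesgue (%\<eta>. indicat_real {0<..<t} \<eta> * gw \<eta>)"
   "(LINT \<eta>|lebesgue. indicat_real {0<..<t} \<eta> * gw \<eta>) = w t - w 0" if t: "t > 0" for t
  proof -
   note F = weighted_FTC[OF wH alpha_bounds(1) VY(3)[OF w] t]
   have ae: "AE y in lebesgue. indicat_real {0<..<t} y * weak_gradient ?J w y = indicat_real {0<..<t} y * gw y"
    using gw(3) unfolding AE_restrict_space_iff[of ?J lebesgue, simplified]
    by eventually_elim (auto simp: indicator_def)
   have m: "(%\<eta>. indicat_real {0<..<t} \<eta> * gw \<eta>) \<in> borel_measurable lebesgue"
    using gw(1) by (intro measurable_completion) auto
   show "integrable lebesgue (%\<eta>. indicat_real {0<..<t} \<eta> * gw \<eta>)"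
    using integrable_cong_AE[OF borel_measurable_integrable[OF F(1)] m ae] F(1) by blast
   show "(LINT \<eta>|lebesgue. indicat_real {0<..<t} \<eta> * gw \<eta>) = w t - w 0"
    using integral_cong_AE[OF borel_measurable_integrable[OF F(1)] m ae] F(2) by simp
  qed
  have e: "indicat_real {0<..<t} \<eta> * Gy (x, \<eta>) = v' x * (indicat_real {0<..<t} \<eta> * gw \<eta>)" for t \<eta> x by (simp add: Gy_def)
  show ?thesis unfolding e using v'(3)
   by eventually_elim (use g in \<open>auto simp: U_def right_diff_distrib\<close>)
 qed
 have "rep U P Gx Gy" unfolding rep_def using meas UP grad I slices ftc by blast
 then show ?thesis unfolding U_def by blast
qed

lemma rep_exists: "U \<in> T ==> \<exists>P Gx Gy. rep U P Gx Gy"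
 unfolding tensor_def
proof (induction rule: span_induct_alt)
 case base
 then show ?case using rep_zero by blast
next
 case (step k x y)
 then obtain v w where vw: "x = (%(x, y). v x * w y)" "v \<in> VX" "w \<in> VY" by auto
 obtain P Gx Gy where 1: "rep x P Gx Gy" using rep_product[OF vw(2,3)] vw(1) by blast
 obtain Q Hx Hy where 2: "rep y Q Hx Hy" using step by blast
 show ?case using rep_add[OF rep_scale[OF 1, of k] 2] by blast
qed

end

section \<open>The bilinear form on discrete functions\<close>

context cylinder
begin

abbreviation "G \<equiv> weak_gradient (cyl \<Omega>)"

definition energy_norm2 :: "((real^'n) \<times> real => real) => real" where
 "energy_norm2 U = (LINT z|MC. wt z * (norm (G U z))^2)"

lemma H1ring_norm_square: "(H1ring_norm \<Omega> s U)^2 = energy_norm2 U" "0 <= H1ring_norm \<Omega> s U" "0 <= energy_norm2 U"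
proof -
 show "0 <= energy_norm2 U" unfolding energy_norm2_def by (intro integral_nonneg_AE) auto
 then show "(H1ring_norm \<Omega> s U)^2 = energy_norm2 U" unfolding H1ring_norm_def energy_norm2_def by simp
 show "0 <= H1ring_norm \<Omega> s U" unfolding H1ring_norm_def using \<open>0 <= energy_norm2 U\<close> unfolding energy_norm2_def by simp
qed

lemma rep_gradient: "rep U P Gx Gy ==> AE z in MC. G U z = (Gx z, Gy z)"
 unfolding rep_def by (intro weak_gradient_eq open_cyl) auto

lemma discrete_function:
 assumes "U \<in> T"
 shows "is_weak_gradient (cyl \<Omega>) U (G U)" "U \<in> borel_measurable MC" "G U \<in> borel_measurable MC"
  and "integrable MC (%z. wt z * (U z)^2)" "integrable MC (%z. wt z * (norm (G U z))^2)"
proof -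
 obtain P Gx Gy where r: "rep U P Gx Gy" using rep_exists[OF assms] by blast
 note r' = r[unfolded rep_def]
 show w: "is_weak_gradient (cyl \<Omega>) U (G U)" using r' by (intro weak_gradient_works) auto
 show m: "U \<in> borel_measurable MC" "G U \<in> borel_measurable MC"
  using is_weak_gradientD(1,2)[OF w] by (auto intro: locally_integrable_measurable[OF open_cyl])
 have UP: "AE z in MC. U z = P z" using r' by auto
 have Pm: "P \<in> borel_measurable MC" "Gx \<in> borel_measurable MC" "Gy \<in> borel_measurable MC" using r' by (auto intro: borel_MC)
 have e1: "AE z in MC. wt z * (P z)^2 = wt z * (U z)^2" using UP by eventually_elim simp
 show "integrable MC (%z. wt z * (U z)^2)"
 proof (rule integrable_cong_AE_imp[OF _ _ e1])
  show "integrable MC (%z. wt z * (P z)^2)" using r' by auto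
  show "(%z. wt z * (U z)^2) \<in> borel_measurable MC" using weight_measurable m(1) by measurable
 qed
 have e2: "AE z in MC. wt z * (norm (Gx z))^2 + wt z * (Gy z)^2 = wt z * (norm (G U z))^2"
  using rep_gradient[OF r] by eventually_elim (simp add: norm_Pair distrib_left)
 show "integrable MC (%z. wt z * (norm (G U z))^2)"
 proof (rule integrable_cong_AE_imp[OF _ _ e2])
  show "integrable MC (%z. wt z * (norm (Gx z))^2 + wt z * (Gy z)^2)" using r' by auto
  show "(%z. wt z * (norm (G U z))^2) \<in> borel_measurable MC" using weight_measurable m(2) by measurable
 qed
qed

lemma gradient_add: "U \<in> T ==> V \<in> T ==> AE z in MC. G (U + V) z = G U z + G V z"
 by (intro weak_gradient_eq[OF open_cyl] is_weak_gradient_add[OF open_cyl] discrete_function(1))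

lemma gradient_scale: "U \<in> T ==> AE z in MC. G (k *\<^sub>R U) z = k *\<^sub>R G U z"
 by (intro weak_gradient_eq[OF open_cyl] is_weak_gradient_scale discrete_function(1))

abbreviation "a \<equiv> form_A \<Omega> A c s"

definition integrand :: "((real^'n) \<times> real => real) => ((real^'n) \<times> real => real) => (real^'n) \<times> real => real" where
 "integrand U V z = wt z * ((A (fst z) *v fst (G U z), snd (G U z)) \<bullet> G V z) + wt z * c (fst z) * U z * V z"

lemma form_A_integrand: "a U V = (LINT z|MC. integrand U V z)"
 unfolding form_A_def integrand_def Let_def ..

lemma coefficients_on_cylinder:
 shows "(%z. A (fst z)) \<in> borel_measurable MC" "(%z. c (fst z)) \<in> borel_measurable MC"
  and "AE z in MC. norm (A (fst z)) <= KA \<and> transpose (A (fst z)) = A (fst z) \<and>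
   (\<forall>\<xi>. \<kappa> * (norm \<xi>)^2 <= (A (fst z) *v \<xi>) \<bullet> \<xi>) \<and> c (fst z) <= Kc \<and> 0 <= c (fst z)"
proof -
 have J: "{0::real<..} \<in> sets borel" by simp
 obtain A' where A': "A' \<in> borel_measurable borel" "AE x in lebesgue_on \<Omega>. A x = A' x"
  using borel_representative[OF Am cyl_sets(3)] by blast
 obtain c' where c': "c' \<in> borel_measurable borel" "AE x in lebesgue_on \<Omega>. c x = c' x"
  using borel_representative[OF cm cyl_sets(3)] by blast
 have ae: "AE z in MC. A' (fst z) = A (fst z)" "AE z in MC. c' (fst z) = c (fst z)"
  using AE_cylinder(1)[OF cyl_sets(3) J A'(2)] AE_cylinder(1)[OF cyl_sets(3) J c'(2)]
  unfolding cyl_def by (auto elim: eventually_mono)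
 have m: "(%z::(real^'n) \<times> real. A' (fst z)) \<in> borel_measurable MC" "(%z::(real^'n) \<times> real. c' (fst z)) \<in> borel_measurable MC"
  using A' c' by (auto intro!: borel_MC measurable_compose[OF measurable_fst] simp: borel_prod[symmetric])
 show "(%z. A (fst z)) \<in> borel_measurable MC" by (rule borel_measurable_AE_lebesgue_on[OF m(1) ae(1)]) simp
 show "(%z. c (fst z)) \<in> borel_measurable MC" by (rule borel_measurable_AE_lebesgue_on[OF m(2) ae(2)]) simp
 have "AE x in lebesgue_on \<Omega>. norm (A x) <= KA \<and> transpose (A x) = A x \<and>
   (\<forall>\<xi>. \<kappa> * (norm \<xi>)^2 <= (A x *v \<xi>) \<bullet> \<xi>) \<and> c x <= Kc \<and> 0 <= c x"
  using AK Asym Apos cK c0 by eventually_elim simp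
 from AE_cylinder(1)[OF cyl_sets(3) J this]
 show "AE z in MC. norm (A (fst z)) <= KA \<and> transpose (A (fst z)) = A (fst z) \<and>
   (\<forall>\<xi>. \<kappa> * (norm \<xi>)^2 <= (A (fst z) *v \<xi>) \<bullet> \<xi>) \<and> c (fst z) <= Kc \<and> 0 <= c (fst z)"
  unfolding cyl_def .
qed

lemma borel_times_indicator:
 fixes J :: "'b::euclidean_space => ennreal"
 assumes "J \<in> borel_measurable borel" "S \<in> sets borel"
 shows "(%y. J y * indicator S y) \<in> borel_measurable lborel"
 using assms by (intro borel_measurable_times_ennreal borel_measurable_indicator) auto

lemma inner_product_le: "\<bar>x \<bullet> y\<bar> <= (norm x)^2 + (norm (y::'z::real_inner))^2"
proof -
 have "\<bar>x \<bullet> y\<bar> <= norm x * norm y" by (rule Cauchy_Schwarz_ineq2)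
 also have "\<dots> <= (norm x)^2 + (norm y)^2" using Young[of "norm x" "norm y"] by (simp add: abs_mult)
 finally show ?thesis .
qed

lemma norm_block: "(norm ((B *v fst g, snd g) :: (real^'n) \<times> real))^2 <= ((norm B)^2 + 1) * (norm (g :: (real^'n) \<times> real))^2"
proof -
 have "(norm (B *v fst g))^2 <= (norm B * norm (fst g))^2" by (intro power_mono norm_matrix_vector_le) auto
 then have "(norm (B *v fst g))^2 + (norm (snd g))^2 <= (norm B)^2 * (norm (fst g))^2 + (norm (snd g))^2" by (simp add: power_mult_distrib)
 also have "\<dots> <= ((norm B)^2 + 1) * ((norm (fst g))^2 + (norm (snd g))^2)" by (simp add: algebra_simps)
 finally show ?thesis by (cases g) (simp add: norm_Pair)
qed

lemma integrand_integrable: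
 assumes "U \<in> T" "V \<in> T"
 shows "integrable MC (integrand U V)"
proof (rule Bochner_Integration.integrable_bound)
 note u = discrete_function[OF assms(1)] and v = discrete_function[OF assms(2)]
 show "integrable MC (%z. (KA^2 + 1) * (wt z * (norm (G U z))^2) + wt z * (norm (G V z))^2
   + Kc * (wt z * (U z)^2 + wt z * (V z)^2))"
  using u v by auto
 have "(%z. A (fst z) *v fst (G U z)) \<in> borel_measurable MC"
  by (intro matrix_vector_measurable coefficients_on_cylinder
    measurable_compose[OF u(3) borel_measurable_continuous_onI[OF continuous_on_fst[OF continuous_on_id]]])
 moreover have "(%z. snd (G U z)) \<in> borel_measurable MC"
  by (rule measurable_compose[OF u(3) borel_measurable_continuous_onI[OF continuous_on_snd[OF continuous_on_id]]])
 ultimately have "(%z. (A (fst z) *v fst (G U z), snd (G U z))) \<in> borel_measurable MC"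
  by (rule borel_measurable_Pair)
 then show "integrand U V \<in> borel_measurable MC"
  unfolding integrand_def using u(2) v(2,3) coefficients_on_cylinder(2) weight_measurable
  by (intro borel_measurable_add borel_measurable_times borel_measurable_inner) auto
 show "AE z in MC. norm (integrand U V z) <= norm ((KA^2 + 1) * (wt z * (norm (G U z))^2) + wt z * (norm (G V z))^2
   + Kc * (wt z * (U z)^2 + wt z * (V z)^2))"
  using coefficients_on_cylinder(3)
 proof eventually_elim
  case (elim z)
  define p where "p = (A (fst z) *v fst (G U z), snd (G U z)) \<bullet> G V z"
  have nA: "(norm (A (fst z)))^2 <= KA^2" using elim by (intro power_mono) auto
  have "\<bar>p\<bar> <= (norm (A (fst z) *v fst (G U z), snd (G U z)))^2 + (norm (G V z))^2" unfolding p_def by (rule inner_product_le)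
  also have "\<dots> <= ((norm (A (fst z)))^2 + 1) * (norm (G U z))^2 + (norm (G V z))^2" using norm_block by (intro add_right_mono)
  also have "\<dots> <= (KA^2 + 1) * (norm (G U z))^2 + (norm (G V z))^2" using nA by (intro add_right_mono mult_right_mono) auto
  finally have p: "\<bar>p\<bar> <= (KA^2 + 1) * (norm (G U z))^2 + (norm (G V z))^2" .
  have "\<bar>c (fst z) * (U z * V z)\<bar> = c (fst z) * \<bar>U z * V z\<bar>" using elim by (simp add: abs_mult)
  also have "\<dots> <= Kc * ((U z)^2 + (V z)^2)" using elim Young[of "U z" "V z"] K0 by (intro mult_mono) auto
  finally have q: "\<bar>c (fst z) * (U z * V z)\<bar> <= Kc * ((U z)^2 + (V z)^2)" .
  have "\<bar>integrand U V z\<bar> = \<bar>wt z * (p + c (fst z) * (U z * V z))\<bar>" by (simp add: integrand_def p_def algebra_simps)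
  also have "\<dots> = wt z * \<bar>p + c (fst z) * (U z * V z)\<bar>" by (simp add: abs_mult)
  also have "\<dots> <= wt z * ((KA^2 + 1) * (norm (G U z))^2 + (norm (G V z))^2 + Kc * ((U z)^2 + (V z)^2))"
   using p q by (intro mult_left_mono) (auto intro: order.trans[OF abs_triangle_ineq])
  also have "\<dots> = (KA^2 + 1) * (wt z * (norm (G U z))^2) + wt z * (norm (G V z))^2
   + Kc * (wt z * (U z)^2 + wt z * (V z)^2)" by (simp add: algebra_simps)
  finally show ?case unfolding real_norm_def by (rule order.trans[OF _ abs_ge_self])
 qed
qed

lemma integrand_self:
 "AE z in MC. wt z * (min \<kappa> 1 * (norm (G U z))^2) <= integrand U U z \<and>
  integrand U U z <= wt z * ((KA + 1) * (norm (G U z))^2) + Kc * (wt z * (U z)^2)"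
 using coefficients_on_cylinder(3)
proof eventually_elim
 case (elim z)
 define g where "g = fst (G U z)"
 define h where "h = snd (G U z)"
 have n: "(norm (G U z))^2 = (norm g)^2 + h^2" unfolding g_def h_def by (cases "G U z") (simp add: norm_Pair)
 have i: "integrand U U z = wt z * ((A (fst z) *v g) \<bullet> g + h^2) + wt z * (c (fst z) * (U z)^2)"
  unfolding integrand_def g_def h_def by (cases "G U z") (simp add: power2_eq_square mult_ac)
 have w: "0 <= wt z" by simp
 have lo: "min \<kappa> 1 * (norm (G U z))^2 <= (A (fst z) *v g) \<bullet> g + h^2"
 proof -
  have "min \<kappa> 1 * (norm g)^2 <= \<kappa> * (norm g)^2" "min \<kappa> 1 * h^2 <= 1 * h^2" by (intro mult_right_mono; simp)+
  moreover have "\<kappa> * (norm g)^2 <= (A (fst z) *v g) \<bullet> g" using elim by blast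
  ultimately show ?thesis unfolding n distrib_left by linarith
 qed
 have up: "(A (fst z) *v g) \<bullet> g + h^2 <= (KA + 1) * (norm (G U z))^2"
 proof -
  have "(A (fst z) *v g) \<bullet> g <= norm (A (fst z) *v g) * norm g" by (rule norm_cauchy_schwarz)
  also have "\<dots> <= (norm (A (fst z)) * norm g) * norm g" by (intro mult_right_mono norm_matrix_vector_le) auto
  also have "\<dots> <= (KA * norm g) * norm g" using elim by (intro mult_right_mono) auto
  finally have "(A (fst z) *v g) \<bullet> g <= KA * (norm g)^2" by (simp add: power2_eq_square mult_ac)
  moreover have "0 <= KA * h^2" "0 <= (norm g)^2" using K0 by simp_all
  ultimately show ?thesis unfolding n distrib_left distrib_right mult_1 by linarith
 qed
 have c: "0 <= c (fst z) * (U z)^2" "c (fst z) * (U z)^2 <= Kc * (U z)^2" using elim by (auto intro!: mult_right_mono)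
 show ?case unfolding i
  using mult_left_mono[OF lo w] mult_left_mono[OF up w] mult_left_mono[OF c(1) w] mult_left_mono[OF c(2) w]
  by (simp add: mult_ac)
qed

lemma form_coercive: "U \<in> T ==> min \<kappa> 1 * energy_norm2 U <= a U U"
proof -
 assume U: "U \<in> T"
 have "min \<kappa> 1 * energy_norm2 U = (LINT z|MC. wt z * (min \<kappa> 1 * (norm (G U z))^2))"
  unfolding energy_norm2_def by (simp flip: integral_mult_right_zero add: mult.left_commute)
 also have "\<dots> <= (LINT z|MC. integrand U U z)"
 proof (rule integral_mono_AE)
  have "integrable MC (%z. min \<kappa> 1 * (wt z * (norm (G U z))^2))" using discrete_function(5)[OF U] by auto
  then show "integrable MC (%z. wt z * (min \<kappa> 1 * (norm (G U z))^2))" by (simp add: mult.left_commute)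
  show "integrable MC (integrand U U)" by (rule integrand_integrable[OF U U])
  show "AE z in MC. wt z * (min \<kappa> 1 * (norm (G U z))^2) <= integrand U U z" using integrand_self[of U] by (auto elim: eventually_mono)
 qed
 finally show ?thesis by (simp add: form_A_integrand)
qed

lemma psd_form_A: "psd_form T a"
proof
 show "subspace T" by (rule T_subspace)
next
 fix U V W assume UVW: "U \<in> T" "V \<in> T" "W \<in> T"
 have UV: "U + V \<in> T" using UVW T_subspace by (simp add: subspace_add)
 have "a (U + V) W = (LINT z|MC. integrand U W z + integrand V W z)"
  unfolding form_A_integrand
 proof (rule integral_cong_AE)
  show "AE z in MC. integrand (U + V) W z = integrand U W z + integrand V W z"
   using gradient_add[OF UVW(1,2)]
   by eventually_elim (simp add: integrand_def matrix_vector_right_distrib inner_prod_def inner_add_left algebra_simps)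
 qed (use integrand_integrable UVW UV in \<open>auto intro!: borel_measurable_integrable\<close>)
 then show "a (U + V) W = a U W + a V W" using integrand_integrable UVW by (simp add: form_A_integrand)
next
 fix U V k assume UV: "U \<in> T" "V \<in> T"
 have kU: "k *\<^sub>R U \<in> T" using UV T_subspace by (simp add: subspace_scale)
 have "a (k *\<^sub>R U) V = (LINT z|MC. k * integrand U V z)"
  unfolding form_A_integrand
 proof (rule integral_cong_AE)
  show "AE z in MC. integrand (k *\<^sub>R U) V z = k * integrand U V z"
   using gradient_scale[OF UV(1), of k]
   by eventually_elim (simp add: integrand_def scaleR_fun_def matrix_vector_mult_scaleR inner_prod_def algebra_simps)
 qed (use integrand_integrable UV kU in \<open>auto intro!: borel_measurable_integrable\<close>)
 then show "a (k *\<^sub>R U) V = k * a U V" by (simp add: form_A_integrand)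
next
 fix U V assume UV: "U \<in> T" "V \<in> T"
 show "a U V = a V U" unfolding form_A_integrand
 proof (rule integral_cong_AE)
  show "AE z in MC. integrand U V z = integrand V U z"
   using coefficients_on_cylinder(3)
  proof eventually_elim
   case (elim z)
   have sym: "(A (fst z) *v x) \<bullet> y = (A (fst z) *v y) \<bullet> x" for x y
   proof -
    have "(A (fst z) *v x) \<bullet> y = (x v* transpose (A (fst z))) \<bullet> y" by simp
    also have "\<dots> = (x v* A (fst z)) \<bullet> y" using elim by simp
    also have "\<dots> = x \<bullet> (A (fst z) *v y)" by (rule dot_lmul_matrix)
    finally show ?thesis by (simp add: inner_commute)
   qed
   show ?case unfolding integrand_def using sym[of "fst (G U z)" "fst (G V z)"]
    by (simp add: inner_prod_def mult_ac)
  qed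
 qed (use integrand_integrable UV in \<open>auto intro!: borel_measurable_integrable\<close>)
next
 fix U assume U: "U \<in> T"
 have "0 <= min \<kappa> 1 * energy_norm2 U" using \<kappa> H1ring_norm_square(3)[of U] by simp
 then show "0 <= a U U" using form_coercive[OF U] by linarith
qed

section \<open>Poincare inequality on the cylinder\<close>

text \<open>Both orders of integration are used, the horizontal slices for the Poincare inequality and the
  vertical ones for Hardy's inequality.\<close>

lemma weighted_iterated:
 fixes F :: "(real^'n) \<times> real => real"
 assumes F: "F \<in> borel_measurable borel" "\<And>z. 0 <= F z" and I: "integrable MC (%z. wt z * F z)"
 shows "ennreal (LINT z|MC. wt z * F z) = (\<integral>\<^sup>+y\<in>{0<..}. (\<integral>\<^sup>+x\<in>\<Omega>. ennreal (y powr alpha s * F (x, y)) \<partial>lborel) \<partial>lborel)"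
  and "ennreal (LINT z|MC. wt z * F z) = (\<integral>\<^sup>+x\<in>\<Omega>. (\<integral>\<^sup>+y\<in>{0<..}. ennreal (y powr alpha s * F (x, y)) \<partial>lborel) \<partial>lborel)"
proof -
 have Fm: "F \<in> borel_measurable (borel \<Otimes>\<^sub>M borel)" using F(1) by (simp add: borel_prod)
 have m: "(%z. ennreal (snd z powr alpha s * F z) * indicator (cyl \<Omega>) z) \<in> borel_measurable (lborel \<Otimes>\<^sub>M lborel)"
 proof -
  have "(%z. ennreal (snd z powr alpha s * F z)) \<in> borel_measurable (borel \<Otimes>\<^sub>M borel)" using Fm by measurable
  moreover have "cyl \<Omega> \<in> sets (borel \<Otimes>\<^sub>M borel)" using cyl_sets(4) unfolding borel_prod .
  ultimately have "(%z. ennreal (snd z powr alpha s * F z) * indicator (cyl \<Omega>) z) \<in> borel_measurable (borel \<Otimes>\<^sub>M borel)"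
   by measurable
  then show ?thesis by (simp add: lborel_prod borel_prod)
 qed
 have "ennreal (LINT z|MC. wt z * F z) = (\<integral>\<^sup>+z. ennreal (wt z * F z) \<partial>MC)"
  using F I by (intro nn_integral_eq_integral[symmetric]) auto
 also have "\<dots> = (\<integral>\<^sup>+z. ennreal (wt z * F z) * indicator (cyl \<Omega>) z \<partial>lebesgue)"
  by (rule nn_integral_restrict_space) simp
 also have "\<dots> = (\<integral>\<^sup>+z. ennreal (wt z * F z) * indicator (cyl \<Omega>) z \<partial>lborel)"
  by (rule nn_integral_completion)
 finally have e: "ennreal (LINT z|MC. wt z * F z) = (\<integral>\<^sup>+z. ennreal (wt z * F z) * indicator (cyl \<Omega>) z \<partial>(lborel \<Otimes>\<^sub>M lborel))"
  by (simp add: lborel_prod)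
 have i1: "(\<integral>\<^sup>+x. ennreal (y powr alpha s * F (x, y)) * indicator (cyl \<Omega>) (x, y) \<partial>lborel)
   = (\<integral>\<^sup>+x\<in>\<Omega>. ennreal (y powr alpha s * F (x, y)) \<partial>lborel) * indicator {0<..} y" for y
  by (cases "y > 0") (auto simp: cyl_def indicator_def intro!: nn_integral_cong)
 show "ennreal (LINT z|MC. wt z * F z) = (\<integral>\<^sup>+y\<in>{0<..}. (\<integral>\<^sup>+x\<in>\<Omega>. ennreal (y powr alpha s * F (x, y)) \<partial>lborel) \<partial>lborel)"
  unfolding e lborel_pair.nn_integral_snd[OF m, symmetric] by (simp add: i1)
 have i2: "(\<integral>\<^sup>+y. ennreal (y powr alpha s * F (x, y)) * indicator (cyl \<Omega>) (x, y) \<partial>lborel)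
   = (\<integral>\<^sup>+y\<in>{0<..}. ennreal (y powr alpha s * F (x, y)) \<partial>lborel) * indicator \<Omega> x" for x
  by (cases "x \<in> \<Omega>") (auto simp: cyl_def indicator_def intro!: nn_integral_cong)
 show "ennreal (LINT z|MC. wt z * F z) = (\<integral>\<^sup>+x\<in>\<Omega>. (\<integral>\<^sup>+y\<in>{0<..}. ennreal (y powr alpha s * F (x, y)) \<partial>lborel) \<partial>lborel)"
  unfolding e lborel.nn_integral_fst[OF m, symmetric] by (simp add: i2)
qed

lemma nn_integral_lebesgue_on:
 fixes f :: "real^'n => real" and f' :: "real^'n => ennreal"
 assumes "f' \<in> borel_measurable borel" "AE x in lebesgue_on \<Omega>. ennreal (f x) = f' x" "integrable (lebesgue_on \<Omega>) f" "\<And>x. 0 <= f x"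
 shows "ennreal (LINT x|lebesgue_on \<Omega>. f x) = (\<integral>\<^sup>+x\<in>\<Omega>. f' x \<partial>lborel)"
proof -
 have "ennreal (LINT x|lebesgue_on \<Omega>. f x) = (\<integral>\<^sup>+x. ennreal (f x) \<partial>lebesgue_on \<Omega>)"
  using assms by (intro nn_integral_eq_integral[symmetric]) auto
 also have "\<dots> = (\<integral>\<^sup>+x. f' x \<partial>lebesgue_on \<Omega>)" by (rule nn_integral_cong_AE[OF assms(2)])
 also have "\<dots> = (\<integral>\<^sup>+x. f' x * indicator \<Omega> x \<partial>lebesgue)" by (rule nn_integral_restrict_space) simp
 also have "\<dots> = (\<integral>\<^sup>+x\<in>\<Omega>. f' x \<partial>lborel)" by (rule nn_integral_completion)
 finally show ?thesis .
qed

lemma slice_norms: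
 assumes U: "U \<in> T" and r: "rep U P Gx Gy" and t: "0 < t"
 shows "ennreal ((L2_norm \<Omega> (%x. U (x, t)))^2) = (\<integral>\<^sup>+x\<in>\<Omega>. ennreal ((P (x, t))^2) \<partial>lborel)"
  and "(\<integral>\<^sup>+x\<in>\<Omega>. ennreal ((P (x, t))^2) \<partial>lborel) <= ennreal (16 * R^2) * (\<integral>\<^sup>+x\<in>\<Omega>. ennreal ((norm (Gx (x, t)))^2) \<partial>lborel)"
  and "ennreal ((H1_norm \<Omega> (%x. U (x, t)))^2) <= ennreal (1 + 16 * R^2) * (\<integral>\<^sup>+x\<in>\<Omega>. ennreal ((norm (Gx (x, t)))^2) \<partial>lborel)"
proof -
 let ?u = "%x. U (x, t)"
 note r' = r[unfolded rep_def]
 have u: "?u \<in> H10 \<Omega>" using slice_in_VX[OF U] VX(2) by blast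
 then have uH: "?u \<in> weighted_H1 (%_. 1) \<Omega>" by (simp add: H10_def)
 note W = weighted_H1D[OF open\<Omega> uH, simplified]
 have UP: "AE x in lebesgue_on \<Omega>. U (x, t) = P (x, t)" using r' t by auto
 have wg: "AE x in lebesgue_on \<Omega>. weak_gradient \<Omega> ?u x = Gx (x, t)"
  using r' t by (intro weak_gradient_eq open\<Omega>) auto
 have m: "(%x. P (x, t)) \<in> borel_measurable borel" "(%x. Gx (x, t)) \<in> borel_measurable borel"
  using r' by (auto intro!: measurable_compose[OF measurable_Pair2'] simp: borel_prod[symmetric])
 have 1: "ennreal (LINT x|lebesgue_on \<Omega>. (?u x)^2) = (\<integral>\<^sup>+x\<in>\<Omega>. ennreal ((P (x, t))^2) \<partial>lborel)"
  using m W(4) UP by (intro nn_integral_lebesgue_on) (auto elim: eventually_mono)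
 have 2: "ennreal (LINT x|lebesgue_on \<Omega>. (norm (weak_gradient \<Omega> ?u x))^2) = (\<integral>\<^sup>+x\<in>\<Omega>. ennreal ((norm (Gx (x, t)))^2) \<partial>lborel)"
  using m W(5) wg by (intro nn_integral_lebesgue_on) (auto elim: eventually_mono)
 have n1: "0 <= (LINT x|lebesgue_on \<Omega>. (?u x)^2)" and n2: "0 <= (LINT x|lebesgue_on \<Omega>. (norm (weak_gradient \<Omega> ?u x))^2)" by auto
 have L2: "(L2_norm \<Omega> ?u)^2 = (LINT x|lebesgue_on \<Omega>. (?u x)^2)"
  unfolding L2_norm_def L2_inner_def using n1 by (simp add: power2_eq_square)
 show "ennreal ((L2_norm \<Omega> ?u)^2) = (\<integral>\<^sup>+x\<in>\<Omega>. ennreal ((P (x, t))^2) \<partial>lborel)" unfolding L2 1 ..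
 have P: "(LINT x|lebesgue_on \<Omega>. (?u x)^2) <= 16 * R^2 * (LINT x|lebesgue_on \<Omega>. (norm (weak_gradient \<Omega> ?u x))^2)"
  by (rule H10_Poincare[OF open\<Omega> R u])
 show "(\<integral>\<^sup>+x\<in>\<Omega>. ennreal ((P (x, t))^2) \<partial>lborel) <= ennreal (16 * R^2) * (\<integral>\<^sup>+x\<in>\<Omega>. ennreal ((norm (Gx (x, t)))^2) \<partial>lborel)"
  unfolding 1[symmetric] 2[symmetric] using P n2 by (simp add: ennreal_mult[symmetric] ennreal_leI)
 have "(H1_norm \<Omega> ?u)^2 = (LINT x|lebesgue_on \<Omega>. (?u x)^2 + (norm (weak_gradient \<Omega> ?u x))^2)"
  unfolding H1_norm_def by simp
 also have "\<dots> = (LINT x|lebesgue_on \<Omega>. (?u x)^2) + (LINT x|lebesgue_on \<Omega>. (norm (weak_gradient \<Omega> ?u x))^2)"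
  using W(4,5) by simp
 also have "\<dots> <= (1 + 16 * R^2) * (LINT x|lebesgue_on \<Omega>. (norm (weak_gradient \<Omega> ?u x))^2)"
  using P by (simp add: distrib_right)
 finally have "ennreal ((H1_norm \<Omega> ?u)^2) <= ennreal ((1 + 16 * R^2) * (LINT x|lebesgue_on \<Omega>. (norm (weak_gradient \<Omega> ?u x))^2))"
  by (rule ennreal_leI)
 also have "\<dots> = ennreal (1 + 16 * R^2) * (\<integral>\<^sup>+x\<in>\<Omega>. ennreal ((norm (Gx (x, t)))^2) \<partial>lborel)"
  unfolding 2[symmetric] using n2 by (simp add: ennreal_mult)
 finally show "ennreal ((H1_norm \<Omega> ?u)^2) <= ennreal (1 + 16 * R^2) * (\<integral>\<^sup>+x\<in>\<Omega>. ennreal ((norm (Gx (x, t)))^2) \<partial>lborel)" .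
qed

lemma energy_split:
 assumes r: "rep U P Gx Gy"
 shows "energy_norm2 U = (LINT z|MC. wt z * (norm (Gx z))^2) + (LINT z|MC. wt z * (Gy z)^2)"
proof -
 note r' = r[unfolded rep_def]
 have m: "G U \<in> borel_measurable MC" "Gx \<in> borel_measurable MC" "Gy \<in> borel_measurable MC"
 proof -
  have "is_weak_gradient (cyl \<Omega>) U (G U)" using r' by (intro weak_gradient_works) auto
  then show "G U \<in> borel_measurable MC" using locally_integrable_measurable[OF open_cyl] is_weak_gradientD(2) by blast
 qed (use r' in \<open>auto intro: borel_MC\<close>)
 have "energy_norm2 U = (LINT z|MC. wt z * (norm (Gx z))^2 + wt z * (Gy z)^2)"
  unfolding energy_norm2_def
 proof (rule integral_cong_AE)
  show "AE z in MC. wt z * (norm (G U z))^2 = wt z * (norm (Gx z))^2 + wt z * (Gy z)^2"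
   using rep_gradient[OF r] by eventually_elim (simp add: norm_Pair distrib_left)
 qed (use m weight_measurable in measurable)
 then show ?thesis using r' by auto
qed

text \<open>The Poincare inequality on every horizontal slice, integrated over the height.\<close>

lemma cylinder_Poincare:
 assumes U: "U \<in> T"
 shows "(LINT z|MC. wt z * (U z)^2) <= 16 * R^2 * energy_norm2 U"
proof -
 obtain P Gx Gy where r: "rep U P Gx Gy" using rep_exists[OF U] by blast
 note r' = r[unfolded rep_def]
 have m: "P \<in> borel_measurable borel" "Gx \<in> borel_measurable borel" using r' by auto
 have m': "P \<in> borel_measurable (borel \<Otimes>\<^sub>M borel)" "Gx \<in> borel_measurable (borel \<Otimes>\<^sub>M borel)" using m by (auto simp: borel_prod)
 have Om: "\<Omega> \<in> sets borel" by simp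
 have sm: "(%x. P (x, y)) \<in> borel_measurable borel" "(%x. Gx (x, y)) \<in> borel_measurable borel" for y
  using m' by (auto intro!: measurable_compose[OF measurable_Pair2'])
 have jm: "(%y. (\<integral>\<^sup>+x\<in>\<Omega>. ennreal (y powr alpha s * (norm (Gx (x, y)))^2) \<partial>lborel)) \<in> borel_measurable borel"
 proof -
  have "(%(y, x). ennreal (y powr alpha s * (norm (Gx (x, y)))^2) * indicator \<Omega> x) \<in> borel_measurable (borel \<Otimes>\<^sub>M lborel)"
   using m'(2) Om by measurable
  then show ?thesis by (intro lborel.borel_measurable_nn_integral) simp
 qed
 have "ennreal (LINT z|MC. wt z * (P z)^2)
   = (\<integral>\<^sup>+y\<in>{0<..}. (\<integral>\<^sup>+x\<in>\<Omega>. ennreal (y powr alpha s * (P (x, y))^2) \<partial>lborel) \<partial>lborel)"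
  using m r' by (intro weighted_iterated(1)) auto
 also have "\<dots> <= (\<integral>\<^sup>+y\<in>{0<..}. ennreal (16 * R^2) * (\<integral>\<^sup>+x\<in>\<Omega>. ennreal (y powr alpha s * (norm (Gx (x, y)))^2) \<partial>lborel) \<partial>lborel)"
 proof (intro nn_integral_mono)
  fix y :: real
  show "(\<integral>\<^sup>+x\<in>\<Omega>. ennreal (y powr alpha s * (P (x, y))^2) \<partial>lborel) * indicator {0<..} y
   <= ennreal (16 * R^2) * (\<integral>\<^sup>+x\<in>\<Omega>. ennreal (y powr alpha s * (norm (Gx (x, y)))^2) \<partial>lborel) * indicator {0<..} y"
  proof (cases "y > 0")
   case True
   have m1: "(%x. ennreal ((P (x, y))^2) * indicator \<Omega> x) \<in> borel_measurable borel" using sm(1)[of y] Om by measurable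
   have m2: "(%x. ennreal ((norm (Gx (x, y)))^2) * indicator \<Omega> x) \<in> borel_measurable borel" using sm(2)[of y] Om by measurable
   have e1: "(\<integral>\<^sup>+x\<in>\<Omega>. ennreal (y powr alpha s * (P (x, y))^2) \<partial>lborel) = ennreal (y powr alpha s) * (\<integral>\<^sup>+x\<in>\<Omega>. ennreal ((P (x, y))^2) \<partial>lborel)"
    using m1 by (subst nn_integral_cmult[symmetric]) (auto simp: ennreal_mult mult.assoc)
   have e2: "(\<integral>\<^sup>+x\<in>\<Omega>. ennreal (y powr alpha s * (norm (Gx (x, y)))^2) \<partial>lborel) = ennreal (y powr alpha s) * (\<integral>\<^sup>+x\<in>\<Omega>. ennreal ((norm (Gx (x, y)))^2) \<partial>lborel)"
    using m2 by (subst nn_integral_cmult[symmetric]) (auto simp: ennreal_mult mult.assoc)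
   have "ennreal (y powr alpha s) * (\<integral>\<^sup>+x\<in>\<Omega>. ennreal ((P (x, y))^2) \<partial>lborel)
     <= ennreal (y powr alpha s) * (ennreal (16 * R^2) * (\<integral>\<^sup>+x\<in>\<Omega>. ennreal ((norm (Gx (x, y)))^2) \<partial>lborel))"
    by (intro mult_left_mono slice_norms(2)[OF U r True]) auto
   then show ?thesis unfolding e1 e2 using True by (simp add: mult_ac)
  qed simp
 qed
 also have "\<dots> = ennreal (16 * R^2) * (\<integral>\<^sup>+y\<in>{0<..}. (\<integral>\<^sup>+x\<in>\<Omega>. ennreal (y powr alpha s * (norm (Gx (x, y)))^2) \<partial>lborel) \<partial>lborel)"
 proof -
  have "{0::real<..} \<in> sets borel" by simp
  from nn_integral_cmult[OF borel_times_indicator[OF jm this], of "ennreal (16 * R^2)"] show ?thesis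
   unfolding mult.assoc .
 qed
 also have "(\<integral>\<^sup>+y\<in>{0<..}. (\<integral>\<^sup>+x\<in>\<Omega>. ennreal (y powr alpha s * (norm (Gx (x, y)))^2) \<partial>lborel) \<partial>lborel) = ennreal (LINT z|MC. wt z * (norm (Gx z))^2)"
  using m r' by (intro weighted_iterated(1)[symmetric]) auto
 also have "ennreal (16 * R^2) * ennreal (LINT z|MC. wt z * (norm (Gx z))^2) = ennreal (16 * R^2 * (LINT z|MC. wt z * (norm (Gx z))^2))"
  by (simp add: ennreal_mult integral_nonneg_AE)
 finally have "(LINT z|MC. wt z * (P z)^2) <= 16 * R^2 * (LINT z|MC. wt z * (norm (Gx z))^2)"
  by (subst (asm) ennreal_le_iff) (auto intro!: mult_nonneg_nonneg integral_nonneg_AE)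
 also have "\<dots> <= 16 * R^2 * energy_norm2 U"
  unfolding energy_split[OF r] by (intro mult_left_mono) (auto intro!: integral_nonneg_AE)
 finally have P: "(LINT z|MC. wt z * (P z)^2) <= 16 * R^2 * energy_norm2 U" .
 have "(LINT z|MC. wt z * (U z)^2) = (LINT z|MC. wt z * (P z)^2)"
 proof (rule integral_cong_AE)
  have "AE z in MC. U z = P z" using r' by auto
  then show "AE z in MC. wt z * (U z)^2 = wt z * (P z)^2" by eventually_elim simp
  show "(%z. wt z * (U z)^2) \<in> borel_measurable MC" using discrete_function(4)[OF U] by auto
  show "(%z. wt z * (P z)^2) \<in> borel_measurable MC" using r' by auto
 qed
 with P show ?thesis by simp
qed

lemma form_bounded:
 assumes U: "U \<in> T"
 shows "a U U <= (KA + 1 + Kc * (16 * R^2)) * energy_norm2 U"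
proof -
 note d = discrete_function[OF U]
 have "a U U <= (LINT z|MC. (KA + 1) * (wt z * (norm (G U z))^2) + Kc * (wt z * (U z)^2))"
  unfolding form_A_integrand
 proof (rule integral_mono_AE[OF integrand_integrable[OF U U]])
  show "integrable MC (%z. (KA + 1) * (wt z * (norm (G U z))^2) + Kc * (wt z * (U z)^2))" using d by auto
  show "AE z in MC. integrand U U z <= (KA + 1) * (wt z * (norm (G U z))^2) + Kc * (wt z * (U z)^2)"
   using integrand_self[of U] by eventually_elim (simp add: mult.left_commute)
 qed
 also have "\<dots> = (KA + 1) * energy_norm2 U + Kc * (LINT z|MC. wt z * (U z)^2)"
  unfolding energy_norm2_def using d by simp
 also have "\<dots> <= (KA + 1) * energy_norm2 U + Kc * (16 * R^2 * energy_norm2 U)"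
  using K0 by (intro add_left_mono mult_left_mono cylinder_Poincare[OF U])
 finally show ?thesis by (simp add: algebra_simps)
qed

end

section \<open>The trace inequality\<close>

lemma nn_integral_powr_from_0:
 fixes s t :: real
 assumes "0 < s" "0 < t"
 shows "(\<integral>\<^sup>+\<eta>. (if 0 < \<eta> \<and> \<eta> < t then ennreal (\<eta> powr (s - 1)) else 0) \<partial>lborel) = ennreal (t powr s / s)"
proof -
 have h: "((%\<eta>. \<eta> powr (s - 1)) has_integral (t powr s / s)) {0..t}"
  using has_integral_powr_from_0[of "s - 1" t] assms by simp
 have e: "(\<integral>\<^sup>+\<eta>. ennreal (indicator {0..t} \<eta> * \<eta> powr (s - 1)) \<partial>lborel) = ennreal (t powr s / s)"
  by (rule nn_integral_has_integral_lebesgue[OF _ h]) simp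
 have ae: "AE \<eta> in lborel. ennreal (indicator {0..t} \<eta> * \<eta> powr (s - 1)) = (if 0 < \<eta> \<and> \<eta> < t then ennreal (\<eta> powr (s - 1)) else 0)"
  using AE_lborel_singleton[of 0] AE_lborel_singleton[of t] by eventually_elim (auto simp: indicator_def)
 show ?thesis unfolding nn_integral_cong_AE[OF ae, symmetric] by (rule e)
qed

lemma nn_integral_powr_to_inf:
 fixes s \<eta> :: real
 assumes "0 < s" "0 < \<eta>"
 shows "(\<integral>\<^sup>+t. (if \<eta> < t then ennreal (t powr (- s - 1)) else 0) \<partial>lborel) = ennreal (\<eta> powr (- s) / s)"
proof -
 have h: "((%t. t powr (- s - 1)) has_integral \<eta> powr (- s) / s) {\<eta>..}"
  using has_integral_powr_to_inf[of "- s - 1" \<eta>] assms by simp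
 have e: "(\<integral>\<^sup>+t. ennreal (indicator {\<eta>..} t * t powr (- s - 1)) \<partial>lborel) = ennreal (\<eta> powr (- s) / s)"
  by (rule nn_integral_has_integral_lebesgue[OF _ h]) simp
 have ae: "AE t in lborel. ennreal (indicator {\<eta>..} t * t powr (- s - 1)) = (if \<eta> < t then ennreal (t powr (- s - 1)) else 0)"
  using AE_lborel_singleton[of \<eta>] by eventually_elim (auto simp: indicator_def)
 show ?thesis unfolding nn_integral_cong_AE[OF ae, symmetric] by (rule e)
qed

text \<open>The Cauchy-Schwarz inequality with the weight \<open>\<eta> powr (1 - s)\<close>, followed by an exchange of the order of
  integration, gives the constant \<open>1 / s\<^sup>2\<close>.\<close>

lemma Hardy_inequality:
 fixes g :: "real => real"
 assumes g: "g \<in> borel_measurable borel" and s: "0 < s"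
 shows "(\<integral>\<^sup>+t\<in>{0<..}. ennreal (t powr (- 2 * s - 1)) * (\<integral>\<^sup>+\<eta>. (if 0 < \<eta> \<and> \<eta> < t then ennreal \<bar>g \<eta>\<bar> else 0) \<partial>lborel)^2 \<partial>lborel)
  <= ennreal (1 / s^2) * (\<integral>\<^sup>+\<eta>\<in>{0<..}. ennreal (\<eta> powr (1 - 2 * s) * (g \<eta>)^2) \<partial>lborel)"
proof -
 define q where "q = (%\<eta>. ennreal (\<eta> powr (1 - s) * (g \<eta>)^2))"
 have qm: "q \<in> borel_measurable borel" unfolding q_def using g by measurable
 note [measurable] = qm g
 have CS: "(\<integral>\<^sup>+\<eta>. (if 0 < \<eta> \<and> \<eta> < t then ennreal \<bar>g \<eta>\<bar> else 0) \<partial>lborel)^2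
   <= ennreal (t powr s / s) * (\<integral>\<^sup>+\<eta>. (if 0 < \<eta> \<and> \<eta> < t then q \<eta> else 0) \<partial>lborel)" if t: "0 < t" for t
 proof -
  define f1 where "f1 = (%\<eta>. if 0 < \<eta> \<and> \<eta> < t then ennreal (\<eta> powr ((s - 1) / 2)) else 0)"
  define f2 where "f2 = (%\<eta>. if 0 < \<eta> \<and> \<eta> < t then ennreal (\<eta> powr ((1 - s) / 2) * \<bar>g \<eta>\<bar>) else 0)"
  have m: "f1 \<in> borel_measurable lborel" "f2 \<in> borel_measurable lborel" unfolding f1_def f2_def using g by measurable
  have 0: "f1 \<eta> * f2 \<eta> = (if 0 < \<eta> \<and> \<eta> < t then ennreal \<bar>g \<eta>\<bar> else 0)" for \<eta>
  proof (cases "0 < \<eta> \<and> \<eta> < t")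
   case True
   have "(s - 1) / 2 + (1 - s) / 2 = 0" by (simp add: field_simps)
   then have "\<eta> powr ((s - 1) / 2) * \<eta> powr ((1 - s) / 2) = 1" using True by (simp flip: powr_add)
   then have "\<eta> powr ((s - 1) / 2) * (\<eta> powr ((1 - s) / 2) * \<bar>g \<eta>\<bar>) = \<bar>g \<eta>\<bar>" by (simp flip: mult.assoc)
   then show ?thesis using True by (simp add: f1_def f2_def ennreal_mult[symmetric])
  qed (auto simp: f1_def)
  have 1: "(f1 \<eta>)^2 = (if 0 < \<eta> \<and> \<eta> < t then ennreal (\<eta> powr (s - 1)) else 0)" for \<eta>
   by (auto simp: f1_def power2_eq_square ennreal_mult[symmetric] powr_add[symmetric])
  have 2: "(f2 \<eta>)^2 = (if 0 < \<eta> \<and> \<eta> < t then q \<eta> else 0)" for \<eta>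
  proof (cases "0 < \<eta> \<and> \<eta> < t")
   case True
   have "(1 - s) / 2 + (1 - s) / 2 = 1 - s" by (simp add: field_simps)
   then have "\<eta> powr ((1 - s) / 2) * \<eta> powr ((1 - s) / 2) = \<eta> powr (1 - s)" by (simp flip: powr_add)
   then have "(\<eta> powr ((1 - s) / 2))^2 = \<eta> powr (1 - s)" by (simp only: power2_eq_square)
   then have "(\<eta> powr ((1 - s) / 2) * \<bar>g \<eta>\<bar>)^2 = \<eta> powr (1 - s) * (g \<eta>)^2"
    by (simp only: power_mult_distrib power2_abs)
   then show ?thesis using True by (simp add: f2_def q_def ennreal_power)
  qed (auto simp: f2_def)
  show ?thesis using Cauchy_Schwarz_nn_integral[OF m] unfolding 0 1 2 nn_integral_powr_from_0[OF s t] .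
 qed
 have "(\<integral>\<^sup>+t\<in>{0<..}. ennreal (t powr (- 2 * s - 1)) * (\<integral>\<^sup>+\<eta>. (if 0 < \<eta> \<and> \<eta> < t then ennreal \<bar>g \<eta>\<bar> else 0) \<partial>lborel)^2 \<partial>lborel)
  <= (\<integral>\<^sup>+t. (\<integral>\<^sup>+\<eta>. (if 0 < \<eta> \<and> \<eta> < t then ennreal (1 / s * t powr (- s - 1)) * q \<eta> else 0) \<partial>lborel) \<partial>lborel)"
 proof (rule nn_integral_mono)
  fix t :: real
  show "ennreal (t powr (- 2 * s - 1)) * (\<integral>\<^sup>+\<eta>. (if 0 < \<eta> \<and> \<eta> < t then ennreal \<bar>g \<eta>\<bar> else 0) \<partial>lborel)^2 * indicator {0<..} t
   <= (\<integral>\<^sup>+\<eta>. (if 0 < \<eta> \<and> \<eta> < t then ennreal (1 / s * t powr (- s - 1)) * q \<eta> else 0) \<partial>lborel)"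
  proof (cases "0 < t")
   case True
   have "- 2 * s - 1 + s = - s - 1" by simp
   then have e: "t powr (- 2 * s - 1) * (t powr s / s) = 1 / s * t powr (- s - 1)"
    by (metis (no_types, lifting) mult.commute mult_1 powr_add times_divide_eq_left times_divide_eq_right)
   have "ennreal (t powr (- 2 * s - 1)) * (\<integral>\<^sup>+\<eta>. (if 0 < \<eta> \<and> \<eta> < t then ennreal \<bar>g \<eta>\<bar> else 0) \<partial>lborel)^2
    <= ennreal (t powr (- 2 * s - 1)) * (ennreal (t powr s / s) * (\<integral>\<^sup>+\<eta>. (if 0 < \<eta> \<and> \<eta> < t then q \<eta> else 0) \<partial>lborel))"
    by (intro mult_left_mono CS True) auto
   also have "\<dots> = ennreal (1 / s * t powr (- s - 1)) * (\<integral>\<^sup>+\<eta>. (if 0 < \<eta> \<and> \<eta> < t then q \<eta> else 0) \<partial>lborel)"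
    using s by (simp only: mult.assoc[symmetric] ennreal_mult[symmetric] e powr_ge_zero divide_nonneg_pos)
   also have "\<dots> = (\<integral>\<^sup>+\<eta>. ennreal (1 / s * t powr (- s - 1)) * (if 0 < \<eta> \<and> \<eta> < t then q \<eta> else 0) \<partial>lborel)"
    by (intro nn_integral_cmult[symmetric]) measurable
   also have "\<dots> = (\<integral>\<^sup>+\<eta>. (if 0 < \<eta> \<and> \<eta> < t then ennreal (1 / s * t powr (- s - 1)) * q \<eta> else 0) \<partial>lborel)"
    by (intro nn_integral_cong) auto
   finally show ?thesis using True by simp
  qed simp
 qed
 also have "\<dots> = (\<integral>\<^sup>+\<eta>. (\<integral>\<^sup>+t. (if 0 < \<eta> \<and> \<eta> < t then ennreal (1 / s * t powr (- s - 1)) * q \<eta> else 0) \<partial>lborel) \<partial>lborel)"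
  by (intro lborel_pair.Fubini') measurable
 also have "\<dots> = (\<integral>\<^sup>+\<eta>. ennreal (1 / s^2) * (ennreal (\<eta> powr (1 - 2 * s) * (g \<eta>)^2) * indicator {0<..} \<eta>) \<partial>lborel)"
 proof (rule nn_integral_cong)
  fix \<eta> :: real
  show "(\<integral>\<^sup>+t. (if 0 < \<eta> \<and> \<eta> < t then ennreal (1 / s * t powr (- s - 1)) * q \<eta> else 0) \<partial>lborel)
   = ennreal (1 / s^2) * (ennreal (\<eta> powr (1 - 2 * s) * (g \<eta>)^2) * indicator {0<..} \<eta>)"
  proof (cases "0 < \<eta>")
   case True
   have "(\<integral>\<^sup>+t. (if 0 < \<eta> \<and> \<eta> < t then ennreal (1 / s * t powr (- s - 1)) * q \<eta> else 0) \<partial>lborel)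
    = (\<integral>\<^sup>+t. (ennreal (1 / s) * q \<eta>) * (if \<eta> < t then ennreal (t powr (- s - 1)) else 0) \<partial>lborel)"
   proof (rule nn_integral_cong)
    fix t
    have "ennreal (1 / s * t powr (- s - 1)) = ennreal (1 / s) * ennreal (t powr (- s - 1))"
     using s by (intro ennreal_mult) auto
    then show "(if 0 < \<eta> \<and> \<eta> < t then ennreal (1 / s * t powr (- s - 1)) * q \<eta> else 0)
     = (ennreal (1 / s) * q \<eta>) * (if \<eta> < t then ennreal (t powr (- s - 1)) else 0)"
     using True by (cases "\<eta> < t") (simp_all only: simp_thms if_True if_False mult_zero_right mult_zero_left mult_ac)
   qed
   also have "\<dots> = (ennreal (1 / s) * q \<eta>) * ennreal (\<eta> powr (- s) / s)"
    by (subst nn_integral_cmult) (auto simp: nn_integral_powr_to_inf[OF s True])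
   also have "\<dots> = ennreal (1 / s * (\<eta> powr (1 - s) * (g \<eta>)^2) * (\<eta> powr (- s) / s))"
    unfolding q_def using s by (simp add: ennreal_mult[symmetric] del: ennreal_mult')
   also have "1 / s * (\<eta> powr (1 - s) * (g \<eta>)^2) * (\<eta> powr (- s) / s) = 1 / s^2 * ((\<eta> powr (1 - s) * \<eta> powr (- s)) * (g \<eta>)^2)"
    by (simp add: power2_eq_square)
   also have "\<eta> powr (1 - s) * \<eta> powr (- s) = \<eta> powr (1 - 2 * s)" by (simp flip: powr_add)
   finally show ?thesis using True by (simp add: ennreal_mult[symmetric] del: ennreal_mult')
  qed simp
 qed
 also have "\<dots> = ennreal (1 / s^2) * (\<integral>\<^sup>+\<eta>\<in>{0<..}. ennreal (\<eta> powr (1 - 2 * s) * (g \<eta>)^2) \<partial>lborel)"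
  by (intro nn_integral_cmult) measurable
 finally show ?thesis .
qed

lemma ennreal_sqrt_square: "(ennreal_sqrt x)^2 = x"
proof (cases x)
 case (real r)
 then have "ennreal_sqrt x = ennreal (sqrt r)" by (simp add: ennreal_sqrt_def)
 then show ?thesis using real by (simp add: ennreal_power)
next
 case top
 then show ?thesis by (simp add: ennreal_sqrt_def power2_eq_square)
qed

lemma nn_integral_linear_combination:
 fixes p q :: ennreal
 assumes "f \<in> borel_measurable M" "g \<in> borel_measurable M"
 shows "(\<integral>\<^sup>+x. p * f x + q * g x \<partial>M) = p * (\<integral>\<^sup>+x. f x \<partial>M) + q * (\<integral>\<^sup>+x. g x \<partial>M)"
 using assms by (simp add: nn_integral_add nn_integral_cmult)

context cylinder
begin

lemma VX_L2:
 assumes "u \<in> VX"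
 shows "u \<in> L2 \<Omega>"
proof -
 have "u \<in> weighted_H1 (%_. 1) \<Omega>" using assms VX(2) by (auto simp: H10_def)
 note W = weighted_H1D[OF open\<Omega> this, simplified]
 show ?thesis using W(2,4) by (simp add: L2_def)
qed

text \<open>Half of the bound on the K-functional at \<open>t\<close> comes from comparing the trace with the slice at
  height \<open>t\<close>.\<close>

lemma trace_minus_slice:
 assumes U: "U \<in> T" and r: "rep U P Gx Gy" and t: "0 < t"
 shows "ennreal ((L2_norm \<Omega> (tr U - (%x. U (x, t))))^2)
  <= (\<integral>\<^sup>+x\<in>\<Omega>. (\<integral>\<^sup>+\<eta>. (if 0 < \<eta> \<and> \<eta> < t then ennreal \<bar>Gy (x, \<eta>)\<bar> else 0) \<partial>lborel)^2 \<partial>lborel)"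
proof -
 note r' = r[unfolded rep_def]
 define d where "d = tr U - (%x. U (x, t))"
 have "d \<in> VX" unfolding d_def tr_def using slice_in_VX[OF U] VX(1) by (intro subspace_diff) auto
 then have di: "integrable (lebesgue_on \<Omega>) (%x. (d x)^2)" using VX_L2 by (simp add: L2_def)
 have m: "(%x. (\<integral>\<^sup>+\<eta>. (if 0 < \<eta> \<and> \<eta> < t then ennreal \<bar>Gy (x, \<eta>)\<bar> else 0) \<partial>lborel)) \<in> borel_measurable borel"
 proof -
  have "Gy \<in> borel_measurable (borel \<Otimes>\<^sub>M borel)" using r' by (simp add: borel_prod)
  then have "(%(x, \<eta>). if 0 < \<eta> \<and> \<eta> < t then ennreal \<bar>Gy (x, \<eta>)\<bar> else 0) \<in> borel_measurable (borel \<Otimes>\<^sub>M lborel)" by measurable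
  then show ?thesis by (intro lborel.borel_measurable_nn_integral) simp
 qed
 have "ennreal ((L2_norm \<Omega> d)^2) = ennreal (LINT x|lebesgue_on \<Omega>. (d x)^2)"
  unfolding L2_norm_def L2_inner_def by (simp add: power2_eq_square[symmetric])
 also have "\<dots> = (\<integral>\<^sup>+x. ennreal ((d x)^2) \<partial>lebesgue_on \<Omega>)"
  using di by (intro nn_integral_eq_integral[symmetric]) auto
 also have "\<dots> <= (\<integral>\<^sup>+x. (\<integral>\<^sup>+\<eta>. (if 0 < \<eta> \<and> \<eta> < t then ennreal \<bar>Gy (x, \<eta>)\<bar> else 0) \<partial>lborel)^2 \<partial>lebesgue_on \<Omega>)"
 proof (rule nn_integral_mono_AE)
  have "AE x in lebesgue_on \<Omega>. \<forall>t>0. integrable lebesgue (%\<eta>. indicat_real {0<..<t} \<eta> * Gy (x, \<eta>)) \<and>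
    (LINT \<eta>|lebesgue. indicat_real {0<..<t} \<eta> * Gy (x, \<eta>)) = U (x, t) - U (x, 0)" using r' by auto
  then show "AE x in lebesgue_on \<Omega>. ennreal ((d x)^2) <= (\<integral>\<^sup>+\<eta>. (if 0 < \<eta> \<and> \<eta> < t then ennreal \<bar>Gy (x, \<eta>)\<bar> else 0) \<partial>lborel)^2"
  proof eventually_elim
   case (elim x)
   have I: "integrable lebesgue (%\<eta>. indicat_real {0<..<t} \<eta> * Gy (x, \<eta>))"
    and e: "(LINT \<eta>|lebesgue. indicat_real {0<..<t} \<eta> * Gy (x, \<eta>)) = U (x, t) - U (x, 0)" using elim t by auto
   have gm: "(%\<eta>. Gy (x, \<eta>)) \<in> borel_measurable borel"
    using r' by (auto intro!: measurable_compose[OF measurable_Pair1'] simp: borel_prod[symmetric])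
   have "ennreal \<bar>d x\<bar> = ennreal (norm (LINT \<eta>|lebesgue. indicat_real {0<..<t} \<eta> * Gy (x, \<eta>)))"
    unfolding e by (simp add: d_def tr_def abs_minus_commute)
   also have "\<dots> <= (\<integral>\<^sup>+\<eta>. ennreal (norm (indicat_real {0<..<t} \<eta> * Gy (x, \<eta>))) \<partial>lebesgue)"
    by (rule integral_norm_bound_ennreal[OF I])
   also have "\<dots> = (\<integral>\<^sup>+\<eta>. ennreal (norm (indicat_real {0<..<t} \<eta> * Gy (x, \<eta>))) \<partial>lborel)"
    by (rule nn_integral_completion)
   also have "\<dots> = (\<integral>\<^sup>+\<eta>. (if 0 < \<eta> \<and> \<eta> < t then ennreal \<bar>Gy (x, \<eta>)\<bar> else 0) \<partial>lborel)"
    by (intro nn_integral_cong) (auto simp: indicator_def)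
   finally have "(ennreal \<bar>d x\<bar>)^2 <= (\<integral>\<^sup>+\<eta>. (if 0 < \<eta> \<and> \<eta> < t then ennreal \<bar>Gy (x, \<eta>)\<bar> else 0) \<partial>lborel)^2"
    by (intro power_mono) auto
   then show ?case by (simp add: ennreal_power)
  qed
 qed
 also have "\<dots> = (\<integral>\<^sup>+x. (\<integral>\<^sup>+\<eta>. (if 0 < \<eta> \<and> \<eta> < t then ennreal \<bar>Gy (x, \<eta>)\<bar> else 0) \<partial>lborel)^2 * indicator \<Omega> x \<partial>lebesgue)"
  by (rule nn_integral_restrict_space) simp
 also have "\<dots> = (\<integral>\<^sup>+x\<in>\<Omega>. (\<integral>\<^sup>+\<eta>. (if 0 < \<eta> \<and> \<eta> < t then ennreal \<bar>Gy (x, \<eta>)\<bar> else 0) \<partial>lborel)^2 \<partial>lborel)"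
  by (rule nn_integral_completion)
 finally show ?thesis unfolding d_def .
qed

lemma K_functional_slice:
 assumes U: "U \<in> T" and t: "0 < t"
 shows "0 <= K_functional (L2_norm \<Omega>) (H10 \<Omega>) (H1_norm \<Omega>) t (tr U)"
  and "K_functional (L2_norm \<Omega>) (H10 \<Omega>) (H1_norm \<Omega>) t (tr U) <= L2_norm \<Omega> (tr U - (%x. U (x, t))) + t * H1_norm \<Omega> (%x. U (x, t))"
proof -
 have nn: "0 <= L2_norm \<Omega> v" "0 <= H1_norm \<Omega> v" for v
  unfolding L2_norm_def L2_inner_def H1_norm_def by (auto intro!: integral_nonneg_AE)
 have u: "(%x. U (x, t)) \<in> H10 \<Omega>" using slice_in_VX[OF U] VX(2) by blast
 have n: "0 <= L2_norm \<Omega> (tr U - v) + t * H1_norm \<Omega> v" for v using nn[of "tr U - v"] nn[of v] t by (intro add_nonneg_nonneg) auto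
 show "0 <= K_functional (L2_norm \<Omega>) (H10 \<Omega>) (H1_norm \<Omega>) t (tr U)"
  unfolding K_functional_def using u n by (intro cINF_greatest) auto
 show "K_functional (L2_norm \<Omega>) (H10 \<Omega>) (H1_norm \<Omega>) t (tr U) <= L2_norm \<Omega> (tr U - (%x. U (x, t))) + t * H1_norm \<Omega> (%x. U (x, t))"
  unfolding K_functional_def using u n by (intro cINF_lower) (auto intro!: bdd_belowI2[of _ 0])
qed

text \<open>The slice at height \<open>t\<close> is an admissible element of the smoother space in the K-functional at \<open>t\<close>, and
  the weights \<open>t powr (- 2 s - 1)\<close> and \<open>t\<^sup>2\<close> combine to that of the energy.\<close>

theorem trace_inequality:
 assumes U: "U \<in> T"
 shows "(Htilde_norm \<Omega> s (tr U))^2 <= ennreal ((2 / s^2 + 2 * (1 + 16 * R^2)) * energy_norm2 U)"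
proof -
 obtain P Gx Gy where r: "rep U P Gx Gy" using rep_exists[OF U] by blast
 note r' = r[unfolded rep_def]
 define H where "H = (%x t. (\<integral>\<^sup>+\<eta>. (if 0 < \<eta> \<and> \<eta> < t then ennreal \<bar>Gy (x, \<eta>)\<bar> else 0) \<partial>lborel))"
 define L where "L = (LINT z|MC. wt z * (norm (Gx z))^2)"
 define V where "V = (LINT z|MC. wt z * (Gy z)^2)"
 let ?K = "%t. K_functional (L2_norm \<Omega>) (H10 \<Omega>) (H1_norm \<Omega>) t (tr U)"
 have Gm: "Gx \<in> borel_measurable (borel \<Otimes>\<^sub>M borel)" "Gy \<in> borel_measurable (borel \<Otimes>\<^sub>M borel)" using r' by (auto simp: borel_prod)
 have Om: "\<Omega> \<in> sets borel" by simp
 have Hm: "(%(x, t). H x t) \<in> borel_measurable (borel \<Otimes>\<^sub>M borel)"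
 proof -
  have "(%(p, \<eta>). if 0 < \<eta> \<and> \<eta> < snd p then ennreal \<bar>Gy (fst p, \<eta>)\<bar> else 0) \<in> borel_measurable ((borel \<Otimes>\<^sub>M borel) \<Otimes>\<^sub>M lborel)"
   using Gm(2) by measurable
  then have "(%p. \<integral>\<^sup>+\<eta>. (if 0 < \<eta> \<and> \<eta> < snd p then ennreal \<bar>Gy (fst p, \<eta>)\<bar> else 0) \<partial>lborel) \<in> borel_measurable (borel \<Otimes>\<^sub>M borel)"
   by (intro lborel.borel_measurable_nn_integral) simp
  then show ?thesis by (simp add: H_def case_prod_beta')
 qed
 have trL2: "tr U \<in> L2 \<Omega>" using VX_L2[OF slice_in_VX[OF U, of 0]] by (simp add: tr_def)
 have hx: "(%t. \<integral>\<^sup>+x\<in>\<Omega>. ennreal (t powr alpha s * (norm (Gx (x, t)))^2) \<partial>lborel) \<in> borel_measurable borel"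
 proof -
  have "(%(t, x). ennreal (t powr alpha s * (norm (Gx (x, t)))^2) * indicator \<Omega> x) \<in> borel_measurable (borel \<Otimes>\<^sub>M lborel)"
   using Gm(1) Om by measurable
  then show ?thesis by (intro lborel.borel_measurable_nn_integral) simp
 qed
 have hH: "(%(t, x). ennreal (t powr (- 2 * s - 1)) * (H x t)^2 * indicator \<Omega> x * indicator {0<..} t) \<in> borel_measurable (lborel \<Otimes>\<^sub>M lborel)"
 proof -
  have "(%(t, x). H x t) \<in> borel_measurable (borel \<Otimes>\<^sub>M borel)"
   using measurable_pair_swap[OF Hm] by (simp add: case_prod_beta')
  then have "(%(t, x). ennreal (t powr (- 2 * s - 1)) * (H x t)^2 * indicator \<Omega> x * indicator {0<..} t) \<in> borel_measurable (borel \<Otimes>\<^sub>M borel)"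
   using Om unfolding case_prod_beta' by measurable
  then show ?thesis by (simp add: lborel_prod borel_prod)
 qed
 have bound: "ennreal (t powr (- 2 * s) * (?K t)^2 / t) * indicator {0<..} t
  <= 2 * ((\<integral>\<^sup>+x. ennreal (t powr (- 2 * s - 1)) * (H x t)^2 * indicator \<Omega> x * indicator {0<..} t \<partial>lborel))
   + ennreal (2 * (1 + 16 * R^2)) * ((\<integral>\<^sup>+x\<in>\<Omega>. ennreal (t powr alpha s * (norm (Gx (x, t)))^2) \<partial>lborel) * indicator {0<..} t)" for t
 proof (cases "0 < t")
  case t: True
  define d where "d = L2_norm \<Omega> (tr U - (%x. U (x, t)))"
  define h where "h = H1_norm \<Omega> (%x. U (x, t))"
  have K: "0 <= ?K t" "?K t <= d + t * h" using K_functional_slice[OF U t] by (auto simp: d_def h_def)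
  have "(?K t)^2 <= (d + t * h)^2" using K by (intro power_mono) auto
  also have "\<dots> <= 2 * d^2 + 2 * (t * h)^2"
   using zero_le_power2[of "d - t * h"] by (simp add: power2_eq_square algebra_simps)
  finally have K2: "(?K t)^2 <= 2 * d^2 + 2 * t^2 * h^2" by (simp add: power_mult_distrib)
  have p1: "t powr (- 2 * s) / t = t powr (- 2 * s - 1)" using t by (simp add: powr_diff)
  have p2: "t powr (- 2 * s - 1) * t^2 = t powr alpha s"
  proof -
   have "t^2 = t powr 2" using t by simp
   then have "t powr (- 2 * s - 1) * t^2 = t powr (- 2 * s - 1 + 2)" by (simp only: powr_add)
   then show ?thesis by (simp add: alpha_def algebra_simps)
  qed
  have "t powr (- 2 * s) * (?K t)^2 / t = t powr (- 2 * s - 1) * (?K t)^2" unfolding p1[symmetric] by simp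
  also have "\<dots> <= t powr (- 2 * s - 1) * (2 * d^2 + 2 * t^2 * h^2)" by (intro mult_left_mono K2) auto
  also have "\<dots> = 2 * (t powr (- 2 * s - 1) * d^2) + 2 * ((t powr (- 2 * s - 1) * t^2) * h^2)" by (simp add: algebra_simps)
  also have "\<dots> = 2 * (t powr (- 2 * s - 1) * d^2) + 2 * (t powr alpha s * h^2)" unfolding p2 ..
  finally have "ennreal (t powr (- 2 * s) * (?K t)^2 / t) <= ennreal (2 * (t powr (- 2 * s - 1) * d^2) + 2 * (t powr alpha s * h^2))"
   by (rule ennreal_leI)
  also have "\<dots> = 2 * (ennreal (t powr (- 2 * s - 1)) * ennreal (d^2)) + 2 * (ennreal (t powr alpha s) * ennreal (h^2))"
   by (simp add: ennreal_mult)
  also have "\<dots> <= 2 * (ennreal (t powr (- 2 * s - 1)) * (\<integral>\<^sup>+x\<in>\<Omega>. (H x t)^2 \<partial>lborel))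
   + 2 * (ennreal (t powr alpha s) * (ennreal (1 + 16 * R^2) * (\<integral>\<^sup>+x\<in>\<Omega>. ennreal ((norm (Gx (x, t)))^2) \<partial>lborel)))"
   using trace_minus_slice[OF U r t] slice_norms(3)[OF U r t] unfolding d_def h_def H_def
   by (intro add_mono mult_left_mono) auto
  also have "ennreal (t powr (- 2 * s - 1)) * (\<integral>\<^sup>+x\<in>\<Omega>. (H x t)^2 \<partial>lborel)
   = (\<integral>\<^sup>+x. ennreal (t powr (- 2 * s - 1)) * (H x t)^2 * indicator \<Omega> x * indicator {0<..} t \<partial>lborel)"
  proof -
   have "(%x. H x t) \<in> borel_measurable borel" using measurable_compose[OF measurable_Pair2' Hm, of t] by simp
   then have "(%x. (H x t)^2 * indicator \<Omega> x) \<in> borel_measurable lborel"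
    unfolding power2_eq_square by (intro borel_times_indicator[OF _ Om] borel_measurable_times_ennreal)
   from nn_integral_cmult[OF this, of "ennreal (t powr (- 2 * s - 1))"] show ?thesis using t by (simp add: mult.assoc)
  qed
  also have "2 * (ennreal (t powr alpha s) * (ennreal (1 + 16 * R^2) * (\<integral>\<^sup>+x\<in>\<Omega>. ennreal ((norm (Gx (x, t)))^2) \<partial>lborel)))
   = ennreal (2 * (1 + 16 * R^2)) * (ennreal (t powr alpha s) * (\<integral>\<^sup>+x\<in>\<Omega>. ennreal ((norm (Gx (x, t)))^2) \<partial>lborel))"
  proof -
   have "ennreal (2 * (1 + 16 * R^2)) = 2 * ennreal (1 + 16 * R^2)" by (simp add: ennreal_mult)
   then show ?thesis by (simp only: mult_ac)
  qed
  also have "ennreal (t powr alpha s) * (\<integral>\<^sup>+x\<in>\<Omega>. ennreal ((norm (Gx (x, t)))^2) \<partial>lborel)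
   = (\<integral>\<^sup>+x\<in>\<Omega>. ennreal (t powr alpha s * (norm (Gx (x, t)))^2) \<partial>lborel)"
  proof -
   have "(%x. Gx (x, t)) \<in> borel_measurable borel" using measurable_compose[OF measurable_Pair2' Gm(1), of t] by simp
   then have "(%x. ennreal ((norm (Gx (x, t)))^2)) \<in> borel_measurable borel" by measurable
   then have "(%x. ennreal ((norm (Gx (x, t)))^2) * indicator \<Omega> x) \<in> borel_measurable lborel"
    by (rule borel_times_indicator[OF _ Om])
   from nn_integral_cmult[OF this, of "ennreal (t powr alpha s)"] show ?thesis by (simp add: ennreal_mult mult.assoc)
  qed
  finally show ?thesis using t by simp
 qed simp
 have "(Htilde_norm \<Omega> s (tr U))^2 = (\<integral>\<^sup>+t\<in>{0<..}. ennreal (t powr (- 2 * s) * (?K t)^2 / t) \<partial>lborel)"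
  unfolding Htilde_norm_def interp_norm_def using trL2 by (simp add: ennreal_sqrt_square)
 also have "\<dots> <= (\<integral>\<^sup>+t. 2 * ((\<integral>\<^sup>+x. ennreal (t powr (- 2 * s - 1)) * (H x t)^2 * indicator \<Omega> x * indicator {0<..} t \<partial>lborel))
   + ennreal (2 * (1 + 16 * R^2)) * ((\<integral>\<^sup>+x\<in>\<Omega>. ennreal (t powr alpha s * (norm (Gx (x, t)))^2) \<partial>lborel) * indicator {0<..} t) \<partial>lborel)"
  by (rule nn_integral_mono[OF bound])
 also have "\<dots> = 2 * (\<integral>\<^sup>+t. (\<integral>\<^sup>+x. ennreal (t powr (- 2 * s - 1)) * (H x t)^2 * indicator \<Omega> x * indicator {0<..} t \<partial>lborel) \<partial>lborel)
   + ennreal (2 * (1 + 16 * R^2)) * (\<integral>\<^sup>+t\<in>{0<..}. (\<integral>\<^sup>+x\<in>\<Omega>. ennreal (t powr alpha s * (norm (Gx (x, t)))^2) \<partial>lborel) \<partial>lborel)"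
 proof -
  have m1: "(%t. \<integral>\<^sup>+x. ennreal (t powr (- 2 * s - 1)) * (H x t)^2 * indicator \<Omega> x * indicator {0<..} t \<partial>lborel) \<in> borel_measurable lborel"
   using hH by (intro lborel.borel_measurable_nn_integral) simp
  have m2: "(%t. (\<integral>\<^sup>+x\<in>\<Omega>. ennreal (t powr alpha s * (norm (Gx (x, t)))^2) \<partial>lborel) * indicator {0<..} t) \<in> borel_measurable lborel"
   by (rule borel_times_indicator[OF hx]) simp
  show ?thesis by (rule nn_integral_linear_combination[OF m1 m2])
 qed
 also have "(\<integral>\<^sup>+t\<in>{0<..}. (\<integral>\<^sup>+x\<in>\<Omega>. ennreal (t powr alpha s * (norm (Gx (x, t)))^2) \<partial>lborel) \<partial>lborel) = ennreal L"
  unfolding L_def using r' by (intro weighted_iterated(1)[symmetric]) auto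
 also have "(\<integral>\<^sup>+t. (\<integral>\<^sup>+x. ennreal (t powr (- 2 * s - 1)) * (H x t)^2 * indicator \<Omega> x * indicator {0<..} t \<partial>lborel) \<partial>lborel)
   = (\<integral>\<^sup>+x. (\<integral>\<^sup>+t. ennreal (t powr (- 2 * s - 1)) * (H x t)^2 * indicator \<Omega> x * indicator {0<..} t \<partial>lborel) \<partial>lborel)"
  by (rule lborel_pair.Fubini'[OF hH, symmetric])
 also have "\<dots> <= (\<integral>\<^sup>+x. ennreal (1 / s^2) * ((\<integral>\<^sup>+y\<in>{0<..}. ennreal (y powr alpha s * (Gy (x, y))^2) \<partial>lborel) * indicator \<Omega> x) \<partial>lborel)"
 proof (rule nn_integral_mono)
  fix x
  have gm: "(%\<eta>. Gy (x, \<eta>)) \<in> borel_measurable borel" using measurable_compose[OF measurable_Pair1' Gm(2), of x] by simp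
  show "(\<integral>\<^sup>+t. ennreal (t powr (- 2 * s - 1)) * (H x t)^2 * indicator \<Omega> x * indicator {0<..} t \<partial>lborel)
   <= ennreal (1 / s^2) * ((\<integral>\<^sup>+y\<in>{0<..}. ennreal (y powr alpha s * (Gy (x, y))^2) \<partial>lborel) * indicator \<Omega> x)"
   using Hardy_inequality[OF gm s(1)] unfolding H_def alpha_def
   by (cases "x \<in> \<Omega>") (auto simp: mult.assoc)
 qed
 also have "\<dots> = ennreal (1 / s^2) * (\<integral>\<^sup>+x\<in>\<Omega>. (\<integral>\<^sup>+y\<in>{0<..}. ennreal (y powr alpha s * (Gy (x, y))^2) \<partial>lborel) \<partial>lborel)"
 proof (rule nn_integral_cmult)
  have "(%(x, y). ennreal (y powr alpha s * (Gy (x, y))^2) * indicator {0<..} y) \<in> borel_measurable (borel \<Otimes>\<^sub>M lborel)"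
   using Gm(2) by measurable
  then have "(%x. \<integral>\<^sup>+y\<in>{0<..}. ennreal (y powr alpha s * (Gy (x, y))^2) \<partial>lborel) \<in> borel_measurable borel"
   by (intro lborel.borel_measurable_nn_integral) simp
  then show "(%x. (\<integral>\<^sup>+y\<in>{0<..}. ennreal (y powr alpha s * (Gy (x, y))^2) \<partial>lborel) * indicator \<Omega> x) \<in> borel_measurable lborel"
   by (rule borel_times_indicator[OF _ Om])
 qed
 also have "(\<integral>\<^sup>+x\<in>\<Omega>. (\<integral>\<^sup>+y\<in>{0<..}. ennreal (y powr alpha s * (Gy (x, y))^2) \<partial>lborel) \<partial>lborel) = ennreal V"
  unfolding V_def using r' by (intro weighted_iterated(2)[symmetric]) auto
 finally have "(Htilde_norm \<Omega> s (tr U))^2 <= 2 * (ennreal (1 / s^2) * ennreal V) + ennreal (2 * (1 + 16 * R^2)) * ennreal L"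
  by (simp add: add_mono mult_left_mono)
 also have "\<dots> = ennreal (2 / s^2 * V + 2 * (1 + 16 * R^2) * L)"
 proof -
  have "0 <= V" "0 <= L" unfolding V_def L_def by (auto intro!: integral_nonneg_AE)
  then show ?thesis by (simp add: ennreal_mult[symmetric] ennreal_plus[symmetric] ennreal_numeral[symmetric] del: ennreal_numeral ennreal_plus ennreal_mult')
 qed
 also have "\<dots> <= ennreal ((2 / s^2 + 2 * (1 + 16 * R^2)) * energy_norm2 U)"
 proof (rule ennreal_leI)
  have "0 <= V" "0 <= L" unfolding V_def L_def by (auto intro!: integral_nonneg_AE)
  moreover have "0 <= 2 / s^2" "0 <= 2 * (1 + 16 * R^2)" by auto
  ultimately have "0 <= 2 / s^2 * L" "0 <= 2 * (1 + 16 * R^2) * V" by (auto intro!: mult_nonneg_nonneg)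
  then show "2 / s^2 * V + 2 * (1 + 16 * R^2) * L <= (2 / s^2 + 2 * (1 + 16 * R^2)) * energy_norm2 U"
   unfolding energy_split[OF r] V_def[symmetric] L_def[symmetric] distrib_left distrib_right by linarith
 qed
 finally show ?thesis .
qed

end

section \<open>The discrete operators in an eigenbasis\<close>

lemma psd_form_subspace:
 assumes "psd_form W B" "subspace V" and VW: "V \<subseteq> W"
 shows "psd_form V B"
proof -
 interpret w: psd_form W B by (rule assms(1))
 show ?thesis
 proof
  show "subspace V" by (rule assms(2))
  fix x y z k
  show "B (x + y) z = B x z + B y z" if "x \<in> V" "y \<in> V" "z \<in> V"
   by (rule w.add) (use that VW in auto)
  show "B (k *\<^sub>R x) z = k * B x z" if "x \<in> V" "z \<in> V"
   by (rule w.scale) (use that VW in auto)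
  show "B x y = B y x" if "x \<in> V" "y \<in> V"
   by (rule w.sym) (use that VW in auto)
  show "0 <= B x x" if "x \<in> V"
   by (rule w.nonneg) (use that VW in auto)
 qed
qed

lemma finite_basis_of_subspace:
 fixes V :: "'v::real_vector set"
 assumes "finite S" "V \<subseteq> span S" "subspace V"
 shows "\<exists>B. finite B \<and> B \<subseteq> V \<and> span B = V"
proof -
 obtain B where B: "B \<subseteq> V" "independent B" "V \<subseteq> span B" "card B = dim V" by (rule basis_exists[of V])
 have "B \<subseteq> span S" using B(1) assms(2) by (rule order.trans)
 then have "finite B" using independent_span_bound[OF assms(1) B(2)] by simp
 moreover have "span B = V" by (rule equalityI[OF span_minimal[OF B(1) assms(3)] B(3)])
 ultimately show ?thesis using B(1) by (intro exI[of _ B] conjI)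
qed

lemma L2_product:
 assumes "u \<in> L2 \<Omega>" "v \<in> L2 \<Omega>"
 shows "integrable (lebesgue_on \<Omega>) (%x. u x * v x)"
proof (rule Bochner_Integration.integrable_bound)
 show "integrable (lebesgue_on \<Omega>) (%x. (u x)^2 + (v x)^2)" using assms by (auto simp: L2_def)
 show "(%x. u x * v x) \<in> borel_measurable (lebesgue_on \<Omega>)" using assms by (auto simp: L2_def)
 show "AE x in lebesgue_on \<Omega>. norm (u x * v x) <= norm ((u x)^2 + (v x)^2)"
 proof (rule AE_I2)
  fix x
  show "norm (u x * v x) <= norm ((u x)^2 + (v x)^2)"
   using Young[of "u x" "v x"] unfolding real_norm_def by (rule order.trans[OF _ abs_ge_self])
 qed
qed

lemma L2_subspace: "subspace (L2 \<Omega>)"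
proof (rule subspaceI)
 show "0 \<in> L2 \<Omega>" by (simp add: L2_def zero_fun_def)
next
 fix u v assume uv: "u \<in> L2 \<Omega>" "v \<in> L2 \<Omega>"
 have e: "((u + v) x)^2 = (u x)^2 + 2 * (u x * v x) + (v x)^2" for x by (simp add: power2_eq_square algebra_simps)
 have "u + v \<in> borel_measurable (lebesgue_on \<Omega>)" using uv unfolding plus_fun_def by (auto simp: L2_def)
 then show "u + v \<in> L2 \<Omega>" using uv L2_product[OF uv] unfolding L2_def mem_Collect_eq e by auto
next
 fix k and u :: "'a => real" assume u: "u \<in> L2 \<Omega>"
 have e: "((k *\<^sub>R u) x)^2 = k^2 * (u x)^2" for x by (simp add: scaleR_fun_def power_mult_distrib)
 have "k *\<^sub>R u \<in> borel_measurable (lebesgue_on \<Omega>)" using u unfolding scaleR_fun_def by (auto simp: L2_def)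
 then show "k *\<^sub>R u \<in> L2 \<Omega>" using u unfolding L2_def mem_Collect_eq e by auto
qed

lemma L2_psd: "psd_form (L2 \<Omega>) (L2_inner \<Omega>)"
proof
 show "subspace (L2 \<Omega>)" by (rule L2_subspace)
next
 fix u v w assume "u \<in> L2 \<Omega>" "v \<in> L2 \<Omega>" "w \<in> L2 \<Omega>"
 then show "L2_inner \<Omega> (u + v) w = L2_inner \<Omega> u w + L2_inner \<Omega> v w"
  unfolding L2_inner_def by (simp add: distrib_right L2_product)
next
 fix k and u v :: "'a => real"
 show "L2_inner \<Omega> (k *\<^sub>R u) v = k * L2_inner \<Omega> u v"
  unfolding L2_inner_def by (simp add: scaleR_fun_def mult.assoc)
next
 fix u v :: "'a => real"
 show "L2_inner \<Omega> u v = L2_inner \<Omega> v u" unfolding L2_inner_def by (simp add: mult.commute)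
next
 fix u :: "'a => real"
 show "0 <= L2_inner \<Omega> u u" unfolding L2_inner_def by (auto intro!: integral_nonneg_AE)
qed

lemma L2_norm_square: "(L2_norm \<Omega> u)^2 = L2_inner \<Omega> u u" "0 <= L2_norm \<Omega> u"
proof -
 have "0 <= L2_inner \<Omega> u u" unfolding L2_inner_def by (auto intro!: integral_nonneg_AE)
 then show "(L2_norm \<Omega> u)^2 = L2_inner \<Omega> u u" "0 <= L2_norm \<Omega> u" by (simp_all add: L2_norm_def)
qed

lemma L2_Cauchy_Schwarz:
 assumes "u \<in> L2 \<Omega>" "v \<in> L2 \<Omega>"
 shows "\<bar>L2_inner \<Omega> u v\<bar> <= L2_norm \<Omega> u * L2_norm \<Omega> v"
proof -
 have "(L2_inner \<Omega> u v)^2 <= (L2_norm \<Omega> u * L2_norm \<Omega> v)^2"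
  using psd_form.Cauchy_Schwarz[OF L2_psd assms] by (simp add: power_mult_distrib L2_norm_square)
 then show ?thesis using L2_norm_square(2) by (metis abs_le_square_iff abs_of_nonneg mult_nonneg_nonneg)
qed

lemma has_L2_derivative_inner:
 assumes d: "has_L2_derivative \<Omega> u u' t J" and u: "\<And>\<tau>. \<tau> \<in> J ==> u \<tau> \<in> L2 \<Omega>" and t: "t \<in> J"
  and u': "u' \<in> L2 \<Omega>" and v: "v \<in> L2 \<Omega>"
 shows "((%\<tau>. L2_inner \<Omega> (u \<tau>) v) has_real_derivative L2_inner \<Omega> u' v) (at t within J)"
proof -
 interpret psd_form "L2 \<Omega>" "L2_inner \<Omega>" by (rule L2_psd)
 define q where "q = (%\<tau>. (u \<tau> - u t) /\<^sub>R (\<tau> - t) - u')"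
 have "((%\<tau>. L2_norm \<Omega> (q \<tau>) * L2_norm \<Omega> v) \<longlongrightarrow> 0 * L2_norm \<Omega> v) (at t within J)"
  using d unfolding has_L2_derivative_def q_def by (intro tendsto_mult tendsto_const)
 then have lim: "((%\<tau>. L2_norm \<Omega> (q \<tau>) * L2_norm \<Omega> v) \<longlongrightarrow> 0) (at t within J)" by simp
 have ev: "\<forall>\<^sub>F \<tau> in at t within J. norm ((L2_inner \<Omega> (u \<tau>) v - L2_inner \<Omega> (u t) v) / (\<tau> - t) - L2_inner \<Omega> u' v) <= L2_norm \<Omega> (q \<tau>) * L2_norm \<Omega> v"
  unfolding eventually_at_filter
 proof (intro always_eventually allI impI)
  fix \<tau> assume "\<tau> \<noteq> t" "\<tau> \<in> J"
  then have W: "u \<tau> \<in> L2 \<Omega>" "u t \<in> L2 \<Omega>" "q \<tau> \<in> L2 \<Omega>" using u t u' by (auto simp: q_def)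
  have "L2_inner \<Omega> (q \<tau>) v = (L2_inner \<Omega> (u \<tau>) v - L2_inner \<Omega> (u t) v) / (\<tau> - t) - L2_inner \<Omega> u' v"
   unfolding q_def using W u' v by (simp add: diff scale divide_inverse mult.commute)
  then show "norm ((L2_inner \<Omega> (u \<tau>) v - L2_inner \<Omega> (u t) v) / (\<tau> - t) - L2_inner \<Omega> u' v) <= L2_norm \<Omega> (q \<tau>) * L2_norm \<Omega> v"
   using L2_Cauchy_Schwarz[OF W(3) v] by simp
 qed
 have "((%\<tau>. (L2_inner \<Omega> (u \<tau>) v - L2_inner \<Omega> (u t) v) / (\<tau> - t) - L2_inner \<Omega> u' v) \<longlongrightarrow> 0) (at t within J)"
  by (rule Lim_null_comparison[OF ev lim])
 then show ?thesis by (simp add: has_field_derivative_iff Lim_null[symmetric])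
qed

context cylinder
begin

abbreviation "lift \<equiv> lifting \<Omega> A c s VX VY"
abbreviation "ip \<equiv> L2_inner \<Omega>"

lemma tr_linear: "tr (U + V) = tr U + tr V" "tr (k *\<^sub>R U) = k *\<^sub>R tr U" "tr (U - V) = tr U - tr V" "tr 0 = 0"
 by (auto simp: tr_def fun_eq_iff scaleR_fun_def)

lemma tr_in_VX: "U \<in> T ==> tr U \<in> VX"
 using slice_in_VX[of U 0] by (simp add: tr_def)

lemma VX_finite: "\<exists>B. finite B \<and> span B = VX"
 using spaces by (auto simp: discrete_spaces_def finite_dim_def)

lemma T_finite: "\<exists>S. finite S \<and> T \<subseteq> span S"
proof -
 obtain BX where BX: "finite BX" "span BX = VX" using VX_finite by blast
 obtain BY where BY: "finite BY" "span BY = VY" using spaces by (auto simp: discrete_spaces_def finite_dim_def)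
 let ?S = "(%(v, w). %(x, y). v x * w y) ` (BX \<times> BY)"
 have "(%(x, y). v x * w y) \<in> span ?S" if v: "v \<in> span BX" and w: "w \<in> span BY" for v w
  using v
 proof (induction rule: span_induct_alt)
  case base
  have "(%(x, y). (0 :: real^'n => real) x * w y) = 0" by (auto simp: fun_eq_iff)
  then show ?case by (metis span_zero)
 next
  case (step k b v)
  have 1: "(%(x, y). b x * w y) \<in> span ?S"
   using w
  proof (induction rule: span_induct_alt)
   case base
   have "(%(x, y). b x * (0 :: real => real) y) = 0" by (auto simp: fun_eq_iff)
   then show ?case by (metis span_zero)
  next
   case (step k' b' w)
   have "(%(x, y). b x * (k' *\<^sub>R b' + w) y) = k' *\<^sub>R (%(x, y). b x * b' y) + (%(x, y). b x * w y)"
    by (auto simp: fun_eq_iff scaleR_fun_def algebra_simps)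
   moreover have "(%(x, y). b x * b' y) \<in> span ?S" using step \<open>b \<in> BX\<close> by (intro span_base) auto
   ultimately show ?case using step by (metis span_add span_scale)
  qed
  have "(%(x, y). (k *\<^sub>R b + v) x * w y) = k *\<^sub>R (%(x, y). b x * w y) + (%(x, y). v x * w y)"
   by (auto simp: fun_eq_iff scaleR_fun_def algebra_simps)
  then show ?case using step 1 by (metis span_add span_scale)
 qed
 then have "T \<subseteq> span ?S" unfolding tensor_def BX(2)[symmetric] BY(2)[symmetric] by (intro span_minimal) auto
 moreover have "finite ?S" using BX BY by auto
 ultimately show ?thesis by blast
qed

text \<open>Subtract from any extension its \<open>a\<close>-projection onto the functions with vanishing trace.\<close>

lemma lifting_exists:
 assumes u: "u \<in> VX"
 shows "\<exists>U. U \<in> T \<and> tr U = u \<and> (\<forall>V\<in>T. tr V = 0 \<longrightarrow> a U V = 0)"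
proof -
 interpret psd_form T a by (rule psd_form_A)
 obtain v0 where v0: "v0 \<in> VY" "v0 0 = 1" using spaces by (auto simp: discrete_spaces_def)
 define U0 where "U0 = (%(x, y). u x * v0 y)"
 have U0: "U0 \<in> T" unfolding tensor_def U0_def using u v0 by (intro span_base) auto
 have trU0: "tr U0 = u" using v0 by (auto simp: tr_def U0_def)
 define N where "N = {V \<in> T. tr V = 0}"
 have N: "subspace N" "N \<subseteq> T"
  unfolding N_def using T_subspace by (auto simp: subspace_def tr_linear)
 obtain S where "finite S" "T \<subseteq> span S" using T_finite by blast
 then obtain B where B: "finite B" "B \<subseteq> N" "span B = N" using finite_basis_of_subspace[of S N] N by blast
 obtain p where p: "p \<in> N" "\<forall>v\<in>N. a (U0 - p) v = 0"
  using projection_onto_span[of B U0] B N U0 by auto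
 then have "U0 - p \<in> T" "tr (U0 - p) = u" using U0 trU0 by (auto simp: N_def tr_linear)
 then show ?thesis using p(2) by (intro exI[of _ "U0 - p"]) (auto simp: N_def)
qed

lemma lift:
 assumes "u \<in> VX"
 shows "lift u \<in> T" "tr (lift u) = u" "\<And>V. V \<in> T ==> tr V = 0 ==> a (lift u) V = 0"
 using someI_ex[OF lifting_exists[OF assms]] unfolding lifting_def by auto

lemma d_pos: "0 < d_const s"
 using s Gamma_real_pos[of s] Gamma_real_pos[of "1 - s"] by (simp add: d_const_def)

text \<open>The form of the discrete fractional operator.\<close>

definition ah :: "(real^'n => real) => (real^'n => real) => real" where
 "ah u v = a (lift u) (lift v) / d_const s"

text \<open>Testing with a lifting only sees the trace, by the defining orthogonality of liftings.\<close>

lemma form_with_lift: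
 assumes U: "U \<in> T" and e: "e \<in> VX"
 shows "a U (lift e) = d_const s * ah (tr U) e"
proof -
 interpret psd_form T a by (rule psd_form_A)
 note le = lift[OF e] and lu = lift[OF tr_in_VX[OF U]]
 have Z: "U - lift (tr U) \<in> T" "tr (U - lift (tr U)) = 0" using U lu by (auto simp: tr_linear)
 have "a (U - lift (tr U)) (lift e) = 0" using le(3)[OF Z] sym[OF Z(1) le(1)] by simp
 then show ?thesis using U lu le d_pos by (simp add: diff ah_def)
qed

lemma ah_psd: "psd_form VX ah"
proof -
 interpret psd_form T a by (rule psd_form_A)
 show ?thesis
 proof
  show "subspace VX" by (rule VX(1))
 next
  fix u v w assume uvw: "u \<in> VX" "v \<in> VX" "w \<in> VX"
  have "a (lift u + lift v) (lift w) = d_const s * ah (u + v) w"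
   using form_with_lift[of "lift u + lift v" w] uvw lift by (simp add: tr_linear)
  moreover have "a (lift u + lift v) (lift w) = d_const s * ah u w + d_const s * ah v w"
   using uvw lift d_pos by (simp add: add ah_def)
  ultimately have "d_const s * ah (u + v) w = d_const s * (ah u w + ah v w)" by (simp add: distrib_left)
  then show "ah (u + v) w = ah u w + ah v w" using d_pos by simp
 next
  fix k u v assume uv: "u \<in> VX" "v \<in> VX"
  have "a (k *\<^sub>R lift u) (lift v) = d_const s * ah (k *\<^sub>R u) v"
   using form_with_lift[of "k *\<^sub>R lift u" v] uv lift by (simp add: tr_linear)
  moreover have "a (k *\<^sub>R lift u) (lift v) = d_const s * (k * ah u v)"
   using uv lift d_pos by (simp add: scale ah_def)
  ultimately show "ah (k *\<^sub>R u) v = k * ah u v" using d_pos by simp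
 next
  fix u v assume "u \<in> VX" "v \<in> VX"
  then show "ah u v = ah v u" using lift by (simp add: ah_def sym[of "lift u" "lift v"])
 next
  fix u assume "u \<in> VX"
  then show "0 <= ah u u" using lift nonneg[of "lift u"] d_pos by (simp add: ah_def)
 qed
qed

lemma VX_sub_L2: "VX \<subseteq> L2 \<Omega>" using VX_L2 by blast

lemma VX_inner: "inner_form VX ip"
proof -
 interpret psd_form VX ip by (rule psd_form_subspace[OF L2_psd VX(1) VX_sub_L2])
 show ?thesis
 proof (rule inner_form.intro[OF psd_form_axioms], rule inner_form_axioms.intro)
  fix u assume u: "u \<in> VX" "ip u u = 0"
  have "integrable (lebesgue_on \<Omega>) (%x. u x * u x)" using VX_L2[OF u(1)] by (intro L2_product)
  then have "AE x in lebesgue_on \<Omega>. u x * u x = 0"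
   using u(2) unfolding L2_inner_def by (subst (asm) integral_nonneg_eq_0_iff_AE) auto
  then have "AE x in lebesgue_on \<Omega>. u x = 0" by eventually_elim simp
  then show "u = 0" by (rule VX(3)[OF u(1)])
 qed
qed

lemma eigenbasis:
 obtains E where "finite E" "E \<subseteq> VX" "span E = VX" "psd_form.orthonormal (L2 \<Omega>) ip E"
  "psd_form.orthonormal VX ip E" "\<And>e v. e \<in> E ==> v \<in> VX ==> ah e v = ah e e * ip e v"
proof -
 interpret i: inner_form VX ip by (rule VX_inner)
 interpret l: psd_form "L2 \<Omega>" ip by (rule L2_psd)
 obtain B where B: "finite B" "span B = VX" using VX_finite by blast
 then obtain E where E: "i.orthonormal E" "span E = VX" "\<forall>e\<in>E. \<forall>v\<in>VX. ah e v = ah e e * ip e v"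
  using i.simultaneous_diagonalisation[OF B(1) _ ah_psd] by auto
 have "l.orthonormal E" using E(1) VX_sub_L2 unfolding i.orthonormal_def l.orthonormal_def by blast
 then show ?thesis using E that[of E] unfolding i.orthonormal_def by blast
qed

lemma energy_in_eigenbasis:
 assumes E: "psd_form.orthonormal VX ip E" "span E = VX" "\<And>e v. e \<in> E ==> v \<in> VX ==> ah e v = ah e e * ip e v"
  and u: "u \<in> VX"
 shows "ah u u = (\<Sum>e\<in>E. ah e e * (ip u e)^2)"
proof -
 interpret i: inner_form VX ip by (rule VX_inner)
 interpret h: psd_form VX ah by (rule ah_psd)
 have EV: "E \<subseteq> VX" using E(1) by (auto simp: i.orthonormal_def)
 have "ah u u = ah (\<Sum>e\<in>E. ip u e *\<^sub>R e) u" using i.orthonormal_expansion[OF E(1,2) u] by simp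
 also have "\<dots> = (\<Sum>e\<in>E. ah (ip u e *\<^sub>R e) u)" using EV u by (intro h.sum_left) auto
 also have "\<dots> = (\<Sum>e\<in>E. ah e e * (ip u e)^2)"
 proof (rule sum.cong[OF refl])
  fix e assume e: "e \<in> E"
  then have eV: "e \<in> VX" using EV by blast
  show "ah (ip u e *\<^sub>R e) u = ah e e * (ip u e)^2"
   using h.scale[OF eV u] E(3)[OF e u] i.sym[OF eV u] by (simp add: power2_eq_square)
 qed
 finally show ?thesis .
qed

lemma Htilde_le_energy:
 assumes u: "u \<in> VX"
 shows "(Htilde_norm \<Omega> s u)^2 <= ennreal ((2 / s^2 + 2 * (1 + 16 * R^2)) * (d_const s / min \<kappa> 1) * ah u u)"
proof -
 note l = lift[OF u]
 define m where "m = min \<kappa> 1"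
 have m: "m > 0" using \<kappa> by (simp add: m_def)
 have "m * energy_norm2 (lift u) <= d_const s * ah u u"
  using form_coercive[OF l(1)] d_pos by (simp add: ah_def m_def)
 then have 1: "energy_norm2 (lift u) <= d_const s / m * ah u u"
  using m by (simp add: pos_le_divide_eq mult.commute)
 have "(Htilde_norm \<Omega> s (tr (lift u)))^2 <= ennreal ((2 / s^2 + 2 * (1 + 16 * R^2)) * energy_norm2 (lift u))"
  by (rule trace_inequality[OF l(1)])
 also have "\<dots> <= ennreal ((2 / s^2 + 2 * (1 + 16 * R^2)) * (d_const s / m * ah u u))"
  using 1 by (intro ennreal_leI mult_left_mono) (auto intro!: add_nonneg_nonneg)
 finally show ?thesis using l(2) by (simp add: m_def mult.assoc)
qed

lemma ah_le_VX_norm: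
 assumes u: "u \<in> VX"
 shows "ah u u <= (KA + 1 + Kc * (16 * R^2)) / d_const s * (VX_norm \<Omega> A c s VX VY u)^2"
 using form_bounded[OF lift(1)[OF u]] d_pos H1ring_norm_square(1)[of "lift u"]
 by (simp add: ah_def VX_norm_def divide_right_mono)

lemma Lh_inner:
 assumes u: "u \<in> VX" and v: "v \<in> VX"
 shows "Lh \<Omega> A c s VX VY u \<in> VX" "ip (Lh \<Omega> A c s VX VY u) v = ah u v"
proof -
 interpret i: inner_form VX ip by (rule VX_inner)
 interpret h: psd_form VX ah by (rule ah_psd)
 obtain B where B: "finite B" "span B = VX" using VX_finite by blast
 have "\<exists>!w. w \<in> VX \<and> (\<forall>v\<in>VX. ip w v = ah u v)"
  using i.Riesz[OF B(1), of "ah u"] B(2) h.add_right h.scale_right u by auto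
 from theI'[OF this] show "Lh \<Omega> A c s VX VY u \<in> VX" "ip (Lh \<Omega> A c s VX VY u) v = ah u v"
  using v unfolding Lh_def ah_def by auto
qed

lemma projection_inner:
 assumes g: "g \<in> L2 \<Omega>" and v: "v \<in> VX"
 shows "L2_projection \<Omega> VX g \<in> VX" "ip (L2_projection \<Omega> VX g) v = ip g v"
proof -
 interpret i: inner_form VX ip by (rule VX_inner)
 interpret l: psd_form "L2 \<Omega>" ip by (rule L2_psd)
 obtain B where B: "finite B" "span B = VX" using VX_finite by blast
 have "\<exists>!w. w \<in> VX \<and> (\<forall>v\<in>VX. ip w v = ip g v)"
  using i.Riesz[OF B(1), of "ip g"] B(2) l.add_right l.scale_right g VX_L2 by auto
 from theI'[OF this] show "L2_projection \<Omega> VX g \<in> VX" "ip (L2_projection \<Omega> VX g) v = ip g v"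
  using v unfolding L2_projection_def by auto
qed

section \<open>The interpolation norm of the initial value\<close>

text \<open>The K-functional increases in \<open>\<tau>\<close>, so its value at \<open>\<tau>\<close> is controlled by the part of the norm
  integral over \<open>[\<tau>, 2\<tau>]\<close>.\<close>

lemma K_functional_bound:
 assumes u: "u \<in> VX" and N1: "\<And>v. 0 <= N1 v" and \<beta>: "0 < \<beta>" and C: "0 <= C"
  and norm: "interp_norm VX (L2_norm \<Omega>) VX N1 \<beta> u <= ennreal C" and \<tau>: "0 < \<tau>"
 shows "(K_functional (L2_norm \<Omega>) VX N1 \<tau> u)^2 <= 2 powr (2 * \<beta> + 1) * C^2 * \<tau> powr (2 * \<beta>)"
proof -
 let ?K = "%t. K_functional (L2_norm \<Omega>) VX N1 t u"
 have ne: "VX \<noteq> {}" using u by blast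
 have nn: "0 <= L2_norm \<Omega> (u - v) + t * N1 v" if "0 < t" for t v
  using L2_norm_square(2) N1 that by (intro add_nonneg_nonneg) auto
 have K0: "0 <= ?K t" if "0 < t" for t unfolding K_functional_def using nn[OF that] ne by (intro cINF_greatest) auto
 have mono: "?K \<tau> <= ?K t" if "\<tau> <= t" for t
  unfolding K_functional_def
 proof (rule cINF_mono[OF ne])
  show "bdd_below ((%v. L2_norm \<Omega> (u - v) + \<tau> * N1 v) ` VX)" using nn[OF \<tau>] by (intro bdd_belowI2[of _ 0])
  show "\<exists>w\<in>VX. L2_norm \<Omega> (u - w) + \<tau> * N1 w <= L2_norm \<Omega> (u - v) + t * N1 v" if "v \<in> VX" for v
   using that \<open>\<tau> <= t\<close> N1 by (intro bexI[of _ v]) (auto intro: mult_right_mono)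
 qed
 define I where "I = (\<integral>\<^sup>+ t\<in>{0<..}. ennreal (t powr (-2 * \<beta>) * (?K t)^2 / t) \<partial>lborel)"
 have "ennreal_sqrt I <= ennreal C" using norm u by (simp add: interp_norm_def I_def)
 then have "(ennreal_sqrt I)^2 <= (ennreal C)^2" by (intro power_mono) auto
 then have I: "I <= ennreal (C^2)" using C by (simp add: ennreal_sqrt_square ennreal_power)
 define q where "q = (2 * \<tau>) powr (- 2 * \<beta> - 1) * (?K \<tau>)^2"
 have q0: "0 <= q" by (simp add: q_def)
 have "ennreal (q * \<tau>) = (\<integral>\<^sup>+ t\<in>{\<tau>..2 * \<tau>}. ennreal q \<partial>lborel)"
  using \<tau> q0 by (simp add: nn_integral_cmult_indicator ennreal_mult)
 also have "\<dots> <= I" unfolding I_def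
 proof (rule nn_integral_mono)
  fix t
  show "ennreal q * indicator {\<tau>..2 * \<tau>} t <= ennreal (t powr (-2 * \<beta>) * (?K t)^2 / t) * indicator {0<..} t"
  proof (cases "t \<in> {\<tau>..2 * \<tau>}")
   case True
   then have t: "0 < t" using \<tau> by auto
   have "q <= t powr (- 2 * \<beta> - 1) * (?K t)^2"
    unfolding q_def using True t \<beta> \<tau> mono K0[OF \<tau>] by (intro mult_mono powr_mono2' power_mono) auto
   also have "\<dots> = t powr (-2 * \<beta>) * (?K t)^2 / t" using t by (simp add: powr_diff)
   finally show ?thesis using True t by (simp add: ennreal_leI)
  qed simp
 qed
 finally have "ennreal (q * \<tau>) <= ennreal (C^2)" using I by (rule order.trans)
 then have le: "q * \<tau> <= C^2" by simp
 have "(2 * \<tau>) powr (- 2 * \<beta> - 1) * (2 * \<tau>) powr (2 * \<beta> + 1) = 1" using \<tau> by (simp flip: powr_add)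
 then have "(?K \<tau>)^2 = q * (2 * \<tau>) powr (2 * \<beta> + 1)" unfolding q_def by (simp add: mult_ac)
 also have "(2 * \<tau>) powr (2 * \<beta> + 1) = 2 powr (2 * \<beta> + 1) * (\<tau> powr (2 * \<beta>) * \<tau>)"
  using \<tau> by (simp add: powr_mult powr_add)
 finally have "(?K \<tau>)^2 = (q * \<tau>) * (2 powr (2 * \<beta> + 1) * \<tau> powr (2 * \<beta>))" by (simp add: mult_ac)
 also have "\<dots> <= C^2 * (2 powr (2 * \<beta> + 1) * \<tau> powr (2 * \<beta>))" using le by (intro mult_right_mono) auto
 finally show ?thesis by (simp add: mult_ac)
qed

definition init_const :: "real => real => real" where
 "init_const \<beta> C = (1 + (KA + 1 + Kc * (16 * R^2)) / d_const s) * (sqrt (2 powr (2 * \<beta> + 1)) * C + 1)^2"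

text \<open>An almost optimal element in the K-functional is the smooth part of the splitting.\<close>

lemma initial_splitting:
 assumes u: "u \<in> VX" and \<beta>: "0 < \<beta>" and C: "0 <= C" and norm: "VX_interp_norm \<Omega> A c s VX VY \<beta> u <= ennreal C" and \<tau>: "0 < \<tau>"
 shows "\<exists>v\<in>VX. (L2_norm \<Omega> (u - v))^2 + \<tau>^2 * ah v v <= init_const \<beta> C * \<tau> powr (2 * \<beta>)"
proof -
 let ?N = "VX_norm \<Omega> A c s VX VY"
 let ?K = "K_functional (L2_norm \<Omega>) VX ?N \<tau> u"
 have sqp: "(\<tau> powr \<beta>)^2 = \<tau> powr (2 * \<beta>)" using \<tau> by (simp add: power2_eq_square powr_add[symmetric])
 have N0: "0 <= ?N v" for v unfolding VX_norm_def by (rule H1ring_norm_square(2))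
 define D where "D = sqrt (2 powr (2 * \<beta> + 1)) * C + 1"
 define Q where "Q = (KA + 1 + Kc * (16 * R^2)) / d_const s"
 have Q: "0 <= Q" unfolding Q_def using K0 d_pos by (intro divide_nonneg_pos add_nonneg_nonneg mult_nonneg_nonneg) auto
 have "?K^2 <= 2 powr (2 * \<beta> + 1) * C^2 * \<tau> powr (2 * \<beta>)"
  using norm by (intro K_functional_bound u N0 \<beta> C \<tau>) (simp add: VX_interp_norm_def)
 also have "\<dots> = (sqrt (2 powr (2 * \<beta> + 1)) * C * \<tau> powr \<beta>)^2"
  by (simp add: power_mult_distrib sqp)
 finally have "?K <= sqrt (2 powr (2 * \<beta> + 1)) * C * \<tau> powr \<beta>"
  using C by (intro power2_le_imp_le[of ?K]) auto
 also have "\<dots> < D * \<tau> powr \<beta>" using \<tau> by (simp add: D_def distrib_right)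
 finally have "?K < D * \<tau> powr \<beta>" .
 then have "\<exists>x\<in>(%v. L2_norm \<Omega> (u - v) + \<tau> * ?N v) ` VX. x < D * \<tau> powr \<beta>"
  unfolding K_functional_def using u by (intro cInf_lessD) auto
 then obtain v where v: "v \<in> VX" "L2_norm \<Omega> (u - v) + \<tau> * ?N v < D * \<tau> powr \<beta>" by blast
 have ic: "init_const \<beta> C = (1 + Q) * D^2" unfolding init_const_def D_def Q_def ..
 have D0: "0 <= D" using C by (simp add: D_def)
 have n: "0 <= L2_norm \<Omega> (u - v)" "0 <= \<tau> * ?N v" using L2_norm_square(2) N0 \<tau> by auto
 have sq: "(D * \<tau> powr \<beta>)^2 = D^2 * \<tau> powr (2 * \<beta>)" by (simp add: power_mult_distrib sqp)
 have 1: "(L2_norm \<Omega> (u - v))^2 <= D^2 * \<tau> powr (2 * \<beta>)" unfolding sq[symmetric] using v(2) n by (intro power_mono) auto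
 have "(\<tau> * ?N v)^2 <= D^2 * \<tau> powr (2 * \<beta>)" unfolding sq[symmetric] using v(2) n by (intro power_mono) auto
 then have "Q * (\<tau> * ?N v)^2 <= Q * (D^2 * \<tau> powr (2 * \<beta>))" using Q by (rule mult_left_mono)
 moreover have "\<tau>^2 * ah v v <= Q * (\<tau> * ?N v)^2"
  using mult_left_mono[OF ah_le_VX_norm[OF v(1)], of "\<tau>^2"] by (simp add: Q_def power_mult_distrib mult_ac)
 ultimately have 2: "\<tau>^2 * ah v v <= Q * (D^2 * \<tau> powr (2 * \<beta>))" by simp
 have "(L2_norm \<Omega> (u - v))^2 + \<tau>^2 * ah v v <= init_const \<beta> C * \<tau> powr (2 * \<beta>)"
  unfolding ic distrib_right mult_1 mult.assoc using 1 2 by linarith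
 then show ?thesis using v(1) by blast
qed

end

section \<open>Piecewise polynomials in time\<close>

lemma space_time_on_cell:
 fixes V :: "('b => real) set"
 assumes V: "subspace V" and U: "U \<in> space_time (pw_poly M \<tau> r) V" and j: "j \<in> {1..M}"
 shows "\<exists>W. (\<forall>k. W k \<in> V) \<and> (\<forall>t\<in>{\<tau> (j-1)<..<\<tau> j}. \<forall>z. U t z = (\<Sum>k\<le>r j. t ^ k * W k z))"
 using U unfolding space_time_def
proof (induction rule: span_induct_alt)
 case base
 then show ?case using subspace_0[OF V] by (intro exI[of _ "%_. 0"]) (simp add: zero_fun_def)
next
 case (step k x y)
 obtain p W0 where x: "x = (%t z. p t * W0 z)" "p \<in> pw_poly M \<tau> r" "W0 \<in> V" using step(1) by auto
 obtain q where q: "degree q <= r j" "\<And>t. t \<in> {\<tau> (j-1)<..<\<tau> j} ==> p t = poly q t"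
  using x(2) j unfolding pw_poly_def by blast
 obtain W where W: "\<And>i. W i \<in> V" "\<And>t z. t \<in> {\<tau> (j-1)<..<\<tau> j} ==> y t z = (\<Sum>i\<le>r j. t ^ i * W i z)"
  using step(2) by blast
 have pq: "poly q t = (\<Sum>i\<le>r j. coeff q i * t ^ i)" for t
  unfolding poly_altdef by (rule sum.mono_neutral_left) (use q(1) in \<open>auto intro: le_degree\<close>)
 show ?case
 proof (intro exI[of _ "%i. (k * coeff q i) *\<^sub>R W0 + W i"] conjI allI ballI)
  fix i show "(k * coeff q i) *\<^sub>R W0 + W i \<in> V" using V W x by (intro subspace_add subspace_scale) auto
 next
  fix t z assume t: "t \<in> {\<tau> (j-1)<..<\<tau> j}"
  show "(k *\<^sub>R x + y) t z = (\<Sum>i\<le>r j. t ^ i * ((k * coeff q i) *\<^sub>R W0 + W i) z)"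
   by (simp add: scaleR_fun_def x(1) q(2)[OF t] W(2)[OF t] pq sum_distrib_left sum_distrib_right
     distrib_left sum.distrib mult_ac)
 qed
qed

lemma cells_disjoint:
 fixes \<tau> :: "nat => real"
 assumes mono: "\<And>i j. i < j ==> \<tau> i < \<tau> j" and i: "i \<in> {1..M}" "i \<noteq> j" and j: "j \<in> {1..M}"
  and t: "t \<in> {\<tau> (i-1)<..<\<tau> i}"
 shows "t \<notin> {\<tau> (j-1)<..<\<tau> j}"
proof -
 have le: "\<tau> a <= \<tau> b" if "a <= b" for a b using that mono[of a b] by (cases "a = b") auto
 show ?thesis
 proof (cases "i < j")
  case True
  then have "\<tau> i <= \<tau> (j - 1)" by (intro le) auto
  then show ?thesis using t by auto
 next
  case False
  then have "\<tau> j <= \<tau> (i - 1)" using i by (intro le) auto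
  then show ?thesis using t by auto
 qed
qed

lemma cell_polynomial:
 assumes mono: "\<And>i j. i < j ==> \<tau> i < \<tau> j" and j: "j \<in> {1..M}" and q: "degree q <= r"
 shows "(%t. if t \<in> {\<tau> (j-1)<..<\<tau> j} then poly q t else 0) \<in> pw_poly M \<tau> (%_. r)"
 unfolding pw_poly_def mem_Collect_eq
proof (intro conjI ballI allI impI)
 fix i assume i: "i \<in> {1..M}"
 show "\<exists>q'. degree q' <= r \<and> (\<forall>t\<in>{\<tau> (i-1)<..<\<tau> i}. (if t \<in> {\<tau> (j-1)<..<\<tau> j} then poly q t else 0) = poly q' t)"
 proof (cases "i = j")
  case True
  then show ?thesis using q by (intro exI[of _ q]) auto
 next
  case False
  show ?thesis
  proof (intro exI[of _ "0 :: real poly"] conjI ballI)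
   show "degree (0 :: real poly) <= r" by simp
   show "(if t \<in> {\<tau> (j-1)<..<\<tau> j} then poly q t else 0) = poly 0 t" if "t \<in> {\<tau> (i-1)<..<\<tau> i}" for t
    by (simp only: poly_0 if_not_P[OF cells_disjoint[OF mono i False j that]])
  qed
 qed
qed (use j in auto)

lemma pw_poly_dim:
 assumes mono: "\<And>i j. i < j ==> \<tau> i < \<tau> j" and M: "1 <= M"
 shows "dim (pw_poly M \<tau> (%_. r)) <= M * (r + 1)" and "1 <= dim (pw_poly M \<tau> (%_. r))"
proof -
 define b where "b = (%(j, k) t. if t \<in> {\<tau> (j-1)<..<\<tau> j} then t ^ k else (0::real))"
 let ?S = "b ` ({1..M} \<times> {..r})"
 have sub: "pw_poly M \<tau> (%_. r) \<subseteq> span ?S"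
 proof
  fix p assume "p \<in> pw_poly M \<tau> (%_. r)"
  then have p: "\<And>j. j \<in> {1..M} ==> \<exists>q. degree q <= r \<and> (\<forall>t\<in>{\<tau> (j-1)<..<\<tau> j}. p t = poly q t)"
   and p0: "\<And>t. t \<notin> (\<Union>j\<in>{1..M}. {\<tau> (j-1)<..<\<tau> j}) ==> p t = 0" unfolding pw_poly_def by auto
  then obtain q where q: "\<And>j. j \<in> {1..M} ==> degree (q j) <= r"
   "\<And>j t. j \<in> {1..M} ==> t \<in> {\<tau> (j-1)<..<\<tau> j} ==> p t = poly (q j) t" by metis
  have pe: "p = (\<Sum>j\<in>{1..M}. \<Sum>k\<in>{..r}. coeff (q j) k *\<^sub>R b (j, k))"
  proof
   fix t
   have e: "(\<Sum>j\<in>{1..M}. \<Sum>k\<in>{..r}. coeff (q j) k *\<^sub>R b (j, k)) t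
     = (\<Sum>j\<in>{1..M}. if t \<in> {\<tau> (j-1)<..<\<tau> j} then poly (q j) t else 0)"
    unfolding sum_fun_apply
   proof (rule sum.cong[OF refl])
    fix j assume j: "j \<in> {1..M}"
    have "poly (q j) t = (\<Sum>i\<le>r. coeff (q j) i * t ^ i)"
     unfolding poly_altdef by (rule sum.mono_neutral_left) (use q(1)[OF j] in \<open>auto intro: le_degree\<close>)
    then have pq: "(\<Sum>k\<le>r. coeff (q j) k * t ^ k) = poly (q j) t" ..
    have bv: "b (j, k) t = (if t \<in> {\<tau> (j-1)<..<\<tau> j} then t ^ k else 0)" for k by (simp only: b_def prod.case)
    show "(\<Sum>k\<le>r. (coeff (q j) k *\<^sub>R b (j, k)) t) = (if t \<in> {\<tau> (j-1)<..<\<tau> j} then poly (q j) t else 0)"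
    proof (cases "t \<in> {\<tau> (j-1)<..<\<tau> j}")
     case True
     show ?thesis by (simp only: scaleR_fun_def bv if_P[OF True] real_scaleR_def pq)
    next
     case False
     show ?thesis by (simp only: scaleR_fun_def bv if_not_P[OF False] scaleR_zero_right sum.neutral_const)
    qed
   qed
   show "p t = (\<Sum>j\<in>{1..M}. \<Sum>k\<in>{..r}. coeff (q j) k *\<^sub>R b (j, k)) t"
   proof (cases "t \<in> (\<Union>j\<in>{1..M}. {\<tau> (j-1)<..<\<tau> j})")
    case True
    then obtain j where j: "j \<in> {1..M}" "t \<in> {\<tau> (j-1)<..<\<tau> j}" by blast
    have "(if t \<in> {\<tau> (i-1)<..<\<tau> i} then poly (q i) t else 0) = (if i = j then poly (q j) t else 0)" if i: "i \<in> {1..M}" for i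
    proof (cases "i = j")
     case False
     then show ?thesis using cells_disjoint[OF mono j(1) _ i j(2)] by auto
    qed (use j in auto)
    then have "(\<Sum>i\<in>{1..M}. if t \<in> {\<tau> (i-1)<..<\<tau> i} then poly (q i) t else 0) = (\<Sum>i\<in>{1..M}. if i = j then poly (q j) t else 0)"
     by (intro sum.cong) auto
    then show ?thesis unfolding e using j q(2) by simp
   next
    case False
    then have "(\<Sum>j\<in>{1..M}. if t \<in> {\<tau> (j-1)<..<\<tau> j} then poly (q j) t else 0) = 0" by (intro sum.neutral) auto
    then show ?thesis unfolding e using p0[OF False] by simp
   qed
  qed
  show "p \<in> span ?S" unfolding pe by (intro span_sum span_scale span_base imageI SigmaI)
 qed
 have fin: "finite ?S" by simp
 have "dim (pw_poly M \<tau> (%_. r)) <= card ?S" by (rule dim_le_card[OF sub fin])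
 also have "\<dots> <= card ({1..M} \<times> {..r})" by (rule card_image_le) simp
 finally show "dim (pw_poly M \<tau> (%_. r)) <= M * (r + 1)" by (simp add: card_cartesian_product)
 show "1 <= dim (pw_poly M \<tau> (%_. r))"
 proof (rule ccontr)
  assume "\<not> 1 <= dim (pw_poly M \<tau> (%_. r))"
  then have d0: "dim (pw_poly M \<tau> (%_. r)) = 0" by simp
  obtain B where B: "B \<subseteq> pw_poly M \<tau> (%_. r)" "independent B" "pw_poly M \<tau> (%_. r) \<subseteq> span B"
   "card B = dim (pw_poly M \<tau> (%_. r))" by (rule basis_exists)
  have "B \<subseteq> span ?S" using B(1) sub by (rule order.trans)
  then have "finite B" using independent_span_bound[OF fin B(2)] by simp
  then have "B = {}" using B(4) d0 by simp
  then have all: "p = 0" if "p \<in> pw_poly M \<tau> (%_. r)" for p using B(3) that by auto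
  define t where "t = (\<tau> 0 + \<tau> 1) / 2"
  have t: "t \<in> {\<tau> (1-1)<..<\<tau> 1}" using mono[of 0 1] by (auto simp: t_def)
  have "(%t. if t \<in> {\<tau> (1-1)<..<\<tau> 1} then poly [:1:] t else 0) \<in> pw_poly M \<tau> (%_. r)"
   using M by (intro cell_polynomial mono) auto
  from fun_cong[OF all[OF this], of t] show False using t by (simp add: zero_fun_def)
 qed
qed

lemma pderiv_sum_set: "pderiv (\<Sum>k\<in>A. p k) = (\<Sum>k\<in>A. pderiv (p k))"
 by (induction A rule: infinite_finite_induct) (simp_all add: pderiv_add)

lemma one_sided_limits:
 fixes u :: "real => 'b => real"
 assumes "a < b" "\<And>t x. t \<in> {a<..<b} ==> u t x = h t x" "\<And>x. continuous_on UNIV (%t. h t x)"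
 shows "lim_right u a = h a" "lim_left u b = h b"
proof -
 have c: "isCont (%t. h t x) t" for t x using assms(3)[of x] continuous_on_eq_continuous_at[OF open_UNIV] by blast
 show "lim_right u a = h a"
 proof
  fix x
  have "((%t. h t x) \<longlongrightarrow> h a x) (at_right a)"
   using c[where x=x and t=a] unfolding isCont_def by (rule tendsto_within_subset) simp
  moreover have "\<forall>\<^sub>F t in at_right a. h t x = u t x"
   unfolding eventually_at_right[OF assms(1)] using assms(1,2) by (intro exI[of _ b]) auto
  ultimately have "((%t. u t x) \<longlongrightarrow> h a x) (at_right a)" by (rule Lim_transform_eventually)
  then show "lim_right u a x = h a x" unfolding lim_right_def by (intro tendsto_Lim) auto
 qed
 show "lim_left u b = h b"
 proof
  fix x
  have "((%t. h t x) \<longlongrightarrow> h b x) (at_left b)"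
   using c[where x=x and t=b] unfolding isCont_def by (rule tendsto_within_subset) simp
  moreover have "\<forall>\<^sub>F t in at_left b. h t x = u t x"
   unfolding eventually_at_left[OF assms(1)] using assms(1,2) by (intro exI[of _ a]) auto
  ultimately have "((%t. u t x) \<longlongrightarrow> h b x) (at_left b)" by (rule Lim_transform_eventually)
  then show "lim_left u b x = h b x" unfolding lim_left_def by (intro tendsto_Lim) auto
 qed
qed

lemma integral_open_cell:
 fixes f :: "real => real"
 assumes "continuous_on {a..b} f"
 shows "(LINT t|lebesgue_on {a<..<b}. f t) = integral {a..b} f"
proof -
 have "f absolutely_integrable_on {a..b}" using assms by (rule absolutely_integrable_continuous_real)
 then have "f absolutely_integrable_on {a<..<b}" by (rule set_integrable_subset) auto
 then have "integrable (lebesgue_on {a<..<b}) f" by (rule absolutely_integrable_imp_integrable) simp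
 then show ?thesis by (simp add: lebesgue_integral_eq_integral integral_open_interval_real)
qed

section \<open>The discontinuous Galerkin equations in the eigenbasis\<close>

context cylinder
begin

lemma ip_scale_right: "ip u (k *\<^sub>R v) = k * ip u v"
 unfolding L2_inner_def by (simp add: scaleR_fun_def mult.left_commute)

lemma traces_on_cell:
 fixes U :: "real => (real^'n) \<times> real => real"
 assumes ab: "\<alpha> < \<beta>" and W: "\<And>k. W k \<in> T" and U: "\<And>t z. t \<in> {\<alpha><..<\<beta>} ==> U t z = (\<Sum>k\<le>r. t ^ k * W k z)"
  and e: "e \<in> VX"
 defines "P \<equiv> \<Sum>k\<le>r. monom (ip (tr (W k)) e) k"
 shows "t \<in> {\<alpha><..<\<beta>} ==> U t \<in> T"
  and "t \<in> {\<alpha><..<\<beta>} ==> ip (tr (U t)) e = poly P t"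
  and "t \<in> {\<alpha><..<\<beta>} ==> ip (tr (time_deriv U t)) e = poly (pderiv P) t"
  and "lim_right (%t. tr (U t)) \<alpha> \<in> VX" "ip (lim_right (%t. tr (U t)) \<alpha>) e = poly P \<alpha>"
  and "lim_left (%t. tr (U t)) \<beta> \<in> VX" "ip (lim_left (%t. tr (U t)) \<beta>) e = poly P \<beta>"
proof -
 interpret v: inner_form VX ip by (rule VX_inner)
 have trW: "tr (W k) \<in> VX" for k using W by (rule tr_in_VX)
 have inVX: "(\<Sum>k\<le>r. c k *\<^sub>R tr (W k)) \<in> VX" for c
  using trW VX(1) by (intro subspace_sum subspace_scale) auto
 have lin: "ip (\<Sum>k\<le>r. c k *\<^sub>R tr (W k)) e = (\<Sum>k\<le>r. c k * ip (tr (W k)) e)" for c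
  using trW e by (subst v.sum_left) (auto simp: v.scale subspace_scale[OF VX(1)])
 have pP: "poly P t = (\<Sum>k\<le>r. t ^ k * ip (tr (W k)) e)" for t
  by (simp add: P_def poly_sum poly_monom mult.commute)
 have dP: "poly (pderiv P) t = (\<Sum>k\<le>r. (real k * t ^ (k - 1)) * ip (tr (W k)) e)" for t
  by (simp add: P_def pderiv_sum_set pderiv_monom poly_sum poly_monom mult_ac)
 have Ut: "U t = (\<Sum>k\<le>r. t ^ k *\<^sub>R W k)" if "t \<in> {\<alpha><..<\<beta>}" for t
  using U[OF that] by (auto simp: fun_eq_iff sum_fun_apply scaleR_fun_def)
 show "U t \<in> T" if "t \<in> {\<alpha><..<\<beta>}" for t
  unfolding Ut[OF that] using W T_subspace by (intro subspace_sum subspace_scale) auto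
 have trU: "tr (U t) = (\<Sum>k\<le>r. t ^ k *\<^sub>R tr (W k))" if "t \<in> {\<alpha><..<\<beta>}" for t
  using U[OF that] by (auto simp: fun_eq_iff sum_fun_apply scaleR_fun_def tr_def)
 show "ip (tr (U t)) e = poly P t" if "t \<in> {\<alpha><..<\<beta>}" for t
  unfolding trU[OF that] lin pP ..
 show "ip (tr (time_deriv U t)) e = poly (pderiv P) t" if t: "t \<in> {\<alpha><..<\<beta>}" for t
 proof -
  have "tr (time_deriv U t) = (\<Sum>k\<le>r. (real k * t ^ (k - 1)) *\<^sub>R tr (W k))"
  proof
   fix x
   define Q where "Q = (\<Sum>k\<le>r. monom (W k (x, 0)) k)"
   have "\<forall>\<^sub>F \<eta> in nhds t. \<eta> \<in> {\<alpha><..<\<beta>}" using t by (intro eventually_nhds_in_open) auto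
   then have "\<forall>\<^sub>F \<eta> in nhds t. U \<eta> (x, 0) = poly Q \<eta>"
    by eventually_elim (simp add: U Q_def poly_sum poly_monom mult.commute)
   then have "deriv (%\<eta>. U \<eta> (x, 0)) t = deriv (poly Q) t" by (rule deriv_cong_ev) simp
   also have "\<dots> = poly (pderiv Q) t" by (intro DERIV_imp_deriv poly_DERIV)
   finally show "tr (time_deriv U t) x = (\<Sum>k\<le>r. (real k * t ^ (k - 1)) *\<^sub>R tr (W k)) x"
    by (simp add: tr_def time_deriv_def sum_fun_apply scaleR_fun_def Q_def pderiv_sum_set pderiv_monom poly_sum poly_monom mult_ac)
  qed
  then show ?thesis unfolding dP by (simp only: lin)
 qed
 define h where "h = (%t. \<Sum>k\<le>r. t ^ k *\<^sub>R tr (W k))"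
 have hx: "h t x = (\<Sum>k\<le>r. t ^ k * tr (W k) x)" for t x by (simp add: h_def sum_fun_apply scaleR_fun_def)
 have lims: "lim_right (%t. tr (U t)) \<alpha> = h \<alpha>" "lim_left (%t. tr (U t)) \<beta> = h \<beta>"
 proof -
  have 1: "\<And>t x. t \<in> {\<alpha><..<\<beta>} ==> tr (U t) x = h t x" using trU by (simp add: h_def)
  have 2: "\<And>x. continuous_on UNIV (%t. h t x)" unfolding hx by (intro continuous_intros)
  show "lim_right (%t. tr (U t)) \<alpha> = h \<alpha>" "lim_left (%t. tr (U t)) \<beta> = h \<beta>"
   using one_sided_limits[OF ab, of "%t. tr (U t)" h] 1 2 by blast+
 qed
 show "lim_right (%t. tr (U t)) \<alpha> \<in> VX" "lim_left (%t. tr (U t)) \<beta> \<in> VX"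
  "ip (lim_right (%t. tr (U t)) \<alpha>) e = poly P \<alpha>" "ip (lim_left (%t. tr (U t)) \<beta>) e = poly P \<beta>"
  unfolding lims unfolding h_def lin pP using inVX by simp_all
qed

text \<open>Testing with \<open>p t * lift e\<close>, where \<open>p\<close> is a polynomial on one interval and zero elsewhere, decouples the
  intervals as well as the eigenvectors.\<close>

lemma dg_equation:
 assumes mono: "\<And>i j. i < j ==> \<tau> i < \<tau> j" and sol: "dg_solution \<Omega> A c s VX VY M \<tau> (%_. r) f u0 U"
  and W: "\<And>j k. W j k \<in> T" "\<And>j t z. j \<in> {1..M} ==> t \<in> {\<tau> (j-1)<..<\<tau> j} ==> U t z = (\<Sum>k\<le>r. t ^ k * W j k z)"
  and e: "e \<in> VX" "\<And>v. v \<in> VX ==> ah e v = ah e e * ip e v"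
  and f: "continuous_on {\<tau> 0..\<tau> M} (%t. ip (f t) e)"
  and j: "j \<in> {1..M}" and q: "degree q <= r"
 defines "P \<equiv> %j. \<Sum>k\<le>r. monom (ip (tr (W j k)) e) k"
 shows "integral {\<tau> (j-1)..\<tau> j} (%t. (poly (pderiv (P j)) t + ah e e * poly (P j) t) * poly q t)
   + (poly (P j) (\<tau> (j-1)) - (if j - 1 = 0 then ip u0 e else poly (P (j-1)) (\<tau> (j-1)))) * poly q (\<tau> (j-1))
  = integral {\<tau> (j-1)..\<tau> j} (%t. ip (f t) e * poly q t)"
proof -
 interpret v: inner_form VX ip by (rule VX_inner)
 interpret h: psd_form VX ah by (rule ah_psd)
 interpret t: psd_form T a by (rule psd_form_A)
 define p where "p = (%t. if t \<in> {\<tau> (j-1)<..<\<tau> j} then poly q t else 0)"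
 define V where "V = (%t z. p t * lift e z)"
 have le: "lift e \<in> T" "tr (lift e) = e" using lift[OF e(1)] by auto
 have pp: "p \<in> pw_poly M \<tau> (%_. r)" unfolding p_def by (rule cell_polynomial[OF mono j q])
 have V: "V \<in> space_time (pw_poly M \<tau> (%_. r)) T"
  unfolding space_time_def by (intro span_base CollectI exI[of _ p] exI[of _ "lift e"] conjI V_def pp le(1))
 have Vt: "V t = p t *\<^sub>R lift e" for t by (simp add: V_def scaleR_fun_def fun_eq_iff)
 have trV: "tr (V t) = p t *\<^sub>R e" for t unfolding Vt tr_linear le ..
 have cell: "\<tau> (i-1) < \<tau> i" if "i \<in> {1..M}" for i using that by (intro mono) auto
 have tc: "\<And>t. t \<in> {\<tau> (i-1)<..<\<tau> i} ==> U t \<in> T"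
  "\<And>t. t \<in> {\<tau> (i-1)<..<\<tau> i} ==> ip (tr (U t)) e = poly (P i) t"
  "\<And>t. t \<in> {\<tau> (i-1)<..<\<tau> i} ==> ip (tr (time_deriv U t)) e = poly (pderiv (P i)) t"
  "lim_right (%t. tr (U t)) (\<tau> (i-1)) \<in> VX" "ip (lim_right (%t. tr (U t)) (\<tau> (i-1))) e = poly (P i) (\<tau> (i-1))"
  "lim_left (%t. tr (U t)) (\<tau> i) \<in> VX" "ip (lim_left (%t. tr (U t)) (\<tau> i)) e = poly (P i) (\<tau> i)"
  if i: "i \<in> {1..M}" for i
  unfolding P_def by (rule traces_on_cell[OF cell[OF i] W(1) W(2)[OF i] e(1)]; assumption)+
 have outside: "t \<notin> {\<tau> (j-1)<..<\<tau> j}" if "i \<in> {1..M}" "i \<noteq> j" "t \<in> {\<tau> (i-1)<..<\<tau> i}" for i t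
  by (rule cells_disjoint[OF mono that(1,2) j that(3)])
 have p0: "p t = 0" if "i \<in> {1..M}" "i \<noteq> j" "t \<in> {\<tau> (i-1)<..<\<tau> i}" for i t
  using if_not_P[OF outside[OF that]] by (simp only: p_def)
 have pj: "p t = poly q t" if "t \<in> {\<tau> (j-1)<..<\<tau> j}" for t using that by (simp add: p_def)
 have limV: "lim_right (%t. tr (V t)) (\<tau> (i-1)) = (if i = j then poly q (\<tau> (j-1)) else 0) *\<^sub>R e" if i: "i \<in> {1..M}" for i
 proof (cases "i = j")
  case True
  have "lim_right (%t. tr (V t)) (\<tau> (j-1)) = (%x. poly q (\<tau> (j-1)) * e x)"
   by (rule one_sided_limits(1)[OF cell[OF j]])
    (auto simp: trV pj scaleR_fun_def intro!: continuous_intros)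
  then show ?thesis using True by (simp add: scaleR_fun_def)
 next
  case False
  have "lim_right (%t. tr (V t)) (\<tau> (i-1)) = (%x. 0)"
   by (rule one_sided_limits(1)[OF cell[OF i]]) (auto simp: trV p0[OF i False] scaleR_fun_def)
  then show ?thesis using False by (simp add: scaleR_fun_def)
 qed
 have int: "ip (tr (time_deriv U t)) (tr (V t)) + a (U t) (V t) / d_const s
   = (poly (pderiv (P i)) t + ah e e * poly (P i) t) * p t" if i: "i \<in> {1..M}" and t: "t \<in> {\<tau> (i-1)<..<\<tau> i}" for i t
 proof -
  note tc' = tc(1-3)[OF i t]
  have tU: "tr (U t) \<in> VX" using tc'(1) by (rule tr_in_VX)
  have "a (U t) (V t) = p t * (d_const s * ah (tr (U t)) e)"
   unfolding Vt using t.scale_right[OF le(1) tc'(1)] form_with_lift[OF tc'(1) e(1)] by simp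
  also have "ah (tr (U t)) e = ah e e * ip (tr (U t)) e"
   using h.sym[OF tU e(1)] e(2)[OF tU] v.sym[OF tU e(1)] by simp
  finally have "a (U t) (V t) / d_const s = p t * (ah e e * poly (P i) t)" using d_pos tc'(2) by simp
  then show ?thesis unfolding trV ip_scale_right tc'(3) by (simp add: algebra_simps)
 qed
 have sums: "(\<Sum>i=1..M. LINT t|lebesgue_on {\<tau> (i-1)<..<\<tau> i}. F i t * p t) = integral {\<tau> (j-1)..\<tau> j} (%t. F j t * poly q t)"
  if F: "continuous_on {\<tau> (j-1)..\<tau> j} (F j)" for F :: "nat => real => real"
 proof -
  have "(LINT t|lebesgue_on {\<tau> (i-1)<..<\<tau> i}. F i t * p t)
    = (if i = j then integral {\<tau> (j-1)..\<tau> j} (%t. F j t * poly q t) else 0)" if i: "i \<in> {1..M}" for i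
  proof (cases "i = j")
   case True
   have "(LINT t|lebesgue_on {\<tau> (j-1)<..<\<tau> j}. F j t * p t) = (LINT t|lebesgue_on {\<tau> (j-1)<..<\<tau> j}. F j t * poly q t)"
    by (intro Bochner_Integration.integral_cong) (auto simp: space_restrict_space pj)
   also have "\<dots> = integral {\<tau> (j-1)..\<tau> j} (%t. F j t * poly q t)"
    using F by (intro integral_open_cell continuous_intros)
   finally show ?thesis using True by simp
  next
   case False
   have "(LINT t|lebesgue_on {\<tau> (i-1)<..<\<tau> i}. F i t * p t) = (LINT t|lebesgue_on {\<tau> (i-1)<..<\<tau> i}. 0)"
    by (intro Bochner_Integration.integral_cong) (auto simp: space_restrict_space p0[OF i False])
   then show ?thesis using False by simp
  qed
  then show ?thesis using j by simp
 qed
 have M: "1 \<in> {1..M}" using j by auto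
 have B: "form_B \<Omega> A c s M \<tau> U V = integral {\<tau> (j-1)..\<tau> j} (%t. (poly (pderiv (P j)) t + ah e e * poly (P j) t) * poly q t)
  + (poly (P j) (\<tau> (j-1)) - (if j - 1 = 0 then 0 else poly (P (j-1)) (\<tau> (j-1)))) * poly q (\<tau> (j-1))"
 proof -
  have 1: "(\<Sum>i=1..M. LINT t|lebesgue_on {\<tau> (i-1)<..<\<tau> i}. ip (tr (time_deriv U t)) (tr (V t)) + a (U t) (V t) / d_const s)
   = integral {\<tau> (j-1)..\<tau> j} (%t. (poly (pderiv (P j)) t + ah e e * poly (P j) t) * poly q t)"
  proof -
   have "(\<Sum>i=1..M. LINT t|lebesgue_on {\<tau> (i-1)<..<\<tau> i}. ip (tr (time_deriv U t)) (tr (V t)) + a (U t) (V t) / d_const s)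
    = (\<Sum>i=1..M. LINT t|lebesgue_on {\<tau> (i-1)<..<\<tau> i}. (poly (pderiv (P i)) t + ah e e * poly (P i) t) * p t)"
    by (intro sum.cong refl Bochner_Integration.integral_cong) (use int in \<open>auto simp: space_restrict_space\<close>)
   also have "\<dots> = integral {\<tau> (j-1)..\<tau> j} (%t. (poly (pderiv (P j)) t + ah e e * poly (P j) t) * poly q t)"
    by (rule sums[of "%i t. poly (pderiv (P i)) t + ah e e * poly (P i) t"]) (intro continuous_intros)
   finally show ?thesis .
  qed
  have jump: "ip (jump (%t. tr (U t)) (\<tau> (i-1))) e = poly (P i) (\<tau> (i-1)) - poly (P (i-1)) (\<tau> (i-1))" if i: "i \<in> {2..M}" for i
  proof -
   have i': "i \<in> {1..M}" "i - 1 \<in> {1..M}" using i by auto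
   note R = tc(4,5)[OF i'(1)] and L = tc(6,7)[OF i'(2)]
   show ?thesis unfolding jump_def using R L e(1) by (simp add: v.diff)
  qed
  have 2: "(\<Sum>i=2..M. ip (jump (%t. tr (U t)) (\<tau> (i-1))) (lim_right (%t. tr (V t)) (\<tau> (i-1))))
   = (if j = 1 then 0 else (poly (P j) (\<tau> (j-1)) - poly (P (j-1)) (\<tau> (j-1))) * poly q (\<tau> (j-1)))"
  proof -
   have "(\<Sum>i=2..M. ip (jump (%t. tr (U t)) (\<tau> (i-1))) (lim_right (%t. tr (V t)) (\<tau> (i-1))))
    = (\<Sum>i=2..M. if i = j then (poly (P j) (\<tau> (j-1)) - poly (P (j-1)) (\<tau> (j-1))) * poly q (\<tau> (j-1)) else 0)"
   proof (rule sum.cong[OF refl])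
    fix i assume i: "i \<in> {2..M}"
    then have i': "i \<in> {1..M}" by auto
    show "ip (jump (%t. tr (U t)) (\<tau> (i-1))) (lim_right (%t. tr (V t)) (\<tau> (i-1)))
     = (if i = j then (poly (P j) (\<tau> (j-1)) - poly (P (j-1)) (\<tau> (j-1))) * poly q (\<tau> (j-1)) else 0)"
     unfolding limV[OF i'] ip_scale_right jump[OF i] by simp
   qed
   also have "\<dots> = (if j \<in> {2..M} then (poly (P j) (\<tau> (j-1)) - poly (P (j-1)) (\<tau> (j-1))) * poly q (\<tau> (j-1)) else 0)"
    by (rule sum.delta) simp
   finally show ?thesis using j by auto
  qed
  have 3: "ip (lim_right (%t. tr (U t)) (\<tau> 0)) (lim_right (%t. tr (V t)) (\<tau> 0)) = (if j = 1 then poly (P 1) (\<tau> 0) * poly q (\<tau> 0) else 0)"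
   using limV[OF M] tc(5)[OF M] by (simp add: ip_scale_right del: scaleR_zero_left)
  show ?thesis unfolding form_B_def 1 2 3 using j by (cases "j = 1") (auto simp: algebra_simps)
 qed
 have Fe: "form_F \<Omega> M \<tau> f u0 V = integral {\<tau> (j-1)..\<tau> j} (%t. ip (f t) e * poly q t) + (if j = 1 then ip u0 e * poly q (\<tau> (j-1)) else 0)"
 proof -
  have sub: "{\<tau> (j-1)..\<tau> j} \<subseteq> {\<tau> 0..\<tau> M}"
  proof -
   have le: "\<tau> a <= \<tau> b" if "a <= b" for a b using that mono[of a b] by (cases "a = b") auto
   show ?thesis using le[of 0 "j-1"] le[of j M] j by auto
  qed
  have 1: "(\<Sum>i=1..M. LINT t|lebesgue_on {\<tau> (i-1)<..<\<tau> i}. ip (f t) (tr (V t))) = integral {\<tau> (j-1)..\<tau> j} (%t. ip (f t) e * poly q t)"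
   using sums[of "%i t. ip (f t) e"] continuous_on_subset[OF f sub] by (simp add: trV ip_scale_right mult.commute)
  have 2: "ip u0 (lim_right (%t. tr (V t)) (\<tau> 0)) = (if j = 1 then ip u0 e * poly q (\<tau> (j-1)) else 0)"
   using limV[OF M] by (simp add: ip_scale_right del: scaleR_zero_left)
  show ?thesis unfolding form_F_def 1 2 ..
 qed
 have "form_B \<Omega> A c s M \<tau> U V = form_F \<Omega> M \<tau> f u0 V" using sol V unfolding dg_solution_def by blast
 then show ?thesis unfolding B Fe using j by (cases "j = 1") (auto simp: algebra_simps)
qed

end

section \<open>Functions analytic on the closure are square integrable\<close>

text \<open>Absolute convergence at one point of the open positive orthant with vertex \<open>p\<close> dominates the power
  series on a cube around \<open>p\<close>, so that it converges uniformly there.\<close>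

lemma real_analytic_imp_isCont:
 assumes "real_analytic_at u p"
 shows "isCont u p"
proof -
 obtain \<epsilon> a where \<epsilon>: "0 < \<epsilon>" and a: "\<And>x. x \<in> ball p \<epsilon> ==>
  ((%\<kappa>. a \<kappa> * (\<Prod>i\<in>UNIV. (x$i - p$i) ^ \<kappa> i)) has_sum u x) UNIV"
  using assms unfolding real_analytic_at_def by blast
 define \<delta> where "\<delta> = \<epsilon> / (2 * real CARD('a))"
 have \<delta>: "0 < \<delta>" using \<epsilon> by (simp add: \<delta>_def)
 define S where "S = {x. \<forall>i. \<bar>x$i - p$i\<bar> <= \<delta>}"
 have SB: "x \<in> ball p \<epsilon>" if "x \<in> S" for x
 proof -
  have "norm (x - p) <= (\<Sum>i\<in>UNIV. \<bar>(x - p)$i\<bar>)" by (rule norm_le_l1_cart)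
  also have "\<dots> <= (\<Sum>i\<in>(UNIV :: 'a set). \<delta>)" using that by (intro sum_mono) (auto simp: S_def)
  also have "\<dots> = \<epsilon> / 2" by (simp add: \<delta>_def)
  finally show ?thesis using \<epsilon> by (simp add: dist_norm norm_minus_commute)
 qed
 define x0 where "x0 = p + (\<chi> i. \<delta>)"
 have "x0 \<in> S" using \<delta> by (simp add: S_def x0_def)
 then have x0: "(%\<kappa>. a \<kappa> * (\<Prod>i\<in>UNIV. (x0$i - p$i) ^ \<kappa> i)) summable_on UNIV"
  by (rule has_sum_imp_summable[OF a[OF SB]])
 have sm: "(%\<kappa>. norm (a \<kappa> * (\<Prod>i\<in>UNIV. \<delta> ^ \<kappa> i))) summable_on UNIV"
  using summable_on_iff_abs_summable_on_real[THEN iffD1, OF x0] by (simp add: x0_def)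
 have "uniform_limit S (%X x. \<Sum>\<kappa>\<in>X. a \<kappa> * (\<Prod>i\<in>UNIV. (x$i - p$i) ^ \<kappa> i)) u (finite_subsets_at_top UNIV)"
 proof (rule Weierstrass_m_test_general'[OF _ _ sm])
  fix \<kappa> :: "'a => nat" and x assume x: "x \<in> S"
  have "(\<Prod>i\<in>UNIV. \<bar>(x$i - p$i) ^ \<kappa> i\<bar>) <= (\<Prod>i\<in>UNIV. \<delta> ^ \<kappa> i)"
   using x by (intro prod_mono) (auto simp: S_def power_abs intro: power_mono)
  then have "\<bar>a \<kappa>\<bar> * (\<Prod>i\<in>UNIV. \<bar>(x$i - p$i) ^ \<kappa> i\<bar>) <= \<bar>a \<kappa>\<bar> * (\<Prod>i\<in>UNIV. \<delta> ^ \<kappa> i)" by (intro mult_left_mono) auto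
  moreover have "0 <= (\<Prod>i\<in>UNIV. \<delta> ^ \<kappa> i)" using \<delta> by (intro prod_nonneg) auto
  ultimately show "norm (a \<kappa> * (\<Prod>i\<in>UNIV. (x$i - p$i) ^ \<kappa> i)) <= norm (a \<kappa> * (\<Prod>i\<in>UNIV. \<delta> ^ \<kappa> i))"
   using \<delta> by (simp add: abs_mult abs_prod power_abs)
 next
  fix x assume "x \<in> S"
  then show "((%\<kappa>. a \<kappa> * (\<Prod>i\<in>UNIV. (x$i - p$i) ^ \<kappa> i)) has_sum u x) UNIV" by (intro a SB)
 qed
 then have c: "continuous_on S u"
 proof (rule uniform_limit_theorem[rotated])
  show "\<forall>\<^sub>F X in finite_subsets_at_top UNIV. continuous_on S (%x. \<Sum>\<kappa>\<in>X. a \<kappa> * (\<Prod>i\<in>UNIV. (x$i - p$i) ^ \<kappa> i))"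
   by (intro always_eventually allI continuous_intros)
 qed simp
 have "ball p \<delta> \<subseteq> S"
 proof
  fix x assume "x \<in> ball p \<delta>"
  then have "norm (x - p) <= \<delta>" by (simp add: dist_norm norm_minus_commute)
  then show "x \<in> S" unfolding S_def using component_le_norm_cart[of "x - p"] by (auto intro: order.trans)
 qed
 then have "continuous_on (ball p \<delta>) u" using c by (rule continuous_on_subset[rotated])
 then show ?thesis using \<delta> by (simp add: continuous_on_eq_continuous_at)
qed

lemma analytic_on_closure_L2:
 assumes "bounded \<Omega>" "open \<Omega>" "analytic_on_closure \<Omega> u"
 shows "u \<in> L2 \<Omega>"
proof -
 obtain v where v: "\<And>x. x \<in> \<Omega> ==> v x = u x" "\<And>p. p \<in> closure \<Omega> ==> real_analytic_at v p"
  using assms(3) unfolding analytic_on_closure_def by blast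
 have c: "continuous_on (closure \<Omega>) v"
  by (intro continuous_at_imp_continuous_on ballI real_analytic_imp_isCont v)
 have "compact (closure \<Omega>)" using assms(1) by simp
 then have "bounded (v ` closure \<Omega>)" using c by (intro compact_imp_bounded compact_continuous_image)
 then obtain K where K: "\<And>x. x \<in> closure \<Omega> ==> norm (v x) <= K" unfolding bounded_iff by auto
 have S: "\<Omega> \<in> sets lebesgue" "\<Omega> \<in> lmeasurable" using assms by (auto intro: bounded_set_imp_lmeasurable)
 have uc: "continuous_on \<Omega> u"
  using continuous_on_subset[OF c closure_subset] v(1) by (simp cong: continuous_on_cong)
 have um: "u \<in> borel_measurable (lebesgue_on \<Omega>)" by (rule continuous_imp_measurable_on_sets_lebesgue[OF uc S(1)])
 have "integrable (lebesgue_on \<Omega>) (%x. (u x)^2)"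
 proof (rule Bochner_Integration.integrable_bound)
  show "integrable (lebesgue_on \<Omega>) (%x. K^2)"
   using S by (intro finite_measure.integrable_const finite_measure_lebesgue_on)
  show "(%x. (u x)^2) \<in> borel_measurable (lebesgue_on \<Omega>)" using um by measurable
  show "AE x in lebesgue_on \<Omega>. norm ((u x)^2) <= norm (K^2)"
  proof (rule AE_I2)
   fix x assume "x \<in> space (lebesgue_on \<Omega>)"
   then have x: "x \<in> \<Omega>" by (simp add: space_restrict_space)
   then have "\<bar>u x\<bar> <= K" using K[of x] v(1)[OF x] closure_subset by auto
   then have "\<bar>u x\<bar>\<^sup>2 <= K^2" by (intro power_mono) auto
   then show "norm ((u x)^2) <= norm (K^2)" by simp
  qed
 qed
 with um show ?thesis by (simp add: L2_def)
qed

section \<open>The error in the eigenbasis\<close>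

text \<open>The time derivatives of a solution of the scalar equation, expressed through the equation itself.\<close>

primrec flow :: "(nat => real => real) => real => (real => real) => nat => real => real" where
 "flow g k y 0 = y"
| "flow g k y (Suc l) = (%t. g l t - k * flow g k y l t)"

lemma flow_derivative:
 assumes "\<And>l. (g l has_real_derivative g (Suc l) t) (at t within J)"
  and "(y has_real_derivative g 0 t - k * y t) (at t within J)"
 shows "(flow g k y l has_real_derivative flow g k y (Suc l) t) (at t within J)"
proof (induction l)
 case 0
 then show ?case using assms(2) by simp
next
 case (Suc l)
 have "((%t. g l t - k * flow g k y l t) has_real_derivative g (Suc l) t - k * flow g k y (Suc l) t) (at t within J)"
  by (intro derivative_intros assms(1) DERIV_cmult Suc.IH)
 then show ?case by simp
qed

text \<open>The two terms belong to the first interval and to the others.\<close>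

definition rate_const :: "nat => real => real => real => real => real => (nat => real) => real" where
 "rate_const r Cs Ca T \<beta> C0 G = \<bar>Cs * smoothing.smoothing_const T \<beta> C0 G 0 * (1 / \<beta> + 1) * T powr \<beta>
  + Ca * smoothing.smoothing_const T \<beta> C0 G (Suc r)
   * (((2 * real r + 3) / \<beta> * 2 powr ((2 * real r + 3) / \<beta>)) powr (2 * real r + 3) * T powr \<beta>)\<bar>"

context cylinder
begin

definition trace_const :: real where
 "trace_const = (2 / s^2 + 2 * (1 + 16 * R^2)) * (d_const s / min \<kappa> 1)"

lemma trace_const_nonneg: "0 <= trace_const"
 unfolding trace_const_def using \<kappa> d_pos s by (intro mult_nonneg_nonneg add_nonneg_nonneg divide_nonneg_pos) auto

text \<open>In the eigenbasis both problems decouple into scalar equations, to which the estimate for graded meshes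
  applies. The nodes, where a discrete function is unrelated to its polynomial pieces, form a null set.\<close>

theorem squared_error_bound:
 assumes Tf: "0 < Tf" and \<beta>: "0 < \<beta>" "\<beta> < 1" and Cst: "0 <= Cst" and M: "1 <= M"
  and u0: "u0 \<in> L2 \<Omega>" and uh0: "uh0 \<in> VX" "VX_interp_norm \<Omega> A c s VX VY \<beta> uh0 <= ennreal Cst"
  and fd: "L2_time_derivatives \<Omega> Tf f fd" and Gb: "\<And>l t. t \<in> {0..Tf} ==> (L2_norm \<Omega> (fd l t))^2 <= Gb l"
  and uh: "semidiscrete_solution \<Omega> A c s VX VY Tf f uh0 uh"
  and \<tau>: "\<tau> = graded_mesh Tf (%t. t powr ((2 * real r + 3) / \<beta>)) M"
  and U: "dg_solution \<Omega> A c s VX VY M \<tau> (%_. r) f u0 U"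
  and Cs: "stable_with r Cs" and Ca: "accurate_with r Ca"
 shows "(\<integral>\<^sup>+ t\<in>{0..Tf}. (Htilde_norm \<Omega> s (uh t - tr (U t)))^2 \<partial>lborel)
  <= ennreal (trace_const * (rate_const r Cs Ca Tf \<beta> (init_const \<beta> Cst) Gb * real M powr (- (2 * real r + 2))
    + (L2_norm \<Omega> (u0 - uh0))^2))"
proof -
 interpret l: psd_form "L2 \<Omega>" ip by (rule L2_psd)
 interpret v: inner_form VX ip by (rule VX_inner)
 interpret h: psd_form VX ah by (rule ah_psd)
 obtain E where E: "finite E" "E \<subseteq> VX" "span E = VX" "l.orthonormal E" "v.orthonormal E"
  and eig: "\<And>e v. e \<in> E ==> v \<in> VX ==> ah e v = ah e e * ip e v"
  by (rule eigenbasis) blast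
 have EL: "e \<in> L2 \<Omega>" if "e \<in> E" for e using that E(2) VX_sub_L2 by blast
 define gam where "gam = (2 * real r + 3) / \<beta>"
 have \<tau>j: "\<tau> j = Tf * (real j / real M) powr gam" for j by (simp add: \<tau> graded_mesh_def gam_def)
 have gam: "0 < gam" using \<beta> by (simp add: gam_def)
 have mono: "\<tau> i < \<tau> j" if "i < j" for i j
  unfolding \<tau>j using that M Tf gam by (intro mult_strict_left_mono powr_less_mono2 divide_strict_right_mono) auto
 have ends: "\<tau> 0 = 0" "\<tau> M = Tf" using M by (auto simp: \<tau>j)
 have US: "U \<in> space_time (pw_poly M \<tau> (%_. r)) T" using U by (simp add: dg_solution_def)
 have "\<forall>j. \<exists>W. j \<in> {1..M} \<longrightarrow> (\<forall>k. W k \<in> T) \<and> (\<forall>t\<in>{\<tau> (j-1)<..<\<tau> j}. \<forall>z. U t z = (\<Sum>k\<le>r. t ^ k * W k z))"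
  using space_time_on_cell[OF T_subspace US] by blast
 then obtain W' where W': "\<And>j. j \<in> {1..M} ==> (\<forall>k. W' j k \<in> T) \<and> (\<forall>t\<in>{\<tau> (j-1)<..<\<tau> j}. \<forall>z. U t z = (\<Sum>k\<le>r. t ^ k * W' j k z))"
  by metis
 \<comment> \<open>The default value makes all coefficient functions discrete functions.\<close>
 define W where "W = (%j. if j \<in> {1..M} then W' j else (%_. 0))"
 have W: "\<And>j k. W j k \<in> T" "\<And>j t z. j \<in> {1..M} ==> t \<in> {\<tau> (j-1)<..<\<tau> j} ==> U t z = (\<Sum>k\<le>r. t ^ k * W j k z)"
  using W' subspace_0[OF T_subspace] by (auto simp: W_def)
 define P where "P = (%e j. \<Sum>k\<le>r. monom (ip (tr (W j k)) e) k)"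
 define g where "g = (%l e t. ip (fd l t) e)"
 define y where "y = (%l e. flow (%l. g l e) (ah e e) (%t. ip (uh t) e) l)"
 define z where "z = ip u0"
 define left where "left = (%e j. if j = 0 then z e else poly (P e j) (\<tau> j))"
 have fdL: "fd l t \<in> L2 \<Omega>" "has_L2_derivative \<Omega> (fd l) (fd (Suc l) t) t {0..Tf}" if "t \<in> {0..Tf}" for l t
  using fd that unfolding L2_time_derivatives_def by auto
 have fd0: "fd 0 t = f t" if "t \<in> {0..Tf}" for t using fd that unfolding L2_time_derivatives_def by auto
 have uhV: "uh t \<in> VX" if "t \<in> {0..Tf}" for t using uh that unfolding semidiscrete_solution_def by auto
 have uhL: "uh t \<in> L2 \<Omega>" if "t \<in> {0..Tf}" for t using uhV[OF that] by (rule VX_L2)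
 have dg: "(g l e has_real_derivative g (Suc l) e t) (at t within {0..Tf})" if "e \<in> E" "t \<in> {0..Tf}" for l e t
  unfolding g_def using that by (intro has_L2_derivative_inner fdL EL) auto
 have duh: "((%t. ip (uh t) e) has_real_derivative g 0 e t - ah e e * ip (uh t) e) (at t within {0..Tf})"
  if e: "e \<in> E" and t: "t \<in> {0..Tf}" for e t
 proof -
  obtain w where w: "w \<in> VX" "has_L2_derivative \<Omega> uh w t {0..Tf}"
   "w + Lh \<Omega> A c s VX VY (uh t) = L2_projection \<Omega> VX (f t)"
   using uh t unfolding semidiscrete_solution_def by blast
  have eV: "e \<in> VX" using e E(2) by blast
  have fL: "f t \<in> L2 \<Omega>" using fdL(1)[OF t, of 0] fd0[OF t] by simp
  have "ip w e + ip (Lh \<Omega> A c s VX VY (uh t)) e = ip (w + Lh \<Omega> A c s VX VY (uh t)) e"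
   using w(1) eV Lh_inner(1)[OF uhV[OF t] eV] by (simp add: v.add)
  also have "\<dots> = g 0 e t" unfolding w(3) projection_inner(2)[OF fL eV] by (simp add: g_def fd0[OF t])
  also have "ip (Lh \<Omega> A c s VX VY (uh t)) e = ah e e * ip (uh t) e"
   using Lh_inner(2)[OF uhV[OF t] eV] h.sym[OF uhV[OF t] eV] eig[OF e uhV[OF t]] v.sym[OF uhV[OF t] eV] by simp
  finally have "ip w e = g 0 e t - ah e e * ip (uh t) e" by simp
  then show ?thesis
   using has_L2_derivative_inner[OF w(2) uhL t VX_L2[OF w(1)] EL[OF e]] by simp
 qed
 have uh0eq: "uh 0 = uh0" using uh by (simp add: semidiscrete_solution_def)
 interpret D: graded_dg E "%e. ah e e" y g Tf \<beta> "init_const \<beta> Cst" Gb r M \<tau> P z left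
 proof
  show "finite E" by (rule E(1))
  show "0 <= ah e e" if "e \<in> E" for e using that E(2) h.nonneg by blast
  show "0 < Tf" "0 < \<beta>" "\<beta> < 1" "1 <= M" by fact+
  show "(y l e has_real_derivative y (Suc l) e t) (at t within {0..Tf})" if "e \<in> E" "t \<in> {0..Tf}" for l e t
   unfolding y_def by (rule flow_derivative[OF dg[OF that] duh[OF that]])
  show "y (Suc l) e t = g l e t - ah e e * y l e t" for l e t by (simp add: y_def)
  show "(\<Sum>e\<in>E. (g l e t)^2) <= Gb l" if "t \<in> {0..Tf}" for l t
   using l.Bessel[OF E(4) fdL(1)[OF that]] Gb[OF that, of l] unfolding g_def L2_norm_square(1) by (rule order.trans)
  show "\<exists>p q. (\<forall>e\<in>E. y 0 e 0 = p e + q e) \<and>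
    (\<Sum>e\<in>E. (p e)^2) + \<tau>'^2 * (\<Sum>e\<in>E. ah e e * (q e)^2) <= init_const \<beta> Cst * \<tau>' powr (2 * \<beta>)" if \<tau>': "0 < \<tau>'" for \<tau>'
  proof -
   obtain w where w: "w \<in> VX" "(L2_norm \<Omega> (uh0 - w))^2 + \<tau>'^2 * ah w w <= init_const \<beta> Cst * \<tau>' powr (2 * \<beta>)"
    using initial_splitting[OF uh0(1) \<beta>(1) Cst uh0(2) \<tau>'] by blast
   have uw: "uh0 - w \<in> VX" using uh0(1) w(1) VX(1) by (intro subspace_diff)
   have "(\<Sum>e\<in>E. (ip (uh0 - w) e)^2) <= (L2_norm \<Omega> (uh0 - w))^2"
    using l.Bessel[OF E(4) VX_L2[OF uw]] by (simp add: L2_norm_square)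
   moreover have "(\<Sum>e\<in>E. ah e e * (ip w e)^2) = ah w w"
    by (rule energy_in_eigenbasis[OF E(5,3) eig w(1), symmetric])
   moreover have "y 0 e 0 = ip (uh0 - w) e + ip w e" if "e \<in> E" for e
    using that E(2) uh0(1) w(1) by (subst v.diff) (auto simp: y_def uh0eq)
   ultimately show ?thesis using w(2) by (intro exI[of _ "ip (uh0 - w)"] exI[of _ "ip w"]) auto
  qed
  show "\<tau> = graded_mesh Tf (%t. t powr ((2 * real r + 3) / \<beta>)) M" by (rule \<tau>)
  show "left e j = (if j = 0 then z e else poly (P e j) (\<tau> j))" for e j by (simp add: left_def)
  show "degree (P e j) <= r" for e j
   unfolding P_def by (intro degree_sum_le) (auto intro: order.trans[OF degree_monom_le])
  show "integral {\<tau> (j-1)..\<tau> j} (%t. (poly (pderiv (P e j)) t + ah e e * poly (P e j) t) * poly q t)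
    + (poly (P e j) (\<tau> (j-1)) - left e (j-1)) * poly q (\<tau> (j-1))
   = integral {\<tau> (j-1)..\<tau> j} (%t. g 0 e t * poly q t)" if e: "e \<in> E" and j: "j \<in> {1..M}" and q: "degree q <= r" for e j q
  proof -
   have "continuous_on {0..Tf} (g 0 e)" using dg[OF e] by (rule DERIV_continuous_on)
   then have fc: "continuous_on {\<tau> 0..\<tau> M} (%t. ip (f t) e)"
    unfolding ends by (rule continuous_on_eq) (simp add: g_def fd0)
   have sub: "{\<tau> (j-1)..\<tau> j} \<subseteq> {0..Tf}"
   proof -
    have le: "\<tau> a <= \<tau> b" if "a <= b" for a b using that mono[of a b] by (cases "a = b") auto
    show ?thesis using le[of 0 "j-1"] le[of j M] j ends by auto
   qed
   have "integral {\<tau> (j-1)..\<tau> j} (%t. g 0 e t * poly q t) = integral {\<tau> (j-1)..\<tau> j} (%t. ip (f t) e * poly q t)"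
    by (rule integral_cong) (use sub in \<open>auto simp: g_def fd0\<close>)
   then have fg: "integral {\<tau> (j-1)..\<tau> j} (%t. g 0 e t * poly q t) = integral {\<tau> (j-1)..\<tau> j} (%t. ip (f t) e * poly q t)" .
   have eV: "e \<in> VX" using e E(2) by blast
   show ?thesis unfolding fg left_def z_def P_def
    by (rule dg_equation[OF mono U W(1) W(2) eV eig[OF e] fc j q])
  qed
 qed
 define err where "err = (%j t. \<Sum>e\<in>E. ah e e * (y 0 e t - poly (P e j) t)^2)"
 have pointwise: "(Htilde_norm \<Omega> s (uh t - tr (U t)))^2 <= ennreal (trace_const * err j t)"
  if j: "j \<in> {1..M}" and t: "t \<in> {\<tau> (j-1)<..<\<tau> j}" for j t
 proof -
  have t0: "t \<in> {0..Tf}" using D.cell(2)[OF j] t by auto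
  have UT: "U t \<in> T"
   by (rule traces_on_cell(1)[OF D.cell(1)[OF j] W(1) W(2)[OF j] subspace_0[OF VX(1)] t])
  have w: "uh t - tr (U t) \<in> VX" using uhV[OF t0] tr_in_VX[OF UT] VX(1) by (intro subspace_diff)
  have ipw: "ip (uh t - tr (U t)) e = y 0 e t - poly (P e j) t" if e: "e \<in> E" for e
  proof -
   have eV: "e \<in> VX" using e E(2) by blast
   have "ip (tr (U t)) e = poly (P e j) t" unfolding P_def
    by (rule traces_on_cell(2)[OF D.cell(1)[OF j] W(1) W(2)[OF j] eV t])
   then show ?thesis using uhV[OF t0] tr_in_VX[OF UT] eV by (simp add: v.diff y_def)
  qed
  have "ah (uh t - tr (U t)) (uh t - tr (U t)) = (\<Sum>e\<in>E. ah e e * (ip (uh t - tr (U t)) e)^2)"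
   by (rule energy_in_eigenbasis[OF E(5,3) eig w])
  also have "\<dots> = err j t" unfolding err_def by (rule sum.cong) (simp_all add: ipw)
  finally show ?thesis using Htilde_le_energy[OF w] by (simp add: trace_const_def)
 qed
 have errc: "continuous_on {\<tau> (j-1)..\<tau> j} (err j)" if j: "j \<in> {1..M}" for j
  unfolding err_def using D.y_cont[OF _ j] by (intro continuous_intros) auto
 have err0: "0 <= err j t" for j t unfolding err_def using E(2) h.nonneg by (intro sum_nonneg mult_nonneg_nonneg) auto
 have le_sum: "AE t in lborel. (Htilde_norm \<Omega> s (uh t - tr (U t)))^2 * indicator {0..Tf} t
   <= (\<Sum>j\<in>{1..M}. ennreal (trace_const * err j t) * indicator {\<tau> (j-1)..\<tau> j} t)"
 proof -
  have "\<tau> ` {..M} \<in> null_sets lborel" by (intro finite_imp_null_set_lborel) auto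
  from AE_not_in[OF this] show ?thesis
  proof eventually_elim
   case (elim t)
   show ?case
   proof (cases "t \<in> {0..Tf}")
    case True
    define j where "j = (LEAST i. t <= \<tau> i)"
    have tM: "t <= \<tau> M" using True ends by simp
    have j: "t <= \<tau> j" "j <= M" unfolding j_def using tM by (rule LeastI, rule Least_le)
    have "t \<noteq> \<tau> 0" using elim by auto
    then have "j \<noteq> 0" using True ends j(1) by (cases "j = 0") auto
    then have "\<not> t <= \<tau> (j - 1)" unfolding j_def by (intro not_less_Least) auto
    moreover have "t \<noteq> \<tau> j" using elim j(2) by auto
    ultimately have tj: "t \<in> {\<tau> (j-1)<..<\<tau> j}" using j(1) by auto
    have jM: "j \<in> {1..M}" using \<open>j \<noteq> 0\<close> j(2) by auto
    have "(Htilde_norm \<Omega> s (uh t - tr (U t)))^2 * indicator {0..Tf} t <= ennreal (trace_const * err j t) * indicator {\<tau> (j-1)..\<tau> j} t"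
     using pointwise[OF jM tj] True tj by simp
    also have "\<dots> <= (\<Sum>j\<in>{1..M}. ennreal (trace_const * err j t) * indicator {\<tau> (j-1)..\<tau> j} t)"
     by (rule member_le_sum[OF jM]) auto
    finally show ?thesis .
   qed simp
  qed
 qed
 have cellint: "(\<integral>\<^sup>+ t. ennreal (trace_const * err j t) * indicator {\<tau> (j-1)..\<tau> j} t \<partial>lborel)
   = ennreal (trace_const * integral {\<tau> (j-1)..\<tau> j} (err j))" if j: "j \<in> {1..M}" for j
 proof (rule nn_integral_has_integral_lebesgue')
  show "0 <= trace_const * err j t" for t using trace_const_nonneg err0 by simp
  have "err j integrable_on {\<tau> (j-1)..\<tau> j}" by (rule integrable_continuous_interval[OF errc[OF j]])
  then show "((%t. trace_const * err j t) has_integral trace_const * integral {\<tau> (j-1)..\<tau> j} (err j)) {\<tau> (j-1)..\<tau> j}"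
   by (intro has_integral_mult_right integrable_integral)
 qed
 have meas: "(%t. ennreal (trace_const * err j t) * indicator {\<tau> (j-1)..\<tau> j} t) \<in> borel_measurable lborel" if j: "j \<in> {1..M}" for j
 proof -
  have "(%t. indicator {\<tau> (j-1)..\<tau> j} t *\<^sub>R err j t) \<in> borel_measurable borel"
   by (rule borel_measurable_continuous_on_indicator[OF _ errc[OF j]]) simp
  then have "(%t. ennreal (trace_const * (indicator {\<tau> (j-1)..\<tau> j} t *\<^sub>R err j t))) \<in> borel_measurable lborel" by simp
  moreover have "ennreal (trace_const * (indicator {\<tau> (j-1)..\<tau> j} t *\<^sub>R err j t)) = ennreal (trace_const * err j t) * indicator {\<tau> (j-1)..\<tau> j} t" for t
   by (auto simp: indicator_def)
  ultimately show ?thesis by simp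
 qed
 have "(\<integral>\<^sup>+ t\<in>{0..Tf}. (Htilde_norm \<Omega> s (uh t - tr (U t)))^2 \<partial>lborel)
   <= (\<integral>\<^sup>+ t. (\<Sum>j\<in>{1..M}. ennreal (trace_const * err j t) * indicator {\<tau> (j-1)..\<tau> j} t) \<partial>lborel)"
  by (rule nn_integral_mono_AE[OF le_sum])
 also have "\<dots> = (\<Sum>j\<in>{1..M}. ennreal (trace_const * integral {\<tau> (j-1)..\<tau> j} (err j)))"
 proof -
  have "(\<integral>\<^sup>+ t. (\<Sum>j\<in>{1..M}. ennreal (trace_const * err j t) * indicator {\<tau> (j-1)..\<tau> j} t) \<partial>lborel)
    = (\<Sum>j\<in>{1..M}. \<integral>\<^sup>+ t. ennreal (trace_const * err j t) * indicator {\<tau> (j-1)..\<tau> j} t \<partial>lborel)"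
   by (rule nn_integral_sum) (rule meas)
  also have "\<dots> = (\<Sum>j\<in>{1..M}. ennreal (trace_const * integral {\<tau> (j-1)..\<tau> j} (err j)))"
   by (rule sum.cong[OF refl]) (rule cellint)
  finally show ?thesis .
 qed
 also have "\<dots> = ennreal (\<Sum>j\<in>{1..M}. trace_const * integral {\<tau> (j-1)..\<tau> j} (err j))"
 proof (rule sum_ennreal)
  fix j assume j: "j \<in> {1..M}"
  show "0 <= trace_const * integral {\<tau> (j-1)..\<tau> j} (err j)"
   by (intro mult_nonneg_nonneg trace_const_nonneg integral_nonneg integrable_continuous_interval errc[OF j] err0)
 qed
 also have "(\<Sum>j\<in>{1..M}. trace_const * integral {\<tau> (j-1)..\<tau> j} (err j))
   = trace_const * (\<Sum>e\<in>E. ah e e * (\<Sum>j=1..M. integral {\<tau> (j-1)..\<tau> j} (%t. (y 0 e t - poly (P e j) t)^2)))"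
 proof -
  have "integral {\<tau> (j-1)..\<tau> j} (err j) = (\<Sum>e\<in>E. ah e e * integral {\<tau> (j-1)..\<tau> j} (%t. (y 0 e t - poly (P e j) t)^2))"
   if j: "j \<in> {1..M}" for j
  proof -
   have i: "(%t. (y 0 e t - poly (P e j) t)^2) integrable_on {\<tau> (j-1)..\<tau> j}" if "e \<in> E" for e
    using D.y_cont[OF that j] by (intro integrable_continuous_interval continuous_intros)
   then have "integral {\<tau> (j-1)..\<tau> j} (err j) = (\<Sum>e\<in>E. integral {\<tau> (j-1)..\<tau> j} (%t. ah e e * (y 0 e t - poly (P e j) t)^2))"
    unfolding err_def using E(1) by (intro integral_sum integrable_on_mult_right) auto
   then show ?thesis by simp
  qed
  then have "(\<Sum>j\<in>{1..M}. trace_const * integral {\<tau> (j-1)..\<tau> j} (err j))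
    = trace_const * (\<Sum>j\<in>{1..M}. \<Sum>e\<in>E. ah e e * integral {\<tau> (j-1)..\<tau> j} (%t. (y 0 e t - poly (P e j) t)^2))"
   by (simp add: sum_distrib_left)
  also have "(\<Sum>j\<in>{1..M}. \<Sum>e\<in>E. ah e e * integral {\<tau> (j-1)..\<tau> j} (%t. (y 0 e t - poly (P e j) t)^2))
    = (\<Sum>e\<in>E. ah e e * (\<Sum>j=1..M. integral {\<tau> (j-1)..\<tau> j} (%t. (y 0 e t - poly (P e j) t)^2)))"
   unfolding sum_distrib_left by (rule sum.swap)
  finally show ?thesis .
 qed
 also have "ennreal \<dots> <= ennreal (trace_const * (rate_const r Cs Ca Tf \<beta> (init_const \<beta> Cst) Gb * real M powr (- (2 * real r + 2))
    + (L2_norm \<Omega> (u0 - uh0))^2))"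
 proof (intro ennreal_leI mult_left_mono trace_const_nonneg)
  have d: "u0 - uh0 \<in> L2 \<Omega>" using u0 VX_L2[OF uh0(1)] L2_subspace by (intro subspace_diff)
  have "(y 0 e 0 - z e)^2 = (ip (u0 - uh0) e)^2" if "e \<in> E" for e
   using l.diff[OF u0 VX_L2[OF uh0(1)] EL[OF that]] by (simp add: y_def z_def uh0eq power2_commute)
  then have "(\<Sum>e\<in>E. (y 0 e 0 - z e)^2) = (\<Sum>e\<in>E. (ip (u0 - uh0) e)^2)" by (rule sum.cong[OF refl])
  also have "\<dots> <= (L2_norm \<Omega> (u0 - uh0))^2" using l.Bessel[OF E(4) d] by (simp add: L2_norm_square)
  finally show "(\<Sum>e\<in>E. ah e e * (\<Sum>j=1..M. integral {\<tau> (j-1)..\<tau> j} (%t. (y 0 e t - poly (P e j) t)^2)))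
   <= rate_const r Cs Ca Tf \<beta> (init_const \<beta> Cst) Gb * real M powr (- (2 * real r + 2)) + (L2_norm \<Omega> (u0 - uh0))^2"
   using D.dg_error[OF Cs Ca] unfolding rate_const_def by linarith
 qed
 finally show ?thesis .
qed

end

section \<open>The convergence theorem\<close>

lemma ennreal_sqrt_le:
 assumes "x <= ennreal (B^2)" "0 <= B"
 shows "ennreal_sqrt x <= ennreal B"
proof (cases x)
 case (real r)
 then have "r <= B^2" using assms(1) by simp
 then have "sqrt r <= B" using assms(2) by (rule real_le_lsqrt[rotated 1])
 then show ?thesis using real by (simp add: ennreal_sqrt_def ennreal_leI)
next
 case top
 then show ?thesis using assms(1) by (simp add: top_unique)
qed

theorem theorem4p4:
  fixes \<Omega> :: "(real^'n) set" and A :: "real^'n \<Rightarrow> real^'n^'n" and c :: "real^'n \<Rightarrow> real"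
    and s T \<beta> b \<mu> Cstab Capprox Cf df :: real and r :: nat
    and u0 :: "real^'n \<Rightarrow> real" and f :: "real \<Rightarrow> real^'n \<Rightarrow> real"
    and fd :: "nat \<Rightarrow> real \<Rightarrow> real^'n \<Rightarrow> real"
  assumes "bounded \<Omega>" and "lipschitz_domain \<Omega>"
    and "admissible_coefficients \<Omega> A c"
    and "0 < s" "s < 1" and "0 < T"
    and "0 < \<beta>" "\<beta> < 1" and "0 < b" and "0 < \<mu>" and "0 \<le> Cstab" and "0 \<le> Capprox"
    and "analytic_on_closure \<Omega> u0"
    and "L2_time_derivatives \<Omega> T f fd"
    and "\<And>l t. t \<in> {0..T} \<Longrightarrow> L2_norm \<Omega> (fd l t) \<le> Cf * df ^ l * Gamma (real l + 1)"
  shows "\<exists>C>0. \<forall>VX VY uh0 uh M \<tau> U.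
    discrete_spaces \<Omega> s VX VY \<longrightarrow>
    initial_condition \<Omega> A c s VX VY u0 uh0 \<beta> b \<mu> Cstab Capprox \<longrightarrow>
    semidiscrete_solution \<Omega> A c s VX VY T f uh0 uh \<longrightarrow>
    1 \<le> M \<longrightarrow>
    \<tau> = graded_mesh T (\<lambda>t. t powr ((2 * real r + 3) / \<beta>)) M \<longrightarrow>
    dg_solution \<Omega> A c s VX VY M \<tau> (\<lambda>_. r) f u0 U \<longrightarrow>
    (let N = dim (pw_poly M \<tau> (\<lambda>_. r)) in
      ennreal_sqrt (\<integral>\<^sup>+ t\<in>{0..T}. (Htilde_norm \<Omega> s (uh t - tr (U t)))\<^sup>2 \<partial>lborel)
        \<le> ennreal (C * (real N powr - (real r + 1) + exp (- b * real (dim VX) powr \<mu>))))"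
proof -
 have op: "open \<Omega>" using assms(2) by (simp add: lipschitz_domain_def)
 obtain R where R: "\<And>x. x \<in> \<Omega> ==> norm x <= R" using assms(1) unfolding bounded_iff by blast
 obtain KA' where KA': "AE x in lebesgue_on \<Omega>. norm (A x) <= KA'" using assms(3) unfolding admissible_coefficients_def by blast
 obtain \<kappa> where \<kappa>: "\<kappa> > 0" "AE x in lebesgue_on \<Omega>. \<forall>\<xi>. \<kappa> * (norm \<xi>)^2 <= (A x *v \<xi>) \<bullet> \<xi>"
  using assms(3) unfolding admissible_coefficients_def by blast
 obtain Kc' where Kc': "AE x in lebesgue_on \<Omega>. c x <= Kc'" using assms(3) unfolding admissible_coefficients_def by blast
 define KA where "KA = max KA' 0"
 define Kc where "Kc = max Kc' 0"
 have cyl: "cylinder \<Omega> A c s R \<kappa> KA Kc VX VY" if "discrete_spaces \<Omega> s VX VY" for VX VY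
 proof
  show "A \<in> borel_measurable (lebesgue_on \<Omega>)" "AE x in lebesgue_on \<Omega>. transpose (A x) = A x"
   "c \<in> borel_measurable (lebesgue_on \<Omega>)" "AE x in lebesgue_on \<Omega>. 0 <= c x"
   using assms(3) unfolding admissible_coefficients_def by blast+
  show "AE x in lebesgue_on \<Omega>. norm (A x) <= KA" using KA' by eventually_elim (simp add: KA_def)
  show "AE x in lebesgue_on \<Omega>. c x <= Kc" using Kc' by eventually_elim (simp add: Kc_def)
 qed (use op R assms \<kappa> that in \<open>auto simp: KA_def Kc_def\<close>)
 obtain Cs where Cs: "stable_with r Cs" using dg_projection_stable[of r] unfolding stable_with_def by blast
 obtain Ca where Ca: "accurate_with r Ca" using dg_projection_accurate[of r] unfolding accurate_with_def by blast
 define G where "G = (%l. (Cf * df ^ l * Gamma (real l + 1))^2)"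
 have G: "(L2_norm \<Omega> (fd l t))^2 <= G l" if "t \<in> {0..T}" for l t
  unfolding G_def using assms(15)[OF that] L2_norm_square(2) by (intro power_mono)
 define Ct where "Ct = cylinder.trace_const s R \<kappa>"
 define K where "K = rate_const r Cs Ca T \<beta> (cylinder.init_const s R KA Kc \<beta> Cstab) G"
 define Cr where "Cr = (real r + 1) powr (real r + 1)"
 have K0: "0 <= K" by (simp add: K_def rate_const_def)
 have u0: "u0 \<in> L2 \<Omega>" by (rule analytic_on_closure_L2[OF assms(1) op assms(13)])
 \<comment> \<open>The absolute value spares a proof that the trace constant is nonnegative, which would need some discrete
  space; adding \<open>1\<close> makes the constant positive.\<close>
 have bound: "ennreal_sqrt (\<integral>\<^sup>+ t\<in>{0..T}. (Htilde_norm \<Omega> s (uh t - tr (U t)))^2 \<partial>lborel)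
    <= ennreal ((sqrt \<bar>Ct\<bar> * (sqrt K * Cr + Capprox) + 1) * (real (dim (pw_poly M \<tau> (%_. r))) powr - (real r + 1) + exp (- b * real (dim VX) powr \<mu>)))"
  if sp: "discrete_spaces \<Omega> s VX VY" and ic: "initial_condition \<Omega> A c s VX VY u0 uh0 \<beta> b \<mu> Cstab Capprox"
   and sd: "semidiscrete_solution \<Omega> A c s VX VY T f uh0 uh" and M: "1 <= M"
   and \<tau>: "\<tau> = graded_mesh T (%t. t powr ((2 * real r + 3) / \<beta>)) M"
   and dg: "dg_solution \<Omega> A c s VX VY M \<tau> (%_. r) f u0 U" for VX VY uh0 uh M \<tau> U
 proof -
  interpret C: cylinder \<Omega> A c s R \<kappa> KA Kc VX VY by (rule cyl[OF sp])
  have i: "uh0 \<in> VX" "VX_interp_norm \<Omega> A c s VX VY \<beta> uh0 <= ennreal Cstab"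
   "L2_norm \<Omega> (u0 - uh0) <= Capprox * exp (- b * real (dim VX) powr \<mu>)"
   using ic unfolding initial_condition_def by auto
  define N where "N = dim (pw_poly M \<tau> (%_. r))"
  define m where "m = real M powr - (real r + 1)"
  define n where "n = real N powr - (real r + 1)"
  define \<delta> where "\<delta> = exp (- b * real (dim VX) powr \<mu>)"
  have mono: "\<tau> i < \<tau> j" if "i < j" for i j
   unfolding \<tau> graded_mesh_def using that M assms(6,7)
   by (intro mult_strict_left_mono powr_less_mono2 divide_strict_right_mono) auto
  have N: "1 <= N" "N <= M * (r + 1)" using pw_poly_dim[OF mono M] by (auto simp: N_def)
  have mn: "m <= Cr * n"
  proof -
   have "real N <= real M * (real r + 1)" using of_nat_mono[OF N(2), where 'a = real] by (simp add: algebra_simps)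
   then have "(real M * (real r + 1)) powr - (real r + 1) <= n"
    unfolding n_def using N(1) by (intro powr_mono2') auto
   then have Crm: "Cr * (m * (real r + 1) powr - (real r + 1)) <= Cr * n"
    unfolding m_def by (intro mult_left_mono) (auto simp: powr_mult Cr_def)
   have Cr1: "Cr * (real r + 1) powr - (real r + 1) = 1"
    unfolding Cr_def by (subst powr_add[symmetric]) simp
   have "Cr * (m * (real r + 1) powr - (real r + 1)) = m" unfolding mult.left_commute[of Cr] Cr1 by simp
   then show ?thesis using Crm by (rule ord_eq_le_trans[OF sym])
  qed
  have m2: "real M powr - (2 * real r + 2) = m^2"
   using M by (simp add: m_def power2_eq_square powr_add[symmetric])
  have "(\<integral>\<^sup>+ t\<in>{0..T}. (Htilde_norm \<Omega> s (uh t - tr (U t)))^2 \<partial>lborel) <= ennreal (Ct * (K * m^2 + (L2_norm \<Omega> (u0 - uh0))^2))"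
   using C.squared_error_bound[OF assms(6,7,8,11) M u0 i(1,2) assms(14) G sd \<tau> dg Cs Ca]
   unfolding Ct_def K_def m2 .
  also have "\<dots> <= ennreal ((sqrt \<bar>Ct\<bar> * (sqrt K * m + Capprox * \<delta>))^2)"
  proof (rule ennreal_leI)
   have Cp: "0 <= Capprox * \<delta>" "0 <= sqrt K * m" using assms(12) K0 by (simp_all add: \<delta>_def m_def)
   have "(L2_norm \<Omega> (u0 - uh0))^2 <= (Capprox * \<delta>)^2"
    unfolding \<delta>_def using i(3) L2_norm_square(2) by (intro power_mono)
   moreover have "K * m^2 = (sqrt K * m)^2" using K0 by (simp add: power_mult_distrib)
   moreover have "(sqrt K * m)^2 + (Capprox * \<delta>)^2 <= (sqrt K * m + Capprox * \<delta>)^2"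
    using mult_nonneg_nonneg[OF Cp] by (simp add: power2_sum mult_ac)
   ultimately have "K * m^2 + (L2_norm \<Omega> (u0 - uh0))^2 <= (sqrt K * m + Capprox * \<delta>)^2" by linarith
   then have "\<bar>Ct\<bar> * (K * m^2 + (L2_norm \<Omega> (u0 - uh0))^2) <= \<bar>Ct\<bar> * (sqrt K * m + Capprox * \<delta>)^2"
    by (intro mult_left_mono) auto
   moreover have "Ct * (K * m^2 + (L2_norm \<Omega> (u0 - uh0))^2) <= \<bar>Ct\<bar> * (K * m^2 + (L2_norm \<Omega> (u0 - uh0))^2)"
    using K0 by (intro mult_right_mono) auto
   ultimately show "Ct * (K * m^2 + (L2_norm \<Omega> (u0 - uh0))^2) <= (sqrt \<bar>Ct\<bar> * (sqrt K * m + Capprox * \<delta>))^2"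
    by (simp add: power_mult_distrib)
  qed
  finally have "ennreal_sqrt (\<integral>\<^sup>+ t\<in>{0..T}. (Htilde_norm \<Omega> s (uh t - tr (U t)))^2 \<partial>lborel)
    <= ennreal (sqrt \<bar>Ct\<bar> * (sqrt K * m + Capprox * \<delta>))"
   by (rule ennreal_sqrt_le) (use K0 assms(12) in \<open>auto simp: m_def \<delta>_def\<close>)
  also have "\<dots> <= ennreal ((sqrt \<bar>Ct\<bar> * (sqrt K * Cr + Capprox) + 1) * (n + \<delta>))"
  proof (rule ennreal_leI)
   have p: "0 <= n" "0 <= \<delta>" "0 <= Cr" "0 <= sqrt K" "0 <= sqrt \<bar>Ct\<bar>" using K0 by (simp_all add: n_def \<delta>_def Cr_def)
   have "sqrt K * m <= sqrt K * (Cr * n)" using mn p by (intro mult_left_mono) auto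
   moreover have "0 <= sqrt K * Cr * \<delta>" "0 <= Capprox * n" using p assms(12) by simp_all
   ultimately have "sqrt K * m + Capprox * \<delta> <= (sqrt K * Cr + Capprox) * (n + \<delta>)" by (simp add: algebra_simps)
   then have "sqrt \<bar>Ct\<bar> * (sqrt K * m + Capprox * \<delta>) <= sqrt \<bar>Ct\<bar> * ((sqrt K * Cr + Capprox) * (n + \<delta>))"
    using p by (intro mult_left_mono)
   then show "sqrt \<bar>Ct\<bar> * (sqrt K * m + Capprox * \<delta>) <= (sqrt \<bar>Ct\<bar> * (sqrt K * Cr + Capprox) + 1) * (n + \<delta>)"
    using p by (simp add: distrib_right mult.assoc)
  qed
  finally show ?thesis unfolding n_def \<delta>_def N_def .
 qed
 have "0 <= sqrt \<bar>Ct\<bar> * (sqrt K * Cr + Capprox)" using K0 assms(12) by (simp add: Cr_def)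
 then have "0 < sqrt \<bar>Ct\<bar> * (sqrt K * Cr + Capprox) + 1" by linarith
 then show ?thesis unfolding Let_def using bound by blast
qed

end
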